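(* Let $M$ be a non-zero submodule of $\mathcal O_n^p$ and let $r=\operatorname{rank}(M)$. Consider the following conditions. (1) $M$ is Newton non-degenerate. (2) $\overline{\mathbf I_r(M)}=J_M^0$. (3) $\overline M=C^0(M)$. Then (1)$\Rightarrow$(2)$\Rightarrow$(3). Moreover, if $r=p$, then these implications become equivalences.
   Context: $\mathcal O_n$ is the local ring of analytic function germs $(\mathbb C^n,0)\to\mathbb C$, with fixed coordinates $x_1,\dots,x_n$; $x^{\mathbf k}=x_1^{k_1}\cdots x_n^{k_n}$. Since $\mathcal O_n$ is a domain, every submodule $M\subseteq\mathcal O_n^p$ has a rank (its rank over the fraction field). A submodule $M\subseteq\mathcal O_n^p$ is identified with a matrix whose columns generate it; $\mathbf I_i(M)$ is the ideal generated by its $i\times i$ minors. For non-empty $L\subseteq\{1,\dots,p\}$, $M_L\subseteq\mathcal O_n^{|L|}$ is the projection of $M$ to the components in $L$; $M_i=M_{\{i\}}$ is the ideal generated by the $i$-th row. For $r=\operatorname{rank}(M)$, $\Lambda_M$ is the set of $(i_1,\dots,i_r)$ with $1\le i_1<\cdots<i_r\le p$ such that some minor of $M$ formed from rows $i_1,\dots,i_r$ is non-zero (regarded also as subsets of $\{1,\dots,p\}$). Integral closure: with $R=\mathcal O_n$, $h\in R^p$ is integral over $M$ if for every discrete valuation ring or field $V$ between $R$ and its fraction field, the image of $h$ in $V^p$ lies in the $V$-submodule generated by the image of $M$; $\overline M\subseteq R^p$ is the submodule of elements integral over $M$ (for ideals, the usual integral closure). Newton polyhedra: for $f=\sum a_{\mathbf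 k}x^{\mathbf k}\in\mathcal O_n$, $\operatorname{supp}(f)=\{\mathbf k:a_{\mathbf k}\ne0\}$; for a non-zero ideal $I$, $\operatorname{supp}(I)=\bigcup_{f\in I}\operatorname{supp}(f)$ and $\Gamma_+(I)$ is the convex hull of $\{\mathbf k+\mathbf v:\mathbf k\in\operatorname{supp}(I),\mathbf v\in\mathbb R_{\ge0}^n\}$; $\Gamma_+(0)=\emptyset$. $I^0$ is the ideal generated by all monomials $x^{\mathbf k}$ with $\mathbf k\in\Gamma_+(I)$, and $I^0=0$ if $I=0$. $\Gamma_+(M)=\Gamma_+(M_1)+\cdots+\Gamma_+(M_p)$ (Minkowski sum), and $\mathscr F_c(\Gamma_+(M))$ is its set of compact faces. For compact $\Delta\subseteq\mathbb R^n_{\ge0}$, $f_\Delta$ is the sum of the terms $a_{\mathbf k}x^{\mathbf k}$ of $f$ with $\mathbf k\in\Delta$ ($f_\Delta=0$ if there are none). Newton non-degeneracy of a non-zero $M\subseteq\mathcal O_n^p$ of rank $r$ with $p\times m$ generating matrix $[m_{ij}]$, $p\le m$: if $r=p$, $M$ is Newton non-degenerate when $\{x\in\mathbb C^n:\operatorname{rank}[(m_{ij})_{\Delta_i}(x)]<p\}\subseteq\{x\in\mathbb C^n:x_1\cdots x_n=0\}$ for every $\Delta\in\mathscr F_c(\Gamma_+(M))$, where $\Delta=\Delta_1+\cdots+\Delta_p$ with $\Delta_i$ a compact face of $\Gamma_+(M_i)$. If $r<p$, $M$ is Newton non-degenerate when $M_L\subseteq\mathcal O_n^r$ (of rank $r$)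 is Newton non-degenerate for every $L\in\Lambda_M$. Finally, $J_M=\sum_{(i_1,\dots,i_r)\in\Lambda_M}M_{i_1}\cdots M_{i_r}$, $J_M^0=(J_M)^0$, $Z(M)=\{h\in\mathcal O_n^p:\operatorname{rank}(M)=\operatorname{rank}(M+\mathcal O_nh)\}$, and $C^0(M)=Z(M)\cap(M_1^0\oplus\cdots\oplus M_p^0)$. *)

theory Defs
  imports
    "HOL-Analysis.Analysis"
    "HOL-Computational_Algebra.Polynomial_Factorial"
    "HOL-Algebra.Ideal_Product"
    "HOL-Algebra.Ring_Divisibility"
    "HOL-Algebra.Subrings"
    "Jordan_Normal_Form.DL_Submatrix"
    "Jordan_Normal_Form.DL_Rank"
begin

unbundle no vec_syntax
notation Finite_Cartesian_Product.vec_nth (infixl \<open>$h\<close> 90)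
notation Finite_Cartesian_Product.vec_lambda (binder \<open>\<chi>\<close> 10)

hide_const (open) Determinants.det Finite_Cartesian_Product.mat Finite_Cartesian_Product.row
  Finite_Cartesian_Product.column Cartesian_Space.rank Polynomial.order
hide_type (open) Finite_Cartesian_Product.vec

section \<open>The ring of germs\<close>

text \<open>
  A germ of an analytic function \<open>(\<complex>\<^sup>n, 0) \<rightarrow> \<complex>\<close> is identified with its Taylor series in the
  coordinates \<open>x\<^sub>i\<close> (\<open>i :: 'n\<close>), i.e. with a power series that converges absolutely on some
  polydisc around the origin. Exponents are vectors of type \<^typ>\<open>nat^'n\<close>.
\<close>

definition total_degree :: "nat^'n::finite \<Rightarrow> nat" where
  "total_degree k = (\<Sum>i\<in>UNIV. k $h i)"

definition convergent_series :: "(nat^'n::finite \<Rightarrow> complex) \<Rightarrow> bool" where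
  "convergent_series a \<longleftrightarrow> (\<exists>r>0. (\<lambda>k. norm (a k) * r ^ total_degree k) summable_on UNIV)"

definition cauchy_prod ::
    "(nat^'n::finite \<Rightarrow> complex) \<Rightarrow> (nat^'n \<Rightarrow> complex) \<Rightarrow> nat^'n \<Rightarrow> complex" where
  "cauchy_prod a b k = (\<Sum>(i,j)\<in>{(i,j). i + j = k}. a i * b j)"

lemma total_degree_add: "total_degree (k + l) = total_degree k + total_degree l"
  by (simp add: total_degree_def sum.distrib)

lemma total_degree_zero [simp]: "total_degree 0 = 0"
  by (simp add: total_degree_def)

lemma nth_le_total_degree: "k $h i \<le> total_degree k"
  unfolding total_degree_def by (rule member_le_sum) auto

lemma finite_total_degree: "finite {k :: nat^'n::finite. total_degree k \<le> d}"
proof (rule finite_subset)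
  show "{k :: nat^'n. total_degree k \<le> d} \<subseteq> vec_lambda ` (UNIV \<rightarrow>\<^sub>E {..d})"
  proof
    fix k :: "nat^'n" assume "k \<in> {k. total_degree k \<le> d}"
    hence "vec_nth k \<in> UNIV \<rightarrow>\<^sub>E {..d}"
      using nth_le_total_degree[of k] by (auto intro: order_trans)
    moreover have "k = vec_lambda (vec_nth k)" by simp
    ultimately show "k \<in> vec_lambda ` (UNIV \<rightarrow>\<^sub>E {..d})" by blast
  qed
  show "finite (vec_lambda ` (UNIV \<rightarrow>\<^sub>E {..d}) :: (nat^'n) set)"
    by (intro finite_imageI finite_PiE) auto
qed

lemma finite_splits: "finite {(i,j). i + j = (k :: nat^'n::finite)}"
proof (rule finite_subset)
  let ?A = "{l :: nat^'n. total_degree l \<le> total_degree k}"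
  show "{(i,j). i + j = k} \<subseteq> ?A \<times> ?A" by (auto simp: total_degree_add)
  show "finite (?A \<times> ?A)" using finite_total_degree by blast
qed

lemma convergent_series_radius_mono:
  assumes "(\<lambda>k. norm (a k) * r ^ total_degree k) summable_on UNIV" "0 \<le> s" "s \<le> r"
  shows "(\<lambda>k. norm (a k) * s ^ total_degree k) summable_on UNIV"
  by (rule summable_on_comparison_test[OF assms(1)])
     (use assms in \<open>auto intro!: mult_left_mono power_mono\<close>)

lemma convergent_series_common_radius:
  assumes "convergent_series a" "convergent_series b"
  obtains r where "r > 0" "(\<lambda>k. norm (a k) * r ^ total_degree k) summable_on UNIV"
    "(\<lambda>k. norm (b k) * r ^ total_degree k) summable_on UNIV"
proof -
  from assms obtain r s where r: "r > 0" "(\<lambda>k. norm (a k) * r ^ total_degree k) summable_on UNIV"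
    and s: "s > 0" "(\<lambda>k. norm (b k) * s ^ total_degree k) summable_on UNIV"
    unfolding convergent_series_def by blast
  show ?thesis
    by (rule that[of "min r s"])
       (use r s in \<open>auto intro: convergent_series_radius_mono[OF r(2)] convergent_series_radius_mono[OF s(2)]\<close>)
qed

lemma convergent_series_finite:
  assumes "finite {k. a k \<noteq> 0}"
  shows "convergent_series a"
proof -
  have "(\<lambda>k. norm (a k) * 1 ^ total_degree k) summable_on UNIV"
    by (rule finite_nonzero_values_imp_summable_on) (use assms in simp)
  thus ?thesis unfolding convergent_series_def by (intro exI[of _ 1]) auto
qed

lemma convergent_series_add:
  assumes "convergent_series a" "convergent_series b"
  shows "convergent_series (\<lambda>k. a k + b k)"
proof -
  obtain r where r: "r > 0" "(\<lambda>k. norm (a k) * r ^ total_degree k) summable_on UNIV"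
    "(\<lambda>k. norm (b k) * r ^ total_degree k) summable_on UNIV"
    using convergent_series_common_radius[OF assms] .
  have "(\<lambda>k. norm (a k + b k) * r ^ total_degree k) summable_on UNIV"
    by (rule summable_on_comparison_test[OF summable_on_add[OF r(2,3)]])
       (use r(1) in \<open>auto simp flip: distrib_right intro!: mult_right_mono norm_triangle_ineq\<close>)
  thus ?thesis using r(1) unfolding convergent_series_def by blast
qed

lemma convergent_series_uminus:
  "convergent_series a \<Longrightarrow> convergent_series (\<lambda>k. - a k)"
  unfolding convergent_series_def by simp

lemma convergent_series_cauchy_prod:
  assumes "convergent_series a" "convergent_series b"
  shows "convergent_series (cauchy_prod a b)"
proof -
  obtain r where r: "r > 0" "(\<lambda>k. norm (a k) * r ^ total_degree k) summable_on UNIV"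
    "(\<lambda>k. norm (b k) * r ^ total_degree k) summable_on UNIV"
    using convergent_series_common_radius[OF assms] .
  define A where "A = (\<lambda>k. norm (a k) * r ^ total_degree k)"
  define B where "B = (\<lambda>k. norm (b k) * r ^ total_degree k)"
  have nonneg: "A k \<ge> 0" "B k \<ge> 0" for k using r(1) by (auto simp: A_def B_def)
  have summ: "A summable_on UNIV" "B summable_on UNIV" using r by (auto simp: A_def B_def)
  have "(\<lambda>k. norm (cauchy_prod a b k) * r ^ total_degree k) summable_on UNIV"
  proof (rule nonneg_bdd_above_summable_on)
    show "norm (cauchy_prod a b k) * r ^ total_degree k \<ge> 0" for k using r(1) by simp
    show "bdd_above (sum (\<lambda>k. norm (cauchy_prod a b k) * r ^ total_degree k) ` {F. F \<subseteq> UNIV \<and> finite F})"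
    proof (intro bdd_aboveI2[where M = "infsum A UNIV * infsum B UNIV"], clarify)
      fix F :: "(nat^'a) set" assume F: "finite F"
      define S where "S = (SIGMA k:F. {(i,j). i + j = k})"
      have finS: "finite S" unfolding S_def using F finite_splits by blast
      define P where "P = (\<lambda>(k,i,j). i) ` S"
      define Q where "Q = (\<lambda>(k,i,j). j) ` S"
      have finPQ: "finite P" "finite Q" using finS by (auto simp: P_def Q_def)
      have "(\<Sum>k\<in>F. norm (cauchy_prod a b k) * r ^ total_degree k) \<le> (\<Sum>k\<in>F. \<Sum>(i,j)\<in>{(i,j). i + j = k}. A i * B j)"
      proof (rule sum_mono)
        fix k assume "k \<in> F"
        have "norm (cauchy_prod a b k) \<le> (\<Sum>(i,j)\<in>{(i,j). i + j = k}. norm (a i) * norm (b j))"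
          unfolding cauchy_prod_def by (rule order_trans[OF norm_sum]) (simp add: case_prod_unfold norm_mult)
        hence "norm (cauchy_prod a b k) * r ^ total_degree k \<le>
            (\<Sum>(i,j)\<in>{(i,j). i + j = k}. norm (a i) * norm (b j)) * r ^ total_degree k"
          using r(1) by (intro mult_right_mono) auto
        also have "\<dots> = (\<Sum>(i,j)\<in>{(i,j). i + j = k}. A i * B j)"
          unfolding sum_distrib_right
          by (rule sum.cong) (auto simp: A_def B_def total_degree_add power_add)
        finally show "norm (cauchy_prod a b k) * r ^ total_degree k \<le> (\<Sum>(i,j)\<in>{(i,j). i + j = k}. A i * B j)" .
      qed
      also have "\<dots> = (\<Sum>(k,i,j)\<in>S. A i * B j)"
        unfolding S_def using F finite_splits by (subst sum.Sigma) (auto simp: case_prod_unfold)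
      also have "\<dots> = (\<Sum>(i,j)\<in>snd ` S. A i * B j)"
        by (subst sum.reindex) (auto simp: inj_on_def S_def case_prod_unfold)
      also have "\<dots> \<le> (\<Sum>(i,j)\<in>P \<times> Q. A i * B j)"
        by (rule sum_mono2) (use finPQ nonneg in \<open>force simp: P_def Q_def\<close>)+
      also have "\<dots> = sum A P * sum B Q" by (simp add: sum_product sum.cartesian_product)
      also have "\<dots> \<le> infsum A UNIV * infsum B UNIV"
        by (intro mult_mono finite_sum_le_infsum sum_nonneg infsum_nonneg)
           (use summ finPQ nonneg in auto)
      finally show "(\<Sum>k\<in>F. norm (cauchy_prod a b k) * r ^ total_degree k) \<le> infsum A UNIV * infsum B UNIV" .
    qed
  qed
  thus ?thesis using r(1) unfolding convergent_series_def by blast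
qed

lemma cauchy_prod_commute: "cauchy_prod a b = cauchy_prod b a"
proof
  fix k
  show "cauchy_prod a b k = cauchy_prod b a k"
    unfolding cauchy_prod_def
    by (rule sum.reindex_bij_witness[of _ prod.swap prod.swap]) (auto simp: add.commute mult.commute)
qed

lemma cauchy_prod_assoc: "cauchy_prod (cauchy_prod a b) c = cauchy_prod a (cauchy_prod b c)"
proof
  fix k
  have "cauchy_prod (cauchy_prod a b) c k =
      (\<Sum>((m,l),(i,j))\<in>(SIGMA (m,l):{(m,l). m + l = k}. {(i,j). i + j = m}). a i * b j * c l)"
    unfolding cauchy_prod_def
    by (simp add: case_prod_unfold sum_distrib_right, subst sum.Sigma)
       (auto simp: case_prod_unfold finite_splits[unfolded case_prod_unfold])
  also have "\<dots> = (\<Sum>((i,m),(j,l))\<in>(SIGMA (i,m):{(i,m). i + m = k}. {(j,l). j + l = m}). a i * (b j * c l))"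
    by (rule sum.reindex_bij_witness[of _ "\<lambda>((i,m),(j,l)). ((i + j, l), (i, j))"
          "\<lambda>((m,l),(i,j)). ((i, j + l), (j, l))"])
       (auto simp: add.assoc mult.assoc)
  also have "\<dots> = cauchy_prod a (cauchy_prod b c) k"
    unfolding cauchy_prod_def
    by (simp add: case_prod_unfold sum_distrib_left, subst sum.Sigma)
       (auto simp: case_prod_unfold finite_splits[unfolded case_prod_unfold])
  finally show "cauchy_prod (cauchy_prod a b) c k = cauchy_prod a (cauchy_prod b c) k" .
qed

lemma cauchy_prod_add_left: "cauchy_prod (\<lambda>k. a k + b k) c k = cauchy_prod a c k + cauchy_prod b c k"
  unfolding cauchy_prod_def by (simp add: case_prod_unfold distrib_right sum.distrib)

lemma cauchy_prod_one_left: "cauchy_prod (\<lambda>k. if k = 0 then 1 else 0) a = a"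
proof
  fix k
  have "cauchy_prod (\<lambda>k. if k = 0 then 1 else 0) a k =
      (\<Sum>(i,j)\<in>{(0 :: nat^'a,k)}. (if i = 0 then 1 else 0) * a j)"
    unfolding cauchy_prod_def
    by (rule sum.mono_neutral_right) (auto simp: finite_splits split: if_splits)
  thus "cauchy_prod (\<lambda>k. if k = 0 then 1 else 0) a k = a k" by simp
qed

lemma exists_unique_split:
  fixes S T :: "(nat^'n::finite) set"
  assumes "S \<noteq> {}" "T \<noteq> {}"
  obtains s t where "s \<in> S" "t \<in> T"
    "\<And>i j. i \<in> S \<Longrightarrow> j \<in> T \<Longrightarrow> i + j = s + t \<Longrightarrow> i = s \<and> j = t"
proof -
  obtain e :: "'n \<Rightarrow> nat" where e: "inj e"
    using finite_imp_inj_to_nat_seg[of "UNIV :: 'n set"] by auto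
  define lt :: "nat^'n \<Rightarrow> nat^'n \<Rightarrow> bool" where
    "lt k l \<longleftrightarrow> (\<exists>x. k $h x < l $h x \<and> (\<forall>y. e y < e x \<longrightarrow> k $h y = l $h y))" for k l
  have total: "lt k l \<or> lt l k" if "k \<noteq> l" for k l
  proof -
    obtain z where "k $h z \<noteq> l $h z"
      using \<open>k \<noteq> l\<close> by (auto simp: Finite_Cartesian_Product.vec_eq_iff)
    then obtain x where x: "k $h x \<noteq> l $h x" "\<And>y. k $h y \<noteq> l $h y \<Longrightarrow> e x \<le> e y"
      using ex_has_least_nat[of "\<lambda>x. k $h x \<noteq> l $h x" z e] by blast
    hence "k $h y = l $h y" if "e y < e x" for y using that by (metis not_le)
    thus ?thesis unfolding lt_def using x(1) by (metis linorder_neqE_nat)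
  qed
  have trans: "lt k m" if "lt k l" "lt l m" for k l m
  proof -
    from that obtain x y where x: "k $h x < l $h x" "\<And>z. e z < e x \<Longrightarrow> k $h z = l $h z"
      and y: "l $h y < m $h y" "\<And>z. e z < e y \<Longrightarrow> l $h z = m $h z"
      unfolding lt_def by blast
    consider "e x < e y" | "x = y" | "e y < e x" using e by (metis injD linorder_neqE_nat)
    thus ?thesis
    proof cases
      case 1 thus ?thesis unfolding lt_def using x y by (intro exI[of _ x]) auto
    next
      case 2 thus ?thesis unfolding lt_def using x y by (intro exI[of _ x]) auto
    next
      case 3 thus ?thesis unfolding lt_def using x y by (intro exI[of _ y]) auto
    qed
  qed
  have irrefl: "\<not> lt k k" for k unfolding lt_def by simp
  have add: "lt (k + m) (l + m)" if "lt k l" for k l m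
    using that unfolding lt_def by auto
  have minimum: "\<exists>s\<in>S. \<forall>i\<in>S. total_degree s \<le> total_degree i \<and>
      (total_degree i = total_degree s \<longrightarrow> i = s \<or> lt s i)" if "S \<noteq> {}" for S
  proof -
    obtain v where "v \<in> S" using \<open>S \<noteq> {}\<close> by auto
    then obtain u where u: "u \<in> S" "\<forall>i. i \<in> S \<longrightarrow> total_degree u \<le> total_degree i"
      using ex_has_least_nat[of "\<lambda>i. i \<in> S" v total_degree] by auto
    let ?D = "{i \<in> S. total_degree i = total_degree u}"
    have fin: "finite ?D"
      by (rule finite_subset[OF _ finite_total_degree[of "total_degree u"]]) auto
    have asymp: "asymp_on ?D lt"
    proof (rule asymp_onI, rule notI)
      fix k l assume "lt k l" "lt l k"
      from trans[OF this] show False using irrefl by simp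
    qed
    have transp: "transp_on ?D lt"
      by (rule transp_onI) (rule trans)
    have "?D \<noteq> {}" using u(1) by auto
    from Finite_Set.bex_min_element[OF fin asymp transp this]
    obtain s where s: "s \<in> ?D" "\<forall>i\<in>?D. i \<noteq> s \<longrightarrow> \<not> lt i s" by (elim bexE)
    have "i = s \<or> lt s i" if "i \<in> S" "total_degree i = total_degree u" for i
    proof -
      have "i \<in> ?D" using that by simp
      thus ?thesis using s(2) total[of s i] by metis
    qed
    thus ?thesis using s(1) u(2) by (intro bexI[of _ s]) simp_all
  qed
  obtain s where s: "s \<in> S" "\<And>i. i \<in> S \<Longrightarrow> total_degree s \<le> total_degree i"
      "\<And>i. i \<in> S \<Longrightarrow> total_degree i = total_degree s \<Longrightarrow> i = s \<or> lt s i"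
    using minimum[OF assms(1)] by metis
  obtain t where t: "t \<in> T" "\<And>i. i \<in> T \<Longrightarrow> total_degree t \<le> total_degree i"
      "\<And>i. i \<in> T \<Longrightarrow> total_degree i = total_degree t \<Longrightarrow> i = t \<or> lt t i"
    using minimum[OF assms(2)] by metis
  show ?thesis
  proof (rule that[OF s(1) t(1)])
    fix i j assume ij: "i \<in> S" "j \<in> T" "i + j = s + t"
    have "total_degree i + total_degree j = total_degree s + total_degree t"
      using ij(3) by (metis total_degree_add)
    hence "total_degree i = total_degree s" "total_degree j = total_degree t"
      using s(2)[OF ij(1)] t(2)[OF ij(2)] by auto
    hence i: "i = s \<or> lt s i" and j: "j = t \<or> lt t j" using s(3) t(3) ij by auto
    have "\<not> lt s i"
    proof
      assume "lt s i"
      hence 1: "lt (s + t) (i + t)" by (rule add)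
      have "j \<noteq> t" using 1 irrefl ij(3) by auto
      hence "lt (t + i) (j + i)" using j add by metis
      hence "lt (i + t) (i + j)" by (simp only: add.commute)
      from trans[OF 1 this] have "lt (s + t) (i + j)" .
      thus False using ij(3) irrefl by simp
    qed
    hence "i = s" using i by blast
    thus "i = s \<and> j = t" using ij(3) by simp
  qed
qed

lemma cauchy_prod_nonzero:
  assumes "a \<noteq> (\<lambda>_. 0)" "b \<noteq> (\<lambda>_. 0)"
  shows "cauchy_prod a b \<noteq> (\<lambda>_. 0)"
proof -
  have "{i. a i \<noteq> 0} \<noteq> {}" "{j. b j \<noteq> 0} \<noteq> {}" using assms by auto
  from exists_unique_split[OF this] obtain s t where "a s \<noteq> 0" "b t \<noteq> 0"
    and "\<And>i j. i \<in> {i. a i \<noteq> 0} \<Longrightarrow> j \<in> {j. b j \<noteq> 0} \<Longrightarrow> i + j = s + t \<Longrightarrow> i = s \<and> j = t"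
    unfolding mem_Collect_eq by blast
  hence st: "a s \<noteq> 0" "b t \<noteq> 0" "\<And>i j. a i \<noteq> 0 \<Longrightarrow> b j \<noteq> 0 \<Longrightarrow> i + j = s + t \<Longrightarrow> i = s \<and> j = t"
    by simp_all
  have "cauchy_prod a b (s + t) = (\<Sum>(i,j)\<in>{(s,t)}. a i * b j)"
    unfolding cauchy_prod_def
  proof (rule sum.mono_neutral_right[OF finite_splits])
    show "\<forall>x \<in> {(i,j). i + j = s + t} - {(s,t)}. (case x of (i,j) \<Rightarrow> a i * b j) = 0"
    proof
      fix x assume x: "x \<in> {(i,j). i + j = s + t} - {(s,t)}"
      obtain i j where "x = (i,j)" by (cases x)
      with x st(3)[of i j] show "(case x of (i,j) \<Rightarrow> a i * b j) = 0"
        by (cases "a i = 0"; cases "b j = 0") simp_all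
    qed
  qed simp
  hence "cauchy_prod a b (s + t) \<noteq> 0" using st(1,2) by simp
  thus ?thesis by (auto simp: fun_eq_iff)
qed

typedef 'n germ = "{a :: nat^'n::finite \<Rightarrow> complex. convergent_series a}"
  morphisms germ_coeff Abs_germ
  by (rule exI[of _ "\<lambda>_. 0"]) (simp add: convergent_series_finite)

setup_lifting type_definition_germ

instantiation germ :: (finite) idom
begin

lift_definition zero_germ :: "'a germ" is "\<lambda>_. 0"
  by (simp add: convergent_series_finite)

lift_definition one_germ :: "'a germ" is "\<lambda>k. if k = 0 then 1 else 0"
  by (rule convergent_series_finite) simp

lift_definition plus_germ :: "'a germ \<Rightarrow> 'a germ \<Rightarrow> 'a germ" is "\<lambda>a b k. a k + b k"
  by (rule convergent_series_add)

lift_definition uminus_germ :: "'a germ \<Rightarrow> 'a germ" is "\<lambda>a k. - a k"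
  by (rule convergent_series_uminus)

lift_definition minus_germ :: "'a germ \<Rightarrow> 'a germ \<Rightarrow> 'a germ" is "\<lambda>a b k. a k - b k"
  using convergent_series_add[OF _ convergent_series_uminus] by simp

lift_definition times_germ :: "'a germ \<Rightarrow> 'a germ \<Rightarrow> 'a germ" is cauchy_prod
  by (rule convergent_series_cauchy_prod)

instance
proof
  fix f g h :: "'a germ"
  show distl: "(f + g) * h = f * h + g * h" for f g h :: "'a germ"
    by transfer (rule ext, rule cauchy_prod_add_left)
  show comm: "f * g = g * f" for f g :: "'a germ" by transfer (rule cauchy_prod_commute)
  show "f * (g + h) = f * g + f * h" by (simp only: comm[of f] distl)
  show zero: "0 * f = 0" for f :: "'a germ"
    by transfer (simp add: cauchy_prod_def fun_eq_iff case_prod_unfold)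
  show "f * 0 = 0" by (simp only: comm[of f] zero)
  show "f * g * h = f * (g * h)" by transfer (rule cauchy_prod_assoc)
  show "1 * f = f" by transfer (rule cauchy_prod_one_left)
  show "f + g + h = f + (g + h)" by transfer (simp add: add.assoc)
  show "f + g = g + f" by transfer (simp add: add.commute)
  show "0 + f = f" by transfer simp
  show "- f + f = 0" by transfer simp
  show "f - g = f + - g" by transfer simp
  show "(0 :: 'a germ) \<noteq> 1" by transfer (metis zero_neq_one)
  show "f \<noteq> 0 \<Longrightarrow> g \<noteq> 0 \<Longrightarrow> f * g \<noteq> 0" by transfer (rule cauchy_prod_nonzero)
qed

end

lift_definition germ_monom :: "nat^'n::finite \<Rightarrow> 'n germ" is "\<lambda>k l. if l = k then 1 else 0"
  by (rule convergent_series_finite) simp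


section \<open>Rank and integral closure\<close>

text \<open>Modules are sets of vectors of dimension \<open>p\<close>; components are numbered \<open>0, \<dots>, p - 1\<close>.\<close>

definition module_rank :: "nat \<Rightarrow> 'a::idom Matrix.vec set \<Rightarrow> nat" where
  "module_rank p M = vectorspace.dim class_ring
     ((module_vec TYPE('a fract) p)\<lparr>carrier :=
        LinearCombinations.module.span class_ring (module_vec TYPE('a fract) p)
          (map_vec to_fract ` M)\<rparr>)"

definition discrete_valuation_ring :: "('a, 'b) ring_scheme \<Rightarrow> bool" where
  "discrete_valuation_ring V \<longleftrightarrow>
     principal_domain V \<and> (\<exists>!I. maximalideal I V) \<and> \<not> Ring.field V"

definition between_dvr_or_field :: "'a::idom fract set \<Rightarrow> bool" where
  "between_dvr_or_field V \<longleftrightarrow>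
     subring V class_ring \<and> range to_fract \<subseteq> V \<and>
     (discrete_valuation_ring (class_ring\<lparr>carrier := V\<rparr>) \<or> Ring.field (class_ring\<lparr>carrier := V\<rparr>))"

text \<open>
  The condition on \<open>h\<close> takes place in \<open>V\<^sup>p\<close>, viewed as a \<open>V\<close>-module inside \<open>K\<^sup>p\<close> with \<open>K\<close> the
  fraction field.
\<close>

definition module_closure :: "nat \<Rightarrow> 'a::idom Matrix.vec set \<Rightarrow> 'a Matrix.vec set" where
  "module_closure p M = {h \<in> carrier_vec p. \<forall>V. between_dvr_or_field V \<longrightarrow>
     map_vec to_fract h \<in>
       LinearCombinations.module.span (class_ring\<lparr>carrier := V\<rparr>)
         ((module_vec TYPE('a fract) p)\<lparr>carrier := {v \<in> carrier_vec p. \<forall>i<p. v $ i \<in> V}\<rparr>)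
         (map_vec to_fract ` M)}"

definition ideal_power :: "'a::comm_ring_1 set \<Rightarrow> nat \<Rightarrow> 'a set" where
  "ideal_power I i = (ideal_prod class_ring I ^^ i) UNIV"

text \<open>
  For ideals the integral closure is the usual one, by equations of integral dependence, and
  not \<^const>\<open>module_closure\<close> with \<open>p = 1\<close>; the two agree by the valuative criterion.
\<close>

definition ideal_closure :: "'a::comm_ring_1 set \<Rightarrow> 'a set" where
  "ideal_closure I = {h. \<exists>s a. s > 0 \<and> (\<forall>i\<in>{1..s}. a i \<in> ideal_power I i) \<and>
     h ^ s + (\<Sum>i=1..s. a i * h ^ (s - i)) = 0}"


section \<open>Matrices, minors and projections\<close>

definition column_module :: "'a::comm_ring_1 mat \<Rightarrow> 'a Matrix.vec set" where
  "column_module A = LinearCombinations.module.span class_ring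
     (module_vec TYPE('a) (dim_row A)) (set (cols A))"

definition minor_ideal :: "nat \<Rightarrow> 'a::comm_ring_1 mat \<Rightarrow> 'a set" where
  "minor_ideal i A = genideal class_ring
     {det (submatrix A I J) | I J. I \<subseteq> {..<dim_row A} \<and> J \<subseteq> {..<dim_col A} \<and> card I = i \<and> card J = i}"

definition nonzero_minor_rows :: "nat \<Rightarrow> 'a::comm_ring_1 mat \<Rightarrow> nat set set" where
  "nonzero_minor_rows r A = {L. L \<subseteq> {..<dim_row A} \<and> card L = r \<and>
     (\<exists>J \<subseteq> {..<dim_col A}. card J = r \<and> det (submatrix A L J) \<noteq> 0)}"

definition component_ideal :: "'a Matrix.vec set \<Rightarrow> nat \<Rightarrow> 'a set" where
  "component_ideal M i = (\<lambda>v. v $ i) ` M"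

definition proj_module :: "nat set \<Rightarrow> 'a Matrix.vec set \<Rightarrow> 'a Matrix.vec set" where
  "proj_module L M = (\<lambda>v. Matrix.vec (card L) (\<lambda>i. v $ pick L i)) ` M"

text \<open>
  The products below generate \<open>\<Prod>\<^bsub>i\<in>L\<^esub> M\<^sub>i\<close> for each \<open>L \<in> \<Lambda>\<close>, hence all together the sum of
  these ideals.
\<close>

definition J_ideal :: "nat set set \<Rightarrow> 'a::comm_ring_1 Matrix.vec set \<Rightarrow> 'a set" where
  "J_ideal \<Lambda> M = genideal class_ring
     {\<Prod>i\<in>L. f i | L f. L \<in> \<Lambda> \<and> (\<forall>i\<in>L. f i \<in> component_ideal M i)}"


section \<open>Newton polyhedra and Newton non-degeneracy\<close>

definition supp :: "'n::finite germ \<Rightarrow> (nat^'n) set" where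
  "supp f = {k. germ_coeff f k \<noteq> 0}"

definition real_exponent :: "nat^'n::finite \<Rightarrow> real^'n" where
  "real_exponent k = (\<chi> i. real (k $h i))"

definition newton_polyhedron :: "'n::finite germ set \<Rightarrow> (real^'n) set" where
  "newton_polyhedron I =
     convex hull {real_exponent k + v | k v. k \<in> (\<Union>f\<in>I. supp f) \<and> (\<forall>i. 0 \<le> v $h i)}"

text \<open>For \<open>I = 0\<close> the polyhedron is empty, so that the ideal below is \<open>0\<close>.\<close>

definition newton_ideal :: "'n::finite germ set \<Rightarrow> 'n germ set" where
  "newton_ideal I =
     genideal class_ring {germ_monom k | k. real_exponent k \<in> newton_polyhedron I}"

text \<open>The value at \<open>x\<close> of the polynomial \<open>f\<^sub>\<Delta>\<close>; the sum is finite because \<open>\<Delta>\<close> is bounded.\<close>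

definition eval_face :: "'n::finite germ \<Rightarrow> (real^'n) set \<Rightarrow> complex^'n \<Rightarrow> complex" where
  "eval_face f \<Delta> x =
     (\<Sum>k | real_exponent k \<in> \<Delta>. germ_coeff f k * (\<Prod>i\<in>UNIV. (x $h i) ^ (k $h i)))"

text \<open>\<open>\<Sum>\<close> over sets is the Minkowski sum of \<^theory>\<open>HOL-Library.Set_Algebras\<close>.\<close>

definition module_polyhedron :: "nat \<Rightarrow> 'n::finite germ Matrix.vec set \<Rightarrow> (real^'n) set" where
  "module_polyhedron p M = (\<Sum>i<p. newton_polyhedron (component_ideal M i))"

text \<open>The relation \<open>face_of\<close> also holds for the empty set, which is not meant here.\<close>

definition compact_faces :: "(real^'n::finite) set \<Rightarrow> (real^'n) set set" where
  "compact_faces P = {F. F face_of P \<and> compact F \<and> F \<noteq> {}}"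

text \<open>
  The case of maximal rank; \<open>A\<close> has \<open>p\<close> rows and its columns generate \<open>M\<close>. The condition does not
  depend on the choice of \<open>A\<close>, and the decomposition of \<open>\<Delta>\<close> into the \<open>\<Delta>s i\<close> is unique.
\<close>

definition newton_nondegenerate_full ::
    "nat \<Rightarrow> 'n::finite germ Matrix.vec set \<Rightarrow> 'n germ mat \<Rightarrow> bool" where
  "newton_nondegenerate_full p M A \<longleftrightarrow>
     (\<forall>\<Delta> \<in> compact_faces (module_polyhedron p M). \<forall>\<Delta>s.
        (\<forall>i<p. \<Delta>s i \<in> compact_faces (newton_polyhedron (component_ideal M i))) \<and>
        \<Delta> = (\<Sum>i<p. \<Delta>s i) \<longrightarrow>
        {x :: complex^'n. vec_space.rank p
            (Matrix.mat p (dim_col A) (\<lambda>(i,j). eval_face (A $$ (i,j)) (\<Delta>s i) x)) < p}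
          \<subseteq> {x. (\<Prod>i\<in>UNIV. x $h i) = 0})"

definition newton_nondegenerate ::
    "nat \<Rightarrow> 'n::finite germ Matrix.vec set \<Rightarrow> 'n germ mat \<Rightarrow> bool" where
  "newton_nondegenerate p M A \<longleftrightarrow>
     (let r = module_rank p M in
      if r = p then newton_nondegenerate_full p M A
      else \<forall>L \<in> nonzero_minor_rows r A.
             newton_nondegenerate_full r (proj_module L M) (submatrix A L UNIV))"


section \<open>The modules $Z(M)$ and $C^0(M)$\<close>

definition Z_module :: "nat \<Rightarrow> 'a::idom Matrix.vec set \<Rightarrow> 'a Matrix.vec set" where
  "Z_module p M = {h \<in> carrier_vec p.
     module_rank p M = module_rank p {v + c \<cdot>\<^sub>v h | v c. v \<in> M}}"

definition C0_module :: "nat \<Rightarrow> 'n::finite germ Matrix.vec set \<Rightarrow> 'n germ Matrix.vec set" where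
  "C0_module p M = Z_module p M \<inter>
     {h \<in> carrier_vec p. \<forall>i<p. h $ i \<in> newton_ideal (component_ideal M i)}"

end

theory Submission
  imports Defs "HOL-Analysis.Analysis" "HOL-Computational_Algebra.Formal_Power_Series"
    "HOL-Library.Poly_Mapping" "Jordan_Normal_Form.Char_Poly" "Jordan_Normal_Form.DL_Rank_Submatrix"
begin

text \<open>
  Let \<open>J\<close> be generated by the monomials with exponents in \<open>\<Gamma>\<^sub>+(J\<^sub>M)\<close>. If a generator of \<open>J\<close> is not
  nilpotent in the fibre cone \<open>\<Oplus> J\<^sup>d / \<mm> J\<^sup>d\<close> modulo the initial forms of the minors, the
  Nullstellensatz provides a complex character of this quotient that does not vanish on it. The
  generators on which the character does not vanish are those on a compact face \<open>\<Delta>\<close>, and on \<open>\<Delta>\<close> the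
  character is, up to a scalar, evaluation at a point \<open>a\<close> of the torus. Hence \<open>g\<^sub>\<Delta>(a) = 0\<close> for
  all minors \<open>g\<close>, which non-degeneracy excludes. By Nakayama some power satisfies
  \<open>J\<^sup>d\<^sup>+\<^sup>1 = I\<^sub>r(M) J\<^sup>d\<close>, so that \<open>J\<close> is integral over \<open>I\<^sub>r(M)\<close>. The reverse inclusions of the
  integral closures follow from monomial valuations.

  For an element \<open>h\<close> of \<open>C\<^sup>0(M)\<close> the minors of the matrix \<open>(M | h)\<close> lie in \<open>J\<^sub>M\<^sup>0\<close>, and Cramer's rule at a
  minor of least value writes \<open>h\<close> as a combination of the columns of \<open>M\<close> over a valuation ring.

  If the rank drops at a torus point \<open>a\<close> on the face \<open>\<Delta>\<close>, a linear relation between the rows of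
  \<open>M\<^sub>\<Delta>(a)\<close> and the divisorial valuation centred at \<open>a\<close> exhibit a vector with a single monomial entry
  that lies in \<open>C\<^sup>0(M)\<close> but not in the integral closure of \<open>M\<close>.
\<close>

section \<open>Newton polyhedra\<close>

text \<open>A germ cannot be evaluated far from the origin, whereas its restriction to a compact
  face is a polynomial. Dividing each power of J by its product with the maximal ideal leaves an
  algebra over the complex numbers, to which the Nullstellensatz applies; countable dimension
  suffices for it, as the complex numbers are uncountable. Products of generators that are not
  minimal in their degree vanish in this algebra, and this vanishing makes the set of surviving
  generators a face. Faces are real objects, while valuations and products of generators are
  integral; simultaneous Diophantine approximation mediates between them. Compactness of a face
  makes its weights strictly positive, so that only finitely many monomials have a given weight. The
  substitution \<open>x_i = a_i t^(w_i)\<close> alone need not be injective on germs; the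
  indeterminates \<open>s_i\<close> in the next term make it so, and the order in t becomes a
  valuation. Exponents may cancel in products and minors. Inclusions of Newton polyhedra are
  therefore tested on positive integral weights, for which initial forms multiply without
  loss.\<close>

lemma dickson:
  fixes S :: "(nat^'n::finite) set"
  obtains E where "finite E" "E \<subseteq> S" "\<forall>k\<in>S. \<exists>e\<in>E. \<forall>i. e $h i \<le> k $h i"
proof -
  have "\<exists>E. finite E \<and> E \<subseteq> S \<and> (\<forall>k\<in>S. \<exists>e\<in>E. \<forall>i\<in>I. e $h i \<le> k $h i)"
    if "finite I" for I :: "'n set" and S :: "(nat^'n) set"
    using that
  proof (induction I arbitrary: S rule: finite_induct)
    case empty
    show ?case
    proof (cases "S = {}")
      case False
      then obtain s where "s \<in> S" by blast
      thus ?thesis by (intro exI[of _ "{s}"]) auto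
    qed auto
  next
    case (insert j I)
    from insert.IH[of S] obtain E0 where
      "finite E0 \<and> E0 \<subseteq> S \<and> (\<forall>k\<in>S. \<exists>e\<in>E0. \<forall>i\<in>I. e $h i \<le> k $h i)" ..
    hence E0: "finite E0" "E0 \<subseteq> S" "\<And>k. k \<in> S \<Longrightarrow> \<exists>e\<in>E0. \<forall>i\<in>I. e $h i \<le> k $h i"
      by blast+
    have "\<exists>E. finite E \<and> E \<subseteq> {k\<in>S. k $h j = c} \<and>
        (\<forall>k\<in>{k\<in>S. k $h j = c}. \<exists>e\<in>E. \<forall>i\<in>I. e $h i \<le> k $h i)" for c
      by (rule insert.IH)
    hence "\<exists>F. \<forall>c. finite (F c) \<and> F c \<subseteq> {k\<in>S. k $h j = c} \<and>
        (\<forall>k\<in>{k\<in>S. k $h j = c}. \<exists>e\<in>F c. \<forall>i\<in>I. e $h i \<le> k $h i)"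
      by (intro choice allI)
    then obtain F where F0: "\<forall>c. finite (F c) \<and> F c \<subseteq> {k\<in>S. k $h j = c} \<and>
        (\<forall>k\<in>{k\<in>S. k $h j = c}. \<exists>e\<in>F c. \<forall>i\<in>I. e $h i \<le> k $h i)" ..
    hence F: "finite (F c)" "F c \<subseteq> {k\<in>S. k $h j = c}" for c by simp_all
    have F3: "\<exists>e\<in>F c. \<forall>i\<in>I. e $h i \<le> k $h i" if "k \<in> S" "k $h j = c" for c k
      using F0 that by simp
    \<comment> \<open>Any upper bound for the j-th coordinates in \<open>E0\<close> serves here.
      Above it the elements of \<open>E0\<close>, chosen without regard to j, lie below k; up to it
      the finitely many slices with fixed j-th coordinate have minimal elements of their
      own.\<close>
    define N where "N = (\<Sum>e\<in>E0. e $h j)"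
    have N: "e $h j \<le> N" if "e \<in> E0" for e
      unfolding N_def using that E0(1) by (intro member_le_sum) auto
    show ?case
    proof (intro exI[of _ "E0 \<union> (\<Union>c\<le>N. F c)"] conjI ballI)
      show "finite (E0 \<union> (\<Union>c\<le>N. F c))" using E0(1) F(1) by auto
      show "E0 \<union> (\<Union>c\<le>N. F c) \<subseteq> S" using E0(2) F(2) by blast
      fix k assume k: "k \<in> S"
      show "\<exists>e\<in>E0 \<union> (\<Union>c\<le>N. F c). \<forall>i\<in>insert j I. e $h i \<le> k $h i"
      proof (cases "k $h j \<le> N")
        case True
        obtain e where e: "e \<in> F (k $h j)" "\<forall>i\<in>I. e $h i \<le> k $h i" using F3[OF k refl] by blast
        moreover have "e $h j = k $h j" using e(1) F(2) by blast
        ultimately show ?thesis using True by (intro bexI[of _ e]) auto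
      next
        case False
        obtain e where e: "e \<in> E0" "\<forall>i\<in>I. e $h i \<le> k $h i" using E0(3)[OF k] by blast
        thus ?thesis using False N[OF e(1)] by (intro bexI[of _ e]) auto
      qed
    qed
  qed
  from this[of UNIV S] obtain E where "finite E \<and> E \<subseteq> S \<and> (\<forall>k\<in>S. \<exists>e\<in>E. \<forall>i\<in>UNIV. e $h i \<le> k $h i)" by auto
  thus ?thesis by (intro that[of E]) simp_all
qed

section \<open>Convex hulls with the orthant added\<close>

definition orthant :: "(real^'n::finite) set" where
  "orthant = {v. \<forall>i. 0 \<le> v $h i}"

text \<open>The shape of a Newton polyhedron in terms of generators:
  \<open>newton_polyhedron I\<close> is the \<open>upper_hull\<close> of all exponents of
  \<open>I\<close>, and by Dickson's lemma that of finitely many of them.\<close>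

definition upper_hull :: "(real^'n::finite) set \<Rightarrow> (real^'n) set" where
  "upper_hull E = convex hull E + orthant"

definition exponents :: "'n::finite germ set \<Rightarrow> (nat^'n) set" where
  "exponents I = (\<Union>f\<in>I. supp f)"

lemma zero_in_orthant [simp]: "0 \<in> orthant"
  by (simp add: orthant_def)

lemma orthant_add: "u \<in> orthant \<Longrightarrow> v \<in> orthant \<Longrightarrow> u + v \<in> orthant"
  by (simp add: orthant_def)

lemma orthant_scaleR: "v \<in> orthant \<Longrightarrow> 0 \<le> t \<Longrightarrow> t *\<^sub>R v \<in> orthant"
  by (simp add: orthant_def)

lemma convex_orthant: "convex orthant"
  by (rule convexI) (simp add: orthant_def)

lemma closed_orthant: "closed orthant"
proof -
  have "orthant = (\<Inter>i. {v. 0 \<le> v $h i})" by (auto simp: orthant_def)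
  also have "closed \<dots>"
    by (intro closed_INT ballI closed_Collect_le continuous_intros)
  finally show ?thesis .
qed

lemma orthant_plus_orthant: "(orthant + orthant :: (real^'n::finite) set) = orthant"
proof
  show "orthant + orthant \<subseteq> (orthant :: (real^'n) set)"
    by (auto simp: set_plus_def intro: orthant_add)
  show "(orthant :: (real^'n) set) \<subseteq> orthant + orthant"
    using set_plus_intro[of _ orthant 0 "orthant :: (real^'n) set"] by auto
qed

lemma newton_polyhedron_eq: "newton_polyhedron I = upper_hull (real_exponent ` exponents I)"
proof -
  have "{real_exponent k + v | k v. k \<in> (\<Union>f\<in>I. supp f) \<and> (\<forall>i. 0 \<le> v $h i)} =
      real_exponent ` exponents I + orthant"
    by (auto simp: set_plus_def exponents_def orthant_def)
  thus ?thesis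
    unfolding newton_polyhedron_def upper_hull_def
    by (simp add: convex_hull_set_plus hull_same[of convex] convex_orthant)
qed

lemma convex_upper_hull: "convex (upper_hull E)"
  unfolding upper_hull_def by (intro convex_set_plus convex_convex_hull convex_orthant)

lemma upper_hull_add_orthant: "x \<in> upper_hull E \<Longrightarrow> v \<in> orthant \<Longrightarrow> x + v \<in> upper_hull E"
  unfolding upper_hull_def set_plus_def by simp (metis add.assoc orthant_add)

lemma convex_hull_subset_upper_hull: "convex hull E \<subseteq> upper_hull E"
proof
  fix x assume "x \<in> convex hull E"
  thus "x \<in> upper_hull E"
    unfolding upper_hull_def using set_plus_intro[of x "convex hull E" 0 orthant] by simp
qed

lemma upper_hull_inc: "x \<in> E \<Longrightarrow> x \<in> upper_hull E"
  by (rule subsetD[OF convex_hull_subset_upper_hull hull_inc])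

lemma upper_hull_empty [simp]: "upper_hull {} = {}"
  by (simp add: upper_hull_def set_plus_def)

lemma upper_hullE:
  assumes "x \<in> upper_hull E"
  obtains y v where "x = y + v" "y \<in> convex hull E" "v \<in> orthant"
  using assms unfolding upper_hull_def by (rule set_plus_elim)

lemma upper_hull_subsetI:
  assumes "S \<subseteq> upper_hull E"
  shows "upper_hull S \<subseteq> upper_hull E"
proof
  fix x assume "x \<in> upper_hull S"
  then obtain y v where yv: "x = y + v" "y \<in> convex hull S" "v \<in> orthant"
    by (rule upper_hullE)
  have "y \<in> upper_hull E"
    by (rule subsetD[OF hull_minimal[of S "upper_hull E" convex, OF assms convex_upper_hull] yv(2)])
  thus "x \<in> upper_hull E" using yv by (simp add: upper_hull_add_orthant)
qed

lemma closed_upper_hull: "finite E \<Longrightarrow> closed (upper_hull E)"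
proof -
  assume "finite E"
  hence "compact (convex hull E)" by (rule finite_imp_compact_convex_hull)
  from compact_closed_sums[OF this closed_orthant]
  have "closed (\<Union>x\<in>convex hull E. \<Union>y\<in>orthant. {x + y})" by simp
  moreover have "(\<Union>x\<in>convex hull E. \<Union>y\<in>orthant. {x + y}) = upper_hull E"
    unfolding upper_hull_def set_plus_def by auto
  ultimately show ?thesis by simp
qed

lemma sum_upper_hull:
  assumes "finite I" "I \<noteq> {}"
  shows "(\<Sum>i\<in>I. upper_hull (E i)) = upper_hull (\<Sum>i\<in>I. E i)"
proof -
  have "(\<Sum>i\<in>I. upper_hull (E i)) = (\<Sum>i\<in>I. convex hull (E i)) + (\<Sum>i\<in>I. orthant)"
    unfolding upper_hull_def by (simp add: sum.distrib)
  also have "(\<Sum>i\<in>I. orthant) = (orthant :: (real^'b) set)"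
    using assms by (induction rule: finite_ne_induct) (simp_all add: orthant_plus_orthant)
  finally show ?thesis by (simp add: upper_hull_def convex_hull_set_sum)
qed

lemma upper_hull_finite:
  assumes "finite E"
  shows "x \<in> upper_hull E \<longleftrightarrow>
    (\<exists>u. (\<forall>e\<in>E. 0 \<le> u e) \<and> sum u E = 1 \<and> (\<forall>i. (\<Sum>e\<in>E. u e *\<^sub>R e) $h i \<le> x $h i))"
proof
  assume "x \<in> upper_hull E"
  then obtain y v where yv: "x = y + v" "y \<in> convex hull E" "v \<in> orthant"
    by (rule upper_hullE)
  with assms show "\<exists>u. (\<forall>e\<in>E. 0 \<le> u e) \<and> sum u E = 1 \<and> (\<forall>i. (\<Sum>e\<in>E. u e *\<^sub>R e) $h i \<le> x $h i)"
    by (auto simp: convex_hull_finite orthant_def)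
next
  assume "\<exists>u. (\<forall>e\<in>E. 0 \<le> u e) \<and> sum u E = 1 \<and> (\<forall>i. (\<Sum>e\<in>E. u e *\<^sub>R e) $h i \<le> x $h i)"
  then obtain u where u: "\<forall>e\<in>E. 0 \<le> u e" "sum u E = 1" "\<forall>i. (\<Sum>e\<in>E. u e *\<^sub>R e) $h i \<le> x $h i"
    by blast
  have "(\<Sum>e\<in>E. u e *\<^sub>R e) \<in> upper_hull E"
    using convex_hull_subset_upper_hull[of E] u assms by (auto simp: convex_hull_finite)
  from upper_hull_add_orthant[OF this, of "x - (\<Sum>e\<in>E. u e *\<^sub>R e)"]
  show "x \<in> upper_hull E" using u(3) by (simp add: orthant_def)
qed

lemma inj_real_exponent: "inj real_exponent"
  by (auto simp: inj_def real_exponent_def Finite_Cartesian_Product.vec_eq_iff)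

lemma real_exponent_nth [simp]: "real_exponent k $h i = real (k $h i)"
  by (simp add: real_exponent_def)

lemma real_exponent_add: "real_exponent (k + l) = real_exponent k + real_exponent l"
  by (simp add: Finite_Cartesian_Product.vec_eq_iff)

lemma real_exponent_zero [simp]: "real_exponent 0 = 0"
  by (simp add: Finite_Cartesian_Product.vec_eq_iff)

lemma real_exponent_sum: "real_exponent (sum f I) = (\<Sum>i\<in>I. real_exponent (f i))"
  by (induction I rule: infinite_finite_induct) (auto simp: real_exponent_add)

lemma upper_hull_exponent_ge:
  assumes "real_exponent e \<in> upper_hull E" "\<And>i. e $h i \<le> k $h i"
  shows "real_exponent k \<in> upper_hull E"
  using upper_hull_add_orthant[OF assms(1), of "real_exponent k - real_exponent e"] assms(2)
  by (simp add: orthant_def)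

lemma upper_hull_dickson:
  assumes "E \<subseteq> S" "\<forall>k\<in>S. \<exists>e\<in>E. \<forall>i. e $h i \<le> k $h i"
  shows "upper_hull (real_exponent ` S) = upper_hull (real_exponent ` E)"
proof
  show "upper_hull (real_exponent ` S) \<subseteq> upper_hull (real_exponent ` E)"
  proof (rule upper_hull_subsetI, rule image_subsetI)
    fix k assume "k \<in> S"
    from bspec[OF assms(2) this] obtain e where "e \<in> E" "\<forall>i. e $h i \<le> k $h i" ..
    thus "real_exponent k \<in> upper_hull (real_exponent ` E)"
      by (intro upper_hull_exponent_ge[of e, OF upper_hull_inc]) simp_all
  qed
  show "upper_hull (real_exponent ` E) \<subseteq> upper_hull (real_exponent ` S)"
  proof (rule upper_hull_subsetI, rule image_subsetI)
    fix e assume "e \<in> E"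
    thus "real_exponent e \<in> upper_hull (real_exponent ` S)"
      using assms(1) by (simp add: upper_hull_inc subset_iff)
  qed
qed

lemma newton_polyhedron_finite:
  obtains E where "finite E" "E \<subseteq> exponents I"
    "\<forall>k\<in>exponents I. \<exists>e\<in>E. \<forall>i. e $h i \<le> k $h i"
    "newton_polyhedron I = upper_hull (real_exponent ` E)"
proof (rule dickson[of "exponents I"])
  fix E :: "(nat^'a) set"
  assume E: "finite E" "E \<subseteq> exponents I"
    "\<forall>k\<in>exponents I. \<exists>e\<in>E. \<forall>i. e $h i \<le> k $h i"
  from upper_hull_dickson[OF E(2,3)]
  have "newton_polyhedron I = upper_hull (real_exponent ` E)"
    by (simp only: newton_polyhedron_eq)
  with E show ?thesis by (rule that)
qed

lemma closed_newton_polyhedron: "closed (newton_polyhedron I)"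
proof -
  obtain E where E: "finite E" "E \<subseteq> exponents I"
    "\<forall>k\<in>exponents I. \<exists>e\<in>E. \<forall>i. e $h i \<le> k $h i"
    "newton_polyhedron I = upper_hull (real_exponent ` E)"
    using newton_polyhedron_finite[of I] .
  show ?thesis unfolding E(4) by (intro closed_upper_hull finite_imageI E(1))
qed

subsection \<open>Weights\<close>

definition weight :: "('n::finite \<Rightarrow> nat) \<Rightarrow> nat^'n \<Rightarrow> nat" where
  "weight w k = (\<Sum>i\<in>UNIV. w i * k $h i)"

lemma weight_add: "weight w (k + l) = weight w k + weight w l"
  by (simp add: weight_def sum.distrib distrib_left)

lemma weight_zero [simp]: "weight w 0 = 0"
  by (simp add: weight_def)

lemma weight_sum: "weight w (sum f I) = (\<Sum>i\<in>I. weight w (f i))"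
  by (induction I rule: infinite_finite_induct) (auto simp: weight_add)

lemma weight_mono: "(\<And>i. k $h i \<le> l $h i) \<Longrightarrow> weight w k \<le> weight w l"
  unfolding weight_def by (intro sum_mono mult_left_mono) auto

lemma total_degree_le_weight: "(\<And>i. 0 < w i) \<Longrightarrow> total_degree k \<le> weight w k"
  unfolding weight_def total_degree_def
  by (intro sum_mono) (simp add: Suc_leI)

lemma real_weight: "real (weight w k) = (\<chi> i. real (w i)) \<bullet> real_exponent k"
  by (simp add: weight_def inner_vec_def)

text \<open>A linear form with nonnegative coefficients is least at a generator. Weights are
  integers, so if all generators weighed more than k, they would weigh at least one more, and a
  convex combination keeps this gap.\<close>

lemma weight_le_on_upper_hull:
  assumes "finite E" "real_exponent k \<in> upper_hull (real_exponent ` E)"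
  shows "\<exists>e\<in>E. weight w e \<le> weight w k"
proof (rule ccontr)
  assume "\<not> (\<exists>e\<in>E. weight w e \<le> weight w k)"
  hence less: "weight w k + 1 \<le> weight w e" if "e \<in> E" for e using that by (simp add: Suc_le_eq not_le)
  let ?w = "(\<chi> i. real (w i)) :: real^'a"
  let ?E = "real_exponent ` E"
  from iffD1[OF upper_hull_finite[OF finite_imageI[OF assms(1)]] assms(2)] obtain u where
    "(\<forall>e\<in>?E. 0 \<le> u e) \<and> sum u ?E = 1 \<and> (\<forall>i. (\<Sum>e\<in>?E. u e *\<^sub>R e) $h i \<le> real_exponent k $h i)" ..
  hence u: "\<forall>e\<in>?E. 0 \<le> u e" "sum u ?E = 1" "\<forall>i. (\<Sum>e\<in>?E. u e *\<^sub>R e) $h i \<le> real_exponent k $h i"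
    by simp_all
  have "real (weight w k) + 1 = (\<Sum>e\<in>real_exponent ` E. u e * (real (weight w k) + 1))"
    using u(2) by (simp flip: sum_distrib_right)
  also have "\<dots> \<le> (\<Sum>e\<in>real_exponent ` E. u e * (?w \<bullet> e))"
  proof (rule sum_mono, rule mult_left_mono)
    fix e assume e: "e \<in> real_exponent ` E"
    then obtain k' where "e = real_exponent k'" "k' \<in> E" by (rule imageE)
    thus "real (weight w k) + 1 \<le> ?w \<bullet> e" using less[of k']
      by (simp flip: real_weight)
    show "0 \<le> u e" by (rule bspec[OF u(1) e])
  qed
  also have "\<dots> = ?w \<bullet> (\<Sum>e\<in>real_exponent ` E. u e *\<^sub>R e)"
    by (simp add: inner_sum_right)
  also have "\<dots> \<le> ?w \<bullet> real_exponent k"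
    unfolding inner_vec_def inner_real_def using u(3) by (intro sum_mono mult_left_mono) simp_all
  finally show False by (simp flip: real_weight)
qed

text \<open>A separating hyperplane gives real coefficients, which are nonnegative because the hull
  absorbs the orthant. Scaling by a large number and rounding up makes them positive
  integers.\<close>

lemma weight_separation:
  assumes "finite E" "real_exponent k \<notin> upper_hull (real_exponent ` E)"
  obtains w :: "'n::finite \<Rightarrow> nat" where "\<forall>i. 0 < w i" "\<forall>e\<in>E. weight w k < weight w e"
proof -
  let ?P = "upper_hull (real_exponent ` E)"
  have "closed ?P" using assms(1) by (intro closed_upper_hull) auto
  from separating_hyperplane_closed_point[OF convex_upper_hull this assms(2)]
  obtain a b where "a \<bullet> real_exponent k < b \<and> (\<forall>x\<in>?P. b < a \<bullet> x)" by (elim exE)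
  hence ab: "a \<bullet> real_exponent k < b" "\<And>x. x \<in> ?P \<Longrightarrow> b < a \<bullet> x" by simp_all
  have abE: "b < a \<bullet> real_exponent e" if "e \<in> E" for e
    by (rule ab(2)[OF upper_hull_inc[OF imageI[OF that]]])
  show ?thesis
  proof (cases "E = {}")
    case True
    show ?thesis by (rule that[of "\<lambda>_. 1"]) (use True in auto)
  next
    case False
    then obtain e0 where e0: "e0 \<in> E" by blast
    have a: "0 \<le> a $h i" for i
    proof (rule ccontr)
      assume neg: "\<not> 0 \<le> a $h i"
      \<comment> \<open>The distance to move from \<open>e0\<close> in the i-th direction until the
        linear form takes exactly the value b, which it must exceed on the hull.\<close>
      define t where "t = (b - a \<bullet> real_exponent e0) / a $h i"
      have t: "0 \<le> t" unfolding t_def using neg abE[OF e0] by (intro divide_nonpos_neg) auto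
      have "real_exponent e0 + axis i t \<in> ?P"
        by (rule upper_hull_add_orthant[OF upper_hull_inc[OF imageI[OF e0]]])
          (use t in \<open>simp add: orthant_def axis_def\<close>)
      from ab(2)[OF this] have "b < a \<bullet> real_exponent e0 + a $h i * t"
        by (simp add: inner_add_right inner_axis)
      also have "a $h i * t = b - a \<bullet> real_exponent e0" using neg by (simp add: t_def)
      finally show False by simp
    qed
    \<comment> \<open>Rounding up and adding 1 raises each coefficient by at most 2, hence the
      weight of k by at most twice its degree; N makes the scaled gap larger than that.\<close>
    obtain N :: nat where N: "2 * real (total_degree k) < real N * (b - a \<bullet> real_exponent k)"
      using reals_Archimedean3[of "b - a \<bullet> real_exponent k"] ab(1) by auto
    define w where "w i = nat \<lceil>real N * a $h i\<rceil> + 1" for i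
    have w: "real N * a $h i \<le> real (w i)" "real (w i) \<le> real N * a $h i + 2" for i
    proof -
      have "0 \<le> real N * a $h i" using a[of i] by simp
      hence "real (nat \<lceil>real N * a $h i\<rceil>) = of_int \<lceil>real N * a $h i\<rceil>" by simp
      thus "real N * a $h i \<le> real (w i)" "real (w i) \<le> real N * a $h i + 2"
        unfolding w_def by linarith+
    qed
    show ?thesis
    proof (rule that[of w]; intro allI ballI)
      show "0 < w i" for i by (simp add: w_def)
      fix e assume e: "e \<in> E"
      have "real (weight w k) \<le> (\<Sum>i\<in>UNIV. (real N * a $h i + 2) * real (k $h i))"
        unfolding weight_def of_nat_sum of_nat_mult using w by (intro sum_mono mult_right_mono) auto
      also have "\<dots> = real N * (a \<bullet> real_exponent k) + 2 * real (total_degree k)"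
        by (simp add: distrib_right sum.distrib inner_vec_def total_degree_def sum_distrib_left mult.assoc)
      also have "\<dots> < real N * b" using N by (simp add: algebra_simps)
      also have "\<dots> \<le> real N * (a \<bullet> real_exponent e)"
        using abE[OF e] by (intro mult_left_mono) simp_all
      also have "\<dots> = (\<Sum>i\<in>UNIV. (real N * a $h i) * real (e $h i))"
        by (simp add: inner_vec_def sum_distrib_left mult.assoc)
      also have "\<dots> \<le> real (weight w e)"
        unfolding weight_def of_nat_sum of_nat_mult using w by (intro sum_mono mult_right_mono) auto
      finally show "weight w k < weight w e" by simp
    qed
  qed
qed

text \<open>This and \<open>newton_polyhedronD_weight\<close> turn membership in a Newton polyhedron
  into inequalities for monomial valuations. Positive weights suffice to exclude a point, by
  \<open>weight_separation\<close>.\<close>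

lemma newton_polyhedronI_weight:
  assumes "\<And>w. (\<And>i. 0 < w i) \<Longrightarrow> \<exists>l\<in>exponents I. weight w l \<le> weight w k"
  shows "real_exponent k \<in> newton_polyhedron I"
proof (rule ccontr)
  assume not: "real_exponent k \<notin> newton_polyhedron I"
  obtain E where E: "finite E" "E \<subseteq> exponents I"
    "\<forall>k\<in>exponents I. \<exists>e\<in>E. \<forall>i. e $h i \<le> k $h i"
    "newton_polyhedron I = upper_hull (real_exponent ` E)"
    using newton_polyhedron_finite[of I] .
  have "real_exponent k \<notin> upper_hull (real_exponent ` E)" using not E(4) by simp
  then obtain w where w: "\<forall>i. 0 < w i" "\<forall>e\<in>E. weight w k < weight w e"
    by (rule weight_separation[OF E(1)])
  from assms[of w] w(1) obtain l where l: "l \<in> exponents I" "weight w l \<le> weight w k" by blast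
  from E(3) l(1) obtain e where "e \<in> E" "\<forall>i. e $h i \<le> l $h i" by blast
  with weight_mono[of e l w] w(2) l(2) show False by (meson leD le_trans)
qed

lemma newton_polyhedronD_weight:
  assumes "real_exponent k \<in> newton_polyhedron I"
  shows "\<exists>l\<in>exponents I. weight w l \<le> weight w k"
proof -
  obtain E where E: "finite E" "E \<subseteq> exponents I"
    "\<forall>k\<in>exponents I. \<exists>e\<in>E. \<forall>i. e $h i \<le> k $h i"
    "newton_polyhedron I = upper_hull (real_exponent ` E)"
    using newton_polyhedron_finite[of I] .
  from weight_le_on_upper_hull[OF E(1), of k w] assms E show ?thesis by auto
qed

subsection \<open>Simultaneous approximation\<close>

lemma dirichlet_finite:
  fixes \<theta> :: "'a \<Rightarrow> real"
  assumes "finite I" "\<epsilon> > 0"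
  obtains q :: nat and p :: "'a \<Rightarrow> int" where "q > 0" "\<forall>i\<in>I. \<bar>real q * \<theta> i - of_int (p i)\<bar> < \<epsilon>"
proof -
  obtain h where h: "bij_betw h {..<card I} I"
    using ex_bij_betw_nat_finite[OF assms(1)] by (auto simp: atLeast0LessThan)
  obtain N :: nat where N: "N > 0" "1 / real N < \<epsilon>"
    using assms(2) by (metis bot_nat_0.not_eq_extremum inverse_eq_divide real_arch_inverse)
  obtain q p where qp: "0 < q" "q \<le> int (N ^ card I)"
    "\<And>i. i < card I \<Longrightarrow> \<bar>of_int q * \<theta> (h i) - of_int (p i)\<bar> < 1 / N"
    using Dirichlet_approx_simult[OF N(1), of "card I" "\<theta> \<circ> h"] by auto
  let ?g = "inv_into {..<card I} h"
  show ?thesis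
  proof (rule that[of "nat q" "p \<circ> ?g"]; (intro ballI)?)
    fix i assume i: "i \<in> I"
    hence "h (?g i) = i" "?g i < card I"
      using h by (auto simp: bij_betw_inv_into_right dest: bij_betwE[OF bij_betw_inv_into])
    thus "\<bar>real (nat q) * \<theta> i - of_int ((p \<circ> ?g) i)\<bar> < \<epsilon>" using qp(3)[of "?g i"] qp(1) N(2) by simp
  qed (use qp(1) in simp)
qed

text \<open>
  Simultaneous approximation keeps all integral linear equations between the approximated numbers,
  because an integer of absolute value less than one vanishes.
\<close>

lemma integral_relation:
  fixes u v :: "nat^'n::finite \<Rightarrow> real"
  assumes "finite E" and u: "\<And>e. e \<in> E \<Longrightarrow> 0 \<le> u e" "sum u E = 1"
    and v: "\<And>e. e \<in> E \<Longrightarrow> 0 \<le> v e" "sum v E = 1"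
    and le: "\<And>i. (\<Sum>e\<in>E. u e * real (e $h i)) \<le> (\<Sum>e\<in>E. v e * real (e $h i))"
  obtains q :: nat and m n :: "nat^'n \<Rightarrow> nat" where "q > 0" "sum m E = q" "sum n E = q"
    "\<forall>e\<in>E. m e > 0 \<longleftrightarrow> u e > 0" "\<forall>e\<in>E. n e > 0 \<longleftrightarrow> v e > 0"
    "\<forall>i. (\<Sum>e\<in>E. m e * e $h i) \<le> (\<Sum>e\<in>E. n e * e $h i)"
    "\<forall>i. (\<Sum>e\<in>E. u e * real (e $h i)) < (\<Sum>e\<in>E. v e * real (e $h i)) \<longrightarrow>
       (\<Sum>e\<in>E. m e * e $h i) < (\<Sum>e\<in>E. n e * e $h i)"
proof -
  let ?U = "\<lambda>i. \<Sum>e\<in>E. u e * real (e $h i)" and ?V = "\<lambda>i. \<Sum>e\<in>E. v e * real (e $h i)"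
  \<comment> \<open>Bounds the accumulated rounding errors in units of \<epsilon>:
    \<open>card E\<close> of them for the total mass, two per unit of degree when coordinates are
    compared, and some slack for strict inequalities.\<close>
  define B where "B = 2 + real (card E) + (\<Sum>e\<in>E. 2 * real (total_degree e))"
  \<comment> \<open>The positive quantities that approximation has to respect: 1 for integrality,
    the positive coefficients, and the strict gaps between coordinates. The choice of \<epsilon>
    keeps \<open>B * \<epsilon>\<close> below each of them.\<close>
  define S where "S = {1} \<union> {u e | e. e \<in> E \<and> u e > 0} \<union> {v e | e. e \<in> E \<and> v e > 0} \<union>
    {?V i - ?U i | i. ?U i < ?V i}"
  have "S \<subseteq> {1} \<union> u ` E \<union> v ` E \<union> range (\<lambda>i. ?V i - ?U i)" unfolding S_def by auto
  hence fin: "finite S" by (rule finite_subset) (use assms(1) in simp)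
  have S_ne: "S \<noteq> {}" by (auto simp: S_def)
  have Min_pos: "Min S > 0" using fin S_ne by (subst Min_gr_iff) (auto simp: S_def)
  have B: "B > 0" unfolding B_def by (intro add_pos_nonneg sum_nonneg) auto
  define \<epsilon> where "\<epsilon> = Min S / B"
  have eps: "\<epsilon> > 0" using B Min_pos by (simp add: \<epsilon>_def)
  have epsB: "B * \<epsilon> \<le> s" if "s \<in> S" for s
    using that fin B by (simp add: \<epsilon>_def)
  have "B \<ge> 2" "B \<ge> 1 + real (card E)"
    unfolding B_def by (auto intro!: add_nonneg_nonneg sum_nonneg)
  have eps_small: "\<epsilon> < s" if "s \<in> S" for s
  proof -
    have "\<epsilon> < 2 * \<epsilon>" using eps by simp
    also have "\<dots> \<le> B * \<epsilon>" using \<open>B \<ge> 2\<close> eps by (intro mult_right_mono) auto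
    finally show ?thesis using epsB[OF that] by simp
  qed
  have one: "1 \<in> S" by (simp add: S_def)
  \<comment> \<open>The Boolean tags the two families, which are thus approximated with one common
    denominator.\<close>
  define \<theta> :: "(nat^'n) \<times> bool \<Rightarrow> real" where "\<theta> = (\<lambda>(e,b). if b then u e else v e)"
  have "finite (E \<times> (UNIV :: bool set))" using assms(1) by simp
  then obtain q p where q: "q > 0" and p: "\<forall>x\<in>E \<times> UNIV. \<bar>real q * \<theta> x - of_int (p x)\<bar> < \<epsilon>"
    by (rule dirichlet_finite[OF _ eps, where \<theta> = \<theta>]) (rule that)
  have appr: "\<exists>m. \<forall>e\<in>E. (real (m e) - \<epsilon> < real q * f e \<and> real q * f e < real (m e) + \<epsilon>) \<and> (m e > 0 \<longleftrightarrow> f e > 0)"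
    if f: "\<And>e. e \<in> E \<Longrightarrow> 0 \<le> f e" "\<And>e. e \<in> E \<Longrightarrow> \<theta> (e,b) = f e" "\<And>e. e \<in> E \<Longrightarrow> f e > 0 \<Longrightarrow> f e \<in> S" for f b
  proof (intro exI[of _ "\<lambda>e. nat (p (e,b))"] ballI)
    fix e assume e: "e \<in> E"
    have 1: "\<bar>real q * f e - of_int (p (e,b))\<bar> < \<epsilon>" using bspec[OF p, of "(e,b)"] e f(2) by auto
    have "real q * f e \<ge> 0" using f(1)[OF e] by simp
    hence "of_int (p (e,b)) > - \<epsilon>" using 1 by linarith
    hence "of_int (p (e,b)) > (-1 :: real)" using eps_small[OF one] by linarith
    hence 2: "p (e,b) \<ge> 0" by linarith
    have 3: "p (e,b) > 0" if "f e > 0"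
    proof -
      have "f e \<le> real q * f e" using q that by simp
      with eps_small[OF f(3)[OF e that]] have "real q * f e > \<epsilon>" by linarith
      hence "of_int (p (e,b)) > (0::real)" using 1 by linarith
      thus ?thesis by simp
    qed
    have 4: "p (e,b) \<le> 0" if "\<not> f e > 0"
    proof -
      have "f e = 0" using that f(1)[OF e] by simp
      hence "\<bar>of_int (p (e,b))\<bar> < (1 :: real)" using 1 eps_small[OF one] by simp
      thus ?thesis by linarith
    qed
    show "(real (nat (p (e,b))) - \<epsilon> < real q * f e \<and> real q * f e < real (nat (p (e,b))) + \<epsilon>) \<and>
        (nat (p (e,b)) > 0 \<longleftrightarrow> f e > 0)"
      using 1 2 3 4 by (cases "f e > 0") (auto simp: abs_less_iff)
  qed
  have "\<exists>m. \<forall>e\<in>E. (real (m e) - \<epsilon> < real q * u e \<and> real q * u e < real (m e) + \<epsilon>) \<and> (m e > 0 \<longleftrightarrow> u e > 0)"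
    by (rule appr[of u True]) (use u(1) in \<open>auto simp: \<theta>_def S_def\<close>)
  then obtain m where "\<forall>e\<in>E. (real (m e) - \<epsilon> < real q * u e \<and> real q * u e < real (m e) + \<epsilon>) \<and> (m e > 0 \<longleftrightarrow> u e > 0)" ..
  hence m: "\<And>e. e \<in> E \<Longrightarrow> real (m e) - \<epsilon> < real q * u e" "\<And>e. e \<in> E \<Longrightarrow> real q * u e < real (m e) + \<epsilon>"
      "\<And>e. e \<in> E \<Longrightarrow> m e > 0 \<longleftrightarrow> u e > 0"
    by simp_all
  have "\<exists>n. \<forall>e\<in>E. (real (n e) - \<epsilon> < real q * v e \<and> real q * v e < real (n e) + \<epsilon>) \<and> (n e > 0 \<longleftrightarrow> v e > 0)"
    by (rule appr[of v False]) (use v(1) in \<open>auto simp: \<theta>_def S_def\<close>)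
  then obtain n where "\<forall>e\<in>E. (real (n e) - \<epsilon> < real q * v e \<and> real q * v e < real (n e) + \<epsilon>) \<and> (n e > 0 \<longleftrightarrow> v e > 0)" ..
  hence n: "\<And>e. e \<in> E \<Longrightarrow> real (n e) - \<epsilon> < real q * v e" "\<And>e. e \<in> E \<Longrightarrow> real q * v e < real (n e) + \<epsilon>"
      "\<And>e. e \<in> E \<Longrightarrow> n e > 0 \<longleftrightarrow> v e > 0"
    by simp_all
  have total: "sum m E = q" if f: "sum f E = 1"
      "\<And>e. e \<in> E \<Longrightarrow> real (m e) - \<epsilon> < real q * f e" "\<And>e. e \<in> E \<Longrightarrow> real q * f e < real (m e) + \<epsilon>" for f m
  proof -
    have "\<bar>real (sum m E) - real q\<bar> = \<bar>\<Sum>e\<in>E. real (m e) - real q * f e\<bar>"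
      by (simp add: sum_subtractf f(1) flip: sum_distrib_left)
    also have "\<dots> \<le> (\<Sum>e\<in>E. \<epsilon>)"
      by (rule order_trans[OF sum_abs], rule sum_mono) (use f in \<open>force simp: abs_le_iff\<close>)
    also have "\<dots> < (1 + real (card E)) * \<epsilon>" using eps by (simp add: distrib_right)
    also have "\<dots> \<le> B * \<epsilon>" using \<open>B \<ge> 1 + real (card E)\<close> eps by (intro mult_right_mono) auto
    also have "\<dots> \<le> 1" by (rule epsB[OF one])
    finally show ?thesis by linarith
  qed
  have diff: "\<bar>(\<Sum>e\<in>E. real (n e) * real (e $h i)) - (\<Sum>e\<in>E. real (m e) * real (e $h i)) - real q * (?V i - ?U i)\<bar> < B * \<epsilon>" for i
  proof -
    have "(\<Sum>e\<in>E. real (n e) * real (e $h i)) - (\<Sum>e\<in>E. real (m e) * real (e $h i)) - real q * (?V i - ?U i) =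
      (\<Sum>e\<in>E. (real (n e) - real q * v e - (real (m e) - real q * u e)) * real (e $h i))"
      by (simp add: algebra_simps sum.distrib sum_subtractf sum_distrib_left)
    also have "\<bar>\<dots>\<bar> \<le> (\<Sum>e\<in>E. (2 * \<epsilon>) * real (total_degree e))"
    proof (rule order_trans[OF sum_abs], rule sum_mono)
      fix e assume e: "e \<in> E"
      have "\<bar>real (n e) - real q * v e - (real (m e) - real q * u e)\<bar> \<le> 2 * \<epsilon>"
        using m(1,2)[OF e] n(1,2)[OF e] by linarith
      thus "\<bar>(real (n e) - real q * v e - (real (m e) - real q * u e)) * real (e $h i)\<bar> \<le> 2 * \<epsilon> * real (total_degree e)"
        unfolding abs_mult by (intro mult_mono) (use nth_le_total_degree[of e i] eps in auto)
    qed
    also have "\<dots> = (\<Sum>e\<in>E. 2 * real (total_degree e)) * \<epsilon>"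
      by (simp add: sum_distrib_right sum_distrib_left mult_ac)
    also have "\<dots> < B * \<epsilon>"
      unfolding B_def using eps by (intro mult_strict_right_mono) auto
    finally show ?thesis .
  qed
  have weak: "(\<Sum>e\<in>E. m e * e $h i) \<le> (\<Sum>e\<in>E. n e * e $h i)" for i
  proof -
    have "0 \<le> real q * (?V i - ?U i)" using le[of i] by simp
    hence "(\<Sum>e\<in>E. real (m e) * real (e $h i)) < (\<Sum>e\<in>E. real (n e) * real (e $h i)) + 1"
      using diff[of i] epsB[OF one] by linarith
    hence "real (\<Sum>e\<in>E. m e * e $h i) < real (\<Sum>e\<in>E. n e * e $h i) + 1" by simp
    thus ?thesis by linarith
  qed
  have strict: "(\<Sum>e\<in>E. m e * e $h i) < (\<Sum>e\<in>E. n e * e $h i)" if less: "?U i < ?V i" for i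
  proof -
    have "B * \<epsilon> \<le> ?V i - ?U i" using less by (intro epsB) (auto simp: S_def)
    also have "\<dots> \<le> real q * (?V i - ?U i)" using less q by simp
    finally have "(\<Sum>e\<in>E. real (m e) * real (e $h i)) < (\<Sum>e\<in>E. real (n e) * real (e $h i))"
      using diff[of i] by linarith
    hence "real (\<Sum>e\<in>E. m e * e $h i) < real (\<Sum>e\<in>E. n e * e $h i)" by simp
    thus ?thesis by linarith
  qed
  show ?thesis
  proof (rule that[of q m n])
    show "q > 0" by (rule q)
    show "sum m E = q" by (rule total[OF u(2) m(1,2)])
    show "sum n E = q" by (rule total[OF v(2) n(1,2)])
  qed (use m(3) n(3) weak strict in simp_all)
qed

subsection \<open>Faces\<close>

text \<open>If v were not zero, y + v would be interior to the segment from y to y + t v for every t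
  > 1, so the face would contain y + t v for arbitrarily large t and be unbounded.\<close>

lemma face_add_orthant_zero:
  assumes F: "F face_of P" "bounded F" and add: "\<And>x v. x \<in> P \<Longrightarrow> v \<in> orthant \<Longrightarrow> x + v \<in> P"
    and y: "y \<in> P" "v \<in> orthant" "y + v \<in> F"
  shows "v = 0"
proof (rule ccontr)
  assume v: "v \<noteq> 0"
  obtain B where B: "\<And>x. x \<in> F \<Longrightarrow> norm x \<le> B" using F(2) unfolding bounded_iff by blast
  have "norm (y + v) \<le> B" by (rule B[OF y(3)])
  hence B0: "0 \<le> B" using norm_ge_zero[of "y + v"] by linarith
  \<comment> \<open>Makes the norm of t v equal to \<open>B + norm y + 1 + norm v\<close>, more than
    a point of F at distance at most B from 0 allows.\<close>
  define t where "t = (B + norm y + 1) / norm v + 1"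
  have t: "1 < t" using B0 v by (simp add: t_def add_nonneg_pos)
  have z: "y + t *\<^sub>R v \<in> P" using add[OF y(1) orthant_scaleR[OF y(2)]] t by simp
  have "y + v = (1 - 1 / t) *\<^sub>R y + (1 / t) *\<^sub>R (y + t *\<^sub>R v)"
    using t by (simp add: algebra_simps)
  hence "y + v \<in> open_segment y (y + t *\<^sub>R v)"
    unfolding in_segment(2) using v t by (intro conjI exI[of _ "1 / t"]) auto
  from face_ofD[OF F(1) this y(1) z y(3)] have "y + t *\<^sub>R v \<in> F" by simp
  from B[OF this] have "norm (y + t *\<^sub>R v) \<le> B" .
  moreover have "norm (t *\<^sub>R v) \<le> norm (y + t *\<^sub>R v) + norm y"
    using norm_triangle_ineq4[of "y + t *\<^sub>R v" y] by simp
  moreover have "norm (t *\<^sub>R v) = t * norm v" using t by simp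
  moreover have "t * norm v = B + norm y + 1 + norm v"
    using v by (simp add: t_def field_simps)
  ultimately show False using norm_ge_zero[of v] by linarith
qed

text \<open>Complementary slackness: the excess over \<kappa> is the sum of the nonnegative terms
  \<open>u e * (\<gamma> \<bullet> e - \<kappa>)\<close>.\<close>

lemma supporting_combination:
  fixes G :: "'a::real_inner set"
  assumes "finite G" "\<forall>e\<in>G. 0 \<le> u e" "sum u G = 1" "\<forall>e\<in>G. \<kappa> \<le> \<gamma> \<bullet> e"
  shows "\<kappa> \<le> \<gamma> \<bullet> (\<Sum>e\<in>G. u e *\<^sub>R e)"
    and "\<gamma> \<bullet> (\<Sum>e\<in>G. u e *\<^sub>R e) = \<kappa> \<longleftrightarrow> (\<forall>e\<in>G. u e = 0 \<or> \<gamma> \<bullet> e = \<kappa>)"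
proof -
  have eq: "\<gamma> \<bullet> (\<Sum>e\<in>G. u e *\<^sub>R e) - \<kappa> = (\<Sum>e\<in>G. u e * (\<gamma> \<bullet> e - \<kappa>))"
    using assms(3) by (simp add: inner_sum_right right_diff_distrib sum_subtractf flip: sum_distrib_right)
  have nn: "0 \<le> u e * (\<gamma> \<bullet> e - \<kappa>)" if "e \<in> G" for e using assms(2,4) that by simp
  have "0 \<le> (\<Sum>e\<in>G. u e * (\<gamma> \<bullet> e - \<kappa>))" by (rule sum_nonneg) (rule nn)
  thus "\<kappa> \<le> \<gamma> \<bullet> (\<Sum>e\<in>G. u e *\<^sub>R e)" using eq by linarith
  have "\<gamma> \<bullet> (\<Sum>e\<in>G. u e *\<^sub>R e) = \<kappa> \<longleftrightarrow> (\<Sum>e\<in>G. u e * (\<gamma> \<bullet> e - \<kappa>)) = 0"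
    using eq by auto
  also have "\<dots> \<longleftrightarrow> (\<forall>e\<in>G. u e * (\<gamma> \<bullet> e - \<kappa>) = 0)"
    by (rule sum_nonneg_eq_0_iff[OF assms(1) nn])
  finally show "\<gamma> \<bullet> (\<Sum>e\<in>G. u e *\<^sub>R e) = \<kappa> \<longleftrightarrow> (\<forall>e\<in>G. u e = 0 \<or> \<gamma> \<bullet> e = \<kappa>)" by simp
qed

text \<open>
  A compact face is a face of the polytope spanned by \<open>E\<close> and its translates by unit vectors, hence
  exposed there; the translates force the exposing functional to be strictly positive. Simultaneous
  approximation then makes it integral.
\<close>

lemma exposing_weight:
  fixes E :: "(nat^'n::finite) set"
  assumes E: "finite E" and F: "F face_of upper_hull (real_exponent ` E)" "bounded F" "F \<noteq> {}"
  obtains w :: "'n \<Rightarrow> nat" and c :: nat where "\<forall>i. 0 < w i"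
    "\<forall>x\<in>upper_hull (real_exponent ` E). real c \<le> (\<chi> i. real (w i)) \<bullet> x"
    "\<forall>x\<in>upper_hull (real_exponent ` E). (\<chi> i. real (w i)) \<bullet> x = real c \<longleftrightarrow> x \<in> F"
proof -
  define G where "G = real_exponent ` E"
  define P where "P = upper_hull G"
  have finG: "finite G" using E by (simp add: G_def)
  have F1: "F face_of P" using F(1) by (simp add: P_def G_def)
  have add: "\<And>x v. x \<in> P \<Longrightarrow> v \<in> orthant \<Longrightarrow> x + v \<in> P"
    unfolding P_def by (rule upper_hull_add_orthant)
  have GP: "convex hull G \<subseteq> P" unfolding P_def by (rule convex_hull_subset_upper_hull)
  have FG: "F \<subseteq> convex hull G"
  proof
    fix x assume x: "x \<in> F"
    hence "x \<in> upper_hull G" using face_of_imp_subset[OF F1] unfolding P_def by (rule rev_subsetD)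
    then obtain y v where yv: "x = y + v" "y \<in> convex hull G" "v \<in> orthant" by (rule upper_hullE)
    have "y \<in> P" by (rule subsetD[OF GP yv(2)])
    from face_add_orthant_zero[OF F1 F(2) add this yv(3)] x yv(1) have "v = 0" by simp
    thus "x \<in> convex hull G" using yv by simp
  qed
  define T where "T = G \<union> (\<lambda>(e,i). e + axis i 1) ` (G \<times> UNIV)"
  have finT: "finite T" using finG by (simp add: T_def)
  define Q where "Q = convex hull T"
  have axis_orthant: "axis i 1 \<in> orthant" for i :: 'n by (simp add: orthant_def axis_def)
  have "T \<subseteq> P"
  proof
    fix x assume "x \<in> T"
    then consider "x \<in> G" | e i where "e \<in> G" "x = e + axis i 1" unfolding T_def by auto
    thus "x \<in> P"
    proof cases
      case 1 thus ?thesis unfolding P_def by (rule upper_hull_inc)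
    next
      case 2
      have "e \<in> P" unfolding P_def by (rule upper_hull_inc[OF 2(1)])
      from add[OF this axis_orthant] show ?thesis using 2(2) by simp
    qed
  qed
  hence QP: "Q \<subseteq> P" unfolding Q_def P_def by (rule hull_minimal[of T _ convex, OF _ convex_upper_hull])
  have GQ: "convex hull G \<subseteq> Q" unfolding Q_def by (rule hull_mono) (simp add: T_def)
  have "F face_of Q" by (rule face_of_subset[OF F1 subset_trans[OF FG GQ] QP])
  moreover have "polyhedron Q"
    unfolding Q_def using finT by (simp add: polytope_imp_polyhedron polytope_convex_hull)
  ultimately have "F exposed_face_of Q" by (simp add: exposed_face_of_polyhedron)
  then obtain a b where ab: "Q \<subseteq> {x. a \<bullet> x \<le> b}" "F = Q \<inter> {x. a \<bullet> x = b}"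
    unfolding exposed_face_of_def by (elim conjE exE)
  \<comment> \<open>An exposed face maximises its functional; the change of sign turns the face into
    a set of minima, as needed for weights.\<close>
  define \<alpha> where "\<alpha> = - a"
  define \<beta> where "\<beta> = - b"
  have ge: "\<beta> \<le> \<alpha> \<bullet> x" if "x \<in> Q" for x using subsetD[OF ab(1) that] by (simp add: \<alpha>_def \<beta>_def)
  have F_iff: "x \<in> F \<longleftrightarrow> \<alpha> \<bullet> x = \<beta>" if "x \<in> Q" for x using that by (simp add: \<alpha>_def \<beta>_def ab(2))
  have inQ: "e \<in> Q" if "e \<in> G" for e by (rule subsetD[OF GQ hull_inc[OF that]])
  have geG: "\<forall>e\<in>G. \<beta> \<le> \<alpha> \<bullet> e" using ge[OF inQ] by simp
  have comb: "\<exists>u. (\<forall>e\<in>G. 0 \<le> u e) \<and> sum u G = 1 \<and> (\<Sum>e\<in>G. u e *\<^sub>R e) = x" if "x \<in> convex hull G" for x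
    using that by (simp add: convex_hull_finite[OF finG])
  have "\<exists>e0\<in>E. real_exponent e0 \<in> F"
  proof -
    obtain x where x: "x \<in> F" using F(3) by blast
    obtain u where u: "\<forall>e\<in>G. 0 \<le> u e" "sum u G = 1" "(\<Sum>e\<in>G. u e *\<^sub>R e) = x"
      using comb[OF subsetD[OF FG x]] by (elim exE conjE)
    have "x \<in> Q" by (rule subsetD[OF GQ subsetD[OF FG x]])
    hence "\<alpha> \<bullet> x = \<beta>" using F_iff x by simp
    hence z: "\<forall>e\<in>G. u e = 0 \<or> \<alpha> \<bullet> e = \<beta>"
      using supporting_combination(2)[OF finG u(1,2) geG] u(3) by simp
    have "\<not> (\<forall>e\<in>G. u e = 0)" using u(2) by (metis sum.neutral zero_neq_one)
    then obtain e where e: "e \<in> G" "u e \<noteq> 0" by blast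
    with z have "\<alpha> \<bullet> e = \<beta>" by blast
    hence "e \<in> F" using F_iff[OF inQ[OF e(1)]] by simp
    thus ?thesis using e(1) unfolding G_def by blast
  qed
  then obtain e0 where e0: "e0 \<in> E" "real_exponent e0 \<in> F" by blast
  have e0G: "real_exponent e0 \<in> G" using e0(1) by (simp add: G_def)
  have e0\<beta>: "\<alpha> \<bullet> real_exponent e0 = \<beta>" using F_iff[OF inQ[OF e0G]] e0(2) by simp
  have pos: "0 < \<alpha> $h i" for i
  proof -
    let ?x = "real_exponent e0 + axis i 1"
    have "(real_exponent e0, i) \<in> G \<times> UNIV" using e0G by simp
    hence "?x \<in> T" unfolding T_def by (intro UnI2 image_eqI[of _ _ "(real_exponent e0, i)"]) auto
    hence xQ: "?x \<in> Q" unfolding Q_def by (rule hull_inc)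
    have eq: "\<alpha> \<bullet> ?x = \<beta> + \<alpha> $h i" by (simp add: inner_add_right inner_axis e0\<beta>)
    have "\<alpha> \<bullet> ?x \<noteq> \<beta>"
    proof
      assume "\<alpha> \<bullet> ?x = \<beta>"
      hence "?x \<in> F" using F_iff[OF xQ] by simp
      from face_add_orthant_zero[OF F1 F(2) add subsetD[OF GP hull_inc[OF e0G]] axis_orthant this]
      show False by (simp add: axis_eq_0_iff)
    qed
    with ge[OF xQ] eq show ?thesis by linarith
  qed
  \<comment> \<open>The positive numbers that must stay positive under approximation: the
    coefficients of \<alpha>, the gaps between \<beta> and the values at generators off the face,
    and 1 to force integers to vanish.\<close>
  define S where "S = {1} \<union> range (\<lambda>i. \<alpha> $h i) \<union> (\<lambda>e. \<alpha> \<bullet> real_exponent e - \<beta>) ` {e\<in>E. \<beta> < \<alpha> \<bullet> real_exponent e}"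
  have finS: "finite S" using E by (simp add: S_def)
  have S_pos: "0 < s" if "s \<in> S" for s using that pos by (auto simp: S_def)
  have "S \<noteq> {}" by (simp add: S_def)
  hence Min_pos: "0 < Min S" using finS S_pos by (simp add: Min_gr_iff)
  \<comment> \<open>Summing over all generators dominates the degree term in each single comparison
    of a generator with \<open>e0\<close>.\<close>
  define B where "B = (\<Sum>e\<in>E. real (total_degree e) + real (total_degree e0))"
  have B0: "0 \<le> B" unfolding B_def by (intro sum_nonneg) simp
  define \<epsilon> where "\<epsilon> = Min S / (B + 1)"
  have eps: "0 < \<epsilon>" using Min_pos B0 by (simp add: \<epsilon>_def)
  have eps_le: "(B + 1) * \<epsilon> \<le> s" if "s \<in> S" for s
    using that finS B0 by (simp add: \<epsilon>_def)
  have eps1: "\<epsilon> \<le> s" if "s \<in> S" for s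
  proof -
    have "1 * \<epsilon> \<le> (B + 1) * \<epsilon>" using B0 eps by (intro mult_right_mono) auto
    thus ?thesis using eps_le[OF that] by simp
  qed
  have epsB: "B * \<epsilon> < s" if "s \<in> S" for s
    using eps_le[OF that] eps by (simp add: distrib_right)
  obtain q p where q: "q > 0" and p: "\<forall>i\<in>(UNIV :: 'n set). \<bar>real q * \<alpha> $h i - of_int (p i)\<bar> < \<epsilon>"
    using dirichlet_finite[OF finite eps, of UNIV "\<lambda>i. \<alpha> $h i"] .
  have p': "\<bar>real q * \<alpha> $h i - of_int (p i)\<bar> < \<epsilon>" for i by (rule bspec[OF p UNIV_I])
  have p_pos: "0 < p i" for i
  proof -
    have "\<alpha> $h i \<le> real q * \<alpha> $h i" using q pos[of i] by simp
    moreover have "\<epsilon> \<le> \<alpha> $h i" by (rule eps1) (simp add: S_def)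
    ultimately have "0 < real_of_int (p i)" using p'[of i] by linarith
    thus ?thesis by simp
  qed
  define w where "w i = nat (p i)" for i
  define \<gamma> where "\<gamma> = (\<chi> i. real (w i))"
  have \<gamma>i: "\<gamma> $h i = of_int (p i)" for i using p_pos[of i] by (simp add: \<gamma>_def w_def)
  \<comment> \<open>The minimum is normalised by the exact weight of \<open>e0\<close>, a generator
    on F. Only differences from \<open>e0\<close> are approximated, so equalities between generators
    on F survive.\<close>
  define c where "c = weight w e0"
  have \<gamma>e: "\<gamma> \<bullet> real_exponent e = real (weight w e)" for e by (simp add: real_weight \<gamma>_def)
  have diff: "\<bar>(real (weight w e) - real c) - real q * (\<alpha> \<bullet> real_exponent e - \<beta>)\<bar> \<le> B * \<epsilon>" if e: "e \<in> E" for e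
  proof -
    have "(real (weight w e) - real c) - real q * (\<alpha> \<bullet> real_exponent e - \<beta>) =
      (\<Sum>i\<in>UNIV. (\<gamma> $h i - real q * \<alpha> $h i) * (real (e $h i) - real (e0 $h i)))"
      unfolding c_def \<gamma>e[symmetric] e0\<beta>[symmetric] inner_vec_def
      by (simp add: algebra_simps sum.distrib sum_subtractf sum_distrib_left)
    also have "\<bar>\<dots>\<bar> \<le> (\<Sum>i\<in>UNIV. \<epsilon> * (real (e $h i) + real (e0 $h i)))"
    proof (rule order_trans[OF sum_abs], rule sum_mono)
      fix i :: 'n
      have "\<bar>\<gamma> $h i - real q * \<alpha> $h i\<bar> \<le> \<epsilon>" using p'[of i] by (simp add: \<gamma>i)
      moreover have "\<bar>real (e $h i) - real (e0 $h i)\<bar> \<le> real (e $h i) + real (e0 $h i)" by linarith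
      ultimately show "\<bar>(\<gamma> $h i - real q * \<alpha> $h i) * (real (e $h i) - real (e0 $h i))\<bar> \<le>
          \<epsilon> * (real (e $h i) + real (e0 $h i))"
        unfolding abs_mult using eps by (intro mult_mono) auto
    qed
    also have "\<dots> = (real (total_degree e) + real (total_degree e0)) * \<epsilon>"
      by (simp add: total_degree_def sum.distrib mult.commute flip: sum_distrib_left)
    also have "\<dots> \<le> B * \<epsilon>"
    proof (rule mult_right_mono)
      show "real (total_degree e) + real (total_degree e0) \<le> B"
        unfolding B_def using E e by (intro member_le_sum) auto
    qed (use eps in simp)
    finally show ?thesis .
  qed
  \<comment> \<open>On the face the integer \<open>weight w k - c\<close> is smaller than 1 in
    absolute value, hence zero; off the face the gap outweighs the error.\<close>
  have key: "real c \<le> \<gamma> \<bullet> e \<and> (\<gamma> \<bullet> e = real c \<longleftrightarrow> \<alpha> \<bullet> e = \<beta>)" if e: "e \<in> G" for e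
  proof -
    obtain k where k: "e = real_exponent k" "k \<in> E" using e unfolding G_def by (rule imageE)
    show ?thesis
    proof (cases "\<alpha> \<bullet> e = \<beta>")
      case True
      hence "\<bar>real (weight w k) - real c\<bar> \<le> B * \<epsilon>" using diff[OF k(2)] k(1) by simp
      also have "\<dots> < 1" by (rule epsB) (simp add: S_def)
      finally have "weight w k = c" by linarith
      thus ?thesis using True k(1) \<gamma>e by simp
    next
      case False
      hence less: "\<beta> < \<alpha> \<bullet> e" using geG e by force
      hence "\<alpha> \<bullet> e - \<beta> \<in> S" using k by (auto simp: S_def)
      hence "B * \<epsilon> < \<alpha> \<bullet> e - \<beta>" by (rule epsB)
      also have "\<dots> \<le> real q * (\<alpha> \<bullet> e - \<beta>)" using less q by simp
      finally have "0 < real (weight w k) - real c" using diff[OF k(2)] unfolding k(1) by linarith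
      thus ?thesis using False k(1) \<gamma>e by simp
    qed
  qed
  have keyG: "\<forall>e\<in>G. real c \<le> \<gamma> \<bullet> e" using key by simp
  have final: "real c \<le> \<gamma> \<bullet> x \<and> (\<gamma> \<bullet> x = real c \<longleftrightarrow> x \<in> F)" if x: "x \<in> P" for x
  proof -
    obtain y v where yv: "x = y + v" "y \<in> convex hull G" "v \<in> orthant"
      using x unfolding P_def by (rule upper_hullE)
    obtain u where u: "\<forall>e\<in>G. 0 \<le> u e" "sum u G = 1" "(\<Sum>e\<in>G. u e *\<^sub>R e) = y"
      using comb[OF yv(2)] by (elim exE conjE)
    have \<gamma>y: "real c \<le> \<gamma> \<bullet> y" "\<gamma> \<bullet> y = real c \<longleftrightarrow> (\<forall>e\<in>G. u e = 0 \<or> \<gamma> \<bullet> e = real c)"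
      using supporting_combination[OF finG u(1,2) keyG] by (simp_all add: u(3))
    have \<alpha>y: "\<alpha> \<bullet> y = \<beta> \<longleftrightarrow> (\<forall>e\<in>G. u e = 0 \<or> \<alpha> \<bullet> e = \<beta>)"
      using supporting_combination(2)[OF finG u(1,2) geG] by (simp add: u(3))
    have same: "\<gamma> \<bullet> y = real c \<longleftrightarrow> \<alpha> \<bullet> y = \<beta>" unfolding \<gamma>y(2) \<alpha>y using key by auto
    have nn: "0 \<le> \<gamma> $h i * v $h i" for i using yv(3) by (simp add: orthant_def \<gamma>_def)
    have v0: "0 \<le> \<gamma> \<bullet> v" unfolding inner_vec_def inner_real_def by (rule sum_nonneg) (rule nn)
    have v1: "v = 0" if "\<gamma> \<bullet> v = 0"
    proof -
      have "(\<Sum>i\<in>UNIV. \<gamma> $h i * v $h i) = 0" using that by (simp add: inner_vec_def)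
      hence "\<gamma> $h i * v $h i = 0" for i using sum_nonneg_eq_0_iff[of UNIV "\<lambda>i. \<gamma> $h i * v $h i"] nn by simp
      moreover have "\<gamma> $h i \<noteq> 0" for i using p_pos[of i] by (simp add: \<gamma>i)
      ultimately show ?thesis by (simp add: Finite_Cartesian_Product.vec_eq_iff)
    qed
    have \<gamma>x: "\<gamma> \<bullet> x = \<gamma> \<bullet> y + \<gamma> \<bullet> v" by (simp add: yv(1) inner_add_right)
    have yQ: "y \<in> Q" by (rule subsetD[OF GQ yv(2)])
    have "x \<in> F" if "\<gamma> \<bullet> x = real c"
    proof -
      have "\<gamma> \<bullet> y = real c" "\<gamma> \<bullet> v = 0" using that \<gamma>x \<gamma>y(1) v0 by linarith+
      thus ?thesis using v1 same F_iff[OF yQ] yv(1) by simp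
    qed
    moreover have "\<gamma> \<bullet> x = real c" if xF: "x \<in> F"
    proof -
      have "v = 0"
        by (rule face_add_orthant_zero[OF F1 F(2) add subsetD[OF GP yv(2)] yv(3)]) (use xF yv(1) in simp_all)
      thus ?thesis using xF same F_iff[OF yQ] yv(1) by simp
    qed
    ultimately show ?thesis using \<gamma>x \<gamma>y(1) v0 by auto
  qed
  show ?thesis
  proof (rule that[of w c])
    show "\<forall>i. 0 < w i" using p_pos by (simp add: w_def)
    show "\<forall>x\<in>upper_hull (real_exponent ` E). real c \<le> (\<chi> i. real (w i)) \<bullet> x"
      using final by (simp add: P_def G_def \<gamma>_def)
    show "\<forall>x\<in>upper_hull (real_exponent ` E). (\<chi> i. real (w i)) \<bullet> x = real c \<longleftrightarrow> x \<in> F"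
      using final by (simp add: P_def G_def \<gamma>_def)
  qed
qed

subsection \<open>Faces of Minkowski sums\<close>

text \<open>The i-th summand of a face F of a Minkowski sum: all i-th terms in representations of
  points of F. It supplies the decomposition of \<Delta> that the non-degeneracy condition speaks
  of.\<close>

definition face_part :: "'a::real_vector set \<Rightarrow> ('i \<Rightarrow> 'a set) \<Rightarrow> 'i set \<Rightarrow> 'i \<Rightarrow> 'a set" where
  "face_part F P I i = {k i | k. (\<forall>j\<in>I. k j \<in> P j) \<and> sum k I \<in> F}"

lemma mem_set_sum_iff:
  fixes P :: "'i \<Rightarrow> 'a::comm_monoid_add set"
  assumes "finite I"
  shows "x \<in> (\<Sum>i\<in>I. P i) \<longleftrightarrow> (\<exists>k. x = sum k I \<and> (\<forall>i\<in>I. k i \<in> P i))"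
  using set_sum_alt[OF assms, of P] by auto

lemma sum_fun_upd:
  fixes k :: "'i \<Rightarrow> 'a::comm_monoid_add"
  assumes "finite I" "i \<in> I"
  shows "sum (k(i := a)) I = a + sum k (I - {i})"
  using assms by (subst sum.remove[of I i]) (auto intro!: sum.cong)

text \<open>Exchanging the i-th terms of two representations gives two points of the Minkowski sum
  with the same midpoint as the original ones. This midpoint lies in F, and F is a face, so both new
  points do.\<close>

lemma face_exchange:
  fixes P :: "'i \<Rightarrow> 'a::real_vector set"
  assumes "finite I" "F face_of (\<Sum>i\<in>I. P i)"
    and k: "\<forall>j\<in>I. k j \<in> P j" "sum k I \<in> F" and l: "\<forall>j\<in>I. l j \<in> P j" "sum l I \<in> F" and i: "i \<in> I"
  shows "sum (k(i := l i)) I \<in> F"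
proof -
  let ?a = "sum (k(i := l i)) I" and ?b = "sum (l(i := k i)) I"
  have upd: "sum (m(i := c)) I \<in> (\<Sum>i\<in>I. P i)" if "\<forall>j\<in>I. m j \<in> P j" "c \<in> P i" for m c
    unfolding mem_set_sum_iff[OF assms(1)] using that by (intro exI[of _ "m(i := c)"]) simp
  have a: "?a \<in> (\<Sum>i\<in>I. P i)" "?b \<in> (\<Sum>i\<in>I. P i)"
    using k(1) l(1) i by (simp_all add: upd del: fun_upd_apply)
  have "?a + ?b = sum k I + sum l I"
    using sum_fun_upd[OF assms(1) i, of k "l i"] sum_fun_upd[OF assms(1) i, of l "k i"]
      sum_fun_upd[OF assms(1) i, of k "k i"] sum_fun_upd[OF assms(1) i, of l "l i"]
    by (simp add: algebra_simps)
  hence mid: "(1 / 2) *\<^sub>R sum k I + (1 / 2) *\<^sub>R sum l I = (1 / 2) *\<^sub>R ?a + (1 / 2) *\<^sub>R ?b"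
    by (simp only: flip: scaleR_add_right)
  have m: "(1 / 2) *\<^sub>R ?a + (1 / 2) *\<^sub>R ?b \<in> F"
    unfolding mid[symmetric] by (rule convexD[OF face_of_imp_convex[OF assms(2)] k(2) l(2)]) simp_all
  show ?thesis
  proof (cases "?a = ?b")
    case True
    thus ?thesis using m by (simp flip: scaleR_add_left)
  next
    case False
    hence "(1 / 2) *\<^sub>R ?a + (1 / 2) *\<^sub>R ?b \<in> open_segment ?a ?b"
      unfolding in_segment(2) by (intro conjI exI[of _ "1 / 2 :: real"]) simp_all
    from face_ofD[OF assms(2) this a m] show ?thesis by simp
  qed
qed

text \<open>Terms taken from different representations can be combined, by exchanging one term at a
  time.\<close>

lemma face_part_sum:
  fixes P :: "'i \<Rightarrow> 'a::real_vector set"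
  assumes "finite I" "F face_of (\<Sum>i\<in>I. P i)" "F \<noteq> {}" "\<forall>i\<in>I. k i \<in> face_part F P I i"
  shows "sum k I \<in> F"
proof -
  have "\<exists>l. (\<forall>j\<in>I. l j \<in> P j) \<and> sum l I \<in> F \<and> (\<forall>j\<in>J. l j = k j)" if "finite J" "J \<subseteq> I" for J
    using that
  proof (induction J rule: finite_induct)
    case empty
    obtain x where x: "x \<in> F" using assms(3) by blast
    hence "x \<in> (\<Sum>i\<in>I. P i)" by (rule subsetD[OF face_of_imp_subset[OF assms(2)]])
    then obtain l where "x = sum l I \<and> (\<forall>i\<in>I. l i \<in> P i)"
      unfolding mem_set_sum_iff[OF assms(1)] ..
    thus ?case using x by (intro exI[of _ l]) simp
  next
    case (insert i J)
    then obtain l where l: "\<forall>j\<in>I. l j \<in> P j" "sum l I \<in> F" "\<forall>j\<in>J. l j = k j" by auto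
    from insert.prems have i: "i \<in> I" by simp
    with assms(4) have "k i \<in> face_part F P I i" by simp
    then obtain k' where k': "k i = k' i" "\<forall>j\<in>I. k' j \<in> P j" "sum k' I \<in> F"
      unfolding face_part_def by auto
    have "sum (l(i := k' i)) I \<in> F" by (rule face_exchange[OF assms(1,2) l(1,2) k'(2,3) i])
    thus ?case using l k' i by (intro exI[of _ "l(i := k' i)"]) auto
  qed
  from this[OF assms(1) subset_refl] obtain l where
    l: "(\<forall>j\<in>I. l j \<in> P j) \<and> sum l I \<in> F \<and> (\<forall>j\<in>I. l j = k j)" ..
  hence "sum l I = sum k I" by (intro sum.cong) auto
  with l show ?thesis by metis
qed

lemma face_part_iff:
  assumes "finite I" "F face_of (\<Sum>i\<in>I. P i)" "F \<noteq> {}" "\<forall>i\<in>I. k i \<in> P i"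
  shows "sum k I \<in> F \<longleftrightarrow> (\<forall>i\<in>I. k i \<in> face_part F P I i)"
proof
  assume "sum k I \<in> F"
  thus "\<forall>i\<in>I. k i \<in> face_part F P I i" using assms(4) by (auto simp: face_part_def)
qed (rule face_part_sum[OF assms(1-3)])

lemma face_part_subset: "i \<in> I \<Longrightarrow> face_part F P I i \<subseteq> P i"
  by (auto simp: face_part_def)

lemma sum_face_part:
  assumes "finite I" "F face_of (\<Sum>i\<in>I. P i)" "F \<noteq> {}"
  shows "F = (\<Sum>i\<in>I. face_part F P I i)"
proof (rule Set.set_eqI)
  fix x
  show "x \<in> F \<longleftrightarrow> x \<in> (\<Sum>i\<in>I. face_part F P I i)"
  proof
    assume x: "x \<in> F"
    hence "x \<in> (\<Sum>i\<in>I. P i)" by (rule subsetD[OF face_of_imp_subset[OF assms(2)]])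
    then obtain k where k: "x = sum k I \<and> (\<forall>i\<in>I. k i \<in> P i)"
      unfolding mem_set_sum_iff[OF assms(1)] ..
    hence "\<forall>i\<in>I. k i \<in> face_part F P I i" using x face_part_iff[OF assms, of k] by simp
    thus "x \<in> (\<Sum>i\<in>I. face_part F P I i)"
      unfolding mem_set_sum_iff[OF assms(1)] using k by (intro exI[of _ k]) simp
  next
    assume "x \<in> (\<Sum>i\<in>I. face_part F P I i)"
    then obtain k where "x = sum k I \<and> (\<forall>i\<in>I. k i \<in> face_part F P I i)"
      unfolding mem_set_sum_iff[OF assms(1)] ..
    thus "x \<in> F" using face_part_sum[OF assms, of k] by simp
  qed
qed

text \<open>A segment in \<open>P i\<close>, translated by the remaining terms of a representation,
  is a segment in the Minkowski sum, where F is a face.\<close>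

lemma face_part_face_of:
  fixes P :: "'i \<Rightarrow> 'a::real_vector set"
  assumes "finite I" "F face_of (\<Sum>i\<in>I. P i)" "i \<in> I" "\<And>j. j \<in> I \<Longrightarrow> convex (P j)"
  shows "face_part F P I i face_of P i"
  unfolding face_of_def
proof (intro conjI ballI impI)
  show "face_part F P I i \<subseteq> P i" by (rule face_part_subset[OF assms(3)])
  show "convex (face_part F P I i)"
  proof (rule convexI)
    fix x y and u v :: real
    assume "x \<in> face_part F P I i" "y \<in> face_part F P I i" and uv: "0 \<le> u" "0 \<le> v" "u + v = 1"
    then obtain k l where k: "x = k i" "\<forall>j\<in>I. k j \<in> P j" "sum k I \<in> F"
      and l: "y = l i" "\<forall>j\<in>I. l j \<in> P j" "sum l I \<in> F" unfolding face_part_def by auto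
    let ?m = "\<lambda>j. u *\<^sub>R k j + v *\<^sub>R l j"
    have "sum ?m I = u *\<^sub>R sum k I + v *\<^sub>R sum l I" by (simp add: sum.distrib scaleR_sum_right)
    also have "\<dots> \<in> F" by (rule convexD[OF face_of_imp_convex[OF assms(2)] k(3) l(3) uv])
    finally have "sum ?m I \<in> F" .
    moreover have "\<forall>j\<in>I. ?m j \<in> P j" using k(2) l(2) uv assms(4) by (auto intro: convexD)
    ultimately show "u *\<^sub>R x + v *\<^sub>R y \<in> face_part F P I i"
      unfolding face_part_def k(1) l(1) by (intro CollectI exI[of _ ?m]) simp
  qed
  fix a b x assume a: "a \<in> P i" "b \<in> P i" and "x \<in> face_part F P I i" and x: "x \<in> open_segment a b"
  then obtain k where k: "x = k i" "\<forall>j\<in>I. k j \<in> P j" "sum k I \<in> F" unfolding face_part_def by auto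
  have eq: "sum (k(i := c)) I = c + sum k (I - {i})" for c by (rule sum_fun_upd[OF assms(1,3)])
  have inP: "sum (k(i := c)) I \<in> (\<Sum>i\<in>I. P i)" if "c \<in> P i" for c
    unfolding mem_set_sum_iff[OF assms(1)] using that k(2) by (intro exI[of _ "k(i := c)"]) simp
  from x obtain t where t: "a \<noteq> b" "0 < t" "t < 1" "x = (1 - t) *\<^sub>R a + t *\<^sub>R b" unfolding in_segment(2) by auto
  have "sum k I = x + sum k (I - {i})" using eq[of x] k(1) by simp
  also have "\<dots> = (1 - t) *\<^sub>R sum (k(i := a)) I + t *\<^sub>R sum (k(i := b)) I"
    unfolding eq t(4) by (simp add: algebra_simps)
  finally have "sum k I = (1 - t) *\<^sub>R sum (k(i := a)) I + t *\<^sub>R sum (k(i := b)) I" .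
  moreover have "sum (k(i := a)) I \<noteq> sum (k(i := b)) I" unfolding eq using t(1) by simp
  ultimately have "sum k I \<in> open_segment (sum (k(i := a)) I) (sum (k(i := b)) I)"
    unfolding in_segment(2) using t(2,3) by (intro conjI exI[of _ t])
  from face_ofD[OF assms(2) this inP[OF a(1)] inP[OF a(2)] k(3)]
  have F: "sum (k(i := a)) I \<in> F" "sum (k(i := b)) I \<in> F" by simp_all
  have part: "c \<in> face_part F P I i" if "sum (k(i := c)) I \<in> F" "c \<in> P i" for c
    unfolding face_part_def using that k(2) by (intro CollectI exI[of _ "k(i := c)"]) auto
  show "a \<in> face_part F P I i" "b \<in> face_part F P I i"
    by (rule part[OF F(1) a(1)], rule part[OF F(2) a(2)])
qed

text \<open>Fixing the other terms embeds the summand into a translate of F, so it is bounded; it is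
  closed as a face of a closed convex set.\<close>

lemma compact_face_part:
  fixes P :: "'i \<Rightarrow> 'a::euclidean_space set"
  assumes "finite I" "F face_of (\<Sum>i\<in>I. P i)" "F \<noteq> {}" "bounded F" "i \<in> I"
    and P: "\<And>j. j \<in> I \<Longrightarrow> convex (P j)" "\<And>j. j \<in> I \<Longrightarrow> closed (P j)"
  shows "compact (face_part F P I i)" "face_part F P I i \<noteq> {}"
proof -
  obtain x where x: "x \<in> F" using assms(3) by blast
  hence "x \<in> (\<Sum>i\<in>I. P i)" by (rule subsetD[OF face_of_imp_subset[OF assms(2)]])
  then obtain k where k: "x = sum k I" "\<forall>i\<in>I. k i \<in> P i"
    unfolding mem_set_sum_iff[OF assms(1)] by (elim exE conjE)
  hence kF: "\<forall>i\<in>I. k i \<in> face_part F P I i" using x face_part_iff[OF assms(1-3), of k] by simp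
  thus "face_part F P I i \<noteq> {}" using assms(5) by blast
  have "closed (face_part F P I i)"
    by (rule face_of_imp_closed[OF P(1)[OF assms(5)] P(2)[OF assms(5)] face_part_face_of[OF assms(1,2,5) P(1)]])
  moreover have "bounded (face_part F P I i)"
  proof (rule bounded_subset)
    show "bounded ((\<lambda>y. - sum k (I - {i}) + y) ` F)" by (rule bounded_translation[OF assms(4)])
    show "face_part F P I i \<subseteq> (\<lambda>y. - sum k (I - {i}) + y) ` F"
    proof
      fix y assume y: "y \<in> face_part F P I i"
      have "sum (k(i := y)) I \<in> F" by (rule face_part_sum[OF assms(1-3)]) (use y kF in simp)
      hence "y + sum k (I - {i}) \<in> F" by (simp only: sum_fun_upd[OF assms(1,5)])
      thus "y \<in> (\<lambda>y. - sum k (I - {i}) + y) ` F" by (rule rev_image_eqI) simp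
    qed
  qed
  ultimately show "compact (face_part F P I i)" by (simp add: compact_eq_bounded_closed)
qed

text \<open>The cancellation law for compact convex sets. A point outside \<open>D i\<close> is
  separated from it by a linear form; adding points where this form is least on the other
  \<open>D j\<close> gives a sum too small for F.\<close>

lemma face_part_unique:
  fixes P :: "'i \<Rightarrow> 'a::euclidean_space set"
  assumes "finite I" "F face_of (\<Sum>i\<in>I. P i)" "F = (\<Sum>i\<in>I. D i)" "i \<in> I"
    and D: "\<And>j. j \<in> I \<Longrightarrow> D j \<subseteq> P j" "\<And>j. j \<in> I \<Longrightarrow> compact (D j)"
      "\<And>j. j \<in> I \<Longrightarrow> convex (D j)" "\<And>j. j \<in> I \<Longrightarrow> D j \<noteq> {}"
  shows "face_part F P I i = D i"
proof
  have sumD: "sum d I \<in> F" if "\<forall>j\<in>I. d j \<in> D j" for d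
    unfolding assms(3) mem_set_sum_iff[OF assms(1)] using that by (intro exI[of _ d]) simp
  have "\<exists>d. \<forall>j\<in>I. d j \<in> D j" by (rule bchoice) (use D(4) in blast)
  then obtain d0 where d0: "\<forall>j\<in>I. d0 j \<in> D j" ..
  have F: "F \<noteq> {}" using sumD[OF d0] by blast
  have sub: "D j \<subseteq> face_part F P I j" if j: "j \<in> I" for j
  proof
    fix y assume y: "y \<in> D j"
    have "\<forall>l\<in>I. (d0(j := y)) l \<in> D l" using y d0 by simp
    moreover have "\<forall>l\<in>I. (d0(j := y)) l \<in> P l" using subsetD[OF D(1)] y d0 by simp
    ultimately show "y \<in> face_part F P I j"
      unfolding face_part_def using sumD[of "d0(j := y)"] by (intro CollectI exI[of _ "d0(j := y)"]) simp
  qed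
  show "D i \<subseteq> face_part F P I i" by (rule sub[OF assms(4)])
  show "face_part F P I i \<subseteq> D i"
  proof (rule subsetI, rule ccontr)
    fix x assume x: "x \<in> face_part F P I i" "x \<notin> D i"
    from separating_hyperplane_closed_point[OF D(3)[OF assms(4)] compact_imp_closed[OF D(2)[OF assms(4)]] x(2)]
    obtain a b where ab: "a \<bullet> x < b \<and> (\<forall>y\<in>D i. b < a \<bullet> y)" by (elim exE)
    have "\<exists>d. \<forall>j\<in>I. d j \<in> D j \<and> (\<forall>y\<in>D j. a \<bullet> d j \<le> a \<bullet> y)"
    proof (rule bchoice, rule ballI)
      fix j assume j: "j \<in> I"
      have "continuous_on (D j) (\<lambda>y. a \<bullet> y)" by (intro continuous_intros)
      from continuous_attains_inf[OF D(2)[OF j] D(4)[OF j] this]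
      show "\<exists>y. y \<in> D j \<and> (\<forall>z\<in>D j. a \<bullet> y \<le> a \<bullet> z)" by blast
    qed
    then obtain d where d: "\<forall>j\<in>I. d j \<in> D j \<and> (\<forall>y\<in>D j. a \<bullet> d j \<le> a \<bullet> y)" ..
    have "sum (d(i := x)) I \<in> F"
      by (rule face_part_sum[OF assms(1,2) F]) (use x(1) d sub in auto)
    then obtain e where e: "sum (d(i := x)) I = sum e I" "\<forall>j\<in>I. e j \<in> D j"
      unfolding assms(3) mem_set_sum_iff[OF assms(1)] by (elim exE conjE)
    have "x + sum d (I - {i}) = e i + sum e (I - {i})"
      using e(1) sum_fun_upd[OF assms(1,4), of d x] sum_fun_upd[OF assms(1,4), of e "e i"] by simp
    hence "a \<bullet> x + a \<bullet> sum d (I - {i}) = a \<bullet> e i + a \<bullet> sum e (I - {i})"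
      by (metis inner_add_right)
    moreover have "a \<bullet> sum d (I - {i}) \<le> a \<bullet> sum e (I - {i})"
      unfolding inner_sum_right using d e(2) by (intro sum_mono) auto
    moreover have "b < a \<bullet> e i" using ab e(2) assms(4) by simp
    ultimately show False using ab by linarith
  qed
qed

hide_const (open) up_ring.coeff up_ring.monom

section \<open>Ideals of a commutative ring\<close>

text \<open>Ideals are handled as submodules of the ring over itself. Spans and subspaces then need
  no carrier sets, and \<open>ideal_iff_subspace\<close> and \<open>genideal_eq_span\<close> connect
  them with the ideals of \<open>class_ring\<close>.\<close>

interpretation ideal: Modules.module "times :: 'a::comm_ring_1 \<Rightarrow> 'a \<Rightarrow> 'a"
  by unfold_locales (simp_all add: algebra_simps)

(* oriented against mult.assoc *)
declare ideal.scale_scale [simp del]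

lemma ideal_iff_subspace:
  "Ideal.ideal I (class_ring :: 'a::comm_ring_1 ring) \<longleftrightarrow> ideal.subspace I"
proof
  assume I: "Ideal.ideal I (class_ring :: 'a ring)"
  show "ideal.subspace I"
  proof (rule ideal.subspaceI)
    show "0 \<in> I" using additive_subgroup.zero_closed[OF ideal.axioms(1)[OF I]] by simp
    show "x + y \<in> I" if "x \<in> I" "y \<in> I" for x y
      using additive_subgroup.a_closed[OF ideal.axioms(1)[OF I] that] by simp
    show "c * x \<in> I" if "x \<in> I" for c x
      using ideal.I_l_closed[OF I that, of c] by simp
  qed
next
  assume I: "ideal.subspace I"
  show "Ideal.ideal I (class_ring :: 'a ring)"
  proof (rule idealI)
    show "ring (class_ring :: 'a ring)" by (rule class_ring.ring_axioms)
    show "subgroup I (add_monoid (class_ring :: 'a ring))"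
    proof
      show "inv\<^bsub>add_monoid class_ring\<^esub> x \<in> I" if "x \<in> I" for x
      proof -
        have "\<ominus>\<^bsub>class_ring\<^esub> x = - x" by (simp add: class_ring_simps)
        hence "inv\<^bsub>add_monoid class_ring\<^esub> x = - x" unfolding a_inv_def .
        thus ?thesis using ideal.subspace_neg[OF I that] by simp
      qed
    qed (use I in \<open>auto intro: ideal.subspace_add ideal.subspace_0\<close>)
    show "x \<otimes>\<^bsub>class_ring\<^esub> a \<in> I" "a \<otimes>\<^bsub>class_ring\<^esub> x \<in> I" if "a \<in> I" "x \<in> carrier class_ring" for a x
      using ideal.subspace_scale[OF I that(1), of x] by (simp_all add: mult.commute)
  qed
qed

lemma genideal_eq_span: "genideal class_ring S = ideal.span (S :: 'a::comm_ring_1 set)"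
  unfolding genideal_def ideal_iff_subspace ideal.span_def hull_def by simp

lemma finite_subset_span:
  "finite T \<Longrightarrow> (\<Sum>s\<in>T. c s * f s) \<in> ideal.span (f ` T)"
  by (intro ideal.span_sum ideal.span_scale ideal.span_base imageI)

lemma ideal_power_0 [simp]: "ideal_power I 0 = UNIV"
  by (simp add: ideal_power_def)

lemma ideal_power_Suc: "ideal_power I (Suc n) = ideal_prod class_ring I (ideal_power I n)"
  by (simp add: ideal_power_def)

lemma ideal_power_add: "a \<in> ideal_power I n \<Longrightarrow> b \<in> ideal_power I n \<Longrightarrow> a + b \<in> ideal_power I n"
  by (cases n) (auto simp: ideal_power_Suc dest: ideal_prod.sum)

lemma ideal_power_SucI: "a \<in> I \<Longrightarrow> b \<in> ideal_power I n \<Longrightarrow> a * b \<in> ideal_power I (Suc n)"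
  using ideal_prod.prod[of a I b "ideal_power I n" class_ring] by (simp add: ideal_power_Suc)

lemma ideal_power_Suc_induct [consumes 1, case_names prod sum]:
  assumes "x \<in> ideal_power I (Suc n)"
    and "\<And>a b. a \<in> I \<Longrightarrow> b \<in> ideal_power I n \<Longrightarrow> P (a * b)"
    and "\<And>a b. P a \<Longrightarrow> P b \<Longrightarrow> P (a + b)"
  shows "P x"
  using assms(1) unfolding ideal_power_Suc
  by (induction rule: ideal_prod.induct) (use assms(2,3) in auto)

lemma ideal_power_scale: "a \<in> ideal_power I n \<Longrightarrow> c * a \<in> ideal_power I n"
proof (induction n arbitrary: a)
  case (Suc n)
  from Suc.prems show ?case
  proof (induction rule: ideal_power_Suc_induct)
    case (prod a b)
    have eq: "c * (a * b) = a * (c * b)" by (rule mult.left_commute)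
    show ?case unfolding eq by (rule ideal_power_SucI[OF prod(1) Suc.IH[OF prod(2)]])
  qed (simp add: distrib_left ideal_power_add)
qed simp

lemma ideal_power_zero: "0 \<in> I \<Longrightarrow> 0 \<in> ideal_power I n"
proof (induction n)
  case (Suc n)
  from ideal_power_SucI[OF Suc.prems Suc.IH[OF Suc.prems]] show ?case by simp
qed simp

lemma ideal_power_mult:
  assumes "0 \<in> I"
  shows "a \<in> ideal_power I m \<Longrightarrow> b \<in> ideal_power I n \<Longrightarrow> a * b \<in> ideal_power I (m + n)"
proof (induction m arbitrary: a)
  case 0
  thus ?case by (simp add: ideal_power_scale)
next
  case (Suc m)
  from Suc.prems(1) show ?case
  proof (induction rule: ideal_power_Suc_induct)
    case (prod x y)
    from ideal_power_SucI[OF prod(1) Suc.IH[OF prod(2) Suc.prems(2)]] show ?case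
      by (simp add: mult.assoc)
  qed (simp add: distrib_right ideal_power_add)
qed

lemma ideal_power_sum:
  assumes "0 \<in> I" "\<And>x. x \<in> A \<Longrightarrow> f x \<in> ideal_power I n"
  shows "sum f A \<in> ideal_power I n"
  using assms(2) by (induction A rule: infinite_finite_induct)
    (simp_all add: ideal_power_zero[OF assms(1)] ideal_power_add)

lemma ideal_power_1: "a \<in> I \<Longrightarrow> a \<in> ideal_power I (Suc 0)"
  using ideal_power_SucI[of a I 1 0] by simp

text \<open>
  The coefficients of the characteristic polynomial of a matrix over \<open>I\<close> lie in the appropriate
  powers of \<open>I\<close>; this grading is multiplicative.
\<close>

lemma det_coeff_ideal_power:
  fixes B :: "'a::comm_ring_1 poly mat"
  assumes I: "0 \<in> I" and B: "B \<in> carrier_mat n n"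
    and entries: "\<And>i j k. i < n \<Longrightarrow> j < n \<Longrightarrow> k \<le> 1 \<Longrightarrow> coeff (B $$ (i,j)) k \<in> ideal_power I (1 - k)"
    and deg: "\<And>i j. i < n \<Longrightarrow> j < n \<Longrightarrow> degree (B $$ (i,j)) \<le> 1"
    and k: "k \<le> n"
  shows "coeff (det B) k \<in> ideal_power I (n - k)"
proof -
  have prod: "degree (\<Prod>i\<in>A. B $$ (i, \<sigma> i)) \<le> card A \<and>
      (\<forall>k\<le>card A. coeff (\<Prod>i\<in>A. B $$ (i, \<sigma> i)) k \<in> ideal_power I (card A - k))"
    if A: "finite A" "A \<subseteq> {0..<n}" and \<sigma>: "\<And>i. i < n \<Longrightarrow> \<sigma> i < n" for A \<sigma>
    using A
  proof (induction A rule: finite_induct)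
    case (insert a A)
    let ?p = "B $$ (a, \<sigma> a)" and ?q = "\<Prod>i\<in>A. B $$ (i, \<sigma> i)"
    have a: "a < n" using insert.prems by simp
    have q: "degree ?q \<le> card A" "\<And>k. k \<le> card A \<Longrightarrow> coeff ?q k \<in> ideal_power I (card A - k)"
      using insert.IH insert.prems by auto
    have p: "degree ?p \<le> 1" "\<And>k. k \<le> 1 \<Longrightarrow> coeff ?p k \<in> ideal_power I (1 - k)"
      using deg[OF a \<sigma>[OF a]] entries[OF a \<sigma>[OF a]] by auto
    have eq: "(\<Prod>i\<in>insert a A. B $$ (i, \<sigma> i)) = ?p * ?q" using insert.hyps by simp
    have card: "card (insert a A) = Suc (card A)" using insert.hyps by simp
    have "degree (?p * ?q) \<le> Suc (card A)"
      using degree_mult_le[of ?p ?q] p(1) q(1) by linarith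
    moreover have "coeff (?p * ?q) k \<in> ideal_power I (Suc (card A) - k)" if k: "k \<le> Suc (card A)" for k
      unfolding coeff_mult
    proof (rule ideal_power_sum[OF I])
      fix i assume "i \<in> {..k}"
      hence i: "i \<le> k" by simp
      show "coeff ?p i * coeff ?q (k - i) \<in> ideal_power I (Suc (card A) - k)"
      proof (cases "i \<le> 1 \<and> k - i \<le> card A")
        case True
        hence "coeff ?p i * coeff ?q (k - i) \<in> ideal_power I ((1 - i) + (card A - (k - i)))"
          by (intro ideal_power_mult I p(2) q(2)) auto
        moreover have "(1 - i) + (card A - (k - i)) = Suc (card A) - k" using True i k by linarith
        ultimately show ?thesis by simp
      next
        case False
        hence "degree ?p < i \<or> degree ?q < k - i" using p(1) q(1) by linarith
        hence "coeff ?p i * coeff ?q (k - i) = 0" by (auto simp: coeff_eq_0)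
        thus ?thesis using ideal_power_zero[OF I] by simp
      qed
    qed
    ultimately show ?case unfolding eq card by blast
  qed simp
  have "coeff (det B) k = (\<Sum>\<sigma>\<in>{\<sigma>. \<sigma> permutes {0..<n}}. coeff (signof \<sigma> * (\<Prod>i = 0..<n. B $$ (i, \<sigma> i))) k)"
    using B by (simp add: det_def'[of B n] coeff_sum)
  also have "\<dots> \<in> ideal_power I (n - k)"
  proof (rule ideal_power_sum[OF I])
    fix \<sigma> assume "\<sigma> \<in> {\<sigma>. \<sigma> permutes {0..<n}}"
    hence \<sigma>: "\<sigma> i < n" if "i < n" for i using that by (auto dest: permutes_in_image[of \<sigma> "{0..<n}" i])
    have "coeff (\<Prod>i = 0..<n. B $$ (i, \<sigma> i)) k \<in> ideal_power I (n - k)"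
      using prod[of "{0..<n}" \<sigma>] \<sigma> k by auto
    moreover from ideal_power_scale[OF this, of "-1"]
    have "- coeff (\<Prod>i = 0..<n. B $$ (i, \<sigma> i)) k \<in> ideal_power I (n - k)" by simp
    ultimately show "coeff (signof \<sigma> * (\<Prod>i = 0..<n. B $$ (i, \<sigma> i))) k \<in> ideal_power I (n - k)"
      by (simp add: sign_def)
  qed
  finally show ?thesis .
qed

text \<open>The determinant trick: multiplication by y acts on the family b through a matrix C over
  I, so y is an eigenvalue of C with eigenvector b and a root of its characteristic polynomial. In a
  domain one non-zero \<open>b t\<close> is enough for this.\<close>

lemma ideal_closureI_module:
  fixes y :: "'a::idom"
  assumes I: "ideal.subspace I" and T: "finite T" "\<exists>t\<in>T. b t \<noteq> 0"
    and stable: "\<And>t. t \<in> T \<Longrightarrow> \<exists>c. (\<forall>s\<in>T. c s \<in> I) \<and> y * b t = (\<Sum>s\<in>T. c s * b s)"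
  shows "y \<in> ideal_closure I"
proof -
  define n where "n = card T"
  obtain h where h: "bij_betw h {0..<n} T"
    using ex_bij_betw_nat_finite[OF T(1)] unfolding n_def by blast
  have hT: "h i \<in> T" if "i < n" for i using h that by (auto simp: bij_betw_def)
  from stable have "\<forall>t\<in>T. \<exists>c. (\<forall>s\<in>T. c s \<in> I) \<and> y * b t = (\<Sum>s\<in>T. c s * b s)" by blast
  from bchoice[OF this] obtain c where
    c: "\<forall>t\<in>T. (\<forall>s\<in>T. c t s \<in> I) \<and> y * b t = (\<Sum>s\<in>T. c t s * b s)" ..
  define C where "C = Matrix.mat n n (\<lambda>(i,j). c (h i) (h j))"
  have C: "C \<in> carrier_mat n n" by (simp add: C_def)
  define v where "v = Matrix.vec n (\<lambda>i. b (h i))"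
  have v: "v \<in> carrier_vec n" by (simp add: v_def)
  have v0: "v \<noteq> 0\<^sub>v n"
  proof
    assume zero: "v = 0\<^sub>v n"
    have "b (h i) = 0" if "i < n" for i
    proof -
      have "v $ i = b (h i)" using that by (simp add: v_def)
      thus ?thesis using zero that by simp
    qed
    moreover from T(2) obtain t where "t \<in> T" "b t \<noteq> 0" by blast
    moreover from this h obtain i where "i < n" "t = h i" by (auto simp: bij_betw_def)
    ultimately show False by simp
  qed
  define p where "p = char_poly C"
  have hom: "comm_ring_hom (\<lambda>p :: 'a poly. poly p y)" by unfold_locales simp_all
  have "poly p y = det (map_mat (\<lambda>p. poly p y) (char_poly_matrix C))"
    unfolding p_def char_poly_def by (simp add: comm_ring_hom.hom_det[OF hom])
  also have "\<dots> = 0"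
  proof (subst det_0_iff_vec_prod_zero[of _ n])
    show "map_mat (\<lambda>p. poly p y) (char_poly_matrix C) \<in> carrier_mat n n" using C by simp
    have "map_mat (\<lambda>p. poly p y) (char_poly_matrix C) *\<^sub>v v = 0\<^sub>v n"
    proof (rule eq_vecI)
      fix i assume "i < dim_vec (0\<^sub>v n)"
      hence i: "i < n" by simp
      have "(map_mat (\<lambda>p. poly p y) (char_poly_matrix C) *\<^sub>v v) $ i =
          (\<Sum>j = 0..<n. (if i = j then y * b (h j) else 0) - C $$ (i,j) * b (h j))"
        using i C by (auto simp: scalar_prod_def v_def char_poly_matrix_def algebra_simps intro!: sum.cong)
      also have "\<dots> = y * b (h i) - (\<Sum>j = 0..<n. c (h i) (h j) * b (h j))"
        using i by (simp add: sum_subtractf C_def)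
      also have "(\<Sum>j = 0..<n. c (h i) (h j) * b (h j)) = (\<Sum>s\<in>T. c (h i) s * b s)"
        by (rule sum.reindex_bij_betw[OF h])
      also have "y * b (h i) - \<dots> = 0" using c hT[OF i] by simp
      finally show "(map_mat (\<lambda>p. poly p y) (char_poly_matrix C) *\<^sub>v v) $ i = 0\<^sub>v n $ i" using i by simp
    qed (use char_poly_matrix_closed[OF C] in simp)
    thus "\<exists>v. v \<in> carrier_vec n \<and> v \<noteq> 0\<^sub>v n \<and> map_mat (\<lambda>p. poly p y) (char_poly_matrix C) *\<^sub>v v = 0\<^sub>v n"
      using v v0 by blast
  qed
  finally have root: "poly p y = 0" .
  have monic: "degree p = n" "coeff p n = 1"
    using degree_monic_char_poly[OF C] by (simp_all add: p_def)
  have I0: "0 \<in> I" by (rule ideal.subspace_0[OF I])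
  have coeffs: "coeff p k \<in> ideal_power I (n - k)" if "k \<le> n" for k
    unfolding p_def char_poly_def
  proof (rule det_coeff_ideal_power[OF I0 _ _ _ that])
    show "char_poly_matrix C \<in> carrier_mat n n" using C by simp
    fix i j assume ij: "i < n" "j < n"
    have e: "char_poly_matrix C $$ (i,j) = [: - C $$ (i,j), if i = j then 1 else 0 :]"
      using ij C by (simp add: char_poly_matrix_def)
    have "C $$ (i,j) \<in> I" using ij c hT by (simp add: C_def)
    hence "- C $$ (i,j) \<in> ideal_power I (Suc 0)" by (intro ideal_power_1 ideal.subspace_neg[OF I])
    thus "coeff (char_poly_matrix C $$ (i,j)) k \<in> ideal_power I (1 - k)" if "k \<le> 1" for k
      using that unfolding e by (cases k) auto
    show "degree (char_poly_matrix C $$ (i,j)) \<le> 1" unfolding e by simp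
  qed
  have "n > 0"
  proof -
    from T(2) have "T \<noteq> {}" by blast
    thus ?thesis using T(1) by (simp add: n_def card_gt_0_iff)
  qed
  moreover have "\<forall>i\<in>{1..n}. coeff p (n - i) \<in> ideal_power I i"
    using coeffs by (metis atLeastAtMost_iff diff_diff_cancel diff_le_self)
  moreover have "y ^ n + (\<Sum>i = 1..n. coeff p (n - i) * y ^ (n - i)) = 0"
  proof -
    have "poly p y = (\<Sum>k\<le>n. coeff p k * y ^ k)" by (simp add: poly_altdef monic)
    also have "\<dots> = (\<Sum>i\<le>n. coeff p (n - i) * y ^ (n - i))"
      by (rule sum.reindex_bij_witness[of _ "\<lambda>i. n - i" "\<lambda>i. n - i"]) auto
    also have "{..n} = insert 0 {1..n}" by auto
    finally show ?thesis using root monic(2) by simp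
  qed
  ultimately show ?thesis unfolding ideal_closure_def
    by (intro CollectI exI[of _ n] exI[of _ "\<lambda>i. coeff p (n - i)"] conjI)
qed

section \<open>Germs\<close>

lemma germ_coeff_zero [simp]: "germ_coeff 0 k = 0" by transfer simp
lemma germ_coeff_one: "germ_coeff 1 k = (if k = 0 then 1 else 0)" by transfer simp
lemma germ_coeff_add [simp]: "germ_coeff (f + g) k = germ_coeff f k + germ_coeff g k" by transfer simp
lemma germ_coeff_uminus [simp]: "germ_coeff (- f) k = - germ_coeff f k" by transfer simp
lemma germ_coeff_diff [simp]: "germ_coeff (f - g) k = germ_coeff f k - germ_coeff g k" by transfer simp
lemma germ_coeff_sum: "germ_coeff (sum f A) k = (\<Sum>x\<in>A. germ_coeff (f x) k)"
  by (induction A rule: infinite_finite_induct) auto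
lemma germ_coeff_times: "germ_coeff (f * g) k = (\<Sum>(i,j)\<in>{(i,j). i + j = k}. germ_coeff f i * germ_coeff g j)"
  by (transfer, simp add: cauchy_prod_def)
lemma germ_coeff_monom: "germ_coeff (germ_monom e) k = (if k = e then 1 else 0)" by transfer simp
lemma germ_eqI: "(\<And>k. germ_coeff f k = germ_coeff g k) \<Longrightarrow> f = g" by transfer auto
lemma convergent_germ_coeff: "convergent_series (germ_coeff f)" using germ_coeff by simp

lemma supp_zero [simp]: "supp 0 = {}" by (simp add: supp_def)
lemma supp_eq_empty: "supp f = {} \<longleftrightarrow> f = 0" by (auto simp: supp_def intro: germ_eqI)
lemma supp_monom [simp]: "supp (germ_monom k) = {k}" by (auto simp: supp_def germ_coeff_monom)
lemma supp_add: "supp (f + g) \<subseteq> supp f \<union> supp g" by (auto simp: supp_def)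

lemma supp_times:
  assumes "k \<in> supp (f * g)"
  obtains i j where "i \<in> supp f" "j \<in> supp g" "k = i + j"
proof -
  have "\<exists>x\<in>{(i,j). i + j = k}. (case x of (i,j) \<Rightarrow> germ_coeff f i * germ_coeff g j) \<noteq> 0"
    using assms unfolding supp_def germ_coeff_times by (metis (mono_tags, lifting) mem_Collect_eq sum.neutral)
  thus ?thesis using that by (auto simp: supp_def)
qed

lemma supp_sum:
  assumes "k \<in> supp (sum f A)"
  obtains x where "x \<in> A" "k \<in> supp (f x)"
  using assms unfolding supp_def germ_coeff_sum by (metis (mono_tags, lifting) mem_Collect_eq sum.neutral)

lemma supp_prod:
  assumes "k \<in> supp (prod f A)" "finite A"
  shows "\<exists>l. k = sum l A \<and> (\<forall>x\<in>A. l x \<in> supp (f x))"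
  using assms(2,1)
proof (induction A arbitrary: k rule: finite_induct)
  case empty
  thus ?case by (simp add: supp_def germ_coeff_one split: if_splits)
next
  case (insert a A)
  hence "k \<in> supp (f a * prod f A)" by simp
  then obtain i j where ij: "i \<in> supp (f a)" "j \<in> supp (prod f A)" "k = i + j" by (rule supp_times)
  from insert.IH[OF ij(2)] obtain l where l: "j = sum l A" "\<forall>x\<in>A. l x \<in> supp (f x)" by blast
  have "sum (l(a := i)) A = sum l A" using insert.hyps by (intro sum.cong) auto
  hence "k = sum (l(a := i)) (insert a A)" using insert.hyps ij l by simp
  moreover have "\<forall>x\<in>insert a A. (l(a := i)) x \<in> supp (f x)" using l(2) ij(1) insert.hyps by auto
  ultimately show ?case by blast
qed

lemma germ_coeff_monom_times:
  "germ_coeff (germ_monom e * f) k = (if \<forall>i. e $h i \<le> k $h i then germ_coeff f (k - e) else 0)"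
proof -
  have sub: "{(i,j). i + j = k} \<inter> {(i,j). i = e} = (if \<forall>i. e $h i \<le> k $h i then {(e, k - e)} else {})"
    by (auto simp: Finite_Cartesian_Product.vec_eq_iff) (metis diff_add_inverse, metis le_add1)
  have "germ_coeff (germ_monom e * f) k =
      (\<Sum>x\<in>{(i,j). i + j = k} \<inter> {(i,j). i = e}. germ_coeff f (snd x))"
    unfolding germ_coeff_times germ_coeff_monom
    by (rule sum.mono_neutral_cong_right) (auto simp: finite_splits split: if_splits)
  thus ?thesis unfolding sub by simp
qed

lemma germ_monom_add: "germ_monom (k + l) = germ_monom k * germ_monom l"
proof (rule germ_eqI)
  fix m
  have "(\<forall>i. k $h i \<le> m $h i) \<and> m - k = l \<longleftrightarrow> m = k + l"
    by (auto simp: Finite_Cartesian_Product.vec_eq_iff) (metis le_add_diff_inverse)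
  thus "germ_coeff (germ_monom (k + l)) m = germ_coeff (germ_monom k * germ_monom l) m"
    by (auto simp: germ_coeff_monom_times germ_coeff_monom)
qed

lemma germ_monom_nonzero [simp]: "germ_monom k \<noteq> 0"
  by (metis supp_monom supp_eq_empty insert_not_empty)

lift_definition germ_const :: "complex \<Rightarrow> 'n::finite germ" is "\<lambda>c k. if k = 0 then c else 0"
  by (rule convergent_series_finite) (rule finite_subset[of _ "{0}"], auto)

lemma germ_coeff_const: "germ_coeff (germ_const c) k = (if k = 0 then c else 0)" by transfer simp

lemma germ_coeff_const_times [simp]: "germ_coeff (germ_const c * f) k = c * germ_coeff f k"
proof -
  have sub: "{(i,j). i + j = k} \<inter> {(i,j). i = 0} = {(0, k)}" by auto
  have "germ_coeff (germ_const c * f) k = (\<Sum>x\<in>{(i,j). i + j = k} \<inter> {(i,j). i = 0}. c * germ_coeff f (snd x))"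
    unfolding germ_coeff_times germ_coeff_const
    by (rule sum.mono_neutral_cong_right) (auto simp: finite_splits split: if_splits)
  thus ?thesis unfolding sub by simp
qed

lemma germ_const_add: "germ_const (a + b) = germ_const a + germ_const b"
  by (rule germ_eqI) (simp add: germ_coeff_const)
lemma germ_const_mult: "germ_const (a * b) = germ_const a * germ_const b"
  by (rule germ_eqI) (simp add: germ_coeff_const)
lemma germ_const_0 [simp]: "germ_const 0 = 0" by (rule germ_eqI) (simp add: germ_coeff_const)
lemma germ_const_1 [simp]: "germ_const 1 = 1" by (rule germ_eqI) (simp add: germ_coeff_const germ_coeff_one)
lemma germ_const_eq_0_iff [simp]: "germ_const c = 0 \<longleftrightarrow> c = 0"
  by (metis germ_coeff_const germ_coeff_zero germ_const_0)
lemma germ_const_sum: "germ_const (sum f A) = (\<Sum>x\<in>A. germ_const (f x))"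
  by (induction A rule: infinite_finite_induct) (auto simp: germ_const_add)
lemma germ_const_prod: "germ_const (prod f A) = (\<Prod>x\<in>A. germ_const (f x))"
  by (induction A rule: infinite_finite_induct) (auto simp: germ_const_mult)
lemma germ_const_power: "germ_const (c ^ n) = germ_const c ^ n"
  by (induction n) (auto simp: germ_const_mult)

lemma germ_coeff_times_0: "germ_coeff (f * g) 0 = germ_coeff f 0 * germ_coeff g 0"
proof -
  have "{(i :: nat^'a, j). i + j = 0} = {(0, 0)}"
    by (auto simp: Finite_Cartesian_Product.vec_eq_iff)
  thus ?thesis by (simp add: germ_coeff_times)
qed

subsection \<open>Division by monomials\<close>

text \<open>The weighted coefficients of the shifted series are a subfamily of the original ones, up
  to the factor \<open>r\<close> to the power \<open>- total_degree e\<close>. The predicate Q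
  selects the terms that are divided by the given monomial.\<close>

lemma convergent_series_shift:
  fixes e :: "nat^'n::finite"
  assumes "convergent_series a"
  shows "convergent_series (\<lambda>k. if Q k then a (k + e) else 0)"
proof -
  obtain r where r: "r > 0" "(\<lambda>k. norm (a k) * r ^ total_degree k) summable_on UNIV"
    using assms unfolding convergent_series_def by blast
  let ?g = "\<lambda>k. norm (a k) * r ^ total_degree k"
  have "?g summable_on range (\<lambda>k. k + e)" by (rule summable_on_subset_banach[OF r(2)]) simp
  hence "(?g \<circ> (\<lambda>k. k + e)) summable_on UNIV"
    by (subst (asm) summable_on_reindex) (auto simp: inj_def)
  from summable_on_cmult_right[OF this, of "1 / r ^ total_degree e"]
  have "(\<lambda>k. norm (a (k + e)) * r ^ total_degree k) summable_on UNIV"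
    using r(1) by (simp add: total_degree_add power_add)
  hence "(\<lambda>k. norm (if Q k then a (k + e) else 0) * r ^ total_degree k) summable_on UNIV"
    by (rule summable_on_comparison_test) (use r(1) in auto)
  thus ?thesis using r(1) unfolding convergent_series_def by blast
qed

text \<open>Each exponent k of f is assigned to one \<open>s k\<close> in E below it. The terms
  assigned to e, divided by the monomial of e, form a convergent series again.\<close>

lemma germ_division:
  fixes f :: "'n::finite germ"
  assumes "finite E" "\<forall>k\<in>supp f. \<exists>e\<in>E. \<forall>i. e $h i \<le> k $h i"
  obtains g where "f = (\<Sum>e\<in>E. g e * germ_monom e)"
    "\<forall>e\<in>E. \<forall>k. germ_coeff (g e) k = 0 \<or> germ_coeff (g e) k = germ_coeff f (k + e)"
proof -
  have "\<forall>k\<in>supp f. \<exists>e. e \<in> E \<and> (\<forall>i. e $h i \<le> k $h i)" using assms(2) by (simp add: Bex_def)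
  from bchoice[OF this] obtain s where s: "\<forall>k\<in>supp f. s k \<in> E \<and> (\<forall>i. s k $h i \<le> k $h i)" ..
  define g where "g e = Abs_germ (\<lambda>k. if k + e \<in> supp f \<and> s (k + e) = e then germ_coeff f (k + e) else 0)" for e
  have g: "germ_coeff (g e) k = (if k + e \<in> supp f \<and> s (k + e) = e then germ_coeff f (k + e) else 0)" for e k
    unfolding g_def
    by (subst Abs_germ_inverse) (simp_all add: convergent_series_shift[OF convergent_germ_coeff])
  show ?thesis
  proof (rule that[of g])
    show "f = (\<Sum>e\<in>E. g e * germ_monom e)"
    proof (rule germ_eqI)
      fix k :: "nat^'n"
      have sub: "k - e + e = k" if "\<forall>i. e $h i \<le> k $h i" for e
        using that by (simp add: Finite_Cartesian_Product.vec_eq_iff)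
      have "germ_coeff (\<Sum>e\<in>E. g e * germ_monom e) k =
          (\<Sum>e\<in>E. if \<forall>i. e $h i \<le> k $h i then germ_coeff (g e) (k - e) else 0)"
        by (simp add: germ_coeff_sum mult.commute[of "g _"] germ_coeff_monom_times)
      also have "\<dots> = (\<Sum>e\<in>E. if e = s k then germ_coeff f k else 0)"
      proof (rule sum.cong[OF refl])
        fix e assume "e \<in> E"
        show "(if \<forall>i. e $h i \<le> k $h i then germ_coeff (g e) (k - e) else 0) =
            (if e = s k then germ_coeff f k else 0)"
        proof (cases "k \<in> supp f")
          case True
          thus ?thesis using s sub[of e] by (auto simp: g)
        next
          case False
          thus ?thesis using sub[of e] by (auto simp: g supp_def)
        qed
      qed
      also have "\<dots> = germ_coeff f k"
      proof (cases "k \<in> supp f")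
        case True
        thus ?thesis using s assms(1) by simp
      qed (use assms(1) in \<open>auto simp: supp_def\<close>)
      finally show "germ_coeff f k = germ_coeff (\<Sum>e\<in>E. g e * germ_monom e) k" by simp
    qed
  qed (simp add: g)
qed

text \<open>Dickson's lemma replaces the infinitely many monomials in the expansion of f by finitely
  many generators, and \<open>germ_division\<close> provides convergent coefficients for
  them.\<close>

lemma mem_newton_ideal:
  "f \<in> newton_ideal I \<longleftrightarrow> (\<forall>k\<in>supp f. real_exponent k \<in> newton_polyhedron I)"
proof
  assume "f \<in> newton_ideal I"
  hence "f \<in> ideal.span {germ_monom k | k. real_exponent k \<in> newton_polyhedron I}"
    by (simp add: newton_ideal_def genideal_eq_span)
  thus "\<forall>k\<in>supp f. real_exponent k \<in> newton_polyhedron I"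
  proof (induction rule: ideal.span_induct_alt)
    case (step c x y)
    then obtain e where e: "x = germ_monom e" "real_exponent e \<in> newton_polyhedron I" by blast
    show ?case
    proof
      fix k assume "k \<in> supp (c * x + y)"
      hence "k \<in> supp (c * x) \<or> k \<in> supp y" using supp_add by blast
      thus "real_exponent k \<in> newton_polyhedron I"
      proof
        assume "k \<in> supp (c * x)"
        then obtain i j where "k = i + j" "j \<in> supp x" by (rule supp_times)
        hence "\<forall>l. e $h l \<le> k $h l" by (simp add: e(1))
        thus ?thesis using e(2) upper_hull_exponent_ge[of e] by (simp add: newton_polyhedron_eq)
      qed (use step.IH in blast)
    qed
  qed simp
next
  assume f: "\<forall>k\<in>supp f. real_exponent k \<in> newton_polyhedron I"
  obtain E where E: "finite E" "E \<subseteq> {k. real_exponent k \<in> newton_polyhedron I}"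
    "\<forall>k\<in>{k. real_exponent k \<in> newton_polyhedron I}. \<exists>e\<in>E. \<forall>i. e $h i \<le> k $h i"
    using dickson[of "{k. real_exponent k \<in> newton_polyhedron I}"] .
  have "\<forall>k\<in>supp f. \<exists>e\<in>E. \<forall>i. e $h i \<le> k $h i" using f E(3) by simp
  then obtain g where g: "f = (\<Sum>e\<in>E. g e * germ_monom e)"
    "\<forall>e\<in>E. \<forall>k. germ_coeff (g e) k = 0 \<or> germ_coeff (g e) k = germ_coeff f (k + e)"
    by (rule germ_division[OF E(1)])
  have "f \<in> ideal.span (germ_monom ` E)" unfolding g by (rule finite_subset_span[OF E(1)])
  also have "\<dots> \<subseteq> ideal.span {germ_monom k | k. real_exponent k \<in> newton_polyhedron I}"
    by (rule ideal.span_mono) (use E(2) in auto)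
  finally show "f \<in> newton_ideal I" by (simp add: newton_ideal_def genideal_eq_span)
qed

subsection \<open>Units\<close>

lemma sum_le_infsum_weighted:
  fixes a :: "nat^'n::finite \<Rightarrow> complex"
  assumes "(\<lambda>k. norm (a k) * r ^ total_degree k) summable_on UNIV" "0 \<le> r" "finite F"
  shows "(\<Sum>k\<in>F. norm (a k) * r ^ total_degree k) \<le> infsum (\<lambda>k. norm (a k) * r ^ total_degree k) UNIV"
  by (rule finite_sum_le_infsum[OF assms(1,3)]) (use assms(2) in auto)

text \<open>Without a constant term every monomial has degree at least 1, so scaling the radius by c
  \<le> 1 scales the weighted sum by at most c.\<close>

lemma small_polydisc:
  fixes a :: "nat^'n::finite \<Rightarrow> complex"
  assumes "convergent_series a" "a 0 = 0"
  obtains s where "s > 0" "\<forall>F. finite F \<longrightarrow> (\<Sum>k\<in>F. norm (a k) * s ^ total_degree k) \<le> 1 / 2"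
proof -
  obtain r where r: "r > 0" "(\<lambda>k. norm (a k) * r ^ total_degree k) summable_on UNIV"
    using assms(1) unfolding convergent_series_def by blast
  define S where "S = infsum (\<lambda>k. norm (a k) * r ^ total_degree k) UNIV"
  have "0 \<le> S" unfolding S_def by (rule infsum_nonneg) (use r(1) in auto)
  \<comment> \<open>Gives \<open>c * S \<le> 1 / 2\<close>, also when S vanishes.\<close>
  define c where "c = 1 / (2 * S + 1)"
  have c: "0 < c" "c \<le> 1" "c * S \<le> 1 / 2" using \<open>0 \<le> S\<close> by (auto simp: c_def field_simps)
  show ?thesis
  proof (rule that[of "c * r"]; (intro allI impI)?)
    show "c * r > 0" using c r by simp
    fix F :: "(nat^'n) set" assume F: "finite F"
    have "(\<Sum>k\<in>F. norm (a k) * (c * r) ^ total_degree k) \<le> (\<Sum>k\<in>F. c * (norm (a k) * r ^ total_degree k))"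
    proof (rule sum_mono)
      fix k
      show "norm (a k) * (c * r) ^ total_degree k \<le> c * (norm (a k) * r ^ total_degree k)"
      proof (cases "k = 0")
        case False
        then obtain i where "k $h i \<noteq> 0" by (auto simp: Finite_Cartesian_Product.vec_eq_iff)
        hence "1 \<le> total_degree k" using nth_le_total_degree[of k i] by linarith
        hence "c ^ total_degree k \<le> c ^ 1" using c by (intro power_decreasing) auto
        hence "c ^ total_degree k * (norm (a k) * r ^ total_degree k) \<le> c * (norm (a k) * r ^ total_degree k)"
          using r(1) by (intro mult_right_mono) auto
        thus ?thesis by (simp add: power_mult_distrib mult_ac)
      qed (simp add: assms(2))
    qed
    also have "\<dots> \<le> c * S"
      unfolding sum_distrib_left[symmetric] S_def using c r F by (intro mult_left_mono sum_le_infsum_weighted) auto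
    finally show "(\<Sum>k\<in>F. norm (a k) * (c * r) ^ total_degree k) \<le> 1 / 2" using c(3) by simp
  qed
qed

lemma germ_coeff_power_eq_0:
  fixes h :: "'n::finite germ"
  assumes "germ_coeff h 0 = 0" "total_degree k < m"
  shows "germ_coeff (h ^ m) k = 0"
  using assms(2)
proof (induction m arbitrary: k)
  case (Suc m)
  have "germ_coeff h i * germ_coeff (h ^ m) j = 0" if "i + j = k" for i j
  proof (cases "i = 0")
    case False
    then obtain l where "i $h l \<noteq> 0" by (auto simp: Finite_Cartesian_Product.vec_eq_iff)
    hence "1 \<le> total_degree i" using nth_le_total_degree[of i l] by linarith
    hence "total_degree j < m" using Suc.prems that total_degree_add[of i j] by simp
    thus ?thesis using Suc.IH by simp
  qed (simp add: assms(1))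
  hence "(\<Sum>(i,j)\<in>{(i,j). i + j = k}. germ_coeff h i * germ_coeff (h ^ m) j) = 0"
    by (intro sum.neutral) auto
  thus ?case by (simp add: germ_coeff_times)
qed simp

text \<open>
  The geometric series converges: if the weighted sum of the coefficients of \<open>h\<close> is at most \<open>1/2\<close>,
  the equation \<open>q = 1 + h q\<close> bounds the partial sums of \<open>q\<close> by \<open>2\<close>.
\<close>

lemma germ_geometric:
  fixes h :: "'n::finite germ"
  assumes h0: "germ_coeff h 0 = 0"
  obtains q where "(1 - h) * q = 1"
proof -
  \<comment> \<open>The geometric series. As h has no constant term, powers beyond
    \<open>total_degree k\<close> do not contribute to the coefficient of k.\<close>
  define q where "q k = (\<Sum>m\<le>total_degree k. germ_coeff (h ^ m) k)" for k
  have q_ext: "q k = (\<Sum>m\<le>d. germ_coeff (h ^ m) k)" if "total_degree k \<le> d" for k d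
    unfolding q_def
    by (rule sum.mono_neutral_left) (use that in \<open>auto intro!: germ_coeff_power_eq_0[OF h0]\<close>)
  have q_eq: "q k = (if k = 0 then 1 else 0) + cauchy_prod (germ_coeff h) q k" for k
  proof -
    let ?d = "total_degree k"
    have "cauchy_prod (germ_coeff h) q k =
        (\<Sum>x\<in>{(i,j). i + j = k}. \<Sum>m\<le>?d. germ_coeff h (fst x) * germ_coeff (h ^ m) (snd x))"
      unfolding cauchy_prod_def case_prod_unfold
      by (rule sum.cong) (auto simp: q_ext[of _ ?d] sum_distrib_left total_degree_add)
    also have "\<dots> = (\<Sum>m\<le>?d. germ_coeff (h ^ Suc m) k)"
      by (subst sum.swap) (simp add: germ_coeff_times case_prod_unfold)
    also have "\<dots> = (\<Sum>m\<le>Suc ?d. germ_coeff (h ^ m) k) - germ_coeff (h ^ 0) k"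
      unfolding sum.atMost_Suc_shift by simp
    also have "(\<Sum>m\<le>Suc ?d. germ_coeff (h ^ m) k) = q k" by (rule q_ext[symmetric]) simp
    finally show ?thesis by (simp add: germ_coeff_one)
  qed
  obtain s where s: "s > 0" "\<forall>F. finite F \<longrightarrow> (\<Sum>k\<in>F. norm (germ_coeff h k) * s ^ total_degree k) \<le> 1 / 2"
    using small_polydisc[OF convergent_germ_coeff h0] .
  let ?w = "\<lambda>a k. norm (a k :: complex) * s ^ total_degree k"
  have bound: "(\<Sum>k\<in>F. ?w q k) \<le> 2" if F: "finite F" for F
  proof -
    define d where "d = (\<Sum>k\<in>F. total_degree k)"
    \<comment> \<open>D contains i and j whenever it contains i + j. Hence the weighted sum X of q
      over D satisfies X \<le> 1 + X / 2, and X is finite.\<close>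
    define D where "D = {k :: nat^'n. total_degree k \<le> d}"
    have D: "finite D" unfolding D_def by (rule finite_total_degree)
    have "F \<subseteq> D" unfolding D_def d_def using F by (auto intro: member_le_sum)
    hence "(\<Sum>k\<in>F. ?w q k) \<le> (\<Sum>k\<in>D. ?w q k)"
      using D s(1) by (intro sum_mono2) auto
    also have "\<dots> \<le> 2"
    proof -
      have "(\<Sum>k\<in>D. ?w q k) \<le> (\<Sum>k\<in>D. (if k = 0 then 1 else 0) +
          (\<Sum>x\<in>{(i,j). i + j = k}. ?w (germ_coeff h) (fst x) * ?w q (snd x)))"
      proof (rule sum_mono)
        fix k
        have "norm (q k) \<le> norm (if k = 0 then 1 else 0 :: complex) +
            (\<Sum>x\<in>{(i,j). i + j = k}. norm (germ_coeff h (fst x)) * norm (q (snd x)))"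
          unfolding q_eq[of k]
          by (rule order_trans[OF norm_triangle_ineq])
            (auto simp: cauchy_prod_def case_prod_unfold norm_mult intro!: order_trans[OF norm_sum])
        hence "?w q k \<le> (norm (if k = 0 then 1 else 0 :: complex) +
            (\<Sum>x\<in>{(i,j). i + j = k}. norm (germ_coeff h (fst x)) * norm (q (snd x)))) * s ^ total_degree k"
          using s(1) by (intro mult_right_mono) auto
        also have "\<dots> = (if k = 0 then 1 else 0) +
            (\<Sum>x\<in>{(i,j). i + j = k}. ?w (germ_coeff h) (fst x) * ?w q (snd x))"
          unfolding distrib_right sum_distrib_right
          by (intro arg_cong2[of _ _ _ _ "(+)"] sum.cong) (auto simp: total_degree_add power_add)
        finally show "?w q k \<le> (if k = 0 then 1 else 0) +
            (\<Sum>x\<in>{(i,j). i + j = k}. ?w (germ_coeff h) (fst x) * ?w q (snd x))" .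
      qed
      also have "\<dots> = 1 + (\<Sum>k\<in>D. \<Sum>x\<in>{(i,j). i + j = k}. ?w (germ_coeff h) (fst x) * ?w q (snd x))"
        using D by (simp add: sum.distrib D_def)
      also have "(\<Sum>k\<in>D. \<Sum>x\<in>{(i,j). i + j = k}. ?w (germ_coeff h) (fst x) * ?w q (snd x)) =
          (\<Sum>(k,x)\<in>(SIGMA k:D. {(i,j). i + j = k}). ?w (germ_coeff h) (fst x) * ?w q (snd x))"
        using D finite_splits by (subst sum.Sigma) auto
      also have "\<dots> = (\<Sum>x\<in>snd ` (SIGMA k:D. {(i,j). i + j = k}). ?w (germ_coeff h) (fst x) * ?w q (snd x))"
        by (subst sum.reindex) (auto simp: inj_on_def case_prod_unfold)
      also have "\<dots> \<le> (\<Sum>x\<in>D \<times> D. ?w (germ_coeff h) (fst x) * ?w q (snd x))"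
        by (rule sum_mono2) (use D s(1) in \<open>auto simp: D_def total_degree_add\<close>)
      also have "\<dots> = (\<Sum>k\<in>D. ?w (germ_coeff h) k) * (\<Sum>k\<in>D. ?w q k)"
        by (simp add: sum_product sum.cartesian_product case_prod_unfold)
      also have "\<dots> \<le> 1 / 2 * (\<Sum>k\<in>D. ?w q k)"
        using s D by (intro mult_right_mono sum_nonneg) auto
      finally show ?thesis by simp
    qed
    finally show ?thesis .
  qed
  have "?w q summable_on UNIV"
    by (rule nonneg_bdd_above_summable_on)
      (use s(1) bound in \<open>auto intro!: bdd_aboveI2[where M = 2]\<close>)
  hence conv: "convergent_series q" unfolding convergent_series_def using s(1) by blast
  have q: "germ_coeff (Abs_germ q) k = q k" for k by (simp add: Abs_germ_inverse conv)
  have "(1 - h) * Abs_germ q = 1"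
  proof (rule germ_eqI)
    fix k
    have "germ_coeff ((1 - h) * Abs_germ q) k = q k - cauchy_prod (germ_coeff h) q k"
      by (simp add: left_diff_distrib germ_coeff_times cauchy_prod_def q)
    thus "germ_coeff ((1 - h) * Abs_germ q) k = germ_coeff 1 k"
      using q_eq[of k] by (simp add: germ_coeff_one)
  qed
  thus ?thesis by (rule that)
qed

lemma germ_unit:
  assumes "germ_coeff f 0 \<noteq> 0"
  obtains g where "f * g = 1"
proof -
  define c where "c = germ_coeff f 0"
  have "germ_coeff (1 - germ_const (1 / c) * f) 0 = 0" using assms by (simp add: germ_coeff_one c_def)
  then obtain q where q: "(1 - (1 - germ_const (1 / c) * f)) * q = 1" by (rule germ_geometric)
  show ?thesis by (rule that[of "germ_const (1 / c) * q"]) (use q in \<open>simp add: mult_ac\<close>)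
qed

section \<open>Valuation rings\<close>

lemma cring_carrier_update:
  assumes "subring V (class_ring :: 'a::comm_ring_1 ring)"
  shows "cring (class_ring\<lparr>carrier := V\<rparr> :: 'a ring)"
proof -
  interpret ring "class_ring\<lparr>carrier := V\<rparr> :: 'a ring" by (rule ring.subring_is_ring[OF class_ring.ring_axioms assms])
  show ?thesis by unfold_locales (simp add: mult.commute)
qed

lemma subring_class_ringD:
  assumes "subring V (class_ring :: 'a::comm_ring_1 ring)"
  shows "0 \<in> V" "1 \<in> V" "x \<in> V \<Longrightarrow> y \<in> V \<Longrightarrow> x + y \<in> V" "x \<in> V \<Longrightarrow> y \<in> V \<Longrightarrow> x * y \<in> V"
    "x \<in> V \<Longrightarrow> - x \<in> V" "x \<in> V \<Longrightarrow> y \<in> V \<Longrightarrow> x - y \<in> V"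
proof -
  note E = subringE[OF assms]
  show "0 \<in> V" using E(2) by simp
  show "1 \<in> V" using E(3) by simp
  show add: "x \<in> V \<Longrightarrow> y \<in> V \<Longrightarrow> x + y \<in> V" for x y using E(7)[of x y] by simp
  show "x \<in> V \<Longrightarrow> y \<in> V \<Longrightarrow> x * y \<in> V" using E(6)[of x y] by simp
  show neg: "x \<in> V \<Longrightarrow> - x \<in> V" for x using E(5)[of x] by (simp add: class_ring_simps)
  show "x \<in> V \<Longrightarrow> y \<in> V \<Longrightarrow> x - y \<in> V" using add[of x "- y"] neg[of y] by simp
qed

lemma ideal_carrier_update_iff:
  assumes V: "subring V (class_ring :: 'a::comm_ring_1 ring)"
  shows "Ideal.ideal I (class_ring\<lparr>carrier := V\<rparr> :: 'a ring) \<longleftrightarrow>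
    I \<subseteq> V \<and> 0 \<in> I \<and> (\<forall>a\<in>I. \<forall>b\<in>I. a + b \<in> I) \<and> (\<forall>a\<in>I. \<forall>x\<in>V. x * a \<in> I)"
proof
  assume I: "Ideal.ideal I (class_ring\<lparr>carrier := V\<rparr> :: 'a ring)"
  note A = ideal.axioms(1)[OF I]
  show "I \<subseteq> V \<and> 0 \<in> I \<and> (\<forall>a\<in>I. \<forall>b\<in>I. a + b \<in> I) \<and> (\<forall>a\<in>I. \<forall>x\<in>V. x * a \<in> I)"
    using additive_subgroup.a_subset[OF A] additive_subgroup.zero_closed[OF A]
      additive_subgroup.a_closed[OF A] ideal.I_l_closed[OF I] by simp
next
  interpret cring "class_ring\<lparr>carrier := V\<rparr> :: 'a ring" by (rule cring_carrier_update[OF V])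
  assume I: "I \<subseteq> V \<and> 0 \<in> I \<and> (\<forall>a\<in>I. \<forall>b\<in>I. a + b \<in> I) \<and> (\<forall>a\<in>I. \<forall>x\<in>V. x * a \<in> I)"
  show "Ideal.ideal I (class_ring\<lparr>carrier := V\<rparr> :: 'a ring)"
  proof (rule idealI)
    show "ring (class_ring\<lparr>carrier := V\<rparr> :: 'a ring)" by (rule ring_axioms)
    show "subgroup I (add_monoid (class_ring\<lparr>carrier := V\<rparr> :: 'a ring))"
    proof
      fix x assume x: "x \<in> I"
      have "- 1 \<in> V" using subring_class_ringD(2,5)[OF V] by blast
      hence neg: "- x \<in> I" using I x by (metis mult_minus1)
      have "inv\<^bsub>add_monoid (class_ring\<lparr>carrier := V\<rparr>)\<^esub> x = - x"
        using add.inv_equality[of "- x" x] x neg I by (auto simp: a_inv_def)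
      thus "inv\<^bsub>add_monoid (class_ring\<lparr>carrier := V\<rparr>)\<^esub> x \<in> I" using neg by simp
    qed (use I in auto)
  qed (use I in \<open>auto simp: mult.commute\<close>)
qed

text \<open>The value at 0 is left open and excluded in each law. The value group may be a proper
  subgroup of the integers; having an element of positive value is all that distinguishes the
  valuation from the trivial one.\<close>

locale field_valuation =
  fixes v :: "'k::field \<Rightarrow> int"
  assumes v_mult: "x \<noteq> 0 \<Longrightarrow> y \<noteq> 0 \<Longrightarrow> v (x * y) = v x + v y"
    and v_add: "x \<noteq> 0 \<Longrightarrow> y \<noteq> 0 \<Longrightarrow> x + y \<noteq> 0 \<Longrightarrow> min (v x) (v y) \<le> v (x + y)"
    and v_nontrivial: "\<exists>x. x \<noteq> 0 \<and> v x > 0"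
begin

definition vring :: "'k set" where "vring = {x. x = 0 \<or> v x \<ge> 0}"

definition vmax :: "'k set" where "vmax = {x. x = 0 \<or> v x > 0}"

lemma v_one [simp]: "v 1 = 0" using v_mult[of 1 1] by simp

lemma v_minus: "x \<noteq> 0 \<Longrightarrow> v (- x) = v x"
proof -
  have "v (- 1) + v (- 1) = 0" using v_mult[of "- 1" "- 1"] by simp
  thus "x \<noteq> 0 \<Longrightarrow> v (- x) = v x" using v_mult[of "- 1" x] by simp
qed

lemma v_inverse: "x \<noteq> 0 \<Longrightarrow> v (inverse x) = - v x"
  using v_mult[of x "inverse x"] by simp

lemma v_divide: "x \<noteq> 0 \<Longrightarrow> y \<noteq> 0 \<Longrightarrow> v (x / y) = v x - v y"
  using v_mult[of x "inverse y"] by (simp add: v_inverse divide_inverse)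

lemma vring_add: "x \<in> vring \<Longrightarrow> y \<in> vring \<Longrightarrow> x + y \<in> vring"
  unfolding vring_def using v_add[of x y] by (cases "x = 0"; cases "y = 0"; cases "x + y = 0") auto

lemma vmax_add: "x \<in> vmax \<Longrightarrow> y \<in> vmax \<Longrightarrow> x + y \<in> vmax"
  unfolding vmax_def using v_add[of x y] by (cases "x = 0"; cases "y = 0"; cases "x + y = 0") auto

lemma vring_mult: "x \<in> vring \<Longrightarrow> y \<in> vring \<Longrightarrow> x * y \<in> vring"
  unfolding vring_def using v_mult[of x y] by (cases "x = 0"; cases "y = 0") auto

lemma vmax_mult: "x \<in> vring \<Longrightarrow> y \<in> vmax \<Longrightarrow> x * y \<in> vmax"
  unfolding vring_def vmax_def using v_mult[of x y] by (cases "x = 0"; cases "y = 0") auto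

lemma subring_vring: "subring vring class_ring"
proof (rule ring.subringI[OF class_ring.ring_axioms])
  show "\<ominus>\<^bsub>class_ring\<^esub> h \<in> vring" if "h \<in> vring" for h
    using that v_minus[of h] by (cases "h = 0") (auto simp: class_ring_simps vring_def)
qed (auto simp: vring_add vring_mult, simp add: vring_def)

text \<open>An element of least value generates an ideal. The elements outside \<open>vmax\<close>
  are units, so \<open>vmax\<close> is the only maximal ideal, and an element of positive value has
  no inverse in the ring.\<close>

lemma discrete_valuation_ring_vring: "discrete_valuation_ring (class_ring\<lparr>carrier := vring\<rparr>)"
proof -
  let ?R = "class_ring\<lparr>carrier := vring\<rparr> :: 'k ring"
  interpret R: cring ?R by (rule cring_carrier_update[OF subring_vring])
  note ideal_iff = ideal_carrier_update_iff[OF subring_vring]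
  interpret R: domain ?R by unfold_locales auto
  have principal: "\<exists>a\<in>vring. I = PIdl\<^bsub>?R\<^esub> a" if "Ideal.ideal I ?R" for I
  proof -
    from that have I: "I \<subseteq> vring" "0 \<in> I" "\<And>a x. a \<in> I \<Longrightarrow> x \<in> vring \<Longrightarrow> x * a \<in> I"
      unfolding ideal_iff by auto
    show ?thesis
    proof (cases "I = {0}")
      case True
      thus ?thesis by (intro bexI[of _ 0]) (auto simp: cgenideal_def vring_def)
    next
      case False
      then obtain b where b: "b \<in> I" "b \<noteq> 0" using I(2) by blast
      obtain a where a: "a \<in> I" "a \<noteq> 0" "\<forall>y. y \<in> I \<and> y \<noteq> 0 \<longrightarrow> nat (v a) \<le> nat (v y)"
        using ex_has_least_nat[of "\<lambda>a. a \<in> I \<and> a \<noteq> 0" b "\<lambda>a. nat (v a)"] b by auto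
      have "I = PIdl\<^bsub>?R\<^esub> a"
      proof (rule Set.set_eqI)
        fix y
        show "y \<in> I \<longleftrightarrow> y \<in> PIdl\<^bsub>?R\<^esub> a"
        proof
          assume y: "y \<in> I"
          have "y / a \<in> vring"
          proof (cases "y = 0")
            case False
            have "v a \<ge> 0" "v y \<ge> 0" using a y I(1) False by (auto simp: vring_def)
            hence "v a \<le> v y" using a(3) y False by (metis nat_le_eq_zle)
            thus ?thesis using a(2) False by (simp add: vring_def v_divide)
          qed (simp add: vring_def)
          thus "y \<in> PIdl\<^bsub>?R\<^esub> a" unfolding cgenideal_def using a(2) by (auto intro!: exI[of _ "y / a"])
        qed (use I(3)[OF a(1)] in \<open>auto simp: cgenideal_def\<close>)
      qed
      thus ?thesis using a(1) I(1) by blast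
    qed
  qed
  have "principal_domain ?R" by unfold_locales (use principal in auto)
  moreover have "\<not> Ring.field ?R"
  proof
    assume "Ring.field ?R"
    then interpret F: Ring.field ?R .
    obtain x where x: "x \<noteq> 0" "v x > 0" using v_nontrivial by blast
    hence "x \<in> Units ?R" using F.field_Units by (simp add: vring_def)
    then obtain y where "y \<in> vring" "x * y = 1" unfolding Units_def by auto
    moreover from this(2) have "y = inverse x" using x(1) by (metis inverse_unique)
    ultimately show False using x v_inverse[of x] by (auto simp: vring_def)
  qed
  moreover have "\<exists>!I. maximalideal I ?R"
  proof (rule ex1I)
    have unit: "J = vring" if J: "Ideal.ideal J ?R" "a \<in> J" "a \<notin> vmax" for J a
    proof -
      have a: "a \<noteq> 0" "v a = 0" using J unfolding ideal_iff by (auto simp: vmax_def vring_def)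
      hence "inverse a \<in> vring" by (simp add: vring_def v_inverse)
      hence "inverse a * a \<in> J" using J unfolding ideal_iff by blast
      hence "1 \<in> J" using a by simp
      hence "x * 1 \<in> J" if "x \<in> vring" for x using J(1) that unfolding ideal_iff by blast
      thus ?thesis using J(1) unfolding ideal_iff by auto
    qed
    have vmax: "Ideal.ideal vmax ?R"
      unfolding ideal_iff by (auto simp: vmax_add vmax_mult) (auto simp: vmax_def vring_def)
    have not1: "1 \<notin> vmax" by (simp add: vmax_def)
    have one: "1 \<in> vring" by (simp add: vring_def)
    show "maximalideal vmax ?R"
    proof (rule maximalidealI[OF vmax])
      show "carrier ?R \<noteq> vmax" using not1 one by auto
      fix J assume "Ideal.ideal J ?R" "vmax \<subseteq> J" "J \<subseteq> carrier ?R"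
      thus "J = vmax \<or> J = carrier ?R" using unit[of J] by auto
    qed
    fix I assume I: "maximalideal I ?R"
    note Ii = maximalideal.axioms(1)[OF I]
    have "I \<subseteq> vmax"
    proof
      fix a assume "a \<in> I"
      show "a \<in> vmax"
      proof (rule ccontr)
        assume "a \<notin> vmax"
        with unit[OF Ii \<open>a \<in> I\<close>] have "I = vring" by simp
        thus False using maximalideal.I_notcarr[OF I] by simp
      qed
    qed
    moreover have "vmax \<subseteq> carrier ?R" by (auto simp: vmax_def vring_def)
    moreover have "vmax \<noteq> carrier ?R" using not1 one by auto
    ultimately show "I = vmax" using maximalideal.I_maximal[OF I vmax] by metis
  qed
  ultimately show ?thesis unfolding discrete_valuation_ring_def by blast
qed

end

text \<open>An order function on a domain, extended to fractions by taking differences. Being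
  nonnegative on the domain, it has a valuation ring that contains the domain. Monomial orders and
  the orders at torus points are of this kind.\<close>

locale domain_valuation =
  fixes s :: "'a::idom \<Rightarrow> nat"
  assumes s_mult: "a \<noteq> 0 \<Longrightarrow> b \<noteq> 0 \<Longrightarrow> s (a * b) = s a + s b"
    and s_add: "a \<noteq> 0 \<Longrightarrow> b \<noteq> 0 \<Longrightarrow> a + b \<noteq> 0 \<Longrightarrow> min (s a) (s b) \<le> s (a + b)"
    and s_nontrivial: "\<exists>a. a \<noteq> 0 \<and> s a > 0"
begin

definition fract_val :: "'a fract \<Rightarrow> int" where
  "fract_val x = (THE n. \<exists>a b. a \<noteq> 0 \<and> b \<noteq> 0 \<and> x = Fract a b \<and> n = int (s a) - int (s b))"

lemma fract_val_Fract:
  assumes "a \<noteq> 0" "b \<noteq> 0"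
  shows "fract_val (Fract a b) = int (s a) - int (s b)"
  unfolding fract_val_def
proof (rule the_equality)
  show "\<exists>a' b'. a' \<noteq> 0 \<and> b' \<noteq> 0 \<and> Fract a b = Fract a' b' \<and> int (s a) - int (s b) = int (s a') - int (s b')"
    using assms by blast
  fix n assume "\<exists>a' b'. a' \<noteq> 0 \<and> b' \<noteq> 0 \<and> Fract a b = Fract a' b' \<and> n = int (s a') - int (s b')"
  then obtain a' b' where ab: "a' \<noteq> 0" "b' \<noteq> 0" "Fract a b = Fract a' b'" "n = int (s a') - int (s b')" by blast
  hence "a * b' = a' * b" using assms by (simp add: eq_fract)
  hence "s a + s b' = s a' + s b" using s_mult assms ab by metis
  thus "n = int (s a) - int (s b)" using ab(4) by linarith
qed

lemma Fract_nonzero_cases: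
  assumes "x \<noteq> (0 :: 'a fract)"
  obtains a b where "x = Fract a b" "a \<noteq> 0" "b \<noteq> 0"
  using assms by (cases x) (metis Zero_fract_def eq_fract(1) mult_zero_left mult_eq_0_iff zero_neq_one)

lemma s_one: "s 1 = 0" using s_mult[of 1 1] by simp

lemma fract_val_to_fract: "a \<noteq> 0 \<Longrightarrow> fract_val (to_fract a) = int (s a)"
  by (simp add: to_fract_def fract_val_Fract s_one)

sublocale field_valuation fract_val
proof
  fix x y :: "'a fract"
  assume x: "x \<noteq> 0" and y: "y \<noteq> 0"
  obtain a b where ab: "x = Fract a b" "a \<noteq> 0" "b \<noteq> 0" using x by (rule Fract_nonzero_cases)
  obtain c d where cd: "y = Fract c d" "c \<noteq> 0" "d \<noteq> 0" using y by (rule Fract_nonzero_cases)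
  show "fract_val (x * y) = fract_val x + fract_val y"
    using ab cd by (simp add: fract_val_Fract s_mult)
  assume xy: "x + y \<noteq> 0"
  have eq: "x + y = Fract (a * d + c * b) (b * d)" using ab cd by simp
  have ne: "a * d + c * b \<noteq> 0" using xy unfolding eq by (auto simp: Zero_fract_def eq_fract)
  have "min (s (a * d)) (s (c * b)) \<le> s (a * d + c * b)" using ab cd ne by (intro s_add) auto
  thus "min (fract_val x) (fract_val y) \<le> fract_val (x + y)"
    unfolding eq using ab cd ne by (simp add: fract_val_Fract s_mult)
next
  obtain a where "a \<noteq> 0" "s a > 0" using s_nontrivial by blast
  thus "\<exists>x. x \<noteq> 0 \<and> fract_val x > 0" by (intro exI[of _ "to_fract a"]) (simp add: fract_val_to_fract)
qed

lemma to_fract_vring: "to_fract a \<in> vring"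
  by (cases "a = 0") (auto simp: vring_def fract_val_to_fract)

lemma between_vring: "between_dvr_or_field vring"
  unfolding between_dvr_or_field_def
  using subring_vring discrete_valuation_ring_vring to_fract_vring by auto

end

text \<open>In the discrete case the ideal generated by numerator a and denominator b is principal,
  say with generator g. With a = a' g and b = b' g, some combination of a' and b' equals 1, so one
  of them is outside the maximal ideal and a unit.\<close>

lemma between_total:
  fixes V :: "'a::idom fract set"
  assumes "between_dvr_or_field V"
  shows "x \<in> V \<or> inverse x \<in> V"
proof -
  from assms have V: "subring V class_ring" and R: "range to_fract \<subseteq> V"
    unfolding between_dvr_or_field_def by auto
  let ?R = "class_ring\<lparr>carrier := V\<rparr> :: 'a fract ring"
  note D = subring_class_ringD[OF V]
  obtain a b where ab: "x = Fract a b" "b \<noteq> 0" by (cases x)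
  have x: "x = to_fract a / to_fract b" using ab by (simp add: Fract_conv_to_fract)
  have aV: "to_fract a \<in> V" "to_fract b \<in> V" using R by auto
  show ?thesis
  proof (cases "a = 0")
    case True
    thus ?thesis using x D(1) by simp
  next
    case False
    consider "discrete_valuation_ring ?R" | "Ring.field ?R" using assms unfolding between_dvr_or_field_def by auto
    thus ?thesis
    proof cases
      case 2
      then interpret F: Ring.field ?R .
      have "to_fract b \<in> Units ?R" using F.field_Units aV ab(2) by simp
      then obtain y where y: "y \<in> V" "to_fract b * y = 1" unfolding Units_def by auto
      hence "y = inverse (to_fract b)" by (metis inverse_unique)
      hence "x = to_fract a * y" using x by (simp add: divide_inverse)
      thus ?thesis using D(4) aV y by simp
    next
      case 1
      then have pd: "principal_domain ?R" and ex1: "\<exists>!I. maximalideal I ?R"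
        unfolding discrete_valuation_ring_def by auto
      interpret P: principal_domain ?R by (rule pd)
      note ideal_iff = ideal_carrier_update_iff[OF V]
      define I where "I = {u * to_fract a + w * to_fract b | u w. u \<in> V \<and> w \<in> V}"
      have I: "Ideal.ideal I ?R"
        unfolding ideal_iff
      proof (intro conjI ballI)
        show "I \<subseteq> V" unfolding I_def using D(3,4) aV by auto
        have "0 = 0 * to_fract a + 0 * to_fract b" by simp
        thus "0 \<in> I" unfolding I_def using D(1) by blast
        fix p assume "p \<in> I"
        then obtain u w where p: "p = u * to_fract a + w * to_fract b" "u \<in> V" "w \<in> V" unfolding I_def by blast
        { fix q assume "q \<in> I"
          then obtain u' w' where q: "q = u' * to_fract a + w' * to_fract b" "u' \<in> V" "w' \<in> V" unfolding I_def by blast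
          have "p + q = (u + u') * to_fract a + (w + w') * to_fract b" unfolding p q by (simp add: algebra_simps)
          thus "p + q \<in> I" unfolding I_def using D(3) p q by blast }
        fix z assume z: "z \<in> V"
        have "z * p = (z * u) * to_fract a + (z * w) * to_fract b" unfolding p by (simp add: algebra_simps)
        thus "z * p \<in> I" unfolding I_def using D(4) p z by blast
      qed
      obtain g where g: "g \<in> V" "I = PIdl\<^bsub>?R\<^esub> g" using P.exists_gen[OF I] by auto
      have gI: "g \<in> I" unfolding g(2) cgenideal_def using D(2) by (auto intro!: exI[of _ 1])
      have "to_fract a = 1 * to_fract a + 0 * to_fract b" "to_fract b = 0 * to_fract a + 1 * to_fract b" by simp_all
      hence "to_fract a \<in> I" "to_fract b \<in> I" unfolding I_def using D(1,2) by blast+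
      then obtain a' b' where a': "a' \<in> V" "to_fract a = a' * g" and b': "b' \<in> V" "to_fract b = b' * g"
        unfolding g(2) cgenideal_def by auto
      have g0: "g \<noteq> 0" using a'(2) False by auto
      from gI obtain u w where uw: "g = u * to_fract a + w * to_fract b" "u \<in> V" "w \<in> V" unfolding I_def by blast
      have "g * 1 = g * (u * a' + w * b')" using uw(1) a'(2) b'(2) by (simp add: algebra_simps)
      hence one: "1 = u * a' + w * b'" using g0 by (metis mult_left_cancel)
      obtain N where N: "maximalideal N ?R" "\<And>N'. maximalideal N' ?R \<Longrightarrow> N' = N" using ex1 by auto
      note Ni = maximalideal.axioms(1)[OF N(1)]
      \<comment> \<open>A non-unit has an irreducible divisor q. In a principal ideal domain q
        generates a maximal ideal, which can only be N.\<close>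
      have unit: "inverse z \<in> V" if z: "z \<in> V" "z \<notin> N" for z
      proof (rule ccontr)
        assume not: "inverse z \<notin> V"
        have "0 \<in> N" using Ni unfolding ideal_iff by blast
        hence z0: "z \<in> carrier ?R - {\<zero>\<^bsub>?R\<^esub>}" using z by auto
        have "z \<notin> Units ?R"
        proof
          assume "z \<in> Units ?R"
          then obtain y where "y \<in> V" "z * y = 1" unfolding Units_def by auto
          thus False using not by (metis inverse_unique)
        qed
        from P.exists_irreducible_divisor[OF z0 this] obtain q where
          q: "q \<in> carrier ?R" "ring_irreducible\<^bsub>?R\<^esub> q" "q divides\<^bsub>?R\<^esub> z" by blast
        have "PIdl\<^bsub>?R\<^esub> q = N" by (rule N(2)[OF P.irreducible_imp_maximalideal[OF q(1,2)]])
        moreover from q(3) obtain y where "y \<in> V" "z = q * y" unfolding factor_def by auto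
        ultimately have "z \<in> N" unfolding cgenideal_def by (auto simp: mult.commute)
        thus False using z by blast
      qed
      have "\<not> (a' \<in> N \<and> b' \<in> N)"
      proof
        assume "a' \<in> N \<and> b' \<in> N"
        hence "u * a' + w * b' \<in> N" using Ni uw(2,3) unfolding ideal_iff by blast
        hence "1 \<in> N" using one by simp
        hence "z * 1 \<in> N" if "z \<in> V" for z using Ni that unfolding ideal_iff by blast
        hence "N = V" using Ni unfolding ideal_iff by auto
        thus False using maximalideal.I_notcarr[OF N(1)] by simp
      qed
      thus ?thesis
      proof (cases "b' \<in> N")
        case True
        hence "inverse a' \<in> V" using \<open>\<not> (a' \<in> N \<and> b' \<in> N)\<close> unit a'(1) by blast
        moreover have "inverse x = b' * inverse a'" using x a'(2) b'(2) g0 by (simp add: field_simps)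
        ultimately show ?thesis using D(4) b'(1) by simp
      next
        case False
        hence "inverse b' \<in> V" using unit b'(1) by blast
        moreover have "x = a' * inverse b'" using x a'(2) b'(2) g0 by (simp add: field_simps)
        ultimately show ?thesis using D(4) a'(1) by simp
      qed
    qed
  qed
qed

text \<open>Valuation rings are integrally closed: an equation of integral dependence, divided by
  \<open>d ^ s\<close>, is monic in z = y / d with coefficients in V. If z were not in V, its
  inverse would be, and division by \<open>z ^ (s - 1)\<close> would express z by elements of
  V.\<close>

lemma between_integrally_closed:
  fixes V :: "'a::idom fract set" and d :: "'a fract"
  assumes V: "between_dvr_or_field V" and d: "d \<noteq> 0"
    and I: "\<And>a. a \<in> I \<Longrightarrow> to_fract a / d \<in> V" and y: "y \<in> ideal_closure I"
  shows "to_fract y / d \<in> V"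
proof -
  have sub: "subring V class_ring" and R: "range to_fract \<subseteq> V"
    using V unfolding between_dvr_or_field_def by auto
  note D = subring_class_ringD[OF sub]
  have power: "to_fract a / d ^ i \<in> V" if "a \<in> ideal_power I i" for a i
    using that
  proof (induction i arbitrary: a)
    case 0
    thus ?case using R by auto
  next
    case (Suc i)
    from Suc.prems show ?case
    proof (induction rule: ideal_power_Suc_induct)
      case (prod a b)
      have "to_fract (a * b) / d ^ Suc i = (to_fract a / d) * (to_fract b / d ^ i)" by simp
      thus ?case using D(4)[OF I[OF prod(1)] Suc.IH[OF prod(2)]] by (simp only:)
    next
      case (sum a b)
      thus ?case using D(3) by (simp add: add_divide_distrib)
    qed
  qed
  from y obtain s a where s: "s > 0" "\<forall>i\<in>{1..s}. a i \<in> ideal_power I i"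
    and eq: "y ^ s + (\<Sum>i=1..s. a i * y ^ (s - i)) = 0"
    unfolding ideal_closure_def by blast
  define z where "z = to_fract y / d"
  have to_fract_power: "to_fract (b ^ n) = to_fract b ^ n" for b :: 'a and n by (induction n) simp_all
  have "to_fract (y ^ s + (\<Sum>i=1..s. a i * y ^ (s - i))) / d ^ s = 0" using eq by simp
  hence "z ^ s + (\<Sum>i=1..s. to_fract (a i) * to_fract y ^ (s - i) / d ^ s) = 0"
    by (simp add: z_def power_divide add_divide_distrib sum_divide_distrib to_fract_power to_fract_sum)
  also have "(\<Sum>i=1..s. to_fract (a i) * to_fract y ^ (s - i) / d ^ s) =
      (\<Sum>i=1..s. (to_fract (a i) / d ^ i) * z ^ (s - i))"
  proof (rule sum.cong[OF refl])
    fix i assume "i \<in> {1..s}"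
    hence "d ^ s = d ^ i * d ^ (s - i)" by (simp flip: power_add)
    thus "to_fract (a i) * to_fract y ^ (s - i) / d ^ s = (to_fract (a i) / d ^ i) * z ^ (s - i)"
      by (simp add: z_def power_divide)
  qed
  finally have zeq: "z ^ s = - (\<Sum>i=1..s. (to_fract (a i) / d ^ i) * z ^ (s - i))"
    by (simp add: eq_neg_iff_add_eq_0)
  have Vsum: "sum f A \<in> V" if "\<And>x. x \<in> A \<Longrightarrow> f x \<in> V" for f :: "nat \<Rightarrow> 'a fract" and A
    using that by (induction A rule: infinite_finite_induct) (auto simp: D)
  have Vpow: "x ^ n \<in> V" if "x \<in> V" for x n using that by (induction n) (auto simp: D)
  show ?thesis
  proof (rule ccontr)
    assume not: "to_fract y / d \<notin> V"
    hence inv: "inverse z \<in> V" using between_total[OF V, of z] by (simp add: z_def)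
    have z0: "z \<noteq> 0" using not D(1) by (auto simp: z_def)
    have "z = z ^ s * inverse z ^ (s - 1)"
    proof -
      have "z ^ s = z * z ^ (s - 1)" using s(1) by (cases s) auto
      thus ?thesis using z0 by (simp add: power_inverse)
    qed
    also have "\<dots> = - (\<Sum>i=1..s. (to_fract (a i) / d ^ i) * z ^ (s - i)) * inverse z ^ (s - 1)"
      by (simp only: zeq)
    also have "\<dots> = - (\<Sum>i=1..s. (to_fract (a i) / d ^ i) * inverse z ^ (i - 1))"
      unfolding mult_minus_left sum_distrib_right
    proof (intro arg_cong[of _ _ uminus] sum.cong[OF refl])
      fix i assume i: "i \<in> {1..s}"
      hence "s - 1 = (s - i) + (i - 1)" by auto
      hence "inverse z ^ (s - 1) = inverse z ^ (s - i) * inverse z ^ (i - 1)" by (metis power_add)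
      thus "to_fract (a i) / d ^ i * z ^ (s - i) * inverse z ^ (s - 1) =
          to_fract (a i) / d ^ i * inverse z ^ (i - 1)"
        using z0 by (simp add: power_inverse)
    qed
    also have "\<dots> \<in> V" using s(2) power inv by (intro D(5) Vsum D(4) Vpow) auto
    finally show False using not by (simp add: z_def)
  qed
qed

section \<open>Spans of columns\<close>

text \<open>The span is formed inside the vectors with entries in V and equals the image of such
  vectors under B. S may be more than the set of columns, so that the image of a whole module can be
  taken for it.\<close>

lemma span_columns:
  fixes B :: "'b::comm_ring_1 mat"
  assumes V: "subring V (class_ring :: 'b ring)" and B: "B \<in> carrier_mat p m"
    and BV: "\<And>i j. i < p \<Longrightarrow> j < m \<Longrightarrow> B $$ (i,j) \<in> V"
    and S: "set (cols B) \<subseteq> S" "\<And>x. x \<in> S \<Longrightarrow> \<exists>c\<in>carrier_vec m. (\<forall>j<m. c $ j \<in> V) \<and> x = B *\<^sub>v c"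
  shows "LinearCombinations.module.span (class_ring\<lparr>carrier := V\<rparr>)
      ((module_vec TYPE('b) p)\<lparr>carrier := {v \<in> carrier_vec p. \<forall>i<p. v $ i \<in> V}\<rparr>) S =
    {B *\<^sub>v c | c. c \<in> carrier_vec m \<and> (\<forall>j<m. c $ j \<in> V)}"
proof -
  let ?R = "class_ring\<lparr>carrier := V\<rparr> :: 'b ring"
  let ?N = "(module_vec TYPE('b) p)\<lparr>carrier := {v \<in> carrier_vec p. \<forall>i<p. v $ i \<in> V}\<rparr>"
  let ?X = "{B *\<^sub>v c | c. c \<in> carrier_vec m \<and> (\<forall>j<m. c $ j \<in> V)}"
  note D = subring_class_ringD[OF V]
  interpret R: cring ?R by (rule cring_carrier_update[OF V])
  have Vsum: "sum f A \<in> V" if "\<And>x. x \<in> A \<Longrightarrow> f x \<in> V" for f :: "nat \<Rightarrow> 'b" and A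
    using that by (induction A rule: infinite_finite_induct) (auto simp: D)
  have "abelian_group ?N"
  proof (rule abelian_groupI)
    fix x assume x: "x \<in> carrier ?N"
    show "\<exists>y\<in>carrier ?N. y \<oplus>\<^bsub>?N\<^esub> x = \<zero>\<^bsub>?N\<^esub>"
      by (rule bexI[of _ "- x"]) (use x D(5) in \<open>auto simp: module_vec_def\<close>)
  qed (auto simp: module_vec_def D comm_add_vec assoc_add_vec)
  then interpret N: Module.module ?R ?N
    by (intro moduleI[OF R.is_cring])
      (auto simp: module_vec_def D add_smult_distrib_vec smult_add_distrib_vec smult_smult_assoc)
  have entry: "(B *\<^sub>v c) $ i = (\<Sum>j<m. B $$ (i,j) * c $ j)" if "c \<in> carrier_vec m" "i < p" for c i
    using that B by (auto simp: scalar_prod_def lessThan_atLeast0 intro!: sum.cong)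
  have X_sub: "?X \<subseteq> carrier ?N"
    using B BV by (auto simp: module_vec_def entry simp del: index_mult_mat_vec intro!: Vsum D(4))
  have X_submodule: "submodule ?R ?X ?N"
  proof (rule submodule.intro[OF N.module_axioms X_sub])
    show "v \<oplus>\<^bsub>?N\<^esub> w \<in> ?X" if "v \<in> ?X" "w \<in> ?X" for v w
    proof -
      from that obtain c d where "v = B *\<^sub>v c" "c \<in> carrier_vec m" "\<forall>j<m. c $ j \<in> V"
        "w = B *\<^sub>v d" "d \<in> carrier_vec m" "\<forall>j<m. d $ j \<in> V" by blast
      thus ?thesis using B
        by (intro CollectI exI[of _ "c + d"]) (auto simp: module_vec_def mult_add_distrib_mat_vec D)
    qed
    show "\<zero>\<^bsub>?N\<^esub> \<in> ?X" using B
      by (intro CollectI exI[of _ "0\<^sub>v m"]) (auto simp: module_vec_def D intro!: eq_vecI)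
    show "a \<odot>\<^bsub>?N\<^esub> v \<in> ?X" if "a \<in> carrier ?R" "v \<in> ?X" for a v
    proof -
      from that obtain c where "v = B *\<^sub>v c" "c \<in> carrier_vec m" "\<forall>j<m. c $ j \<in> V" by blast
      thus ?thesis using B that(1)
        by (intro CollectI exI[of _ "a \<cdot>\<^sub>v c"]) (auto simp: module_vec_def mult_mat_vec D)
    qed
  qed
  have SX: "S \<subseteq> ?X"
  proof
    fix x assume "x \<in> S"
    from S(2)[OF this] show "x \<in> ?X" by blast
  qed
  show ?thesis
  proof
    show "N.span S \<subseteq> ?X" by (rule N.span_is_subset[OF SX X_submodule])
    have sp: "submodule ?R (N.span S) ?N" by (rule N.span_is_submodule) (use SX X_sub in blast)
    have own: "S \<subseteq> N.span S" by (rule N.in_own_span) (use SX X_sub in blast)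
    \<comment> \<open>Induction on the number of columns works with their indices; in the set of
      columns equal ones would be identified.\<close>
    have part: "vec p (\<lambda>i. \<Sum>j<k. B $$ (i,j) * c $ j) \<in> N.span S"
      if c: "c \<in> carrier_vec m" "\<forall>j<m. c $ j \<in> V" and k: "k \<le> m" for c k
      using k
    proof (induction k)
      case 0
      have "vec p (\<lambda>i. \<Sum>j<0. B $$ (i,j) * c $ j) = \<zero>\<^bsub>?N\<^esub>" by (auto simp: module_vec_def)
      thus ?case using submodule.zero_closed[OF sp] by metis
    next
      case (Suc k)
      have "col B k \<in> set (cols B)" using Suc.prems B by (auto simp: cols_def)
      hence "col B k \<in> N.span S" using own S(1) by blast
      hence 1: "c $ k \<odot>\<^bsub>?N\<^esub> col B k \<in> N.span S"
        using c(2) Suc.prems by (intro submodule.smult_closed[OF sp]) simp_all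
      have "vec p (\<lambda>i. \<Sum>j<Suc k. B $$ (i,j) * c $ j) =
          vec p (\<lambda>i. \<Sum>j<k. B $$ (i,j) * c $ j) \<oplus>\<^bsub>?N\<^esub> (c $ k \<odot>\<^bsub>?N\<^esub> col B k)"
        using B Suc.prems by (auto simp: module_vec_def mult.commute)
      also have "\<dots> \<in> N.span S" using Suc 1 by (intro submodule.m_closed[OF sp]) simp_all
      finally show ?case .
    qed
    show "?X \<subseteq> N.span S"
    proof
      fix x assume "x \<in> ?X"
      then obtain c where c: "x = B *\<^sub>v c" "c \<in> carrier_vec m" "\<forall>j<m. c $ j \<in> V" by blast
      have "x = vec p (\<lambda>i. \<Sum>j<m. B $$ (i,j) * c $ j)"
        by (rule eq_vecI) (use c(1,2) B entry[OF c(2)] in simp_all)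
      thus "x \<in> N.span S" using part[OF c(2,3) order_refl] by simp
    qed
  qed
qed

lemma subring_UNIV: "subring UNIV (class_ring :: 'b::comm_ring_1 ring)"
  by (rule ring.subringI[OF class_ring.ring_axioms]) auto

lemma span_columns_UNIV:
  fixes B :: "'b::comm_ring_1 mat"
  assumes B: "B \<in> carrier_mat p m"
    and S: "set (cols B) \<subseteq> S" "\<And>x. x \<in> S \<Longrightarrow> \<exists>c\<in>carrier_vec m. x = B *\<^sub>v c"
  shows "LinearCombinations.module.span class_ring (module_vec TYPE('b) p) S =
    {B *\<^sub>v c | c. c \<in> carrier_vec m}"
proof -
  have "(module_vec TYPE('b) p)\<lparr>carrier := {v \<in> carrier_vec p. \<forall>i<p. v $ i \<in> UNIV}\<rparr> = module_vec TYPE('b) p"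
    by (simp add: module_vec_def)
  moreover have "(class_ring :: 'b ring)\<lparr>carrier := UNIV\<rparr> = class_ring" by simp
  ultimately show ?thesis
    using span_columns[OF subring_UNIV B _ S(1)] S(2) by simp
qed

lemma column_module_eq:
  fixes A :: "'b::comm_ring_1 mat"
  assumes A: "A \<in> carrier_mat p m"
  shows "column_module A = {A *\<^sub>v c | c. c \<in> carrier_vec m}"
proof -
  have "\<exists>c\<in>carrier_vec m. x = A *\<^sub>v c" if "x \<in> set (cols A)" for x
  proof -
    from that obtain j where j: "j < m" "x = col A j" using A by (auto simp: cols_def)
    thus ?thesis using A by (intro bexI[of _ "unit_vec m j"]) (auto intro!: eq_vecI)
  qed
  from span_columns_UNIV[OF A subset_refl this] A show ?thesis
    by (simp add: column_module_def)
qed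

section \<open>Minors and rank\<close>

text \<open>Gaussian elimination: an equation with a non-zero coefficient at \<open>u0\<close> is
  used to eliminate \<open>u0\<close> from the others, and finally determines the value
  there.\<close>

lemma underdetermined_system:
  fixes M :: "'e \<Rightarrow> 'u \<Rightarrow> 'k::field"
  assumes "finite E" "finite U" "card E < card U"
  obtains a where "\<exists>u\<in>U. a u \<noteq> 0" "\<forall>e\<in>E. (\<Sum>u\<in>U. M e u * a u) = 0"
proof -
  have "\<exists>a. (\<exists>u\<in>U. a u \<noteq> 0) \<and> (\<forall>e\<in>E. (\<Sum>u\<in>U. M e u * a u) = 0)"
    using assms
  proof (induction E arbitrary: U M rule: finite_induct)
    case empty
    then obtain u where "u \<in> U" by fastforce
    thus ?case by (intro exI[of _ "\<lambda>_. 1"]) auto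
  next
    case (insert e E)
    have card: "Suc (card E) < card U" using insert.prems insert.hyps by simp
    show ?case
    proof (cases "\<forall>u\<in>U. M e u = 0")
      case True
      obtain a where a: "\<exists>u\<in>U. a u \<noteq> 0" "\<forall>e\<in>E. (\<Sum>u\<in>U. M e u * a u) = 0"
        using insert.IH[OF insert.prems(1), of M] card by auto
      have "(\<Sum>u\<in>U. M e u * a u) = 0" using True by (intro sum.neutral) auto
      thus ?thesis using a by blast
    next
      case False
      then obtain u0 where u0: "u0 \<in> U" "M e u0 \<noteq> 0" by blast
      let ?U = "U - {u0}"
      let ?M = "\<lambda>e' u. M e' u - M e' u0 * M e u / M e u0"
      have "card E < card ?U" using card u0 insert.prems(1) by simp
      from insert.IH[OF _ this, of ?M] insert.prems(1)
      obtain a where a: "\<exists>u\<in>?U. a u \<noteq> 0" "\<forall>e'\<in>E. (\<Sum>u\<in>?U. ?M e' u * a u) = 0" by auto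
      define b where "b = a(u0 := - (\<Sum>u\<in>?U. M e u * a u) / M e u0)"
      have split: "(\<Sum>u\<in>U. M e' u * b u) = M e' u0 * b u0 + (\<Sum>u\<in>?U. M e' u * a u)" for e'
        unfolding sum.remove[OF insert.prems(1) u0(1)] by (simp add: b_def)
      have "(\<Sum>u\<in>U. M e u * b u) = 0" unfolding split using u0(2) by (simp add: b_def)
      moreover have "(\<Sum>u\<in>U. M e' u * b u) = 0" if "e' \<in> E" for e'
      proof -
        have "(\<Sum>u\<in>?U. ?M e' u * a u) = (\<Sum>u\<in>?U. M e' u * a u) - M e' u0 / M e u0 * (\<Sum>u\<in>?U. M e u * a u)"
          unfolding sum_distrib_left sum_subtractf[symmetric] by (intro sum.cong) (simp_all add: left_diff_distrib)
        hence "(\<Sum>u\<in>?U. M e' u * a u) = M e' u0 / M e u0 * (\<Sum>u\<in>?U. M e u * a u)" using a(2) that by simp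
        thus ?thesis unfolding split by (simp add: b_def)
      qed
      moreover have "\<exists>u\<in>U. b u \<noteq> 0" using a(1) by (auto simp: b_def)
      ultimately show ?thesis by blast
    qed
  qed
  thus ?thesis using that by blast
qed

section \<open>Submatrices and non-vanishing minors\<close>

lemma bij_betw_pick:
  assumes "finite L"
  shows "bij_betw (pick L) {..<card L} L"
proof -
  have "L \<subseteq> pick L ` {..<card L}"
  proof
    fix i assume i: "i \<in> L"
    have "{a\<in>L. a < i} \<subset> L" using i by blast
    hence "card {a\<in>L. a < i} < card L" by (rule psubset_card_mono[OF assms])
    thus "i \<in> pick L ` {..<card L}"
      using pick_card_in_set[OF i] by (intro image_eqI[of _ _ "card {a\<in>L. a < i}"]) auto
  qed
  moreover have "card (pick L ` {..<card L}) \<le> card L" using card_image_le[of "{..<card L}" "pick L"] by simp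
  ultimately have eq: "L = pick L ` {..<card L}" by (intro card_seteq) auto
  have "inj_on (pick L) {..<card L}" by (rule eq_card_imp_inj_on) (simp_all flip: eq)
  thus ?thesis unfolding bij_betw_def using eq by simp
qed

lemma card_restrict_subset: "I \<subseteq> {..<n} \<Longrightarrow> card {i. i < n \<and> i \<in> I} = card I"
  by (rule arg_cong[of _ _ card]) auto

lemma submatrix_carrier:
  assumes "A \<in> carrier_mat p m" "I \<subseteq> {..<p}" "J \<subseteq> {..<m}"
  shows "submatrix A I J \<in> carrier_mat (card I) (card J)"
  using assms by (auto simp: dim_submatrix card_restrict_subset)

lemma submatrix_nth:
  assumes "A \<in> carrier_mat p m" "I \<subseteq> {..<p}" "J \<subseteq> {..<m}" "i < card I" "j < card J"
  shows "submatrix A I J $$ (i,j) = A $$ (pick I i, pick J j)"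
  using assms by (intro submatrix_index) (auto simp: card_restrict_subset)

lemma pick_mem: "finite L \<Longrightarrow> i < card L \<Longrightarrow> pick L i \<in> L"
  using bij_betw_pick[of L] by (auto simp: bij_betw_def)

text \<open>Injectivity of the block with rows I and columns J. It keeps the indices of the whole
  matrix, whereas determinants of submatrices renumber them by \<open>pick\<close>; for blocks of
  equal size \<open>nonsing_iff_det\<close> relates the two.\<close>

definition nonsing :: "'k::comm_ring_1 mat \<Rightarrow> nat set \<Rightarrow> nat set \<Rightarrow> bool" where
  "nonsing B I J \<longleftrightarrow> (\<forall>a. (\<forall>i\<in>I. (\<Sum>j\<in>J. B $$ (i,j) * a j) = 0) \<longrightarrow> (\<forall>j\<in>J. a j = 0))"

lemma nonsing_iff_det:
  fixes B :: "'k::idom mat"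
  assumes B: "B \<in> carrier_mat p m" and I: "I \<subseteq> {..<p}" and J: "J \<subseteq> {..<m}" and card: "card I = card J"
  shows "nonsing B I J \<longleftrightarrow> det (submatrix B I J) \<noteq> 0"
proof -
  let ?n = "card J"
  let ?S = "submatrix B I J"
  have fin: "finite I" "finite J" using I J finite_subset by auto
  note bI = bij_betw_pick[OF fin(1)] and bJ = bij_betw_pick[OF fin(2)]
  have S: "?S \<in> carrier_mat ?n ?n" using submatrix_carrier[OF B I J] card by simp
  have prod: "(?S *\<^sub>v v) $ i = (\<Sum>j<?n. B $$ (pick I i, pick J j) * v $ j)"
    if "v \<in> carrier_vec ?n" "i < ?n" for v i
    using that S submatrix_nth[OF B I J] card
    by (auto simp: scalar_prod_def lessThan_atLeast0 intro!: sum.cong)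
  have reindex: "(\<Sum>j<?n. B $$ (i, pick J j) * a (pick J j)) = (\<Sum>j\<in>J. B $$ (i,j) * a j)" for i a
    by (rule sum.reindex_bij_betw[OF bJ])
  show ?thesis
  proof
    assume ns: "nonsing B I J"
    show "det ?S \<noteq> 0"
    proof
      assume "det ?S = 0"
      then obtain v where v: "v \<in> carrier_vec ?n" "v \<noteq> 0\<^sub>v ?n" "?S *\<^sub>v v = 0\<^sub>v ?n"
        using det_0_iff_vec_prod_zero[OF S] by blast
      define a where "a j = v $ (inv_into {..<?n} (pick J) j)" for j
      have a: "a (pick J j) = v $ j" if "j < ?n" for j
        using bJ that by (simp add: a_def bij_betw_def)
      have "(\<Sum>j\<in>J. B $$ (i,j) * a j) = 0" if i: "i \<in> I" for i
      proof -
        obtain i' where i': "i' < ?n" "i = pick I i'" using bI i card by (auto simp: bij_betw_def)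
        have "(\<Sum>j\<in>J. B $$ (i,j) * a j) = (\<Sum>j<?n. B $$ (i, pick J j) * v $ j)"
          unfolding reindex[symmetric] using a by simp
        also have "\<dots> = (?S *\<^sub>v v) $ i'" using prod[OF v(1) i'(1)] i'(2) by simp
        also have "\<dots> = 0" using v(3) i'(1) by simp
        finally show ?thesis .
      qed
      with ns have z: "\<forall>j\<in>J. a j = 0" unfolding nonsing_def by blast
      have "v $ j = 0" if "j < ?n" for j using z a[OF that] pick_mem[OF fin(2) that] by simp
      hence "v = 0\<^sub>v ?n" using v(1) by (intro eq_vecI) auto
      thus False using v(2) by simp
    qed
  next
    assume det: "det ?S \<noteq> 0"
    show "nonsing B I J"
      unfolding nonsing_def
    proof (intro allI impI)
      fix a assume a: "\<forall>i\<in>I. (\<Sum>j\<in>J. B $$ (i,j) * a j) = 0"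
      define v where "v = vec ?n (\<lambda>j. a (pick J j))"
      have v: "v \<in> carrier_vec ?n" by (simp add: v_def)
      have "?S *\<^sub>v v = 0\<^sub>v ?n"
      proof (rule eq_vecI)
        fix i assume "i < dim_vec (0\<^sub>v ?n)"
        hence i: "i < ?n" by simp
        have "(?S *\<^sub>v v) $ i = (\<Sum>j<?n. B $$ (pick I i, pick J j) * a (pick J j))"
          unfolding prod[OF v i] by (simp add: v_def)
        also have "\<dots> = 0" unfolding reindex using a pick_mem[OF fin(1), of i] i card by simp
        finally show "(?S *\<^sub>v v) $ i = 0\<^sub>v ?n $ i" using i by simp
      qed (use S in simp)
      hence "v = 0\<^sub>v ?n" using det det_0_iff_vec_prod_zero[OF S] v by blast
      show "\<forall>j\<in>J. a j = 0"
      proof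
        fix j assume "j \<in> J"
        then obtain j' where "j' < ?n" "j = pick J j'" using bJ by (auto simp: bij_betw_def)
        thus "a j = 0" using arg_cong[OF \<open>v = 0\<^sub>v ?n\<close>, of "\<lambda>v. v $ j'"] by (simp add: v_def)
      qed
    qed
  qed
qed

text \<open>Each singular bordered block expresses the j-th column by the columns in J, on the rows
  I and one more row. Non-singularity of the block itself makes the coefficients unique, so they are
  the same for all rows.\<close>

lemma column_combination:
  fixes B :: "'k::field mat"
  assumes fin: "finite I" "finite J" and card: "card I = card J" and ns: "nonsing B I J"
    and border: "\<forall>i. i \<notin> I \<and> i < p \<and> j \<notin> J \<longrightarrow> \<not> nonsing B (insert i I) (insert j J)"
  obtains c where "\<forall>i\<in>I \<union> {..<p}. B $$ (i,j) = (\<Sum>l\<in>J. B $$ (i,l) * c l)"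
proof (cases "j \<in> J")
  case True
  have "(\<Sum>l\<in>J. B $$ (i,l) * (if l = j then 1 else 0)) = (\<Sum>l\<in>J. if l = j then B $$ (i,l) else 0)" for i
    by (rule sum.cong) auto
  hence "(\<Sum>l\<in>J. B $$ (i,l) * (if l = j then 1 else 0)) = B $$ (i,j)" for i using True fin(2) by simp
  thus ?thesis by (intro that[of "\<lambda>l. if l = j then 1 else 0"]) simp
next
  case False
  have normalize: "\<exists>c. \<forall>i\<in>K. B $$ (i,j) = (\<Sum>l\<in>J. B $$ (i,l) * c l)"
    if K: "I \<subseteq> K" and a: "\<exists>l\<in>insert j J. a l \<noteq> 0" "\<forall>i\<in>K. (\<Sum>l\<in>insert j J. B $$ (i,l) * a l) = 0" for K a
  proof -
    have sum: "B $$ (i,j) * a j + (\<Sum>l\<in>J. B $$ (i,l) * a l) = 0" if "i \<in> K" for i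
      using a(2) that fin(2) False by simp
    have aj: "a j \<noteq> 0"
    proof
      assume z: "a j = 0"
      have "\<forall>i\<in>I. (\<Sum>l\<in>J. B $$ (i,l) * a l) = 0" using sum K z by auto
      hence "\<forall>l\<in>J. a l = 0" using ns unfolding nonsing_def by blast
      thus False using a(1) z by auto
    qed
    have "B $$ (i,j) = (\<Sum>l\<in>J. B $$ (i,l) * (- a l / a j))" if i: "i \<in> K" for i
    proof -
      have "(\<Sum>l\<in>J. B $$ (i,l) * (- a l / a j)) = - (\<Sum>l\<in>J. B $$ (i,l) * a l) / a j"
        by (simp add: sum_negf sum_divide_distrib)
      also have "- (\<Sum>l\<in>J. B $$ (i,l) * a l) = B $$ (i,j) * a j" using minus_unique[OF sum[OF i, unfolded add.commute[of "B $$ (i,j) * a j"]]] .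
      finally show ?thesis using aj by simp
    qed
    thus ?thesis by (intro exI[of _ "\<lambda>l. - a l / a j"]) blast
  qed
  have "card I < card (insert j J)" using False fin card by simp
  moreover have finj: "finite (insert j J)" using fin by simp
  ultimately obtain a where "\<exists>l\<in>insert j J. a l \<noteq> 0" "\<forall>i\<in>I. (\<Sum>l\<in>insert j J. B $$ (i,l) * a l) = 0"
    by (elim underdetermined_system[OF fin(1) finj, where M = "\<lambda>i l. B $$ (i,l)"])
  from normalize[OF subset_refl this] obtain c where
    c: "\<forall>i\<in>I. B $$ (i,j) = (\<Sum>l\<in>J. B $$ (i,l) * c l)" ..
  have "B $$ (i,j) = (\<Sum>l\<in>J. B $$ (i,l) * c l)" if i: "i \<notin> I" "i < p" for i
  proof -
    from border i False obtain a where a: "\<forall>i'\<in>insert i I. (\<Sum>l\<in>insert j J. B $$ (i',l) * a l) = 0"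
      "\<exists>l\<in>insert j J. a l \<noteq> 0" unfolding nonsing_def by blast
    from normalize[OF _ a(2,1)] obtain c' where
      c': "\<forall>i'\<in>insert i I. B $$ (i',j) = (\<Sum>l\<in>J. B $$ (i',l) * c' l)" by auto
    have "\<forall>i'\<in>I. (\<Sum>l\<in>J. B $$ (i',l) * (c l - c' l)) = 0"
    proof
      fix i' assume "i' \<in> I"
      hence "(\<Sum>l\<in>J. B $$ (i',l) * c l) = (\<Sum>l\<in>J. B $$ (i',l) * c' l)" using c c' by simp
      thus "(\<Sum>l\<in>J. B $$ (i',l) * (c l - c' l)) = 0" by (simp add: right_diff_distrib sum_subtractf)
    qed
    hence "\<forall>l\<in>J. c l - c' l = 0" using ns unfolding nonsing_def by (elim allE impE)
    hence "(\<Sum>l\<in>J. B $$ (i,l) * c l) = (\<Sum>l\<in>J. B $$ (i,l) * c' l)" by (intro sum.cong) auto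
    thus ?thesis using c' by simp
  qed
  thus ?thesis using c by (intro that[of c]) auto
qed

lemma nonsing_le_rank:
  fixes B :: "'k::field mat"
  assumes B: "B \<in> carrier_mat p m" and I: "I \<subseteq> {..<p}" and J: "J \<subseteq> {..<m}" and card: "card I = card J"
    and ns: "nonsing B I J"
  shows "card J \<le> vec_space.rank p B"
proof -
  have "det (submatrix B I J) \<noteq> 0" using ns nonsing_iff_det[OF B I J card] by simp
  from vec_space.rank_gt_minor[OF B this] show ?thesis using card_restrict_subset[OF J] by simp
qed

text \<open>A largest non-singular block has only singular borders, so its k columns span all
  columns and more than k columns cannot be independent. Conversely, a non-singular block bounds the
  rank from below.\<close>

lemma rank_minor:
  fixes B :: "'k::field mat"
  assumes B: "B \<in> carrier_mat p m"
  obtains I J where "I \<subseteq> {..<p}" "J \<subseteq> {..<m}" "card I = vec_space.rank p B" "card J = vec_space.rank p B"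
    "nonsing B I J"
proof -
  define P where "P n \<longleftrightarrow> (\<exists>I J. I \<subseteq> {..<p} \<and> J \<subseteq> {..<m} \<and> card I = n \<and> card J = n \<and> nonsing B I J)" for n
  have P_le: "n \<le> vec_space.rank p B" if "P n" for n
    using that nonsing_le_rank[OF B] unfolding P_def by metis
  have P0: "P 0" unfolding P_def by (intro exI[of _ "{}"]) (simp add: nonsing_def)
  define k where "k = (GREATEST n. P n)"
  have Pk: "P k" unfolding k_def by (rule GreatestI_nat[of P, OF P0 P_le])
  have kmax: "n \<le> k" if "P n" for n unfolding k_def by (rule Greatest_le_nat[of P, OF that P_le])
  from Pk obtain I J where IJ: "I \<subseteq> {..<p}" "J \<subseteq> {..<m}" "card I = k" "card J = k" "nonsing B I J"
    unfolding P_def by blast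
  have finIJ: "finite I" "finite J" using IJ finite_subset by auto
  have "\<exists>c. \<forall>i<p. B $$ (i,j) = (\<Sum>l\<in>J. B $$ (i,l) * c l)" if j: "j < m" for j
  proof -
    have border: "\<forall>i. i \<notin> I \<and> i < p \<and> j \<notin> J \<longrightarrow> \<not> nonsing B (insert i I) (insert j J)"
    proof (intro allI impI notI)
      fix i assume i: "i \<notin> I \<and> i < p \<and> j \<notin> J" and "nonsing B (insert i I) (insert j J)"
      hence "P (Suc k)" unfolding P_def using IJ finIJ j
        by (intro exI[of _ "insert i I"] exI[of _ "insert j J"]) auto
      thus False using kmax[of "Suc k"] by simp
    qed
    have "card I = card J" using IJ by simp
    then obtain c where "\<forall>i\<in>I \<union> {..<p}. B $$ (i,j) = (\<Sum>l\<in>J. B $$ (i,l) * c l)"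
      by (rule column_combination[OF finIJ _ IJ(5) border])
    thus ?thesis by auto
  qed
  hence "\<forall>j\<in>{..<m}. \<exists>c. \<forall>i<p. B $$ (i,j) = (\<Sum>l\<in>J. B $$ (i,l) * c l)" by simp
  from bchoice[OF this] obtain c where "\<forall>j\<in>{..<m}. \<forall>i<p. B $$ (i,j) = (\<Sum>l\<in>J. B $$ (i,l) * c j l)" ..
  hence c: "\<And>i j. i < p \<Longrightarrow> j < m \<Longrightarrow> B $$ (i,j) = (\<Sum>l\<in>J. B $$ (i,l) * c j l)" by simp
  interpret vec_space "TYPE('k)" p .
  have "rank B \<le> k"
  proof -
    have "lin_indpt {}" by (auto simp: lin_dep_def)
    hence "\<exists>U. finite U \<and> maximal U (\<lambda>T. T \<subseteq> set (cols B) \<and> lin_indpt T) \<and> {} \<subseteq> U"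
      by (intro maximal_exists_superset[of "set (cols B)"]) simp_all
    then obtain U where U: "maximal U (\<lambda>T. T \<subseteq> set (cols B) \<and> lin_indpt T)" by (elim exE conjE)
    have rk: "rank B = card U" by (rule rank_card_indpt[OF B U])
    have Us: "U \<subseteq> set (cols B)" and indpt: "lin_indpt U" using U unfolding maximal_def by auto
    have finU: "finite U" using Us finite_subset by auto
    show ?thesis
    proof (rule ccontr)
      assume "\<not> rank B \<le> k"
      hence less: "card J < card U" using rk IJ by simp
      have "\<forall>u\<in>U. \<exists>j. j < m \<and> u = col B j" using Us B by (fastforce simp: cols_def)
      from bchoice[OF this] obtain f where f: "\<forall>u\<in>U. f u < m \<and> u = col B (f u)" ..
      obtain a where a: "\<exists>u\<in>U. a u \<noteq> 0" "\<forall>l\<in>J. (\<Sum>u\<in>U. c (f u) l * a u) = 0"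
        using underdetermined_system[OF finIJ(2) finU less, of "\<lambda>l u. c (f u) l"] .
      from a(1) obtain u where u: "u \<in> U" "a u \<noteq> 0" by blast
      have Uc: "U \<subseteq> carrier_vec p" using Us B cols_dim[of B] by auto
      have "lincomb a U = 0\<^sub>v p"
      proof (rule eq_vecI)
        fix i assume "i < dim_vec (0\<^sub>v p)"
        hence i: "i < p" by simp
        have "lincomb a U $ i = (\<Sum>u\<in>U. a u * u $ i)" by (rule lincomb_index[OF i Uc])
        also have "\<dots> = (\<Sum>u\<in>U. \<Sum>l\<in>J. B $$ (i,l) * (c (f u) l * a u))"
        proof (rule sum.cong[OF refl])
          fix u assume "u \<in> U"
          hence fu: "f u < m" "u = col B (f u)" using f by auto
          have "u $ i = B $$ (i, f u)" using fu B i by (metis carrier_matD index_col)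
          also have "\<dots> = (\<Sum>l\<in>J. B $$ (i,l) * c (f u) l)" by (rule c[OF i fu(1)])
          finally show "a u * u $ i = (\<Sum>l\<in>J. B $$ (i,l) * (c (f u) l * a u))"
            by (simp add: sum_distrib_left mult_ac)
        qed
        also have "\<dots> = (\<Sum>l\<in>J. B $$ (i,l) * (\<Sum>u\<in>U. c (f u) l * a u))"
          by (subst sum.swap) (simp add: sum_distrib_left)
        also have "\<dots> = 0" using a(2) by simp
        finally show "lincomb a U $ i = 0\<^sub>v p $ i" using i by simp
      qed (use lincomb_dim[OF finU Uc] in simp)
      hence "lin_dep U" unfolding lin_dep_def using u finU by (intro exI[of _ U] exI[of _ a] exI[of _ u]) auto
      thus False using indpt by simp
    qed
  qed
  moreover have "k \<le> rank B" by (rule P_le[OF Pk])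
  ultimately have "k = rank B" by simp
  thus ?thesis using that IJ by auto
qed

lemma rank_column_combination:
  fixes B :: "'k::field mat"
  assumes B: "B \<in> carrier_mat p m" and I: "I \<subseteq> {..<p}" and J: "J \<subseteq> {..<m}"
    and card: "card I = vec_space.rank p B" "card J = vec_space.rank p B" and ns: "nonsing B I J" and j: "j < m"
  obtains c where "\<forall>i<p. B $$ (i,j) = (\<Sum>l\<in>J. B $$ (i,l) * c l)"
proof -
  have fin: "finite I" "finite J" using I J finite_subset by auto
  have border: "\<forall>i. i \<notin> I \<and> i < p \<and> j \<notin> J \<longrightarrow> \<not> nonsing B (insert i I) (insert j J)"
  proof (intro allI impI notI)
    fix i assume i: "i \<notin> I \<and> i < p \<and> j \<notin> J" and "nonsing B (insert i I) (insert j J)"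
    from nonsing_le_rank[OF B _ _ _ this(2)] I J i j fin card show False by simp
  qed
  have IJ: "card I = card J" using card by simp
  obtain c where "\<forall>i\<in>I \<union> {..<p}. B $$ (i,j) = (\<Sum>l\<in>J. B $$ (i,l) * c l)"
    using column_combination[OF fin IJ ns border] .
  thus ?thesis by (intro that[of c]) simp
qed

text \<open>It suffices to annihilate the columns of a maximal non-singular block: they are fewer
  than the p unknowns, and the other columns are combinations of them.\<close>

lemma left_kernel:
  fixes B :: "'k::field mat"
  assumes B: "B \<in> carrier_mat p m" and less: "vec_space.rank p B < p"
  obtains b where "\<exists>i<p. b i \<noteq> 0" "\<forall>j<m. (\<Sum>i<p. b i * B $$ (i,j)) = 0"
proof -
  obtain I J where IJ: "I \<subseteq> {..<p}" "J \<subseteq> {..<m}" "card I = vec_space.rank p B"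
    "card J = vec_space.rank p B" "nonsing B I J" using rank_minor[OF B] .
  have finJ: "finite J" using IJ finite_subset by auto
  have "card J < card {..<p}" using IJ less by simp
  then obtain b where b: "\<exists>i\<in>{..<p}. b i \<noteq> 0" "\<forall>j\<in>J. (\<Sum>i<p. B $$ (i,j) * b i) = 0"
    by (rule underdetermined_system[OF finJ finite_lessThan])
  have "(\<Sum>i<p. b i * B $$ (i,j)) = 0" if j: "j < m" for j
  proof -
    obtain c where c: "\<forall>i<p. B $$ (i,j) = (\<Sum>l\<in>J. B $$ (i,l) * c l)"
      using rank_column_combination[OF B IJ j] .
    have "(\<Sum>i<p. b i * B $$ (i,j)) = (\<Sum>i<p. \<Sum>l\<in>J. c l * (B $$ (i,l) * b i))"
      using c by (intro sum.cong) (auto simp: sum_distrib_left mult_ac)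
    also have "\<dots> = (\<Sum>l\<in>J. c l * (\<Sum>i<p. B $$ (i,l) * b i))"
      by (subst sum.swap) (simp add: sum_distrib_left)
    finally show ?thesis using b(2) by simp
  qed
  thus ?thesis using b(1) by (intro that[of b]) auto
qed

lemma full_rank_minor:
  fixes B :: "'k::field mat"
  assumes B: "B \<in> carrier_mat p m" and rk: "\<not> vec_space.rank p B < p"
  obtains J where "J \<subseteq> {..<m}" "card J = p" "det (submatrix B {..<p} J) \<noteq> 0"
proof -
  obtain I J where IJ: "I \<subseteq> {..<p}" "J \<subseteq> {..<m}" "card I = vec_space.rank p B"
    "card J = vec_space.rank p B" "nonsing B I J" using rank_minor[OF B] .
  have "card I \<le> p" using card_mono[OF finite_lessThan IJ(1)] by simp
  hence eq: "vec_space.rank p B = p" using rk IJ(3) by simp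
  have I: "I = {..<p}" by (rule card_subset_eq[OF finite_lessThan IJ(1)]) (use IJ eq in simp)
  have "card I = card J" using IJ by simp
  hence "det (submatrix B I J) \<noteq> 0" using nonsing_iff_det[OF B IJ(1,2)] IJ(5) by simp
  thus ?thesis using that IJ eq I by metis
qed

section \<open>Passage to the fraction field\<close>

lemma submatrix_map_mat: "submatrix (map_mat f A) I J = map_mat f (submatrix A I J)"
proof (rule eq_matI)
  fix i j assume "i < dim_row (map_mat f (submatrix A I J))" "j < dim_col (map_mat f (submatrix A I J))"
  hence ij: "i < card {i. i < dim_row A \<and> i \<in> I}" "j < card {j. j < dim_col A \<and> j \<in> J}"
    by (simp_all add: dim_submatrix)
  hence "pick I i < dim_row A" "pick J j < dim_col A" using pick_le by auto
  thus "submatrix (map_mat f A) I J $$ (i,j) = map_mat f (submatrix A I J) $$ (i,j)"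
    using ij by (simp add: submatrix_index dim_submatrix)
qed (simp_all add: dim_submatrix)

lemma to_fract_hom: "comm_ring_hom (to_fract :: 'a::idom \<Rightarrow> 'a fract)"
  by unfold_locales simp_all

lemma det_to_fract: "det (map_mat to_fract A) = to_fract (det A)"
  by (rule comm_ring_hom.hom_det[OF to_fract_hom])

lemma map_vec_to_fract_mult:
  assumes "A \<in> carrier_mat p m" "c \<in> carrier_vec m"
  shows "map_vec to_fract (A *\<^sub>v c) = map_mat to_fract A *\<^sub>v map_vec to_fract c"
  using assms by (intro eq_vecI) (auto simp: scalar_prod_def to_fract_sum)

lemma map_vec_column_module:
  assumes A: "A \<in> carrier_mat p m"
  shows "set (cols (map_mat to_fract A)) \<subseteq> map_vec to_fract ` column_module A"
    and "x \<in> map_vec to_fract ` column_module A \<Longrightarrow>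
      \<exists>c\<in>carrier_vec m. (\<forall>j<m. c $ j \<in> range to_fract) \<and> x = map_mat to_fract A *\<^sub>v c"
proof -
  show "x \<in> map_vec to_fract ` column_module A \<Longrightarrow>
      \<exists>c\<in>carrier_vec m. (\<forall>j<m. c $ j \<in> range to_fract) \<and> x = map_mat to_fract A *\<^sub>v c"
    unfolding column_module_eq[OF A] using map_vec_to_fract_mult[OF A]
    by (auto intro!: bexI[of _ "map_vec to_fract _"])
  show "set (cols (map_mat to_fract A)) \<subseteq> map_vec to_fract ` column_module A"
  proof
    fix x assume "x \<in> set (cols (map_mat to_fract A))"
    then obtain j where j: "j < m" "x = col (map_mat to_fract A) j" using A by (auto simp: cols_def)
    have "x = map_vec to_fract (A *\<^sub>v unit_vec m j)"
      using A j by (intro eq_vecI) auto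
    moreover have "A *\<^sub>v unit_vec m j \<in> column_module A" unfolding column_module_eq[OF A] by auto
    ultimately show "x \<in> map_vec to_fract ` column_module A" by blast
  qed
qed

lemma col_in_column_module: "A \<in> carrier_mat p m \<Longrightarrow> j < m \<Longrightarrow> col A j \<in> column_module A"
  unfolding column_module_eq
  by (intro CollectI exI[of _ "unit_vec m j"]) (auto intro!: eq_vecI)

lemma module_rank_column_module:
  fixes A :: "'a::idom mat"
  assumes A: "A \<in> carrier_mat p m"
  shows "module_rank p (column_module A) = vec_space.rank p (map_mat to_fract A)"
proof -
  interpret vec_space "TYPE('a fract)" p .
  let ?B = "map_mat to_fract A"
  have B: "?B \<in> carrier_mat p m" using A by simp
  have "span (map_vec to_fract ` column_module A) = {?B *\<^sub>v c | c. c \<in> carrier_vec m}"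
    by (rule span_columns_UNIV[OF B map_vec_column_module(1)[OF A]])
      (use map_vec_column_module(2)[OF A] in blast)
  moreover have "span (set (cols ?B)) = {?B *\<^sub>v c | c. c \<in> carrier_vec m}"
    by (rule span_columns_UNIV[OF B subset_refl])
      (use map_vec_column_module[OF A] in blast)
  ultimately show ?thesis unfolding module_rank_def rank_def by simp
qed

lemma between_UNIV: "between_dvr_or_field (UNIV :: 'a::idom fract set)"
  unfolding between_dvr_or_field_def using subring_UNIV class_field by auto

lemma module_closure_column_module:
  fixes A :: "'a::idom mat"
  assumes A: "A \<in> carrier_mat p m"
  shows "h \<in> module_closure p (column_module A) \<longleftrightarrow> h \<in> carrier_vec p \<and>
    (\<forall>V. between_dvr_or_field V \<longrightarrow> (\<exists>c\<in>carrier_vec m. (\<forall>j<m. c $ j \<in> V) \<and>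
      map_vec to_fract h = map_mat to_fract A *\<^sub>v c))"
proof -
  have "LinearCombinations.module.span (class_ring\<lparr>carrier := V\<rparr>)
         ((module_vec TYPE('a fract) p)\<lparr>carrier := {v \<in> carrier_vec p. \<forall>i<p. v $ i \<in> V}\<rparr>)
         (map_vec to_fract ` column_module A) =
      {map_mat to_fract A *\<^sub>v c | c. c \<in> carrier_vec m \<and> (\<forall>j<m. c $ j \<in> V)}"
    if V: "between_dvr_or_field V" for V
  proof -
    have sub: "subring V class_ring" and R: "range to_fract \<subseteq> V" using V unfolding between_dvr_or_field_def by auto
    show ?thesis
    proof (rule span_columns[OF sub _ _ map_vec_column_module(1)[OF A]])
      show "map_mat to_fract A \<in> carrier_mat p m" using A by simp
      show "map_mat to_fract A $$ (i,j) \<in> V" if "i < p" "j < m" for i j using that A R by auto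
      fix x assume "x \<in> map_vec to_fract ` column_module A"
      from map_vec_column_module(2)[OF A this]
      show "\<exists>c\<in>carrier_vec m. (\<forall>j<m. c $ j \<in> V) \<and> x = map_mat to_fract A *\<^sub>v c" using R by blast
    qed
  qed
  note span = this
  have ex: "x \<in> {map_mat to_fract A *\<^sub>v c | c. c \<in> carrier_vec m \<and> (\<forall>j<m. c $ j \<in> V)} \<longleftrightarrow>
      (\<exists>c\<in>carrier_vec m. (\<forall>j<m. c $ j \<in> V) \<and> x = map_mat to_fract A *\<^sub>v c)" for x V by blast
  show ?thesis unfolding module_closure_def mem_Collect_eq using span ex by (metis (no_types, lifting))
qed

text \<open>The matrix (A | h). Its columns generate the module enlarged by h, so membership in
  \<open>Z_module\<close> becomes an equality of two matrix ranks.\<close>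

definition append_column :: "'a mat \<Rightarrow> 'a Matrix.vec \<Rightarrow> 'a mat" where
  "append_column A h = Matrix.mat (dim_row A) (Suc (dim_col A)) (\<lambda>(i,j). if j < dim_col A then A $$ (i,j) else h $ i)"

lemma append_column_module:
  fixes A :: "'a::comm_ring_1 mat"
  assumes A: "A \<in> carrier_mat p m" and h: "h \<in> carrier_vec p"
  shows "column_module (append_column A h) = {v + c \<cdot>\<^sub>v h | v c. v \<in> column_module A}"
proof -
  let ?A = "append_column A h"
  have A': "?A \<in> carrier_mat p (Suc m)" using A by (simp add: append_column_def)
  have mult: "?A *\<^sub>v c = A *\<^sub>v vec m (\<lambda>j. c $ j) + c $ m \<cdot>\<^sub>v h" if "c \<in> carrier_vec (Suc m)" for c
    using that A h by (intro eq_vecI) (auto simp: append_column_def scalar_prod_def mult.commute)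
  show ?thesis
    unfolding column_module_eq[OF A'] column_module_eq[OF A]
  proof (intro subset_antisym subsetI)
    fix x assume "x \<in> {?A *\<^sub>v c | c. c \<in> carrier_vec (Suc m)}"
    then obtain c where "c \<in> carrier_vec (Suc m)" "x = ?A *\<^sub>v c" by blast
    thus "x \<in> {v + c \<cdot>\<^sub>v h | v c. v \<in> {A *\<^sub>v c | c. c \<in> carrier_vec m}}"
      using mult[of c] by (intro CollectI exI[of _ "A *\<^sub>v vec m (\<lambda>j. c $ j)"] exI[of _ "c $ m"]) auto
  next
    fix x assume "x \<in> {v + c \<cdot>\<^sub>v h | v c. v \<in> {A *\<^sub>v c | c. c \<in> carrier_vec m}}"
    then obtain c d where c: "c \<in> carrier_vec m" "x = A *\<^sub>v c + d \<cdot>\<^sub>v h" by blast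
    let ?c = "vec (Suc m) (\<lambda>j. if j < m then c $ j else d)"
    have "vec m (\<lambda>j. ?c $ j) = c" using c by (intro eq_vecI) auto
    hence "?A *\<^sub>v ?c = x" using mult[of ?c] c by simp
    thus "x \<in> {?A *\<^sub>v c | c. c \<in> carrier_vec (Suc m)}" by (intro CollectI exI[of _ ?c]) auto
  qed
qed

text \<open>A vector leaves the rank unchanged exactly when it is a combination of the columns over
  the fraction field. The second statement confines the combination to the columns J of a given
  non-zero minor, which is the form that Cramer's rule needs.\<close>

lemma Z_module_column_module:
  fixes A :: "'a::idom mat"
  assumes A: "A \<in> carrier_mat p m" and r: "r = module_rank p (column_module A)"
  shows "h \<in> Z_module p (column_module A) \<longleftrightarrow> h \<in> carrier_vec p \<and>
    (\<exists>c\<in>carrier_vec m. map_vec to_fract h = map_mat to_fract A *\<^sub>v c)"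
    and "h \<in> Z_module p (column_module A) \<Longrightarrow> I \<subseteq> {..<p} \<Longrightarrow> J \<subseteq> {..<m} \<Longrightarrow> card I = r \<Longrightarrow> card J = r \<Longrightarrow>
      det (submatrix A I J) \<noteq> 0 \<Longrightarrow> \<exists>c. \<forall>i<p. to_fract (h $ i) = (\<Sum>l\<in>J. to_fract (A $$ (i,l)) * c l)"
proof -
  let ?B = "map_mat to_fract A"
  have B: "?B \<in> carrier_mat p m" using A by simp
  have rB: "vec_space.rank p ?B = r" using module_rank_column_module[OF A] r by simp
  define C where "C = map_mat to_fract (append_column A h)"
  have A': "append_column A h \<in> carrier_mat p (Suc m)" using A by (simp add: append_column_def)
  have C: "C \<in> carrier_mat p (Suc m)" using A' by (simp add: C_def)
  have Cj: "C $$ (i,j) = ?B $$ (i,j)" if "i < p" "j < m" for i j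
    using that A by (simp add: C_def append_column_def)
  have Cm: "C $$ (i,m) = to_fract (h $ i)" if "i < p" for i
    using that A by (simp add: C_def append_column_def)
  have nsBC: "nonsing C I J \<longleftrightarrow> nonsing ?B I J" if IJ: "I \<subseteq> {..<p}" "J \<subseteq> {..<m}" for I J
  proof -
    have "(\<Sum>j\<in>J. C $$ (i,j) * a j) = (\<Sum>j\<in>J. ?B $$ (i,j) * a j)" if "i \<in> I" for i a
      using that IJ by (intro sum.cong) (auto simp: Cj subset_iff)
    thus ?thesis unfolding nonsing_def by simp
  qed
  have Z: "h \<in> Z_module p (column_module A) \<longleftrightarrow> h \<in> carrier_vec p \<and> r = vec_space.rank p C"
    unfolding Z_module_def mem_Collect_eq C_def
    using append_column_module[OF A] module_rank_column_module[OF A'] r by auto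
  have comb: "\<exists>c. \<forall>i<p. to_fract (h $ i) = (\<Sum>l\<in>J. to_fract (A $$ (i,l)) * c l)"
    if rC: "r = vec_space.rank p C" and IJ: "I \<subseteq> {..<p}" "J \<subseteq> {..<m}" "card I = r" "card J = r" "nonsing ?B I J" for I J
  proof -
    have J': "J \<subseteq> {..<Suc m}" using IJ(2) by auto
    have ns: "nonsing C I J" using nsBC IJ by simp
    have cards: "card I = vec_space.rank p C" "card J = vec_space.rank p C" using IJ rC by simp_all
    obtain c where c: "\<forall>i<p. C $$ (i,m) = (\<Sum>l\<in>J. C $$ (i,l) * c l)"
      using rank_column_combination[OF C IJ(1) J' cards ns lessI] .
    have "to_fract (h $ i) = (\<Sum>l\<in>J. to_fract (A $$ (i,l)) * c l)" if i: "i < p" for i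
    proof -
      have "(\<Sum>l\<in>J. C $$ (i,l) * c l) = (\<Sum>l\<in>J. to_fract (A $$ (i,l)) * c l)"
        using IJ(2) i A by (intro sum.cong) (auto simp: Cj subset_iff)
      thus ?thesis using c i Cm by simp
    qed
    thus ?thesis by blast
  qed
  show "\<exists>c. \<forall>i<p. to_fract (h $ i) = (\<Sum>l\<in>J. to_fract (A $$ (i,l)) * c l)"
    if h: "h \<in> Z_module p (column_module A)" and IJ: "I \<subseteq> {..<p}" "J \<subseteq> {..<m}" "card I = r" "card J = r"
      and det: "det (submatrix A I J) \<noteq> 0"
  proof -
    have "det (submatrix ?B I J) \<noteq> 0" using det by (simp add: submatrix_map_mat det_to_fract)
    moreover have "card I = card J" using IJ by simp
    ultimately have "nonsing ?B I J" using nonsing_iff_det[OF B IJ(1,2)] by simp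
    thus ?thesis using comb IJ h Z by blast
  qed
  obtain I J where IJ: "I \<subseteq> {..<p}" "J \<subseteq> {..<m}" "card I = r" "card J = r" "nonsing ?B I J"
    using rank_minor[OF B, unfolded rB] .
  show "h \<in> Z_module p (column_module A) \<longleftrightarrow> h \<in> carrier_vec p \<and>
    (\<exists>c\<in>carrier_vec m. map_vec to_fract h = ?B *\<^sub>v c)"
  proof
    assume h: "h \<in> Z_module p (column_module A)"
    hence "r = vec_space.rank p C" using Z by simp
    from comb[OF this IJ] obtain c where c: "\<forall>i<p. to_fract (h $ i) = (\<Sum>l\<in>J. to_fract (A $$ (i,l)) * c l)" ..
    let ?c = "vec m (\<lambda>l. if l \<in> J then c l else 0)"
    have "(?B *\<^sub>v ?c) $ i = to_fract (h $ i)" if i: "i < p" for i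
    proof -
      have "(?B *\<^sub>v ?c) $ i = (\<Sum>l<m. if l \<in> J then to_fract (A $$ (i,l)) * c l else 0)"
        using i A by (auto simp: scalar_prod_def lessThan_atLeast0 intro!: sum.cong)
      also have "\<dots> = (\<Sum>l\<in>{..<m} \<inter> J. to_fract (A $$ (i,l)) * c l)"
        by (simp add: sum.inter_restrict)
      also have "{..<m} \<inter> J = J" using IJ(2) by blast
      finally show ?thesis using c i by simp
    qed
    hence "map_vec to_fract h = ?B *\<^sub>v ?c"
      using h Z A by (intro eq_vecI) auto
    moreover have "?c \<in> carrier_vec m" by simp
    ultimately show "h \<in> carrier_vec p \<and> (\<exists>c\<in>carrier_vec m. map_vec to_fract h = ?B *\<^sub>v c)"
      using h Z by blast
  next
    assume "h \<in> carrier_vec p \<and> (\<exists>c\<in>carrier_vec m. map_vec to_fract h = ?B *\<^sub>v c)"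
    then obtain d where h: "h \<in> carrier_vec p" and d: "d \<in> carrier_vec m" "map_vec to_fract h = ?B *\<^sub>v d" by blast
    have hd: "to_fract (h $ i) = (\<Sum>j<m. ?B $$ (i,j) * d $ j)" if i: "i < p" for i
    proof -
      have "to_fract (h $ i) = map_vec to_fract h $ i" using i h by simp
      also have "\<dots> = (\<Sum>j<m. ?B $$ (i,j) * d $ j)"
        unfolding d(2) using i A d(1) by (auto simp: scalar_prod_def lessThan_atLeast0 intro!: sum.cong)
      finally show ?thesis .
    qed
    have "\<forall>j. \<exists>c. j < m \<longrightarrow> (\<forall>i<p. ?B $$ (i,j) = (\<Sum>l\<in>J. ?B $$ (i,l) * c l))"
    proof
      fix j
      show "\<exists>c. j < m \<longrightarrow> (\<forall>i<p. ?B $$ (i,j) = (\<Sum>l\<in>J. ?B $$ (i,l) * c l))"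
      proof (cases "j < m")
        case True
        have "card I = vec_space.rank p ?B" "card J = vec_space.rank p ?B" using IJ rB by simp_all
        then obtain c where "\<forall>i<p. ?B $$ (i,j) = (\<Sum>l\<in>J. ?B $$ (i,l) * c l)"
          by (rule rank_column_combination[OF B IJ(1,2) _ _ IJ(5) True])
        thus ?thesis by blast
      qed simp
    qed
    from choice[OF this] obtain c where c: "\<forall>j. j < m \<longrightarrow> (\<forall>i<p. ?B $$ (i,j) = (\<Sum>l\<in>J. ?B $$ (i,l) * c j l))" ..
    \<comment> \<open>Coefficients of all columns of (A | h) in terms of the columns J; those of the
      last column arise by inserting the expansions of the other columns into the given combination
      for h.\<close>
    define e where "e j l = (if j < m then c j l else (\<Sum>j'<m. c j' l * d $ j'))" for j l
    have e: "C $$ (i,j) = (\<Sum>l\<in>J. ?B $$ (i,l) * e j l)" if i: "i < p" and j: "j < Suc m" for i j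
    proof (cases "j < m")
      case True
      thus ?thesis using c i Cj by (simp add: e_def)
    next
      case False
      hence jm: "j = m" using j by simp
      have "C $$ (i,m) = (\<Sum>j<m. \<Sum>l\<in>J. ?B $$ (i,l) * (c j l * d $ j))"
        unfolding Cm[OF i] hd[OF i] using c i by (intro sum.cong) (auto simp: sum_distrib_right mult.assoc)
      also have "\<dots> = (\<Sum>l\<in>J. ?B $$ (i,l) * e m l)"
        by (subst sum.swap) (simp add: e_def sum_distrib_left)
      finally show ?thesis using jm by simp
    qed
    obtain I' J' where IJ': "I' \<subseteq> {..<p}" "J' \<subseteq> {..<Suc m}" "card I' = vec_space.rank p C"
      "card J' = vec_space.rank p C" "nonsing C I' J'" using rank_minor[OF C] .
    have fin: "finite J" "finite J'"
      by (rule finite_subset[OF IJ(2)], simp, rule finite_subset[OF IJ'(2)], simp)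
    have "card J' \<le> card J"
    proof (rule ccontr)
      assume "\<not> card J' \<le> card J"
      hence "card J < card J'" by simp
      then obtain a where a: "\<exists>j\<in>J'. a j \<noteq> 0" "\<forall>l\<in>J. (\<Sum>j\<in>J'. e j l * a j) = 0"
        by (rule underdetermined_system[OF fin])
      have "(\<Sum>j\<in>J'. C $$ (i,j) * a j) = 0" if i: "i \<in> I'" for i
      proof -
        have ip: "i < p" using i IJ'(1) by auto
        have "(\<Sum>j\<in>J'. C $$ (i,j) * a j) = (\<Sum>j\<in>J'. \<Sum>l\<in>J. ?B $$ (i,l) * (e j l * a j))"
          using e[OF ip] IJ'(2) by (intro sum.cong) (auto simp: sum_distrib_right mult.assoc)
        also have "\<dots> = (\<Sum>l\<in>J. ?B $$ (i,l) * (\<Sum>j\<in>J'. e j l * a j))"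
          by (subst sum.swap) (simp add: sum_distrib_left)
        finally show ?thesis using a(2) by simp
      qed
      thus False using IJ'(5) a(1) unfolding nonsing_def by blast
    qed
    moreover have "r \<le> vec_space.rank p C"
    proof -
      have "nonsing C I J" using nsBC IJ by simp
      moreover have "J \<subseteq> {..<Suc m}" using IJ(2) by auto
      ultimately show ?thesis using nonsing_le_rank[OF C IJ(1)] IJ(3,4) by metis
    qed
    ultimately show "h \<in> Z_module p (column_module A)" using Z h IJ IJ' by simp
  qed
qed

lemma nonzero_minor_exists:
  fixes A :: "'a::idom mat"
  assumes A: "A \<in> carrier_mat p m"
  obtains I J where "I \<subseteq> {..<p}" "J \<subseteq> {..<m}" "card I = module_rank p (column_module A)"
    "card J = module_rank p (column_module A)" "det (submatrix A I J) \<noteq> 0"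
proof -
  let ?B = "map_mat to_fract A"
  have B: "?B \<in> carrier_mat p m" using A by simp
  obtain I J where IJ: "I \<subseteq> {..<p}" "J \<subseteq> {..<m}" "card I = vec_space.rank p ?B"
    "card J = vec_space.rank p ?B" "nonsing ?B I J" using rank_minor[OF B] .
  hence "det (submatrix ?B I J) \<noteq> 0" using nonsing_iff_det[OF B IJ(1,2)] by simp
  hence "det (submatrix A I J) \<noteq> 0" by (auto simp: submatrix_map_mat det_to_fract)
  thus ?thesis using that IJ module_rank_column_module[OF A] by simp
qed

section \<open>Monomial valuations\<close>

definition weight_order :: "('n::finite \<Rightarrow> nat) \<Rightarrow> 'n germ \<Rightarrow> nat" where
  "weight_order w f = (LEAST n. \<exists>k\<in>supp f. weight w k = n)"

lemma weight_order_attained: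
  assumes "f \<noteq> 0"
  obtains k where "k \<in> supp f" "weight w k = weight_order w f"
proof -
  obtain k where k: "k \<in> supp f" using assms supp_eq_empty[of f] by blast
  have "\<exists>k\<in>supp f. weight w k = weight_order w f"
    unfolding weight_order_def by (rule LeastI_ex) (use k in blast)
  thus ?thesis using that by blast
qed

lemma weight_order_le: "k \<in> supp f \<Longrightarrow> weight_order w f \<le> weight w k"
  unfolding weight_order_def by (rule Least_le) blast

lemma weight_order_eqI:
  assumes "k \<in> supp f" "weight w k = n" "\<And>l. l \<in> supp f \<Longrightarrow> n \<le> weight w l"
  shows "weight_order w f = n"
  unfolding weight_order_def by (rule Least_equality) (use assms in auto)

text \<open>Initial forms multiply without cancellation: \<open>exists_unique_split\<close> yields
  exponents of least weight in both factors whose sum arises from no other such pair.\<close>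

lemma weight_order_mult:
  assumes "f \<noteq> 0" "g \<noteq> 0"
  shows "weight_order w (f * g) = weight_order w f + weight_order w g"
proof -
  let ?S = "{k \<in> supp f. weight w k = weight_order w f}" and ?T = "{k \<in> supp g. weight w k = weight_order w g}"
  obtain k where k: "k \<in> supp f" "weight w k = weight_order w f" using weight_order_attained[OF assms(1)] .
  obtain l where l: "l \<in> supp g" "weight w l = weight_order w g" using weight_order_attained[OF assms(2)] .
  have ne: "?S \<noteq> {}" "?T \<noteq> {}" using k l by blast+
  show ?thesis
  proof (rule exists_unique_split[OF ne])
  fix s t assume st: "s \<in> ?S" "t \<in> ?T"
    and uniq: "\<And>i j. i \<in> ?S \<Longrightarrow> j \<in> ?T \<Longrightarrow> i + j = s + t \<Longrightarrow> i = s \<and> j = t"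
  have zero: "germ_coeff f i * germ_coeff g j = 0" if ij: "i + j = s + t" "(i,j) \<noteq> (s,t)" for i j
  proof (rule ccontr)
    assume "germ_coeff f i * germ_coeff g j \<noteq> 0"
    hence i: "i \<in> supp f" and j: "j \<in> supp g" by (auto simp: supp_def)
    have "weight w i + weight w j = weight_order w f + weight_order w g"
      using ij(1) st weight_add[of w i j] weight_add[of w s t] by simp
    hence "weight w i = weight_order w f" "weight w j = weight_order w g"
      using weight_order_le[OF i, of w] weight_order_le[OF j, of w] by linarith+
    thus False using uniq[of i j] i j ij by auto
  qed
  have "(\<Sum>(i,j)\<in>{(i,j). i + j = s + t}. germ_coeff f i * germ_coeff g j) =
      (\<Sum>(i,j)\<in>{(s,t)}. germ_coeff f i * germ_coeff g j)"
  proof (rule sum.mono_neutral_right[OF finite_splits])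
    show "\<forall>x\<in>{(i,j). i + j = s + t} - {(s,t)}. (case x of (i,j) \<Rightarrow> germ_coeff f i * germ_coeff g j) = 0"
    proof
      fix x assume x: "x \<in> {(i,j). i + j = s + t} - {(s,t)}"
      obtain i j where "x = (i,j)" by (cases x)
      with x zero[of i j] show "(case x of (i,j) \<Rightarrow> germ_coeff f i * germ_coeff g j) = 0" by simp
    qed
  qed simp
  hence "germ_coeff (f * g) (s + t) = germ_coeff f s * germ_coeff g t" by (simp add: germ_coeff_times)
  hence mem: "s + t \<in> supp (f * g)" using st by (auto simp: supp_def)
  show "weight_order w (f * g) = weight_order w f + weight_order w g"
  proof (rule weight_order_eqI[OF mem])
    show "weight w (s + t) = weight_order w f + weight_order w g" using st by (simp add: weight_add)
    fix l assume "l \<in> supp (f * g)"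
    then obtain i j where "i \<in> supp f" "j \<in> supp g" "l = i + j" by (rule supp_times)
    thus "weight_order w f + weight_order w g \<le> weight w l"
      using weight_order_le[of i f w] weight_order_le[of j g w] by (simp add: weight_add)
  qed
  qed
qed

lemma weight_order_prod:
  assumes "finite A" "\<And>x. x \<in> A \<Longrightarrow> f x \<noteq> 0"
  shows "weight_order w (\<Prod>x\<in>A. f x) = (\<Sum>x\<in>A. weight_order w (f x))"
  using assms
proof (induction A rule: finite_induct)
  case empty
  show ?case by (simp, rule weight_order_eqI[of 0]) (auto simp: supp_def germ_coeff_one)
qed (simp add: weight_order_mult)

lemma domain_valuation_weight_order:
  assumes "\<forall>i. 0 < w i"
  shows "domain_valuation (weight_order w)"
proof
  fix f g :: "'a germ"
  show "f \<noteq> 0 \<Longrightarrow> g \<noteq> 0 \<Longrightarrow> weight_order w (f * g) = weight_order w f + weight_order w g"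
    by (rule weight_order_mult)
  assume "f + g \<noteq> 0"
  then obtain k where k: "k \<in> supp (f + g)" "weight w k = weight_order w (f + g)"
    using weight_order_attained by blast
  hence "k \<in> supp f \<or> k \<in> supp g" using supp_add by blast
  thus "min (weight_order w f) (weight_order w g) \<le> weight_order w (f + g)"
    using weight_order_le[of k f w] weight_order_le[of k g w] k(2) by auto
next
  let ?k = "(\<chi> i. 1) :: nat^'a"
  have "0 < weight w ?k" unfolding weight_def using assms by (intro sum_pos) auto
  moreover have "weight_order w (germ_monom ?k) = weight w ?k" by (rule weight_order_eqI[of ?k]) auto
  ultimately show "\<exists>a. a \<noteq> 0 \<and> 0 < weight_order w a" by (intro exI[of _ "germ_monom ?k"]) simp
qed

lemma (in field_valuation) v_sum_greater:
  assumes "\<And>x. x \<in> A \<Longrightarrow> f x = 0 \<or> n < v (f x)"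
  shows "sum f A = 0 \<or> n < v (sum f A)"
  using assms
proof (induction A rule: infinite_finite_induct)
  case (insert x A)
  hence "f x = 0 \<or> n < v (f x)" "sum f A = 0 \<or> n < v (sum f A)" by auto
  thus ?case using v_add[of "f x" "sum f A"] insert.hyps
    by (cases "f x = 0"; cases "sum f A = 0"; cases "f x + sum f A = 0") auto
qed auto

text \<open>Divisibility in a valuation ring is a total preorder, so a finite set has a member
  dividing all others. This replaces the choice of an element of least value where V is given
  without a valuation.\<close>

lemma between_least:
  fixes V :: "'a::idom fract set"
  assumes V: "between_dvr_or_field V" and X: "finite X" "X \<noteq> {}" "0 \<notin> X"
  obtains d where "d \<in> X" "\<forall>x\<in>X. x / d \<in> V"
proof -
  have "subring V class_ring" using V unfolding between_dvr_or_field_def by auto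
  note D = subring_class_ringD[OF this]
  have "\<exists>d\<in>X. \<forall>x\<in>X. x / d \<in> V"
    using X
  proof (induction X rule: finite_ne_induct)
    case (singleton x)
    thus ?case using D(2) by simp
  next
    case (insert x X)
    then obtain d where d: "d \<in> X" "\<forall>y\<in>X. y / d \<in> V" by auto
    have d0: "d \<noteq> 0" "x \<noteq> 0" using d insert.prems by auto
    from between_total[OF V, of "x / d"] show ?case
    proof
      assume "x / d \<in> V"
      thus ?thesis using d by auto
    next
      assume "inverse (x / d) \<in> V"
      hence dx: "d / x \<in> V" by simp
      have "y / x \<in> V" if "y \<in> X" for y
      proof -
        have "(y / d) * (d / x) \<in> V" using d that dx by (intro D(4)) auto
        thus ?thesis using d0 by simp
      qed
      moreover have "x / x \<in> V" using d0 D(2) by simp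
      ultimately show ?thesis by auto
    qed
  qed
  thus ?thesis using that by blast
qed

section \<open>The ideals of minors\<close>

definition minors :: "nat \<Rightarrow> 'a::comm_ring_1 mat \<Rightarrow> 'a set" where
  "minors r A = {det (submatrix A I J) | I J. I \<subseteq> {..<dim_row A} \<and> J \<subseteq> {..<dim_col A} \<and> card I = r \<and> card J = r}"

lemma minor_ideal_eq: "minor_ideal r A = ideal.span (minors r A)"
  unfolding minor_ideal_def minors_def by (rule genideal_eq_span)

lemma finite_minors: "finite (minors r A)"
proof -
  have "minors r A \<subseteq> (\<lambda>(I,J). det (submatrix A I J)) ` (Pow {..<dim_row A} \<times> Pow {..<dim_col A})"
    unfolding minors_def by auto
  thus ?thesis by (rule finite_subset) simp
qed

lemma minors_nonzero_rows:
  assumes "A \<in> carrier_mat p m" "d \<in> minors r A" "d \<noteq> 0"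
  obtains I J where "I \<in> nonzero_minor_rows r A" "I \<subseteq> {..<p}" "J \<subseteq> {..<m}" "card I = r" "card J = r"
    "d = det (submatrix A I J)"
  using assms unfolding minors_def nonzero_minor_rows_def by auto

lemma supp_minus: "supp (- f) = supp f" by (simp add: supp_def)

lemma supp_det:
  assumes "R \<in> carrier_mat r r" "k \<in> supp (det R)"
  shows "\<exists>\<sigma> l. \<sigma> permutes {..<r} \<and> k = (\<Sum>i<r. l i) \<and> (\<forall>i<r. l i \<in> supp (R $$ (i, \<sigma> i)))"
proof -
  from assms(2) have "k \<in> supp (\<Sum>\<sigma>\<in>{\<sigma>. \<sigma> permutes {0..<r}}. signof \<sigma> * (\<Prod>i = 0..<r. R $$ (i, \<sigma> i)))"
    by (simp add: det_def'[OF assms(1)])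
  then obtain \<sigma> where \<sigma>: "\<sigma> permutes {0..<r}" "k \<in> supp (signof \<sigma> * (\<Prod>i = 0..<r. R $$ (i, \<sigma> i)))"
    by (elim supp_sum) simp
  have "k \<in> supp (\<Prod>i = 0..<r. R $$ (i, \<sigma> i))"
    using \<sigma>(2) by (simp add: sign_def supp_minus split: if_splits)
  from supp_prod[OF this] show ?thesis using \<sigma>(1)
    by (intro exI[of _ \<sigma>]) (auto simp: lessThan_atLeast0)
qed

lemma J_ideal_eq:
  "J_ideal \<Lambda> M = ideal.span {\<Prod>i\<in>L. f i | L f. L \<in> \<Lambda> \<and> (\<forall>i\<in>L. f i \<in> component_ideal M i)}"
  unfolding J_ideal_def by (rule genideal_eq_span)

text \<open>The exponent \<open>\<Sum>i<r. l i\<close> itself may cancel in every product of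
  elements of the component ideals. For a fixed weight, however, elements of small order can be
  chosen in each component, and the orders add up in the product.\<close>

lemma weight_le_J_ideal:
  fixes M :: "'n::finite germ Matrix.vec set"
  assumes L: "L \<in> \<Lambda>" "finite L" "card L = r"
    and l: "\<And>i. i < r \<Longrightarrow> real_exponent (l i) \<in> newton_polyhedron (component_ideal M (pick L i))"
  shows "\<exists>k\<in>exponents (J_ideal \<Lambda> M). weight w k \<le> weight w (\<Sum>i<r. l i)"
proof -
  have "\<forall>i\<in>{..<r}. \<exists>u. u \<in> component_ideal M (pick L i) \<and> u \<noteq> 0 \<and> weight_order w u \<le> weight w (l i)"
  proof
    fix i assume "i \<in> {..<r}"
    with newton_polyhedronD_weight[OF l] obtain k where
      k: "k \<in> exponents (component_ideal M (pick L i))" "weight w k \<le> weight w (l i)" by blast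
    then obtain u where u: "u \<in> component_ideal M (pick L i)" "k \<in> supp u" by (auto simp: exponents_def)
    moreover have "u \<noteq> 0" using u by auto
    ultimately show "\<exists>u. u \<in> component_ideal M (pick L i) \<and> u \<noteq> 0 \<and> weight_order w u \<le> weight w (l i)"
      using k(2) weight_order_le[OF u(2), of w] by (intro exI[of _ u]) auto
  qed
  from bchoice[OF this] obtain u where
    u: "\<forall>i\<in>{..<r}. u i \<in> component_ideal M (pick L i) \<and> u i \<noteq> 0 \<and> weight_order w (u i) \<le> weight w (l i)" ..
  have bij: "bij_betw (pick L) {..<r} L" using bij_betw_pick[OF L(2)] L(3) by simp
  define f where "f i = u (inv_into {..<r} (pick L) i)" for i
  have f: "f (pick L i) = u i" if "i < r" for i
    using that bij by (simp add: f_def bij_betw_def)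
  have prod: "(\<Prod>i\<in>L. f i) = (\<Prod>i<r. u i)"
    using prod.reindex_bij_betw[OF bij, of f] f by simp
  have fL: "\<forall>i\<in>L. f i \<in> component_ideal M i"
  proof
    fix i assume "i \<in> L"
    then obtain j where "j < r" "i = pick L j" using bij by (auto simp: bij_betw_def)
    thus "f i \<in> component_ideal M i" using f u by auto
  qed
  have mem: "(\<Prod>i<r. u i) \<in> J_ideal \<Lambda> M"
    unfolding J_ideal_eq prod[symmetric] by (rule ideal.span_base) (use L(1) fL in blast)
  have ne: "(\<Prod>i<r. u i) \<noteq> 0" using u by simp
  obtain k where k: "k \<in> supp (\<Prod>i<r. u i)" "weight w k = weight_order w (\<Prod>i<r. u i)"
    using weight_order_attained[OF ne] .
  have "weight w k = (\<Sum>i<r. weight_order w (u i))"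
    unfolding k(2) by (rule weight_order_prod) (use u in auto)
  also have "\<dots> \<le> (\<Sum>i<r. weight w (l i))" using u by (intro sum_mono) auto
  finally show ?thesis using k(1) mem by (intro bexI[of _ k]) (auto simp: weight_sum exponents_def)
qed

text \<open>An exponent of a term of the Leibniz formula is a sum with one exponent from each row.
  The matrix may consist of columns of A, or have one of them replaced by an element of
  \<open>C0_module\<close>.\<close>

lemma det_mem_newton_ideal:
  fixes M :: "'n::finite germ Matrix.vec set"
  assumes L: "L \<in> \<Lambda>" "finite L" "card L = r" and R: "R \<in> carrier_mat r r"
    and entries: "\<And>i j. i < r \<Longrightarrow> j < r \<Longrightarrow> R $$ (i,j) \<in> newton_ideal (component_ideal M (pick L i))"
  shows "det R \<in> newton_ideal (J_ideal \<Lambda> M)"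
  unfolding mem_newton_ideal
proof
  fix k assume "k \<in> supp (det R)"
  from supp_det[OF R this] obtain \<sigma> l where \<sigma>: "\<sigma> permutes {..<r}"
    and l: "k = (\<Sum>i<r. l i)" "\<forall>i<r. l i \<in> supp (R $$ (i, \<sigma> i))" by blast
  have "real_exponent (l i) \<in> newton_polyhedron (component_ideal M (pick L i))" if i: "i < r" for i
  proof -
    have "\<sigma> i < r" using \<sigma> i permutes_in_image[OF \<sigma>, of i] by simp
    thus ?thesis using entries[OF i, of "\<sigma> i"] l(2) i unfolding mem_newton_ideal by blast
  qed
  hence "\<exists>k\<in>exponents (J_ideal \<Lambda> M). weight w k \<le> weight w (\<Sum>i<r. l i)" for w
    by (rule weight_le_J_ideal[OF L])
  thus "real_exponent k \<in> newton_polyhedron (J_ideal \<Lambda> M)"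
    unfolding l(1) by (rule newton_polyhedronI_weight)
qed

lemma mem_newton_idealI: "f \<in> I \<Longrightarrow> f \<in> newton_ideal I"
  unfolding mem_newton_ideal newton_polyhedron_eq by (auto simp: exponents_def intro!: upper_hull_inc)

lemma component_ideal_entry:
  assumes "A \<in> carrier_mat p m" "i < p" "j < m"
  shows "A $$ (i,j) \<in> component_ideal (column_module A) i"
  unfolding component_ideal_def
  by (rule image_eqI[of _ _ "col A j"]) (use assms col_in_column_module[OF assms(1,3)] in auto)

lemma nonzero_minor_rowsD:
  assumes "A \<in> carrier_mat p m" "L \<in> nonzero_minor_rows r A"
  shows "L \<subseteq> {..<p}" "card L = r" "finite L" "i < r \<Longrightarrow> pick L i < p"
proof -
  show L: "L \<subseteq> {..<p}" "card L = r" using assms unfolding nonzero_minor_rows_def by auto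
  show fin: "finite L" using L(1) finite_subset by auto
  show "pick L i < p" if "i < r" using pick_mem[OF fin, of i] that L by auto
qed

lemma minors_subset_newton_ideal:
  fixes A :: "'n::finite germ mat"
  assumes A: "A \<in> carrier_mat p m"
  shows "minors r A \<subseteq> newton_ideal (J_ideal (nonzero_minor_rows r A) (column_module A))"
proof
  fix d assume d: "d \<in> minors r A"
  show "d \<in> newton_ideal (J_ideal (nonzero_minor_rows r A) (column_module A))"
  proof (cases "d = 0")
    case False
    obtain I J where IJ: "I \<in> nonzero_minor_rows r A" "I \<subseteq> {..<p}" "J \<subseteq> {..<m}" "card I = r" "card J = r"
      "d = det (submatrix A I J)" using minors_nonzero_rows[OF A d False] .
    have fin: "finite I" "finite J" using IJ(2,3) finite_subset by blast+
    have S: "submatrix A I J \<in> carrier_mat r r" using submatrix_carrier[OF A IJ(2,3)] IJ by simp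
    show ?thesis
      unfolding IJ(6)
    proof (rule det_mem_newton_ideal[OF IJ(1) fin(1) IJ(4) S])
      fix i j assume ij: "i < r" "j < r"
      have "submatrix A I J $$ (i,j) = A $$ (pick I i, pick J j)"
        using submatrix_nth[OF A IJ(2,3)] ij IJ by simp
      moreover have "pick I i < p" "pick J j < m" using pick_mem[OF fin(1), of i] pick_mem[OF fin(2), of j] ij IJ by auto
      ultimately show "submatrix A I J $$ (i,j) \<in> newton_ideal (component_ideal (column_module A) (pick I i))"
        using component_ideal_entry[OF A] by (intro mem_newton_idealI) simp
    qed
  qed (simp add: mem_newton_ideal)
qed

text \<open>Over V the ideal of maximal minors is generated by a single non-zero minor, one that
  divides all others in V.\<close>

lemma minor_ideal_quotient:
  fixes A :: "'a::idom mat" and V :: "'a fract set"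
  assumes A: "A \<in> carrier_mat p m" and V: "between_dvr_or_field V"
  obtains I J where "I \<subseteq> {..<p}" "J \<subseteq> {..<m}" "card I = module_rank p (column_module A)"
    "card J = module_rank p (column_module A)" "det (submatrix A I J) \<noteq> 0"
    "\<forall>a\<in>minor_ideal (module_rank p (column_module A)) A. to_fract a / to_fract (det (submatrix A I J)) \<in> V"
proof -
  let ?r = "module_rank p (column_module A)"
  have sub: "subring V class_ring" and R: "range to_fract \<subseteq> V" using V unfolding between_dvr_or_field_def by auto
  note D = subring_class_ringD[OF sub]
  define X where "X = to_fract ` (minors ?r A - {0})"
  obtain I J where IJ: "I \<subseteq> {..<p}" "J \<subseteq> {..<m}" "card I = ?r" "card J = ?r" "det (submatrix A I J) \<noteq> 0"
    using nonzero_minor_exists[OF A] .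
  hence "det (submatrix A I J) \<in> minors ?r A - {0}" unfolding minors_def using A by auto
  hence X: "finite X" "X \<noteq> {}" "0 \<notin> X" unfolding X_def using finite_minors by auto
  obtain d where d: "d \<in> X" "\<forall>x\<in>X. x / d \<in> V" using between_least[OF V X] .
  then obtain d' where d': "d' \<in> minors ?r A" "d' \<noteq> 0" "d = to_fract d'" unfolding X_def by auto
  obtain I J where IJ: "I \<in> nonzero_minor_rows ?r A" "I \<subseteq> {..<p}" "J \<subseteq> {..<m}" "card I = ?r" "card J = ?r"
    "d' = det (submatrix A I J)" using minors_nonzero_rows[OF A d'(1,2)] .
  have "to_fract a / d \<in> V" if "a \<in> minor_ideal ?r A" for a
    using that unfolding minor_ideal_eq
  proof (induction rule: ideal.span_induct_alt)
    case base
    show ?case using D(1) by simp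
  next
    case (step c x y)
    have "to_fract x / d \<in> V"
    proof (cases "x = 0")
      case False
      thus ?thesis using d(2) step.hyps unfolding X_def by blast
    qed (simp add: D(1))
    moreover have "to_fract c \<in> V" using R by auto
    ultimately have "to_fract c * (to_fract x / d) + to_fract y / d \<in> V" using step.IH by (intro D(3,4))
    thus ?case by (simp add: add_divide_distrib)
  qed
  thus ?thesis using IJ d' by (intro that[of I J]) simp_all
qed

text \<open>In the ring of a monomial valuation, y is divisible by the minor d of least order. As d
  lies in the Newton ideal, the order of y is bounded below by the weight of some exponent of the
  ideal \<open>J_ideal\<close>.\<close>

lemma closure_minor_ideal_subset:
  fixes A :: "'n::finite germ mat"
  assumes A: "A \<in> carrier_mat p m" and r: "r = module_rank p (column_module A)"
  shows "ideal_closure (minor_ideal r A) \<subseteq> newton_ideal (J_ideal (nonzero_minor_rows r A) (column_module A))"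
proof
  fix y assume y: "y \<in> ideal_closure (minor_ideal r A)"
  show "y \<in> newton_ideal (J_ideal (nonzero_minor_rows r A) (column_module A))"
    unfolding mem_newton_ideal
  proof (intro ballI newton_polyhedronI_weight)
    fix k and w :: "'n \<Rightarrow> nat" assume k: "k \<in> supp y" and w: "\<And>i. 0 < w i"
    interpret W: domain_valuation "weight_order w" by (rule domain_valuation_weight_order) (use w in simp)
    obtain I J where IJ: "I \<subseteq> {..<p}" "J \<subseteq> {..<m}" "card I = r" "card J = r" "det (submatrix A I J) \<noteq> 0"
      "\<forall>a\<in>minor_ideal r A. to_fract a / to_fract (det (submatrix A I J)) \<in> W.vring"
      using minor_ideal_quotient[OF A W.between_vring, folded r] .
    let ?d = "det (submatrix A I J)"
    have d0: "to_fract ?d \<noteq> 0" using IJ(5) by simp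
    have y0: "y \<noteq> 0" using k by auto
    have "to_fract y / to_fract ?d \<in> W.vring"
      by (rule between_integrally_closed[OF W.between_vring d0 _ y]) (use IJ(6) in blast)
    hence le: "weight_order w ?d \<le> weight_order w y"
      using y0 IJ(5) by (simp add: W.vring_def W.v_divide W.fract_val_to_fract)
    have "?d \<in> minors r A" unfolding minors_def using A IJ by auto
    hence dJ: "?d \<in> newton_ideal (J_ideal (nonzero_minor_rows r A) (column_module A))"
      using minors_subset_newton_ideal[OF A] by blast
    obtain l where l: "l \<in> supp ?d" "weight w l = weight_order w ?d" using weight_order_attained[OF IJ(5)] .
    with dJ have "real_exponent l \<in> newton_polyhedron (J_ideal (nonzero_minor_rows r A) (column_module A))"
      unfolding mem_newton_ideal by blast
    from newton_polyhedronD_weight[OF this, of w] obtain k' where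
      "k' \<in> exponents (J_ideal (nonzero_minor_rows r A) (column_module A))" "weight w k' \<le> weight w l" by blast
    thus "\<exists>l\<in>exponents (J_ideal (nonzero_minor_rows r A) (column_module A)). weight w l \<le> weight w k"
      using l(2) le weight_order_le[OF k, of w] by (intro bexI[of _ k']) auto
  qed
qed

section \<open>The second condition implies the third\<close>

lemma mult_mat_vec_entry:
  assumes "B \<in> carrier_mat p m" "c \<in> carrier_vec m" "i < p"
  shows "(B *\<^sub>v c) $ i = (\<Sum>j<m. B $$ (i,j) * c $ j)"
  using assms by (auto simp: scalar_prod_def lessThan_atLeast0 intro!: sum.cong)

lemma module_closure_subset_C0:
  fixes A :: "'n::finite germ mat"
  assumes A: "A \<in> carrier_mat p m"
  shows "module_closure p (column_module A) \<subseteq> C0_module p (column_module A)"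
proof
  fix h assume h: "h \<in> module_closure p (column_module A)"
  hence hc: "h \<in> carrier_vec p" and cl: "\<And>V. between_dvr_or_field V \<Longrightarrow>
      \<exists>c\<in>carrier_vec m. (\<forall>j<m. c $ j \<in> V) \<and> map_vec to_fract h = map_mat to_fract A *\<^sub>v c"
    unfolding module_closure_column_module[OF A] by auto
  have "h \<in> Z_module p (column_module A)"
    unfolding Z_module_column_module(1)[OF A refl] using hc cl[OF between_UNIV] by blast
  moreover have "h $ i \<in> newton_ideal (component_ideal (column_module A) i)" if i: "i < p" for i
    unfolding mem_newton_ideal
  proof (intro ballI newton_polyhedronI_weight)
    fix k and w :: "'n \<Rightarrow> nat" assume k: "k \<in> supp (h $ i)" and w: "\<And>i. 0 < w i"
    interpret W: domain_valuation "weight_order w" by (rule domain_valuation_weight_order) (use w in simp)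
    from cl[OF W.between_vring] obtain c where c: "c \<in> carrier_vec m" "\<forall>j<m. c $ j \<in> W.vring"
      "map_vec to_fract h = map_mat to_fract A *\<^sub>v c" by blast
    have "to_fract (h $ i) = (map_mat to_fract A *\<^sub>v c) $ i" using c(3) i hc by (metis carrier_vecD index_map_vec(1))
    also have "\<dots> = (\<Sum>j<m. to_fract (A $$ (i,j)) * c $ j)"
      using mult_mat_vec_entry[of "map_mat to_fract A" p m c i] A c(1) i by simp
    finally have eq: "to_fract (h $ i) = (\<Sum>j<m. to_fract (A $$ (i,j)) * c $ j)" .
    have h0: "h $ i \<noteq> 0" using k by auto
    show "\<exists>l\<in>exponents (component_ideal (column_module A) i). weight w l \<le> weight w k"
    proof (rule ccontr)
      assume none: "\<not> (\<exists>l\<in>exponents (component_ideal (column_module A) i). weight w l \<le> weight w k)"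
      \<comment> \<open>If no exponent of the i-th component ideal weighs as little as k, the whole
        i-th row has greater order, and so has each of its combinations over the valuation ring, in
        particular \<open>h $ i\<close>.\<close>
      have big: "int (weight w k) < W.fract_val (to_fract (A $$ (i,j)))" if j: "j < m" "A $$ (i,j) \<noteq> 0" for j
      proof -
        obtain l where l: "l \<in> supp (A $$ (i,j))" "weight w l = weight_order w (A $$ (i,j))"
          using weight_order_attained[OF j(2)] .
        have "l \<in> exponents (component_ideal (column_module A) i)"
          unfolding exponents_def using l component_ideal_entry[OF A i j(1)] by blast
        hence "weight w k < weight w l" using none by (meson not_le)
        thus ?thesis using l(2) j(2) by (simp add: W.fract_val_to_fract)
      qed
      have "to_fract (A $$ (i,j)) * c $ j = 0 \<or> int (weight w k) < W.fract_val (to_fract (A $$ (i,j)) * c $ j)"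
        if "j \<in> {..<m}" for j
      proof (cases "A $$ (i,j) = 0 \<or> c $ j = 0")
        case False
        moreover have "W.fract_val (c $ j) \<ge> 0" using c(2) that False by (auto simp: W.vring_def)
        ultimately show ?thesis using big[of j] that by (simp add: W.v_mult)
      qed auto
      from W.v_sum_greater[of "{..<m}" "\<lambda>j. to_fract (A $$ (i,j)) * c $ j", OF this] have "int (weight w k) < W.fract_val (to_fract (h $ i))"
        unfolding eq[symmetric] using h0 by auto
      thus False using weight_order_le[OF k, of w] h0 by (simp add: W.fract_val_to_fract)
    qed
  qed
  ultimately show "h \<in> C0_module p (column_module A)" unfolding C0_module_def using hc by auto
qed

lemma replace_col_map: "b \<in> carrier_vec (dim_row S) \<Longrightarrow>
  replace_col (map_mat f S) (map_vec f b) k = map_mat f (replace_col S b k)"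
  unfolding replace_col_def by (intro eq_matI) auto

lemma C0_subset_module_closure:
  fixes A :: "'n::finite germ mat"
  assumes A: "A \<in> carrier_mat p m" and r: "r = module_rank p (column_module A)"
    and H: "ideal_closure (minor_ideal r A) = newton_ideal (J_ideal (nonzero_minor_rows r A) (column_module A))"
  shows "C0_module p (column_module A) \<subseteq> module_closure p (column_module A)"
proof
  fix h assume h: "h \<in> C0_module p (column_module A)"
  hence hc: "h \<in> carrier_vec p" and hZ: "h \<in> Z_module p (column_module A)"
    and hN: "\<And>i. i < p \<Longrightarrow> h $ i \<in> newton_ideal (component_ideal (column_module A) i)"
    unfolding C0_module_def by auto
  show "h \<in> module_closure p (column_module A)"
    unfolding module_closure_column_module[OF A]
  proof (intro conjI allI impI hc)
    fix V :: "'n germ fract set" assume V: "between_dvr_or_field V"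
    have "subring V class_ring" using V unfolding between_dvr_or_field_def by auto
    note D = subring_class_ringD[OF this]
    obtain I J where IJ: "I \<subseteq> {..<p}" "J \<subseteq> {..<m}" "card I = r" "card J = r" "det (submatrix A I J) \<noteq> 0"
      "\<forall>a\<in>minor_ideal r A. to_fract a / to_fract (det (submatrix A I J)) \<in> V"
      using minor_ideal_quotient[OF A V, folded r] .
    have fin: "finite I" "finite J" using IJ(1,2) finite_subset by blast+
    have I\<Lambda>: "I \<in> nonzero_minor_rows r A" unfolding nonzero_minor_rows_def using A IJ by auto
    let ?S = "submatrix A I J"
    have S: "?S \<in> carrier_mat r r" using submatrix_carrier[OF A IJ(1,2)] IJ by simp
    have Sij: "?S $$ (i,j) = A $$ (pick I i, pick J j)" if "i < r" "j < r" for i j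
      using submatrix_nth[OF A IJ(1,2)] that IJ by simp
    have pI: "pick I i < p" "pick I i \<in> I" if "i < r" for i using pick_mem[OF fin(1), of i] that IJ by auto
    have pJ: "pick J j < m" "pick J j \<in> J" if "j < r" for j using pick_mem[OF fin(2), of j] that IJ by auto
    from Z_module_column_module(2)[OF A r hZ IJ(1,2,3,4,5)] obtain c where
      c: "\<forall>i<p. to_fract (h $ i) = (\<Sum>l\<in>J. to_fract (A $$ (i,l)) * c l)" by blast
    define hI where "hI = vec r (\<lambda>i. h $ pick I i)"
    define x where "x = vec r (\<lambda>k. c (pick J k))"
    have x: "x \<in> carrier_vec r" by (simp add: x_def)
    have bJ: "bij_betw (pick J) {..<r} J" using bij_betw_pick[OF fin(2)] IJ by simp
    have Sx: "map_mat to_fract ?S *\<^sub>v x = map_vec to_fract hI"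
    proof (rule eq_vecI)
      fix i assume "i < dim_vec (map_vec to_fract hI)"
      hence i: "i < r" by (simp add: hI_def)
      have "(map_mat to_fract ?S *\<^sub>v x) $ i = (\<Sum>k<r. map_mat to_fract ?S $$ (i,k) * x $ k)"
        using S x i by (intro mult_mat_vec_entry) auto
      also have "\<dots> = (\<Sum>k<r. to_fract (A $$ (pick I i, pick J k)) * c (pick J k))"
        using S i by (intro sum.cong) (auto simp: Sij x_def)
      also have "\<dots> = (\<Sum>l\<in>J. to_fract (A $$ (pick I i, l)) * c l)"
        by (rule sum.reindex_bij_betw[OF bJ])
      also have "\<dots> = to_fract (h $ pick I i)" using c pI[OF i] by simp
      finally show "(map_mat to_fract ?S *\<^sub>v x) $ i = map_vec to_fract hI $ i" using i by (simp add: hI_def)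
    qed (use S in \<open>simp add: hI_def\<close>)
    \<comment> \<open>By Cramer's rule the coefficient is a quotient of two determinants. The
      numerator has entries of h in one column, lies in the Newton ideal and hence, by hypothesis,
      is integral over the minors; dividing by the pivot minor then stays in V.\<close>
    have cV: "c (pick J k) \<in> V" if k: "k < r" for k
    proof -
      let ?g = "det (replace_col ?S hI k)"
      have "x $ k * det (map_mat to_fract ?S) = det (replace_col (map_mat to_fract ?S) (map_vec to_fract hI) k)"
        using cramer_lemma_mat[of "map_mat to_fract ?S" r x k] S x k by (simp add: Sx)
      also have "replace_col (map_mat to_fract ?S) (map_vec to_fract hI) k = map_mat to_fract (replace_col ?S hI k)"
        by (rule replace_col_map) (use S in \<open>simp add: hI_def\<close>)
      finally have eq: "c (pick J k) * to_fract (det ?S) = to_fract ?g" using k by (simp add: det_to_fract x_def)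
      have "?g \<in> newton_ideal (J_ideal (nonzero_minor_rows r A) (column_module A))"
      proof (rule det_mem_newton_ideal[OF I\<Lambda> fin(1) IJ(3)])
        show "replace_col ?S hI k \<in> carrier_mat r r" using S by (simp add: replace_col_def)
        fix i j assume ij: "i < r" "j < r"
        show "replace_col ?S hI k $$ (i,j) \<in> newton_ideal (component_ideal (column_module A) (pick I i))"
        proof (cases "j = k")
          case True
          thus ?thesis using S ij hN pI by (simp add: replace_col_def hI_def)
        next
          case False
          hence "replace_col ?S hI k $$ (i,j) = A $$ (pick I i, pick J j)" using S ij Sij by (simp add: replace_col_def)
          thus ?thesis using component_ideal_entry[OF A pI(1)[OF ij(1)] pJ(1)[OF ij(2)]] mem_newton_idealI by metis
        qed
      qed
      hence g: "?g \<in> ideal_closure (minor_ideal r A)" using H by simp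
      have d0: "to_fract (det ?S) \<noteq> 0" using IJ(5) by simp
      have "c (pick J k) = to_fract ?g / to_fract (det ?S)" using eq d0 by (simp add: eq_divide_eq)
      also have "\<dots> \<in> V"
        by (rule between_integrally_closed[OF V d0 _ g]) (use IJ(6) in blast)
      finally show ?thesis .
    qed
    have cJ: "c l \<in> V" if "l \<in> J" for l
    proof -
      from bJ that obtain k where "k < r" "l = pick J k" unfolding bij_betw_def by blast
      thus ?thesis using cV by simp
    qed
    let ?c = "vec m (\<lambda>l. if l \<in> J then c l else 0)"
    have "map_vec to_fract h = map_mat to_fract A *\<^sub>v ?c"
    proof (rule eq_vecI)
      fix i assume "i < dim_vec (map_mat to_fract A *\<^sub>v ?c)"
      hence i: "i < p" using A by simp
      have "(map_mat to_fract A *\<^sub>v ?c) $ i = (\<Sum>l<m. map_mat to_fract A $$ (i,l) * ?c $ l)"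
        using A i by (intro mult_mat_vec_entry) auto
      also have "\<dots> = (\<Sum>l<m. if l \<in> J then to_fract (A $$ (i,l)) * c l else 0)"
        using A i by (intro sum.cong) auto
      also have "\<dots> = (\<Sum>l\<in>{..<m} \<inter> J. to_fract (A $$ (i,l)) * c l)" by (simp add: sum.inter_restrict)
      also have "{..<m} \<inter> J = J" using IJ(2) by blast
      finally show "map_vec to_fract h $ i = (map_mat to_fract A *\<^sub>v ?c) $ i" using c i hc by simp
    qed (use hc A in simp)
    moreover have "\<forall>j<m. ?c $ j \<in> V" using cJ D(1) by simp
    moreover have "?c \<in> carrier_vec m" by simp
    ultimately show "\<exists>c\<in>carrier_vec m. (\<forall>j<m. c $ j \<in> V) \<and> map_vec to_fract h = map_mat to_fract A *\<^sub>v c" by blast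
  qed
qed

section \<open>Divisorial valuations centred at points of the torus\<close>

definition monom_eval :: "complex^'n::finite \<Rightarrow> nat^'n \<Rightarrow> complex" where
  "monom_eval x k = (\<Prod>i\<in>UNIV. (x $h i) ^ (k $h i))"

lemma monom_eval_add: "monom_eval x (k + l) = monom_eval x k * monom_eval x l"
  by (simp add: monom_eval_def power_add prod.distrib)

lemma monom_eval_zero [simp]: "monom_eval x 0 = 1"
  by (simp add: monom_eval_def)

lemma monom_eval_nonzero: "(\<Prod>i\<in>UNIV. x $h i) \<noteq> 0 \<Longrightarrow> monom_eval x k \<noteq> 0"
  by (simp add: monom_eval_def)

lemma finite_weight_le:
  assumes "\<forall>i. 0 < w i"
  shows "finite {k :: nat^'n::finite. weight w k \<le> d}"
  by (rule finite_subset[OF _ finite_total_degree[of d]])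
    (use total_degree_le_weight[of w] assms in \<open>auto intro: order_trans\<close>)

text \<open>The substitution \<open>x\<^sub>i \<mapsto> t\<^bsup>w\<^sub>i\<^esup> (a\<^sub>i + t s\<^sub>i)\<close>, with germs in the variables \<open>s\<^sub>i\<close> as coefficients.\<close>

definition torus_factor :: "complex^'n::finite \<Rightarrow> nat^'n \<Rightarrow> 'n germ fps" where
  "torus_factor a k = (\<Prod>i\<in>UNIV. (fps_const (germ_const (a $h i)) +
     fps_const (germ_monom (\<chi> j. if j = i then 1 else 0)) * fps_X) ^ (k $h i))"

definition subst_monom :: "('n::finite \<Rightarrow> nat) \<Rightarrow> complex^'n \<Rightarrow> nat^'n \<Rightarrow> 'n germ fps" where
  "subst_monom w a k = fps_X ^ weight w k * torus_factor a k"

text \<open>A monomial of weight greater than d contributes only beyond \<open>t^d\<close>, so each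
  coefficient in t is a finite sum and no convergence in t is involved.\<close>

definition torus_subst :: "('n::finite \<Rightarrow> nat) \<Rightarrow> complex^'n \<Rightarrow> 'n germ \<Rightarrow> 'n germ fps" where
  "torus_subst w a f = Abs_fps (\<lambda>d. \<Sum>k | weight w k \<le> d. germ_const (germ_coeff f k) * fps_nth (subst_monom w a k) d)"

lemma torus_factor_add: "torus_factor a (k + l) = torus_factor a k * torus_factor a l"
  by (simp add: torus_factor_def power_add prod.distrib)

lemma torus_factor_nth_0: "fps_nth (torus_factor a k) 0 = germ_const (monom_eval a k)"
proof -
  have "fps_nth (prod f A) 0 = (\<Prod>i\<in>A. fps_nth (f i) 0)" for f :: "'a \<Rightarrow> 'a germ fps" and A
    by (induction A rule: infinite_finite_induct) auto
  moreover have "fps_nth (f ^ n) 0 = fps_nth f 0 ^ n" for f :: "'a germ fps" and n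
    by (induction n) auto
  ultimately show ?thesis
    by (simp add: torus_factor_def monom_eval_def germ_const_prod germ_const_power)
qed

lemma subst_monom_add: "subst_monom w a (k + l) = subst_monom w a k * subst_monom w a l"
  by (simp add: subst_monom_def torus_factor_add weight_add power_add mult_ac)

lemma subst_monom_low: "d < weight w k \<Longrightarrow> fps_nth (subst_monom w a k) d = 0"
  by (simp add: subst_monom_def fps_X_power_mult_nth)

lemma subst_monom_weight: "fps_nth (subst_monom w a k) (weight w k) = germ_const (monom_eval a k)"
  by (simp add: subst_monom_def fps_X_power_mult_nth torus_factor_nth_0)

context
  fixes w :: "'n::finite \<Rightarrow> nat"
  assumes w: "\<forall>i. 0 < w i"
begin

lemma torus_subst_nth:
  assumes "e \<le> d"
  shows "fps_nth (torus_subst w a f) e =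
    (\<Sum>k | weight w k \<le> d. germ_const (germ_coeff f k) * fps_nth (subst_monom w a k) e)"
  unfolding torus_subst_def fps_nth_Abs_fps
  by (rule sum.mono_neutral_left[OF finite_weight_le[OF w]]) (use assms in \<open>auto simp: subst_monom_low not_le\<close>)

lemma torus_subst_add: "torus_subst w a (f + g) = torus_subst w a f + torus_subst w a g"
  by (rule fps_ext) (simp add: torus_subst_def germ_const_add distrib_right sum.distrib)

lemma torus_subst_zero [simp]: "torus_subst w a 0 = 0"
  by (rule fps_ext) (simp add: torus_subst_def)

lemma torus_subst_sum: "torus_subst w a (sum f A) = (\<Sum>x\<in>A. torus_subst w a (f x))"
  by (induction A rule: infinite_finite_induct) (auto simp: torus_subst_add)

lemma torus_subst_const_times_nth:
  "fps_nth (torus_subst w a (germ_const c * f)) d = germ_const c * fps_nth (torus_subst w a f) d"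
  by (simp add: torus_subst_def germ_const_mult sum_distrib_left mult.assoc)

text \<open>Up to order d all sums may be cut off at weight d. The pairs in the product of the two
  truncations that add up to a larger weight contribute nothing to the coefficient of
  \<open>t^d\<close>.\<close>

lemma torus_subst_mult: "torus_subst w a (f * g) = torus_subst w a f * torus_subst w a g"
proof (rule fps_ext)
  fix d
  define D where "D = {k :: nat^'n. weight w k \<le> d}"
  have D: "finite D" unfolding D_def by (rule finite_weight_le[OF w])
  let ?c = "\<lambda>k l. germ_const (germ_coeff f k * germ_coeff g l) * fps_nth (subst_monom w a (k + l)) d"
  have "fps_nth (torus_subst w a f * torus_subst w a g) d =
      (\<Sum>e=0..d. (\<Sum>k\<in>D. germ_const (germ_coeff f k) * fps_nth (subst_monom w a k) e) *
        (\<Sum>l\<in>D. germ_const (germ_coeff g l) * fps_nth (subst_monom w a l) (d - e)))"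
    unfolding fps_mult_nth D_def by (intro sum.cong refl arg_cong2[of _ _ _ _ "(*)"] torus_subst_nth) auto
  also have "\<dots> = (\<Sum>e=0..d. \<Sum>k\<in>D. \<Sum>l\<in>D. germ_const (germ_coeff f k * germ_coeff g l) *
        (fps_nth (subst_monom w a k) e * fps_nth (subst_monom w a l) (d - e)))"
    unfolding sum_product by (intro sum.cong refl) (simp add: germ_const_mult mult_ac)
  also have "\<dots> = (\<Sum>k\<in>D. \<Sum>e=0..d. \<Sum>l\<in>D. germ_const (germ_coeff f k * germ_coeff g l) *
        (fps_nth (subst_monom w a k) e * fps_nth (subst_monom w a l) (d - e)))"
    by (rule sum.swap)
  also have "\<dots> = (\<Sum>k\<in>D. \<Sum>l\<in>D. \<Sum>e=0..d. germ_const (germ_coeff f k * germ_coeff g l) *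
        (fps_nth (subst_monom w a k) e * fps_nth (subst_monom w a l) (d - e)))"
    by (intro sum.cong refl sum.swap)
  also have "\<dots> = (\<Sum>k\<in>D. \<Sum>l\<in>D. ?c k l)"
    by (simp add: subst_monom_add fps_mult_nth flip: sum_distrib_left)
  also have "\<dots> = (\<Sum>x\<in>D \<times> D. ?c (fst x) (snd x))"
    by (simp add: sum.cartesian_product case_prod_unfold)
  also have "\<dots> = (\<Sum>x\<in>snd ` (SIGMA m:D. {(i,j). i + j = m}). ?c (fst x) (snd x))"
  proof (rule sum.mono_neutral_right)
    show "snd ` (SIGMA m:D. {(i,j). i + j = m}) \<subseteq> D \<times> D" by (auto simp: D_def weight_add)
    show "\<forall>x\<in>D \<times> D - snd ` (SIGMA m:D. {(i,j). i + j = m}). ?c (fst x) (snd x) = 0"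
    proof
      fix x assume x: "x \<in> D \<times> D - snd ` (SIGMA m:D. {(i,j). i + j = m})"
      have "fst x + snd x \<notin> D"
      proof
        assume "fst x + snd x \<in> D"
        hence "x \<in> snd ` (SIGMA m:D. {(i,j). i + j = m})"
          by (intro image_eqI[of _ _ "(fst x + snd x, x)"]) auto
        thus False using x by blast
      qed
      thus "?c (fst x) (snd x) = 0" by (simp add: D_def subst_monom_low)
    qed
  qed (use D in auto)
  also have "\<dots> = (\<Sum>y\<in>(SIGMA m:D. {(i,j). i + j = m}). ?c (fst (snd y)) (snd (snd y)))"
    by (subst sum.reindex) (auto simp: inj_on_def)
  also have "\<dots> = (\<Sum>m\<in>D. \<Sum>x\<in>{(i,j). i + j = m}. ?c (fst x) (snd x))"
    using D finite_splits by (subst sum.Sigma) (auto simp: case_prod_unfold)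
  also have "\<dots> = (\<Sum>m\<in>D. germ_const (germ_coeff (f * g) m) * fps_nth (subst_monom w a m) d)"
  proof (rule sum.cong[OF refl])
    fix m
    have "(\<Sum>x\<in>{(i,j). i + j = m}. ?c (fst x) (snd x)) =
        (\<Sum>x\<in>{(i,j). i + j = m}. germ_const (germ_coeff f (fst x) * germ_coeff g (snd x))) * fps_nth (subst_monom w a m) d"
      unfolding sum_distrib_right by (rule sum.cong) auto
    thus "(\<Sum>x\<in>{(i,j). i + j = m}. ?c (fst x) (snd x)) =
        germ_const (germ_coeff (f * g) m) * fps_nth (subst_monom w a m) d"
      by (simp add: germ_coeff_times germ_const_sum case_prod_unfold)
  qed
  finally show "fps_nth (torus_subst w a (f * g)) d = fps_nth (torus_subst w a f * torus_subst w a g) d"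
    by (simp add: torus_subst_def D_def)
qed

lemma torus_subst_low:
  assumes "\<And>k. k \<in> supp f \<Longrightarrow> d < weight w k"
  shows "fps_nth (torus_subst w a f) d = 0"
proof -
  have "germ_coeff f k = 0" if "weight w k \<le> d" for k
    using assms[of k] that by (cases "germ_coeff f k = 0") (auto simp: supp_def)
  thus ?thesis by (simp add: torus_subst_def)
qed

text \<open>In lowest order every factor \<open>a_i + t s_i\<close> contributes its constant term,
  so the coefficient is the initial form evaluated at a and is free of the variables
  \<open>s_i\<close>.\<close>

lemma torus_subst_initial:
  assumes "\<And>k. k \<in> supp f \<Longrightarrow> c \<le> weight w k"
  shows "fps_nth (torus_subst w a f) c =
    germ_const (\<Sum>k | weight w k = c. germ_coeff f k * monom_eval a k)"
proof -
  have zero: "germ_coeff f k = 0" if "weight w k < c" for k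
    using assms[of k] that by (cases "germ_coeff f k = 0") (auto simp: supp_def)
  have "fps_nth (torus_subst w a f) c =
      (\<Sum>k | weight w k = c. germ_const (germ_coeff f k) * fps_nth (subst_monom w a k) c)"
    unfolding torus_subst_def fps_nth_Abs_fps
    by (rule sum.mono_neutral_right[OF finite_weight_le[OF w]]) (auto simp: zero)
  also have "\<dots> = germ_const (\<Sum>k | weight w k = c. germ_coeff f k * monom_eval a k)"
    unfolding germ_const_sum by (rule sum.cong) (auto simp: germ_const_mult subst_monom_weight)
  finally show ?thesis .
qed

end

text \<open>
  Homogeneity in \<open>t\<close> and \<open>s\<close>: the coefficient of \<open>s\<^sup>l\<close> in \<open>\<Prod>(a\<^sub>i + t s\<^sub>i)\<^bsup>k\<^sub>i\<^esup>\<close> is a multiple of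
  \<open>t\<^bsup>|l|\<^esup>\<close> and vanishes unless \<open>l \<le> k\<close>. Hence the coefficient of \<open>t\<^bsup>w\<cdot>l+|l|\<^esup> s\<^sup>l\<close> in the
  image of \<open>f\<close> is that of \<open>x\<^sup>l\<close> in \<open>f\<close>, and the substitution is injective.
\<close>

definition graded_below :: "nat^'n::finite \<Rightarrow> 'n germ fps \<Rightarrow> bool" where
  "graded_below k P \<longleftrightarrow> (\<forall>e l. germ_coeff (fps_nth P e) l \<noteq> 0 \<longrightarrow> total_degree l = e \<and> (\<forall>i. l $h i \<le> k $h i)) \<and>
     germ_coeff (fps_nth P (total_degree k)) k = 1"

lemma graded_below_one: "graded_below 0 1"
  by (auto simp: graded_below_def germ_coeff_one split: if_splits)

lemma graded_below_mult:
  assumes P: "graded_below k P" and Q: "graded_below k' Q"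
  shows "graded_below (k + k') (P * Q)"
proof -
  have expand: "germ_coeff (fps_nth (P * Q) e) l =
      (\<Sum>d=0..e. \<Sum>x\<in>{(i,j). i + j = l}. germ_coeff (fps_nth P d) (fst x) * germ_coeff (fps_nth Q (e - d)) (snd x))" for e l
    by (simp add: fps_mult_nth germ_coeff_sum germ_coeff_times case_prod_unfold)
  have nz: "total_degree i = d \<and> total_degree j = e - d \<and> (\<forall>x. i $h x \<le> k $h x) \<and> (\<forall>x. j $h x \<le> k' $h x)"
    if "germ_coeff (fps_nth P d) i * germ_coeff (fps_nth Q (e - d)) j \<noteq> 0" for d e i j
    using that P Q by (auto simp: graded_below_def)
  have 1: "total_degree l = e \<and> (\<forall>i. l $h i \<le> (k + k') $h i)" if ne: "germ_coeff (fps_nth (P * Q) e) l \<noteq> 0" for e l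
  proof -
    from ne[unfolded expand] obtain d where d: "d \<in> {0..e}"
      "(\<Sum>x\<in>{(i,j). i + j = l}. germ_coeff (fps_nth P d) (fst x) * germ_coeff (fps_nth Q (e - d)) (snd x)) \<noteq> 0"
      by (rule sum.not_neutral_contains_not_neutral)
    from d(2) obtain x where x: "x \<in> {(i,j). i + j = l}"
      "germ_coeff (fps_nth P d) (fst x) * germ_coeff (fps_nth Q (e - d)) (snd x) \<noteq> 0"
      by (rule sum.not_neutral_contains_not_neutral)
    have l: "l = fst x + snd x" using x(1) by auto
    show ?thesis using nz[OF x(2)] d(1) unfolding l by (auto simp: total_degree_add intro: add_mono)
  qed
  have "germ_coeff (fps_nth (P * Q) (total_degree (k + k'))) (k + k') =
      (\<Sum>d\<in>{total_degree k}. \<Sum>x\<in>{(k,k')}. germ_coeff (fps_nth P d) (fst x) *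
        germ_coeff (fps_nth Q (total_degree (k + k') - d)) (snd x))"
  proof -
    have only: "i = k \<and> j = k' \<and> d = total_degree k"
      if "i + j = k + k'" "germ_coeff (fps_nth P d) i * germ_coeff (fps_nth Q (total_degree (k + k') - d)) j \<noteq> 0" for d i j
    proof -
      note n = nz[OF that(2)]
      have "i $h x = k $h x" for x
      proof -
        have "i $h x + j $h x = k $h x + k' $h x" using arg_cong[OF that(1), of "\<lambda>v. v $h x"] by simp
        thus ?thesis using n by (metis add_le_cancel_left add_mono_thms_linordered_semiring(1) dual_order.antisym nat_add_left_cancel_le le_antisym add_le_imp_le_right order_refl)
      qed
      hence "i = k" by (simp add: Finite_Cartesian_Product.vec_eq_iff)
      thus ?thesis using that(1) n by auto
    qed
    show ?thesis
      unfolding expand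
    proof (rule sum.mono_neutral_cong_right)
      show "\<forall>d\<in>{0..total_degree (k + k')} - {total_degree k}.
          (\<Sum>x\<in>{(i,j). i + j = k + k'}. germ_coeff (fps_nth P d) (fst x) * germ_coeff (fps_nth Q (total_degree (k + k') - d)) (snd x)) = 0"
        using only by (intro ballI sum.neutral) fastforce
      fix d assume "d \<in> {total_degree k}"
      show "(\<Sum>x\<in>{(i,j). i + j = k + k'}. germ_coeff (fps_nth P d) (fst x) * germ_coeff (fps_nth Q (total_degree (k + k') - d)) (snd x)) =
          (\<Sum>x\<in>{(k,k')}. germ_coeff (fps_nth P d) (fst x) * germ_coeff (fps_nth Q (total_degree (k + k') - d)) (snd x))"
        by (rule sum.mono_neutral_right[OF finite_splits]) (use only in fastforce)+
    qed (auto simp: total_degree_add)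
  qed
  also have "\<dots> = 1" using P Q by (simp add: graded_below_def total_degree_add)
  finally show ?thesis unfolding graded_below_def using 1 by blast
qed

lemma graded_below_torus_factor: "graded_below k (torus_factor a k)"
proof -
  let ?Y = "\<lambda>i. fps_const (germ_const (a $h i)) + fps_const (germ_monom (\<chi> j. if j = i then 1 else 0)) * fps_X"
  have td: "total_degree ((\<chi> j. if j = i then 1 else 0) :: nat^'a) = 1" for i :: 'a by (simp add: total_degree_def)
  have Y: "graded_below (\<chi> j. if j = i then 1 else 0) (?Y i)" for i
  proof -
    have "fps_nth (?Y i) e = (if e = 0 then germ_const (a $h i) else if e = 1 then germ_monom (\<chi> j. if j = i then 1 else 0) else 0)" for e
      by (cases e) auto
    thus ?thesis by (auto simp: graded_below_def td germ_coeff_const germ_coeff_monom split: if_splits)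
  qed
  have power: "graded_below (\<chi> j. if j = i then n else 0) (?Y i ^ n)" for i n
  proof (induction n)
    case 0
    have "((\<chi> j. if j = i then 0 else 0) :: nat^'a) = 0" by (simp add: Finite_Cartesian_Product.vec_eq_iff)
    thus ?case using graded_below_one by simp
  next
    case (Suc n)
    have "((\<chi> j. if j = i then Suc n else 0) :: nat^'a) =
        (\<chi> j. if j = i then 1 else 0) + (\<chi> j. if j = i then n else 0)"
      by (simp add: Finite_Cartesian_Product.vec_eq_iff)
    thus ?case using graded_below_mult[OF Y[of i] Suc] by simp
  qed
  have "graded_below (\<chi> j. if j \<in> A then k $h j else 0) (\<Prod>i\<in>A. ?Y i ^ (k $h i))" if "finite A" for A
    using that
  proof (induction A rule: finite_induct)
    case empty
    have "(\<chi> j. if j \<in> {} then k $h j else 0) = 0" by (simp add: Finite_Cartesian_Product.vec_eq_iff)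
    thus ?case using graded_below_one by simp
  next
    case (insert i A)
    have "(\<chi> j. if j \<in> insert i A then k $h j else 0) =
        (\<chi> j. if j = i then k $h i else 0) + (\<chi> j. if j \<in> A then k $h j else 0)"
      using insert.hyps by (auto simp: Finite_Cartesian_Product.vec_eq_iff)
    moreover have "(\<Prod>j\<in>insert i A. ?Y j ^ (k $h j)) = ?Y i ^ (k $h i) * (\<Prod>j\<in>A. ?Y j ^ (k $h j))"
      using insert.hyps by simp
    ultimately show ?case using graded_below_mult[OF power insert.IH] by (simp only:)
  qed
  from this[of UNIV] show ?thesis by (simp add: torus_factor_def)
qed

lemma torus_subst_nonzero:
  fixes w :: "'n::finite \<Rightarrow> nat"
  assumes w: "\<forall>i. 0 < w i" and f: "f \<noteq> 0"
  shows "torus_subst w a f \<noteq> 0"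
proof -
  obtain l where l: "l \<in> supp f" using f supp_eq_empty[of f] by blast
  define d where "d = weight w l + total_degree l"
  have graded: "germ_coeff (fps_nth (torus_factor a k) e) l' \<noteq> 0 \<Longrightarrow> total_degree l' = e \<and> (\<forall>i. l' $h i \<le> k $h i)"
    "germ_coeff (fps_nth (torus_factor a k) (total_degree k)) k = 1" for k e l'
    using graded_below_torus_factor[of k a] unfolding graded_below_def by blast+
  \<comment> \<open>A contributing k must satisfy k \<ge> l componentwise and have the same weight
    as l; positive weights then force k = l.\<close>
  have zero: "germ_coeff (fps_nth (subst_monom w a k) d) l = 0" if k: "weight w k \<le> d" "k \<noteq> l" for k
  proof (rule ccontr)
    assume "germ_coeff (fps_nth (subst_monom w a k) d) l \<noteq> 0"
    hence ne: "germ_coeff (fps_nth (torus_factor a k) (d - weight w k)) l \<noteq> 0"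
      using k(1) by (simp add: subst_monom_def fps_X_power_mult_nth)
    from graded(1)[OF this] have le: "\<forall>i. l $h i \<le> k $h i" and eq: "weight w k = weight w l"
      using k(1) by (auto simp: d_def)
    have "k = l + (k - l)" using le by (simp add: Finite_Cartesian_Product.vec_eq_iff)
    hence "weight w (k - l) = 0" using eq weight_add[of w l "k - l"] by simp
    hence "total_degree (k - l) = 0" using total_degree_le_weight[of w "k - l"] w by simp
    hence "(k - l) $h i = 0" for i using nth_le_total_degree[of "k - l" i] by linarith
    hence "k = l" using le by (auto simp: Finite_Cartesian_Product.vec_eq_iff intro: antisym)
    thus False using k(2) by blast
  qed
  have "germ_coeff (fps_nth (torus_subst w a f) d) l =
      (\<Sum>k | weight w k \<le> d. germ_coeff f k * germ_coeff (fps_nth (subst_monom w a k) d) l)"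
    by (simp add: torus_subst_def germ_coeff_sum)
  also have "\<dots> = (\<Sum>k\<in>{l}. germ_coeff f k * germ_coeff (fps_nth (subst_monom w a k) d) l)"
    by (rule sum.mono_neutral_right[OF finite_weight_le[OF w]]) (auto simp: zero[unfolded d_def] d_def)
  also have "\<dots> = germ_coeff f l"
    using graded(2)[of l] by (simp add: subst_monom_def fps_X_power_mult_nth d_def)
  finally show ?thesis using l by (auto simp: supp_def)
qed

text \<open>The order in t equals the least weight occurring in f unless the initial form of f
  vanishes at a, in which case it is larger. Monomial valuations do not see this vanishing.\<close>

definition torus_order :: "('n::finite \<Rightarrow> nat) \<Rightarrow> complex^'n \<Rightarrow> 'n germ \<Rightarrow> nat" where
  "torus_order w a f = subdegree (torus_subst w a f)"

lemma domain_valuation_torus_order: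
  fixes w :: "'n::finite \<Rightarrow> nat"
  assumes w: "\<forall>i. 0 < w i"
  shows "domain_valuation (torus_order w a)"
proof
  fix f g :: "'n germ"
  show "f \<noteq> 0 \<Longrightarrow> g \<noteq> 0 \<Longrightarrow> torus_order w a (f * g) = torus_order w a f + torus_order w a g"
    by (simp add: torus_order_def torus_subst_mult[OF w] torus_subst_nonzero[OF w])
  assume "f + g \<noteq> 0"
  hence "torus_subst w a f + torus_subst w a g \<noteq> 0"
    using torus_subst_nonzero[OF w, of "f + g" a] by (simp add: torus_subst_add[OF w])
  thus "min (torus_order w a f) (torus_order w a g) \<le> torus_order w a (f + g)"
    unfolding torus_order_def torus_subst_add[OF w] by (rule subdegree_add_ge')
next
  let ?k = "(\<chi> i. 1) :: nat^'n"
  have "0 < weight w ?k" unfolding weight_def using w by (intro sum_pos) auto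
  hence "fps_nth (torus_subst w a (germ_monom ?k)) 0 = 0" by (intro torus_subst_low[OF w]) simp
  hence "0 < torus_order w a (germ_monom ?k)"
    unfolding torus_order_def using torus_subst_nonzero[OF w, of "germ_monom ?k" a]
    by (metis germ_monom_nonzero gr0I nth_subdegree_nonzero)
  thus "\<exists>f. f \<noteq> 0 \<and> 0 < torus_order w a f" by (intro exI[of _ "germ_monom ?k"]) simp
qed

lemma fps_mult_nth_initial:
  fixes P Q :: "'a::comm_ring_1 fps"
  assumes "\<And>d. d < m \<Longrightarrow> fps_nth P d = 0" "\<And>d. d < n \<Longrightarrow> fps_nth Q d = 0"
  shows "fps_nth (P * Q) (m + n) = fps_nth P m * fps_nth Q n"
    and "d < m + n \<Longrightarrow> fps_nth (P * Q) d = 0"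
proof -
  have z: "fps_nth P i * fps_nth Q (d - i) = 0" if "d < m + n \<or> d = m + n \<and> i \<noteq> m" "i \<le> d" for d i
    using assms(1)[of i] assms(2)[of "d - i"] that by (cases "i < m") auto
  have "fps_nth (P * Q) (m + n) = (\<Sum>i\<in>{m}. fps_nth P i * fps_nth Q (m + n - i))"
    unfolding fps_mult_nth by (rule sum.mono_neutral_right) (auto intro!: z)
  thus "fps_nth (P * Q) (m + n) = fps_nth P m * fps_nth Q n" by simp
  show "d < m + n \<Longrightarrow> fps_nth (P * Q) d = 0"
    unfolding fps_mult_nth by (rule sum.neutral) (auto intro!: z)
qed

section \<open>The third condition implies the first\<close>

text \<open>A bounded face contains no point of the hull shifted by a non-zero vector of the
  orthant, so it is a face of the polytope spanned by G and hence the hull of a subset of G.\<close>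

lemma face_generator:
  assumes G: "finite G" and F: "F face_of upper_hull G" "bounded F" "F \<noteq> {}"
  obtains e where "e \<in> G" "e \<in> F"
proof -
  have FG: "F \<subseteq> convex hull G"
  proof
    fix x assume x: "x \<in> F"
    hence "x \<in> upper_hull G" using face_of_imp_subset[OF F(1)] by blast
    then obtain y v where yv: "x = y + v" "y \<in> convex hull G" "v \<in> orthant" by (rule upper_hullE)
    have "y \<in> upper_hull G" by (rule subsetD[OF convex_hull_subset_upper_hull yv(2)])
    from face_add_orthant_zero[OF F(1,2) upper_hull_add_orthant this yv(3)] x yv(1) have "v = 0" by simp
    thus "x \<in> convex hull G" using yv by simp
  qed
  have "F face_of convex hull G" by (rule face_of_subset[OF F(1) FG convex_hull_subset_upper_hull])
  from face_of_convex_hull_subset[OF finite_imp_compact[OF G] this]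
  obtain S where S: "S \<subseteq> G" "F = convex hull S" by blast
  have "S \<noteq> {}" using S(2) F(3) by auto
  then obtain e where "e \<in> S" by blast
  thus ?thesis using that[of e] S hull_inc[of e S convex] by blast
qed

lemma Z_module_full_rank:
  fixes A :: "'a::idom mat"
  assumes A: "A \<in> carrier_mat p m" and rank: "module_rank p (column_module A) = p" and h: "h \<in> carrier_vec p"
  shows "h \<in> Z_module p (column_module A)"
proof -
  let ?C = "map_mat to_fract (append_column A h)"
  have A': "append_column A h \<in> carrier_mat p (Suc m)" using A by (simp add: append_column_def)
  have C: "?C \<in> carrier_mat p (Suc m)" using A' by simp
  obtain I J where IJ: "I \<subseteq> {..<p}" "J \<subseteq> {..<m}" "card I = p" "card J = p" "det (submatrix A I J) \<noteq> 0"
    using nonzero_minor_exists[OF A, unfolded rank] .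
  have J': "J \<subseteq> {..<Suc m}" using IJ(2) by auto
  have fin: "finite I" "finite J" using IJ(1,2) finite_subset by blast+
  have "submatrix (append_column A h) I J = submatrix A I J"
  proof (rule eq_matI)
    fix i j assume "i < dim_row (submatrix A I J)" "j < dim_col (submatrix A I J)"
    hence ij: "i < card I" "j < card J" using submatrix_carrier[OF A IJ(1,2)] by auto
    have "pick I i < p" "pick J j < m" using pick_mem[OF fin(1) ij(1)] pick_mem[OF fin(2) ij(2)] IJ(1,2) by auto
    thus "submatrix (append_column A h) I J $$ (i,j) = submatrix A I J $$ (i,j)"
      using submatrix_nth[OF A IJ(1,2) ij] submatrix_nth[OF A' IJ(1) J' ij] A by (simp add: append_column_def)
  qed (use submatrix_carrier[OF A IJ(1,2)] submatrix_carrier[OF A' IJ(1) J'] in auto)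
  hence "det (submatrix ?C I J) \<noteq> 0" using IJ(5) by (simp add: submatrix_map_mat det_to_fract)
  moreover have card: "card I = card J" using IJ by simp
  ultimately have "nonsing ?C I J" using nonsing_iff_det[OF C IJ(1) J'] by simp
  from nonsing_le_rank[OF C IJ(1) J' card this] have "p \<le> vec_space.rank p ?C" using IJ by simp
  moreover have "vec_space.rank p ?C \<le> p"
  proof -
    obtain I' J' where "I' \<subseteq> {..<p}" "J' \<subseteq> {..<Suc m}" "card I' = vec_space.rank p ?C"
      "card J' = vec_space.rank p ?C" "nonsing ?C I' J'" using rank_minor[OF C] .
    thus ?thesis using card_mono[of "{..<p}" I'] by simp
  qed
  ultimately have "module_rank p (column_module (append_column A h)) = p"
    using module_rank_column_module[OF A'] by simp
  thus ?thesis unfolding Z_module_def using append_column_module[OF A h] rank h by simp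
qed

text \<open>Sums of generators generate the Minkowski sum. With finitely many generators
  \<open>exposing_weight\<close> becomes applicable to the polyhedron of the module.\<close>

lemma module_polyhedron_finite:
  fixes M :: "'n::finite germ Matrix.vec set"
  assumes "p > 0"
  obtains E where "finite E" "module_polyhedron p M = upper_hull (real_exponent ` E)"
proof -
  have "\<forall>i\<in>{..<p}. \<exists>E. finite E \<and> newton_polyhedron (component_ideal M i) = upper_hull (real_exponent ` E)"
  proof
    fix i
    obtain E where "finite E" "E \<subseteq> exponents (component_ideal M i)"
      "\<forall>k\<in>exponents (component_ideal M i). \<exists>e\<in>E. \<forall>j. e $h j \<le> k $h j"
      "newton_polyhedron (component_ideal M i) = upper_hull (real_exponent ` E)"
      using newton_polyhedron_finite[of "component_ideal M i"] .
    thus "\<exists>E. finite E \<and> newton_polyhedron (component_ideal M i) = upper_hull (real_exponent ` E)" by blast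
  qed
  from bchoice[OF this] obtain E where
    E: "\<forall>i\<in>{..<p}. finite (E i) \<and> newton_polyhedron (component_ideal M i) = upper_hull (real_exponent ` E i)" ..
  have "module_polyhedron p M = (\<Sum>i<p. upper_hull (real_exponent ` E i))"
    unfolding module_polyhedron_def using E by (intro sum.cong) auto
  also have "\<dots> = upper_hull (\<Sum>i<p. real_exponent ` E i)"
    by (rule sum_upper_hull) (use assms in auto)
  also have "(\<Sum>i<p. real_exponent ` E i) = real_exponent ` (\<Sum>i<p. E i)"
    using E
  proof (induction p)
    case (Suc p)
    have plus: "real_exponent ` (S + T) = real_exponent ` S + real_exponent ` T" for S T :: "(nat^'n) set"
      by (auto simp: set_plus_def real_exponent_add image_iff)
        (metis real_exponent_add)+
    show ?case using Suc by (simp add: plus)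
  qed (simp add: set_zero)
  finally have eq: "module_polyhedron p M = upper_hull (real_exponent ` (\<Sum>i<p. E i))" .
  have "finite (\<Sum>i<q. E i)" if "q \<le> p" for q
    using that
  proof (induction q)
    case (Suc q)
    have "finite (E q)" using E Suc.prems by auto
    moreover have "finite (\<Sum>i<q. E i)" using Suc by simp
    ultimately show ?case by (simp add: finite_set_plus)
  qed (simp add: set_zero)
  thus ?thesis using eq that by blast
qed

lemma eval_face_eq:
  "eval_face f \<Delta> x = (\<Sum>k | real_exponent k \<in> \<Delta>. germ_coeff f k * monom_eval x k)"
  by (simp add: eval_face_def monom_eval_def)

lemma finite_exponents_bounded:
  assumes "bounded (\<Delta> :: (real^'n::finite) set)"
  shows "finite {k. real_exponent k \<in> \<Delta>}"
proof -
  obtain B where B: "\<And>x. x \<in> \<Delta> \<Longrightarrow> norm x \<le> B" using assms by (auto simp: bounded_iff)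
  have "{k. real_exponent k \<in> \<Delta>} \<subseteq> {k. total_degree k \<le> CARD('n) * nat \<lceil>B\<rceil>}"
  proof
    fix k :: "nat^'n" assume "k \<in> {k. real_exponent k \<in> \<Delta>}"
    hence k: "norm (real_exponent k) \<le> B" using B by blast
    have "k $h i \<le> nat \<lceil>B\<rceil>" for i
    proof -
      have "real (k $h i) \<le> norm (real_exponent k)" using component_le_norm_cart[of "real_exponent k" i] by simp
      thus ?thesis using k by linarith
    qed
    hence "total_degree k \<le> (\<Sum>i\<in>(UNIV :: 'n set). nat \<lceil>B\<rceil>)" unfolding total_degree_def by (intro sum_mono)
    thus "k \<in> {k. total_degree k \<le> CARD('n) * nat \<lceil>B\<rceil>}" by simp
  qed
  thus ?thesis using finite_total_degree finite_subset by blast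
qed

text \<open>A linear form that is least on a Minkowski sum exactly along F is least on each summand
  exactly along the corresponding part of F: replacing one term changes the value only by the
  difference of the two terms.\<close>

lemma face_part_weight:
  fixes P :: "'i \<Rightarrow> 'a::real_inner set" and v :: 'a and k :: "'i \<Rightarrow> 'a"
  assumes I: "finite I" and F: "F face_of (\<Sum>i\<in>I. P i)" "F \<noteq> {}"
    and v: "\<forall>x\<in>(\<Sum>i\<in>I. P i). c \<le> inner v x" "\<forall>x\<in>(\<Sum>i\<in>I. P i). inner v x = c \<longleftrightarrow> x \<in> F"
    and k: "\<forall>j\<in>I. k j \<in> face_part F P I j" and i: "i \<in> I" and y: "y \<in> P i"
  shows "inner v (k i) \<le> inner v y" "inner v y = inner v (k i) \<longleftrightarrow> y \<in> face_part F P I i"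
proof -
  define x where "x = sum (k(i := y)) I"
  have kP: "\<forall>j\<in>I. k j \<in> P j" using k by (auto simp: face_part_def)
  hence xP: "\<forall>j\<in>I. (k(i := y)) j \<in> P j" using y by simp
  hence x: "x \<in> (\<Sum>i\<in>I. P i)" unfolding x_def mem_set_sum_iff[OF I] by (intro exI[of _ "k(i := y)"]) simp
  have kF: "sum k I \<in> F" by (rule face_part_sum[OF I F k])
  hence "sum k I \<in> (\<Sum>i\<in>I. P i)" by (rule subsetD[OF face_of_imp_subset[OF F(1)]])
  from bspec[OF v(2) this] kF have "inner v (sum k I) = c" by (rule iffD2)
  moreover have "inner v (sum k I) = inner v (k i) + inner v (sum k (I - {i}))"
    by (simp add: sum.remove[OF I i] inner_add_right)
  moreover have vx: "inner v x = inner v y + inner v (sum k (I - {i}))"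
    unfolding x_def sum_fun_upd[OF I i] by (rule inner_add_right)
  ultimately have eq: "inner v x = c + (inner v y - inner v (k i))" by simp
  show "inner v (k i) \<le> inner v y" using bspec[OF v(1) x] unfolding eq by linarith
  have "inner v y = inner v (k i) \<longleftrightarrow> inner v x = c" unfolding eq by auto
  also have "\<dots> \<longleftrightarrow> x \<in> F" by (rule bspec[OF v(2) x])
  also have "\<dots> \<longleftrightarrow> (\<forall>j\<in>I. (k(i := y)) j \<in> face_part F P I j)" unfolding x_def by (rule face_part_iff[OF I F xP])
  also have "\<dots> \<longleftrightarrow> y \<in> face_part F P I i" using k i by auto
  finally show "inner v y = inner v (k i) \<longleftrightarrow> y \<in> face_part F P I i" .
qed

text \<open>Connects faces with the substitution: if D carries exactly the terms of least possible
  weight n, then the value of the restriction of f to D at the point a is the coefficient of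
  \<open>t^n\<close>.\<close>

lemma torus_subst_face:
  fixes f :: "'n::finite germ"
  assumes w: "\<forall>i. 0 < w i" and D: "bounded D"
    and f: "\<And>l. l \<in> supp f \<Longrightarrow> n \<le> weight w l" "\<And>l. l \<in> supp f \<Longrightarrow> weight w l = n \<longleftrightarrow> real_exponent l \<in> D"
  shows "fps_nth (torus_subst w a f) n = germ_const (eval_face f D a)"
proof -
  have "fps_nth (torus_subst w a f) n = germ_const (\<Sum>l | weight w l = n. germ_coeff f l * monom_eval a l)"
    by (rule torus_subst_initial[OF w f(1)])
  also have "(\<Sum>l | weight w l = n. germ_coeff f l * monom_eval a l) =
      (\<Sum>l\<in>{l. weight w l = n} \<inter> supp f. germ_coeff f l * monom_eval a l)"
    by (rule sum.mono_neutral_right[OF finite_subset[OF _ finite_weight_le[OF w, of n]]]) (auto simp: supp_def)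
  also have "{l. weight w l = n} \<inter> supp f = {l. real_exponent l \<in> D} \<inter> supp f" using f(2) by blast
  also have "(\<Sum>l\<in>{l. real_exponent l \<in> D} \<inter> supp f. germ_coeff f l * monom_eval a l) = eval_face f D a"
    unfolding eval_face_eq
    by (rule sum.mono_neutral_left[OF finite_exponents_bounded[OF D]]) (auto simp: supp_def)
  finally show ?thesis .
qed

lemma nondegenerate_of_C0_subset:
  fixes A :: "'n::finite germ mat"
  assumes A: "A \<in> carrier_mat p m" and rank: "module_rank p (column_module A) = p"
    and sub: "C0_module p (column_module A) \<subseteq> module_closure p (column_module A)"
  shows "newton_nondegenerate_full p (column_module A) A"
  unfolding newton_nondegenerate_full_def
proof (intro ballI allI impI subsetI, rule CollectI, rule ccontr)
  fix \<Delta> \<Delta>s and x :: "complex^'n"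
  let ?M = "column_module A"
  let ?P = "\<lambda>i. newton_polyhedron (component_ideal ?M i)"
  define B where "B = Matrix.mat p (dim_col A) (\<lambda>(i,j). eval_face (A $$ (i,j)) (\<Delta>s i) x)"
  assume \<Delta>: "\<Delta> \<in> compact_faces (module_polyhedron p ?M)"
    and \<Delta>s: "(\<forall>i<p. \<Delta>s i \<in> compact_faces (?P i)) \<and> \<Delta> = (\<Sum>i<p. \<Delta>s i)"
    and x: "x \<in> {x. vec_space.rank p (Matrix.mat p (dim_col A) (\<lambda>(i,j). eval_face (A $$ (i,j)) (\<Delta>s i) x)) < p}"
    and torus: "(\<Prod>i\<in>UNIV. x $h i) \<noteq> 0"
  have rkB: "vec_space.rank p B < p" using x by (simp add: B_def)
  hence p: "p > 0" by simp
  have B: "B \<in> carrier_mat p m" using A by (simp add: B_def)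
  obtain E where E: "finite E" "module_polyhedron p ?M = upper_hull (real_exponent ` E)"
    using module_polyhedron_finite[OF p] .
  have face: "\<Delta> face_of (\<Sum>i\<in>{..<p}. ?P i)" "compact \<Delta>" "\<Delta> \<noteq> {}"
    using \<Delta> by (simp_all add: compact_faces_def module_polyhedron_def)
  have faceE: "\<Delta> face_of upper_hull (real_exponent ` E)" using \<Delta> E(2) by (simp add: compact_faces_def)
  obtain w c where w: "\<forall>i. 0 < w i"
    and wc: "\<forall>x\<in>upper_hull (real_exponent ` E). real c \<le> (\<chi> i. real (w i)) \<bullet> x"
      "\<forall>x\<in>upper_hull (real_exponent ` E). (\<chi> i. real (w i)) \<bullet> x = real c \<longleftrightarrow> x \<in> \<Delta>"
    using exposing_weight[OF E(1) faceE compact_imp_bounded[OF face(2)] face(3)] .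
  have \<Delta>i: "\<Delta>s i face_of ?P i" "compact (\<Delta>s i)" "\<Delta>s i \<noteq> {}" if "i < p" for i
    using \<Delta>s that by (simp_all add: compact_faces_def)
  have part: "face_part \<Delta> ?P {..<p} i = \<Delta>s i" if "i < p" for i
  proof (rule face_part_unique[OF finite_lessThan face(1)])
    show "\<Delta> = (\<Sum>i\<in>{..<p}. \<Delta>s i)" using \<Delta>s by simp
    show "i \<in> {..<p}" using that by simp
    fix j assume "j \<in> {..<p}"
    hence j: "j < p" by simp
    show "\<Delta>s j \<subseteq> ?P j" by (rule face_of_imp_subset[OF \<Delta>i(1)[OF j]])
    show "convex (\<Delta>s j)" by (rule face_of_imp_convex[OF \<Delta>i(1)[OF j]])
    show "compact (\<Delta>s j)" "\<Delta>s j \<noteq> {}" using \<Delta>i[OF j] by simp_all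
  qed
  have "\<forall>i\<in>{..<p}. \<exists>k. real_exponent k \<in> \<Delta>s i"
  proof
    fix i assume i: "i \<in> {..<p}"
    obtain F where F: "finite F" "F \<subseteq> exponents (component_ideal ?M i)"
      "\<forall>k\<in>exponents (component_ideal ?M i). \<exists>e\<in>F. \<forall>j. e $h j \<le> k $h j"
      "?P i = upper_hull (real_exponent ` F)"
      using newton_polyhedron_finite[of "component_ideal ?M i"] .
    have "finite (real_exponent ` F)" using F(1) by simp
    moreover have "\<Delta>s i face_of upper_hull (real_exponent ` F)" using \<Delta>i(1)[of i] i unfolding F(4) by simp
    ultimately obtain e where "e \<in> real_exponent ` F" "e \<in> \<Delta>s i"
      using \<Delta>i i by (elim face_generator) (auto simp: compact_imp_bounded)
    thus "\<exists>k. real_exponent k \<in> \<Delta>s i" by blast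
  qed
  from bchoice[OF this] obtain k where "\<forall>i\<in>{..<p}. real_exponent (k i) \<in> \<Delta>s i" ..
  hence k: "real_exponent (k i) \<in> \<Delta>s i" if "i < p" for i using that by simp
  have kP: "real_exponent (k i) \<in> ?P i" if "i < p" for i
    using k[OF that] face_of_imp_subset[OF \<Delta>i(1)[OF that]] by blast
  \<comment> \<open>The exponents \<open>k i\<close> lie on the parts of \<Delta>, so
    \<open>weight w (k i)\<close> is a lower bound for the weights in row i. Multiplying row i by
    the complementary monomial with exponent \<open>K i\<close> gives all rows the common bound
    \<kappa>.\<close>
  define \<kappa> where "\<kappa> = weight w (\<Sum>i<p. k i)"
  have kpart: "\<forall>j\<in>{..<p}. real_exponent (k j) \<in> face_part \<Delta> ?P {..<p} j" using k part by simp
  have wc': "\<forall>x\<in>(\<Sum>i<p. ?P i). real c \<le> (\<chi> i. real (w i)) \<bullet> x"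
    "\<forall>x\<in>(\<Sum>i<p. ?P i). (\<chi> i. real (w i)) \<bullet> x = real c \<longleftrightarrow> x \<in> \<Delta>"
    using wc unfolding E(2)[symmetric] module_polyhedron_def .
  define K where "K i = (\<Sum>j\<in>{..<p} - {i}. k j)" for i
  have K: "(\<Sum>j<p. (k(i := l)) j) = l + K i" if "i < p" for i l
    unfolding K_def using sum_fun_upd[of "{..<p}" i k l] that by simp
  have \<kappa>i: "\<kappa> = weight w (k i) + weight w (K i)" if "i < p" for i
    using K[OF that, of "k i"] unfolding \<kappa>_def by (simp add: weight_add)
  have comp: "weight w (k i) \<le> weight w l" "weight w l = weight w (k i) \<longleftrightarrow> real_exponent l \<in> \<Delta>s i"
    if "i < p" and l: "l \<in> exponents (component_ideal ?M i)" for i l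
  proof -
    have i: "i \<in> {..<p}" using that(1) by simp
    have lP: "real_exponent l \<in> ?P i"
      unfolding newton_polyhedron_eq by (rule upper_hull_inc[OF imageI[OF l]])
    note fw = face_part_weight[OF finite_lessThan face(1,3) wc' kpart i lP, unfolded part[OF that(1)]]
    have "real (weight w (k i)) \<le> real (weight w l)" unfolding real_weight by (rule fw(1))
    thus "weight w (k i) \<le> weight w l" by simp
    have "real (weight w l) = real (weight w (k i)) \<longleftrightarrow> real_exponent l \<in> \<Delta>s i"
      unfolding real_weight by (rule fw(2))
    thus "weight w l = weight w (k i) \<longleftrightarrow> real_exponent l \<in> \<Delta>s i" by simp
  qed
  let ?\<phi> = "torus_subst w x"
  have supp_A: "l \<in> exponents (component_ideal ?M i)" if "i < p" "j < m" "l \<in> supp (A $$ (i,j))" for i j l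
    unfolding exponents_def using component_ideal_entry[OF A that(1,2)] that(3) by blast
  have A_low: "fps_nth (?\<phi> (A $$ (i,j))) d = 0" if "i < p" "j < m" "d < weight w (k i)" for i j d
    by (rule torus_subst_low[OF w]) (use comp(1)[OF that(1) supp_A[OF that(1,2)]] that(3) in force)
  have A_init: "fps_nth (?\<phi> (A $$ (i,j))) (weight w (k i)) = germ_const (B $$ (i,j))" if ij: "i < p" "j < m" for i j
  proof -
    have "fps_nth (?\<phi> (A $$ (i,j))) (weight w (k i)) = germ_const (eval_face (A $$ (i,j)) (\<Delta>s i) x)"
      by (rule torus_subst_face[OF w compact_imp_bounded[OF \<Delta>i(2)[OF ij(1)]]])
        (use comp[OF ij(1) supp_A[OF ij]] in blast)+
    thus ?thesis using ij A by (simp add: B_def)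
  qed
  have mono_low: "fps_nth (?\<phi> (germ_monom l)) d = 0" if "d < weight w l" for l d
    by (rule torus_subst_low[OF w]) (use that in simp)
  have mono_init: "fps_nth (?\<phi> (germ_monom l)) (weight w l) = germ_const (monom_eval x l)" for l
  proof -
    have "fps_nth (?\<phi> (germ_monom l)) (weight w l) =
        germ_const (\<Sum>k | weight w k = weight w l. germ_coeff (germ_monom l) k * monom_eval x k)"
      by (rule torus_subst_initial[OF w]) simp
    also have "(\<Sum>k | weight w k = weight w l. germ_coeff (germ_monom l) k * monom_eval x k) =
        (\<Sum>k\<in>{l}. germ_coeff (germ_monom l) k * monom_eval x k)"
      by (rule sum.mono_neutral_right[OF finite_subset[OF _ finite_weight_le[OF w, of "weight w l"]]])
        (auto simp: germ_coeff_monom)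
    finally show ?thesis by (simp add: germ_coeff_monom)
  qed
  obtain b where b: "\<exists>i<p. b i \<noteq> 0" "\<forall>j<m. (\<Sum>i<p. b i * B $$ (i,j)) = 0" using left_kernel[OF B rkB] .
  from b(1) obtain i0 where i0: "i0 < p" "b i0 \<noteq> 0" by blast
  \<comment> \<open>The factor \<open>monom_eval x (k i)\<close> compensates for the complementary
    monomial: its product with \<open>monom_eval x (K i)\<close> is the same for all i, so the
    relation b between the rows at x carries over to the coefficients of order \<kappa>.\<close>
  define \<beta> where "\<beta> i = b i * monom_eval x (k i)" for i
  \<comment> \<open>The values of one linear form on the columns of A. By the relation b their
    coefficients of order \<kappa> cancel, so their order exceeds \<kappa>.\<close>
  define u where "u j = (\<Sum>i<p. germ_const (\<beta> i) * (A $$ (i,j) * germ_monom (K i)))" for j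
  interpret W: domain_valuation "torus_order w x" by (rule domain_valuation_torus_order[OF w])
  have u_big: "u j = 0 \<or> int \<kappa> < W.fract_val (to_fract (u j))" if j: "j < m" for j
  proof (cases "u j = 0")
    case False
    have nth_u: "fps_nth (?\<phi> (u j)) d = (\<Sum>i<p. germ_const (\<beta> i) * fps_nth (?\<phi> (A $$ (i,j)) * ?\<phi> (germ_monom (K i))) d)" for d
      unfolding u_def torus_subst_sum[OF w] fps_sum_nth
      by (intro sum.cong refl) (simp only: torus_subst_const_times_nth[OF w], simp only: torus_subst_mult[OF w])
    note init = fps_mult_nth_initial[of "weight w (k i)" "?\<phi> (A $$ (i,j))" "weight w (K i)" "?\<phi> (germ_monom (K i))" for i]
    have low: "fps_nth (?\<phi> (u j)) d = 0" if d: "d < \<kappa>" for d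
      unfolding nth_u
    proof (rule sum.neutral, rule ballI)
      fix i assume "i \<in> {..<p}"
      hence i: "i < p" by simp
      have "fps_nth (?\<phi> (A $$ (i,j)) * ?\<phi> (germ_monom (K i))) d = 0"
        by (rule init(2)) (use A_low[OF i j] mono_low d \<kappa>i[OF i] in auto)
      thus "germ_const (\<beta> i) * fps_nth (?\<phi> (A $$ (i,j)) * ?\<phi> (germ_monom (K i))) d = 0" by simp
    qed
    have "fps_nth (?\<phi> (u j)) \<kappa> = (\<Sum>i<p. germ_const (b i * B $$ (i,j) * monom_eval x (\<Sum>i<p. k i)))"
      unfolding nth_u
    proof (rule sum.cong[OF refl])
      fix i assume "i \<in> {..<p}"
      hence i: "i < p" by simp
      have "fps_nth (?\<phi> (A $$ (i,j)) * ?\<phi> (germ_monom (K i))) \<kappa> =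
          germ_const (B $$ (i,j)) * germ_const (monom_eval x (K i))"
        unfolding \<kappa>i[OF i]
        by (subst init(1)) (use A_low[OF i j] mono_low A_init[OF i j] mono_init in auto)
      moreover have "monom_eval x (\<Sum>i<p. k i) = monom_eval x (k i) * monom_eval x (K i)"
        using K[OF i, of "k i"] by (simp add: monom_eval_add)
      ultimately show "germ_const (\<beta> i) * fps_nth (?\<phi> (A $$ (i,j)) * ?\<phi> (germ_monom (K i))) \<kappa> =
          germ_const (b i * B $$ (i,j) * monom_eval x (\<Sum>i<p. k i))"
        by (simp add: \<beta>_def germ_const_mult mult_ac)
    qed
    also have "\<dots> = germ_const ((\<Sum>i<p. b i * B $$ (i,j)) * monom_eval x (\<Sum>i<p. k i))"
      by (simp add: sum_distrib_right flip: germ_const_sum)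
    also have "\<dots> = 0" using b(2) j by simp
    finally have "fps_nth (?\<phi> (u j)) d = 0" if "d \<le> \<kappa>" for d
      using low[of d] that by (cases "d = \<kappa>") auto
    hence "\<kappa> < torus_order w x (u j)"
      unfolding torus_order_def by (intro subdegree_greaterI torus_subst_nonzero[OF w False]) auto
    thus ?thesis using False by (simp add: W.fract_val_to_fract)
  qed simp
  \<comment> \<open>The same linear form takes h to a non-zero constant times a monomial whose order
    is exactly \<kappa>. Hence h cannot be a combination of the columns over the valuation
    ring.\<close>
  define h where "h = vec p (\<lambda>i. if i = i0 then germ_monom (k i0) else 0)"
  have h: "h \<in> carrier_vec p" by (simp add: h_def)
  have "h \<in> C0_module p ?M"
    unfolding C0_module_def
  proof (intro IntI CollectI conjI allI impI h)
    show "h \<in> Z_module p ?M" by (rule Z_module_full_rank[OF A rank h])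
    fix i assume "i < p"
    thus "h $ i \<in> newton_ideal (component_ideal ?M i)" using kP by (simp add: h_def mem_newton_ideal)
  qed
  hence "h \<in> module_closure p ?M" using sub by blast
  then obtain d where d: "d \<in> carrier_vec m" "\<forall>j<m. d $ j \<in> W.vring"
    "map_vec to_fract h = map_mat to_fract A *\<^sub>v d"
    unfolding module_closure_column_module[OF A] using W.between_vring by blast
  have hd: "to_fract (h $ i) = (\<Sum>j<m. to_fract (A $$ (i,j)) * d $ j)" if i: "i < p" for i
  proof -
    have "to_fract (h $ i) = map_vec to_fract h $ i" using i h by simp
    also have "\<dots> = (\<Sum>j<m. map_mat to_fract A $$ (i,j) * d $ j)"
      unfolding d(3) using A d(1) i by (intro mult_mat_vec_entry) auto
    also have "\<dots> = (\<Sum>j<m. to_fract (A $$ (i,j)) * d $ j)"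
      using A i by (intro sum.cong) auto
    finally show ?thesis .
  qed
  define t where "t = germ_const (\<beta> i0) * germ_monom (\<Sum>i<p. k i)"
  have mk: "germ_monom (\<Sum>i<p. k i) = germ_monom (k i0) * germ_monom (K i0)"
    using K[OF i0(1), of "k i0"] by (simp add: germ_monom_add)
  have "to_fract t = (\<Sum>i<p. to_fract (germ_const (\<beta> i) * germ_monom (K i)) * to_fract (h $ i))"
  proof -
    have "(\<Sum>i<p. to_fract (germ_const (\<beta> i) * germ_monom (K i)) * to_fract (h $ i)) =
        (\<Sum>i<p. if i = i0 then to_fract t else 0)"
      by (intro sum.cong) (auto simp: h_def t_def mk mult_ac)
    thus ?thesis using i0(1) by simp
  qed
  also have "\<dots> = (\<Sum>i<p. \<Sum>j<m. d $ j * to_fract (germ_const (\<beta> i) * (A $$ (i,j) * germ_monom (K i))))"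
    using hd by (intro sum.cong) (auto simp: sum_distrib_left mult_ac)
  also have "\<dots> = (\<Sum>j<m. to_fract (u j) * d $ j)"
    unfolding u_def by (subst sum.swap) (simp add: to_fract_sum sum_distrib_left sum_distrib_right mult.commute)
  finally have t_eq: "to_fract t = (\<Sum>j<m. to_fract (u j) * d $ j)" .
  have "\<beta> i0 \<noteq> 0" using i0(2) monom_eval_nonzero[OF torus] by (simp add: \<beta>_def)
  hence t0: "t \<noteq> 0" by (simp add: t_def)
  have "torus_order w x t = \<kappa>"
    unfolding torus_order_def
  proof (rule subdegreeI)
    show "fps_nth (?\<phi> t) \<kappa> \<noteq> 0"
      unfolding t_def torus_subst_const_times_nth[OF w] \<kappa>_def mono_init
      using \<open>\<beta> i0 \<noteq> 0\<close> monom_eval_nonzero[OF torus] by simp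
    show "fps_nth (?\<phi> t) d = 0" if "d < \<kappa>" for d
      unfolding t_def torus_subst_const_times_nth[OF w] using mono_low that by (simp add: \<kappa>_def)
  qed
  moreover have "to_fract (u j) * d $ j = 0 \<or> int \<kappa> < W.fract_val (to_fract (u j) * d $ j)" if "j \<in> {..<m}" for j
  proof (cases "u j = 0 \<or> d $ j = 0")
    case False
    moreover have "W.fract_val (d $ j) \<ge> 0" using d(2) that False by (auto simp: W.vring_def)
    ultimately show ?thesis using u_big[of j] that by (simp add: W.v_mult)
  qed auto
  from W.v_sum_greater[of "{..<m}" "\<lambda>j. to_fract (u j) * d $ j", OF this]
  have "int \<kappa> < W.fract_val (to_fract t)" unfolding t_eq[symmetric] using t0 by simp
  ultimately show False using t0 by (simp add: W.fract_val_to_fract)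
qed

section \<open>The Nullstellensatz for algebras of countable dimension\<close>

text \<open>By Zorn's lemma, with maximality in a form ready for use: every element outside P
  divides a power of z modulo P. In other words, the quotient by P becomes a field when z is
  inverted.\<close>

lemma maximal_ideal_avoiding_powers:
  fixes z :: "'a::comm_ring_1"
  assumes I: "ideal.subspace I" and z: "\<forall>N. z ^ N \<notin> I"
  obtains P where "ideal.subspace P" "I \<subseteq> P" "\<forall>N. z ^ N \<notin> P"
    "\<forall>a. a \<notin> P \<longrightarrow> (\<exists>N h p. p \<in> P \<and> z ^ N = a * h + p)"
proof -
  define \<A> where "\<A> = {J. ideal.subspace J \<and> I \<subseteq> J \<and> (\<forall>N. z ^ N \<notin> J)}"
  have "I \<in> \<A>" using assms by (simp add: \<A>_def)
  hence "\<A> \<noteq> {}" by blast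
  moreover have "\<Union>\<C> \<in> \<A>" if ne: "\<C> \<noteq> {}" and chain: "subset.chain \<A> \<C>" for \<C>
  proof -
    have sub: "J \<in> \<A>" if "J \<in> \<C>" for J using chain that by (auto simp: subset_chain_def)
    have "ideal.subspace (\<Union>\<C>)"
    proof (rule ideal.subspaceI)
      show "0 \<in> \<Union>\<C>" using ne sub by (auto simp: \<A>_def intro: ideal.subspace_0)
      fix x y assume "x \<in> \<Union>\<C>" "y \<in> \<Union>\<C>"
      then obtain J K where JK: "J \<in> \<C>" "K \<in> \<C>" "x \<in> J" "y \<in> K" by blast
      hence "J \<subseteq> K \<or> K \<subseteq> J" using chain by (auto simp: subset_chain_def)
      then obtain L where "L \<in> \<C>" "x \<in> L" "y \<in> L" using JK by blast
      moreover from this have "ideal.subspace L" using sub by (simp add: \<A>_def)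
      ultimately show "x + y \<in> \<Union>\<C>" using ideal.subspace_add by blast
    next
      fix c x assume "x \<in> \<Union>\<C>"
      then obtain J where "J \<in> \<C>" "x \<in> J" by blast
      moreover from this have "ideal.subspace J" using sub by (simp add: \<A>_def)
      ultimately show "c * x \<in> \<Union>\<C>" using ideal.subspace_scale by blast
    qed
    moreover have "I \<subseteq> \<Union>\<C>" using ne sub by (auto simp: \<A>_def)
    moreover have "\<forall>N. z ^ N \<notin> \<Union>\<C>" using sub by (auto simp: \<A>_def)
    ultimately show ?thesis by (simp add: \<A>_def)
  qed
  ultimately obtain P where P: "P \<in> \<A>" "\<forall>X\<in>\<A>. P \<subseteq> X \<longrightarrow> X = P"
    using subset_Zorn_nonempty[of \<A>] by blast
  have subP: "ideal.subspace P" using P(1) by (simp add: \<A>_def)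
  have "\<exists>N h p. p \<in> P \<and> z ^ N = a * h + p" if a: "a \<notin> P" for a
  proof (rule ccontr)
    assume no: "\<not> (\<exists>N h p. p \<in> P \<and> z ^ N = a * h + p)"
    define X where "X = {a * h + p | h p. p \<in> P}"
    have PX: "P \<subseteq> X" 
    proof
      fix p assume p: "p \<in> P"
      have "p = a * 0 + p" by simp
      thus "p \<in> X" unfolding X_def using p by blast
    qed
    have "a = a * 1 + 0" by simp
    hence aX: "a \<in> X" unfolding X_def using ideal.subspace_0[OF subP] by blast
    have "ideal.subspace X"
    proof (rule ideal.subspaceI)
      show "0 \<in> X" using PX ideal.subspace_0[OF subP] by blast
      fix x y assume "x \<in> X" "y \<in> X"
      then obtain h p h' p' where "x = a * h + p" "y = a * h' + p'" "p \<in> P" "p' \<in> P"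
        unfolding X_def by blast
      hence "x + y = a * (h + h') + (p + p')" "p + p' \<in> P"
        using ideal.subspace_add[OF subP] by (simp_all add: algebra_simps)
      thus "x + y \<in> X" unfolding X_def by blast
    next
      fix c x assume "x \<in> X"
      then obtain h p where "x = a * h + p" "p \<in> P" unfolding X_def by blast
      hence "c * x = a * (c * h) + c * p" "c * p \<in> P"
        using ideal.subspace_scale[OF subP, of p c] by (simp_all add: distrib_left mult.left_commute)
      thus "c * x \<in> X" unfolding X_def by blast
    qed
    moreover have "\<forall>N. z ^ N \<notin> X" using no by (auto simp: X_def)
    ultimately have "X \<in> \<A>" using P(1) PX by (auto simp: \<A>_def)
    with P(2) PX aX a show False by blast
  qed
  thus ?thesis using that[of P] P(1) by (simp add: \<A>_def)
qed

lemma avoiding_ideal_prime: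
  assumes P: "ideal.subspace P" "\<forall>N. z ^ N \<notin> P"
    and max: "\<forall>a. a \<notin> P \<longrightarrow> (\<exists>N h p. p \<in> P \<and> z ^ N = a * h + p)"
    and ab: "a * b \<in> P"
  shows "a \<in> P \<or> b \<in> P"
proof (rule ccontr)
  assume "\<not> ?thesis"
  then obtain m h p n h' p' where hp: "p \<in> P" "z ^ m = a * h + p" "p' \<in> P" "z ^ n = b * h' + p'"
    using max by blast
  have "z ^ (m + n) = (h * h') * (a * b) + ((b * h' + p') * p + (a * h) * p')"
    unfolding power_add hp(2,4) by (simp add: algebra_simps)
  also have "\<dots> \<in> P"
    by (intro ideal.subspace_add[OF P(1)] ideal.subspace_scale[OF P(1)] hp(1,3) ab)
  finally show False using P(2) by blast
qed

text \<open>The complex numbers are algebraically closed: a polynomial relation of f modulo a prime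
  ideal splits into linear factors, one of which lies in the ideal.\<close>

lemma linear_factor_in_prime:
  fixes \<iota> :: "complex \<Rightarrow> 'a::comm_ring_1"
  assumes \<iota>: "comm_ring_hom \<iota>" and P: "ideal.subspace P" "1 \<notin> P"
    and prime: "\<And>a b. a * b \<in> P \<Longrightarrow> a \<in> P \<or> b \<in> P"
  shows "q \<noteq> 0 \<Longrightarrow> poly (map_poly \<iota> q) f \<in> P \<Longrightarrow> \<exists>\<mu>. f - \<iota> \<mu> \<in> P"
proof (induction "degree q" arbitrary: q rule: less_induct)
  case less
  interpret comm_ring_hom \<iota> by (rule \<iota>)
  interpret mp: map_poly_comm_ring_hom \<iota> ..
  show ?case
  proof (cases "\<exists>a. q = [:a:]")
    case True
    then obtain a where a: "q = [:a:]" ..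
    hence "a \<noteq> 0" using less.prems(1) by simp
    have "\<iota> a \<in> P" using less.prems(2) unfolding a by (simp add: hom_distribs)
    hence "\<iota> (1 / a) * \<iota> a \<in> P" by (rule ideal.subspace_scale[OF P(1)])
    hence False using P(2) \<open>a \<noteq> 0\<close> by (simp flip: hom_mult)
    thus ?thesis ..
  next
    case False
    then obtain \<mu> where "poly q \<mu> = 0" using fundamental_theorem_of_algebra_alt[of q] by auto
    then obtain q' where q': "q = [:-\<mu>, 1:] * q'" unfolding poly_eq_0_iff_dvd by (elim dvdE)
    hence nz: "q' \<noteq> 0" using less.prems(1) by auto
    have "degree q = Suc (degree q')" unfolding q' using nz by (subst degree_mult_eq) auto
    moreover have "poly (map_poly \<iota> q) f = (f - \<iota> \<mu>) * poly (map_poly \<iota> q') f"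
      unfolding q' mp.hom_mult by (simp add: hom_distribs left_diff_distrib)
    ultimately show ?thesis using less.hyps[of q'] less.prems(2) prime nz by (metis lessI)
  qed
qed

lemma infinite_fibre:
  fixes f :: "'a \<Rightarrow> 'b::countable"
  assumes "uncountable (UNIV :: 'a set)"
  shows "\<exists>y. infinite {x. f x = y}"
proof (rule ccontr)
  assume "\<not> ?thesis"
  hence "countable {x. f x = y}" for y by (auto intro: countable_finite)
  hence "countable (\<Union>y\<in>UNIV. {x. f x = y})" by (intro countable_UN) auto
  moreover have "(\<Union>y\<in>UNIV. {x. f x = y}) = UNIV" by auto
  ultimately show False using assms by simp
qed

text \<open>If f were congruent to no scalar modulo P, each f - \<mu> would be invertible modulo P
  up to a power of z. These inverses form an uncountable family in a space of countable dimension,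
  and a linear relation between them makes f algebraic modulo P.\<close>

lemma character_exists:
  fixes \<iota> :: "complex \<Rightarrow> 'a::comm_ring_1"
  assumes \<iota>: "comm_ring_hom \<iota>"
    and span: "\<And>f. \<exists>k c. f = (\<Sum>i<(k::nat). \<iota> (c i) * B i)"
    and I: "ideal.subspace I" and z: "\<forall>N. z ^ N \<notin> I"
  obtains \<psi> :: "'a \<Rightarrow> complex" where "\<forall>f g. \<psi> (f + g) = \<psi> f + \<psi> g" "\<forall>f g. \<psi> (f * g) = \<psi> f * \<psi> g"
    "\<forall>c. \<psi> (\<iota> c) = c" "\<forall>f\<in>I. \<psi> f = 0" "\<psi> z \<noteq> 0"
proof -
  interpret comm_ring_hom \<iota> by (rule \<iota>)
  interpret mp: map_poly_comm_ring_hom \<iota> ..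
  obtain P where P: "ideal.subspace P" "I \<subseteq> P" "\<forall>N. z ^ N \<notin> P"
    and max: "\<forall>a. a \<notin> P \<longrightarrow> (\<exists>N h p. p \<in> P \<and> z ^ N = a * h + p)"
    using maximal_ideal_avoiding_powers[OF I z] .
  note add = ideal.subspace_add[OF P(1)] and scale = ideal.subspace_scale[OF P(1)]
  have prime: "a \<in> P \<or> b \<in> P" if "a * b \<in> P" for a b by (rule avoiding_ideal_prime[OF P(1,3) max that])
  have P1: "1 \<notin> P" using P(3) by (metis power_0)
  have ex: "\<exists>\<mu>. f - \<iota> \<mu> \<in> P" for f
  proof (rule ccontr)
    assume "\<not> ?thesis"
    hence "\<forall>\<mu>. \<exists>N h p. p \<in> P \<and> z ^ N = (f - \<iota> \<mu>) * h + p" using max by blast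
    then obtain N h p where hp: "\<And>\<mu>. p \<mu> \<in> P" "\<And>\<mu>. z ^ N \<mu> = (f - \<iota> \<mu>) * h \<mu> + p \<mu>" by metis
    have "\<forall>\<mu>. \<exists>k c. h \<mu> = (\<Sum>i<(k::nat). \<iota> (c i) * B i)" using span by blast
    then obtain k c where h: "\<And>\<mu>. h \<mu> = (\<Sum>i<k \<mu>. \<iota> (c \<mu> i) * B i)" by metis
    \<comment> \<open>The exponents of z and the lengths of the expansions take countably many
      values, so infinitely many \<mu> share both.\<close>
    obtain y where inf: "infinite {\<mu>. (N \<mu>, k \<mu>) = y}"
      using infinite_fibre[OF uncountable_UNIV_complex, of "\<lambda>\<mu>. (N \<mu>, k \<mu>)"] ..
    obtain M K where y: "y = (M, K)" by (cases y)
    \<comment> \<open>One element more than there are coordinates, so that a linear relation between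
      the inverses exists.\<close>
    obtain U where U: "finite U" "card U = Suc K" "U \<subseteq> {\<mu>. (N \<mu>, k \<mu>) = y}"
      using infinite_arbitrarily_large[OF inf] by blast
    hence NU: "N \<mu> = M" "k \<mu> = K" if "\<mu> \<in> U" for \<mu> using that y by auto
    obtain a where a: "\<exists>u\<in>U. a u \<noteq> 0" "\<forall>i\<in>{..<K}. (\<Sum>u\<in>U. c u i * a u) = 0"
      by (rule underdetermined_system[of "{..<K}" U "\<lambda>i u. c u i"]) (use U in auto)
    have dep: "(\<Sum>u\<in>U. \<iota> (a u) * h u) = 0"
    proof -
      have "(\<Sum>u\<in>U. \<iota> (a u) * h u) = (\<Sum>u\<in>U. \<Sum>i<K. \<iota> (c u i * a u) * B i)"
        by (intro sum.cong refl) (simp add: h NU sum_distrib_left hom_mult mult_ac)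
      also have "\<dots> = (\<Sum>i<K. \<iota> (\<Sum>u\<in>U. c u i * a u) * B i)"
        by (subst sum.swap) (simp add: hom_sum sum_distrib_right)
      also have "\<dots> = 0" using a(2) by simp
      finally show ?thesis .
    qed
    define D where "D u = (\<Prod>v\<in>U - {u}. f - \<iota> v)" for u
    \<comment> \<open>The numerator of the partial fraction
      \<open>\<Sum>u\<in>U. a u / (X - u)\<close>. It is not zero, because only the term of
      \<open>u0\<close> survives at \<open>u0\<close>.\<close>
    define q where "q = (\<Sum>u\<in>U. Polynomial.smult (a u) (\<Prod>v\<in>U - {u}. [:-v, 1:]))"
    have ev: "poly (map_poly \<iota> q) f = (\<Sum>u\<in>U. \<iota> (a u) * D u)"
      unfolding q_def D_def mp.hom_sum poly_sum
      by (intro sum.cong refl) (simp add: hom_distribs mp.hom_prod poly_prod)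
    obtain u0 where u0: "u0 \<in> U" "a u0 \<noteq> 0" using a(1) by blast
    have "poly q u0 = (\<Sum>u\<in>U. a u * (\<Prod>v\<in>U - {u}. u0 - v))"
      unfolding q_def poly_sum by (simp add: poly_prod)
    also have "\<dots> = (\<Sum>u\<in>U. if u = u0 then a u0 * (\<Prod>v\<in>U - {u0}. u0 - v) else 0)"
    proof (intro sum.cong refl)
      fix u assume u: "u \<in> U"
      have "(\<Prod>v\<in>U - {u}. u0 - v) = 0" if "u \<noteq> u0"
        using U(1) u0(1) that by (intro prod_zero) auto
      thus "a u * (\<Prod>v\<in>U - {u}. u0 - v) = (if u = u0 then a u0 * (\<Prod>v\<in>U - {u0}. u0 - v) else 0)" by auto
    qed
    also have "\<dots> \<noteq> 0" using U(1) u0 by simp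
    finally have "q \<noteq> 0" by auto
    \<comment> \<open>Modulo P, \<open>z ^ M\<close> times the value of q at f is the product of all
      f - v times the vanishing linear combination of the inverses. Since P is prime and contains no
      power of z, the value itself lies in P.\<close>
    have "z ^ M * (\<Sum>u\<in>U. \<iota> (a u) * D u) = (\<Sum>u\<in>U. \<iota> (a u) * (z ^ N u * D u))"
      unfolding sum_distrib_left by (intro sum.cong refl) (simp add: NU mult_ac)
    also have "\<dots> = (\<Sum>u\<in>U. (\<Prod>v\<in>U. f - \<iota> v) * (\<iota> (a u) * h u) + (\<iota> (a u) * D u) * p u)"
    proof (intro sum.cong refl)
      fix u assume u: "u \<in> U"
      have "(\<Prod>v\<in>U. f - \<iota> v) = (f - \<iota> u) * D u" unfolding D_def by (rule prod.remove[OF U(1) u])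
      thus "\<iota> (a u) * (z ^ N u * D u) = (\<Prod>v\<in>U. f - \<iota> v) * (\<iota> (a u) * h u) + (\<iota> (a u) * D u) * p u"
        unfolding hp(2) by (simp only: distrib_left distrib_right mult_ac)
    qed
    also have "\<dots> = (\<Prod>v\<in>U. f - \<iota> v) * (\<Sum>u\<in>U. \<iota> (a u) * h u) + (\<Sum>u\<in>U. (\<iota> (a u) * D u) * p u)"
      by (simp add: sum.distrib sum_distrib_left)
    also have "\<dots> \<in> P" unfolding dep using hp(1) by (auto intro!: ideal.subspace_sum[OF P(1)] scale)
    finally have "poly (map_poly \<iota> q) f \<in> P" unfolding ev using prime P(3) by blast
    from linear_factor_in_prime[OF \<iota> P(1) P1 prime \<open>q \<noteq> 0\<close> this] \<open>\<not> ?thesis\<close> show False by blast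
  qed
  then obtain \<psi> where \<psi>: "\<And>f. f - \<iota> (\<psi> f) \<in> P" by metis
  have unique: "\<mu> = \<nu>" if "f - \<iota> \<mu> \<in> P" "f - \<iota> \<nu> \<in> P" for f \<mu> \<nu>
  proof (rule ccontr)
    assume "\<mu> \<noteq> \<nu>"
    have "(f - \<iota> \<nu>) - (f - \<iota> \<mu>) \<in> P" using that by (rule ideal.subspace_diff[OF P(1), rotated])
    hence "\<iota> (1 / (\<mu> - \<nu>)) * \<iota> (\<mu> - \<nu>) \<in> P" by (intro scale) (simp add: hom_minus)
    thus False using P1 \<open>\<mu> \<noteq> \<nu>\<close> by (simp flip: hom_mult)
  qed
  show ?thesis
  proof (rule that[of \<psi>]; (intro allI ballI)?)
    fix f g
    have "(f + g) - \<iota> (\<psi> f + \<psi> g) = (f - \<iota> (\<psi> f)) + (g - \<iota> (\<psi> g))" by (simp add: hom_add)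
    also have "\<dots> \<in> P" by (intro add \<psi>)
    finally show "\<psi> (f + g) = \<psi> f + \<psi> g" by (rule unique[OF \<psi>])
    have "f * g - \<iota> (\<psi> f * \<psi> g) = g * (f - \<iota> (\<psi> f)) + \<iota> (\<psi> f) * (g - \<iota> (\<psi> g))"
      by (simp add: hom_mult algebra_simps)
    also have "\<dots> \<in> P" by (intro add scale \<psi>)
    finally show "\<psi> (f * g) = \<psi> f * \<psi> g" by (rule unique[OF \<psi>])
  next
    fix c show "\<psi> (\<iota> c) = c" by (rule unique[OF \<psi>]) (simp add: ideal.subspace_0[OF P(1)])
  next
    fix f assume "f \<in> I"
    thus "\<psi> f = 0" using P(2) by (intro unique[OF \<psi>]) auto
  next
    show "\<psi> z \<noteq> 0"
    proof
      assume "\<psi> z = 0"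
      hence "z ^ 1 \<in> P" using \<psi>[of z] by simp
      thus False using P(3) by blast
    qed
  qed
qed

section \<open>Generators of powers of a monomial ideal\<close>

lemma finite_multisets: "finite E \<Longrightarrow> finite {A. set_mset A \<subseteq> E \<and> size A = d}"
proof -
  assume E: "finite E"
  have "{A. set_mset A \<subseteq> E \<and> size A = d} \<subseteq> mset ` {xs. set xs \<subseteq> E \<and> length xs = d}"
  proof
    fix A assume A: "A \<in> {A. set_mset A \<subseteq> E \<and> size A = d}"
    obtain xs where "A = mset xs" by (metis ex_mset)
    thus "A \<in> mset ` {xs. set xs \<subseteq> E \<and> length xs = d}" using A by auto
  qed
  thus ?thesis using finite_lists_length_eq[OF E] finite_surj by blast
qed

lemma poly_mapping_sum_single:
  "f = (\<Sum>A\<in>Poly_Mapping.keys f. Poly_Mapping.single A (Poly_Mapping.lookup f A))"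
proof (rule poly_mapping_eqI)
  fix B
  have "(\<Sum>A\<in>Poly_Mapping.keys f. Poly_Mapping.lookup (Poly_Mapping.single A (Poly_Mapping.lookup f A)) B) =
      (\<Sum>A\<in>Poly_Mapping.keys f. if A = B then Poly_Mapping.lookup f B else 0)"
    by (intro sum.cong refl) (auto simp: lookup_single when_def)
  thus "Poly_Mapping.lookup f B =
      Poly_Mapping.lookup (\<Sum>A\<in>Poly_Mapping.keys f. Poly_Mapping.single A (Poly_Mapping.lookup f A)) B"
    by (simp add: lookup_sum in_keys_iff)
qed

text \<open>Multisets serve as monomials of a polynomial ring with countably many variables. They
  are enumerated through lists, and \<open>idx\<close> fixes one list for each of them.\<close>

lemma poly_mapping_countable_span:
  fixes f :: "'a::countable multiset \<Rightarrow>\<^sub>0 'b::comm_ring_1"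
  shows "\<exists>k c. f = (\<Sum>i<k. Poly_Mapping.single 0 (c i) * Poly_Mapping.single (mset (from_nat i)) 1)"
proof -
  let ?K = "Poly_Mapping.keys f" and ?l = "Poly_Mapping.lookup f"
  have "\<exists>xs. mset xs = A" for A :: "'a multiset" by (rule ex_mset)
  then obtain list where list: "mset (list A) = A" for A :: "'a multiset" by metis
  define idx where "idx A = to_nat (list A)" for A
  have idx: "mset (from_nat (idx A)) = A" for A by (simp add: idx_def list)
  have inj: "inj_on idx ?K" by (rule inj_onI) (metis idx)
  define k where "k = Suc (Max (idx ` ?K))"
  define c where "c i = (if i \<in> idx ` ?K then ?l (mset (from_nat i)) else 0)" for i
  have "(\<Sum>i<k. Poly_Mapping.single 0 (c i) * Poly_Mapping.single (mset (from_nat i)) 1) =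
      (\<Sum>i\<in>idx ` ?K. Poly_Mapping.single 0 (c i) * Poly_Mapping.single (mset (from_nat i)) 1)"
  proof (rule sum.mono_neutral_right)
    show "idx ` ?K \<subseteq> {..<k}" unfolding k_def using Max_ge[of "idx ` ?K"] by (auto simp: less_Suc_eq_le)
  qed (auto simp: c_def)
  also have "\<dots> = (\<Sum>A\<in>?K. Poly_Mapping.single A (?l A))"
    unfolding sum.reindex[OF inj] by (intro sum.cong refl) (simp add: c_def idx mult_single)
  also have "\<dots> = f" by (rule poly_mapping_sum_single[symmetric])
  finally show ?thesis by metis
qed

text \<open>
  In degree \<open>d\<close> this is \<open>(G) J\<^sup>d\<^sup>-\<^sup>1 + \<mm> J\<^sup>d\<close>, where \<open>J\<close> is generated by the monomials with exponents
  in \<open>E\<close>.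
\<close>

definition fibre_ideal :: "(nat^'n::finite) set \<Rightarrow> 'n germ set \<Rightarrow> nat \<Rightarrow> 'n germ set" where
  "fibre_ideal E G d = ideal.span
     ({g * germ_monom (sum_mset A) | g A. g \<in> G \<and> set_mset A \<subseteq> E \<and> Suc (size A) = d} \<union>
      {germ_monom (sum_mset A + l) | A l. l \<noteq> 0 \<and> set_mset A \<subseteq> E \<and> size A = d})"

lemma subspace_fibre_ideal: "ideal.subspace (fibre_ideal E G d)"
  unfolding fibre_ideal_def by (rule ideal.subspace_span)

lemma fibre_ideal_generator:
  "g \<in> G \<Longrightarrow> set_mset A \<subseteq> E \<Longrightarrow> Suc (size A) = d \<Longrightarrow> g * germ_monom (sum_mset A) \<in> fibre_ideal E G d"
  unfolding fibre_ideal_def by (rule ideal.span_base) blast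

lemma fibre_ideal_nonminimal:
  "l \<noteq> 0 \<Longrightarrow> set_mset A \<subseteq> E \<Longrightarrow> size A = d \<Longrightarrow> germ_monom (sum_mset A + l) \<in> fibre_ideal E G d"
  unfolding fibre_ideal_def by (rule ideal.span_base) blast

lemma fibre_ideal_mult:
  assumes f: "f \<in> fibre_ideal E G d" and B: "set_mset B \<subseteq> E"
  shows "f * germ_monom (sum_mset B) \<in> fibre_ideal E G (d + size B)"
proof -
  note N = subspace_fibre_ideal[of E G "d + size B"]
  from f[unfolded fibre_ideal_def] show ?thesis
  proof (induction rule: ideal.span_induct_alt)
    case base
    show ?case using ideal.subspace_0[OF N] by simp
  next
    case (step c x y)
    have "x * germ_monom (sum_mset B) \<in> fibre_ideal E G (d + size B)"
      using step(1)
    proof (elim UnE CollectE exE conjE)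
      fix g A assume g: "x = g * germ_monom (sum_mset A)" "g \<in> G" "set_mset A \<subseteq> E" "Suc (size A) = d"
      have "g * germ_monom (sum_mset (A + B)) \<in> fibre_ideal E G (d + size B)"
        by (rule fibre_ideal_generator) (use g B in auto)
      thus ?thesis by (simp add: g(1) germ_monom_add mult_ac)
    next
      fix A l assume l: "x = germ_monom (sum_mset A + l)" "l \<noteq> 0" "set_mset A \<subseteq> E" "size A = d"
      have "germ_monom (sum_mset (A + B) + l) \<in> fibre_ideal E G (d + size B)"
        by (rule fibre_ideal_nonminimal) (use l B in auto)
      thus ?thesis by (simp add: l(1) germ_monom_add mult_ac)
    qed
    hence "c * (x * germ_monom (sum_mset B)) + y * germ_monom (sum_mset B) \<in> fibre_ideal E G (d + size B)"
      by (intro ideal.subspace_add[OF N ideal.subspace_scale[OF N] step(2)])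
    thus ?case by (simp add: distrib_right mult.assoc)
  qed
qed

text \<open>Outside E an exponent of g is a proper multiple of an element of E, so the remaining
  terms belong to the product of J with the maximal ideal.\<close>

lemma initial_form_congruence:
  fixes g :: "'n::finite germ"
  assumes E: "finite E" and g: "\<forall>k\<in>supp g. \<exists>e\<in>E. \<forall>i. e $h i \<le> k $h i"
    and b: "set_mset b \<subseteq> E" "Suc (size b) = d"
  shows "(g - (\<Sum>e\<in>E. germ_const (germ_coeff g e) * germ_monom e)) * germ_monom (sum_mset b) \<in> fibre_ideal E G d"
proof -
  note N = subspace_fibre_ideal[of E G d]
  define h where "h = g - (\<Sum>e\<in>E. germ_const (germ_coeff g e) * germ_monom e)"
  have coeff_h: "germ_coeff h k = (if k \<in> E then 0 else germ_coeff g k)" for k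
  proof -
    have "(\<Sum>e\<in>E. germ_coeff (germ_const (germ_coeff g e) * germ_monom e) k) =
        (\<Sum>e\<in>E. if e = k then germ_coeff g k else 0)"
      by (intro sum.cong refl) (auto simp: germ_coeff_monom)
    thus ?thesis using E by (simp add: h_def germ_coeff_sum)
  qed
  obtain F where F: "finite F" "F \<subseteq> supp h" "\<forall>k\<in>supp h. \<exists>e\<in>F. \<forall>i. e $h i \<le> k $h i"
    by (rule dickson[of "supp h"])
  obtain q where q: "h = (\<Sum>k\<in>F. q k * germ_monom k)"
    using germ_division[OF F(1,3)] by metis
  have "q k * germ_monom k * germ_monom (sum_mset b) \<in> fibre_ideal E G d" if k: "k \<in> F" for k
  proof -
    have "germ_coeff h k \<noteq> 0" using k F(2) by (auto simp: supp_def)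
    hence kE: "k \<notin> E" "k \<in> supp g" by (auto simp: coeff_h supp_def split: if_splits)
    then obtain e where e: "e \<in> E" "\<forall>i. e $h i \<le> k $h i" using g by blast
    have ke: "k = e + (k - e)" using e(2) by (simp add: Finite_Cartesian_Product.vec_eq_iff)
    hence "k - e \<noteq> 0" using kE(1) e(1) by auto
    hence "germ_monom (sum_mset (add_mset e b) + (k - e)) \<in> fibre_ideal E G d"
      by (rule fibre_ideal_nonminimal) (use e b in auto)
    also have "sum_mset (add_mset e b) + (k - e) = k + sum_mset b" by (subst (2) ke) (simp add: add_ac)
    finally have "q k * germ_monom (k + sum_mset b) \<in> fibre_ideal E G d" by (rule ideal.subspace_scale[OF N])
    thus ?thesis by (simp add: germ_monom_add mult.assoc)
  qed
  thus ?thesis unfolding h_def[symmetric] q sum_distrib_right by (rule ideal.subspace_sum[OF N])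
qed

text \<open>The character is constructed on a polynomial ring whose variables are exponents, by
  means of an ideal that contains the relations of the fibre cone. The conclusions list what these
  relations mean for the values c: dependence on degree and total exponent only, vanishing on
  non-minimal products, and vanishing of the initial forms of G.\<close>

lemma fibre_cone_character:
  fixes E :: "(nat^'n::finite) set"
  assumes E: "finite E" and G: "\<forall>g\<in>G. \<forall>k\<in>supp g. \<exists>e\<in>E. \<forall>i. e $h i \<le> k $h i"
    and e0: "e0 \<in> E" "\<forall>N. germ_monom (sum_mset (replicate_mset N e0)) \<notin> fibre_ideal E G N"
  obtains c :: "nat^'n \<Rightarrow> complex" where "c e0 \<noteq> 0"
    "\<forall>A B. set_mset A \<subseteq> E \<longrightarrow> set_mset B \<subseteq> E \<longrightarrow> size A = size B \<longrightarrow> sum_mset A = sum_mset B \<longrightarrow>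
       prod_mset (image_mset c A) = prod_mset (image_mset c B)"
    "\<forall>A B l. set_mset A \<subseteq> E \<longrightarrow> set_mset B \<subseteq> E \<longrightarrow> size A = size B \<longrightarrow> sum_mset A = sum_mset B + l \<longrightarrow> l \<noteq> 0 \<longrightarrow>
       prod_mset (image_mset c A) = 0"
    "\<forall>g\<in>G. (\<Sum>e\<in>E. germ_coeff g e * c e) = 0"
proof -
  let ?s = "Poly_Mapping.single :: (nat^'n) multiset \<Rightarrow> complex \<Rightarrow> _"
  define D where "D d = {A :: (nat^'n) multiset. set_mset A \<subseteq> E \<and> size A = d}" for d
  have finD: "finite (D d)" for d unfolding D_def by (rule finite_multisets[OF E])
  \<comment> \<open>Evaluates the part of degree d in germs, replacing each variable by its
    monomial. Other degrees and monomials with variables outside E are sent to 0.\<close>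
  define \<Phi> where "\<Phi> d f = (\<Sum>A\<in>D d. germ_const (Poly_Mapping.lookup f A) * germ_monom (sum_mset A))" for d f
  have \<Phi>_add: "\<Phi> d (f + g) = \<Phi> d f + \<Phi> d g" for d f g
    by (simp add: \<Phi>_def lookup_add germ_const_add distrib_right sum.distrib)
  have \<Phi>_0: "\<Phi> d 0 = 0" for d by (simp add: \<Phi>_def)
  have \<Phi>_sum: "\<Phi> d (sum F I) = (\<Sum>i\<in>I. \<Phi> d (F i))" for d F and I :: "'i set"
    by (induction I rule: infinite_finite_induct) (simp_all add: \<Phi>_add \<Phi>_0)
  have \<Phi>_single: "\<Phi> d (?s A \<gamma>) = (if A \<in> D d then germ_const \<gamma> * germ_monom (sum_mset A) else 0)" for d A \<gamma>
  proof -
    have "\<Phi> d (?s A \<gamma>) = (\<Sum>B\<in>D d. if B = A then germ_const \<gamma> * germ_monom (sum_mset A) else 0)"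
      unfolding \<Phi>_def by (intro sum.cong refl) (auto simp: lookup_single when_def)
    thus ?thesis using finD by simp
  qed
  \<comment> \<open>The largest ideal mapped into \<open>fibre_ideal\<close> in every degree; the
    condition on all monomial multiples makes it closed under multiplication.\<close>
  define \<aa> where "\<aa> = {f. \<forall>b \<gamma> d. \<Phi> d (?s b \<gamma> * f) \<in> fibre_ideal E G d}"
  note N = subspace_fibre_ideal[of E G]
  have "ideal.subspace \<aa>"
  proof (rule ideal.subspaceI)
    show "0 \<in> \<aa>" using ideal.subspace_0[OF N] by (simp add: \<aa>_def \<Phi>_0)
    show "f + g \<in> \<aa>" if "f \<in> \<aa>" "g \<in> \<aa>" for f g
      using that ideal.subspace_add[OF N] by (simp add: \<aa>_def \<Phi>_add distrib_left)
    fix c f assume f: "f \<in> \<aa>"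
    have "\<Phi> d (?s b \<gamma> * (c * f)) \<in> fibre_ideal E G d" for b \<gamma> d
    proof -
      have "?s b \<gamma> * (c * f) = ?s b \<gamma> * (\<Sum>A\<in>Poly_Mapping.keys c. ?s A (Poly_Mapping.lookup c A)) * f"
        by (simp add: mult.assoc flip: poly_mapping_sum_single)
      also have "\<dots> = (\<Sum>A\<in>Poly_Mapping.keys c. ?s (b + A) (\<gamma> * Poly_Mapping.lookup c A) * f)"
        by (simp add: sum_distrib_left sum_distrib_right mult_single)
      finally show ?thesis
        using f by (auto simp: \<Phi>_sum \<aa>_def intro!: ideal.subspace_sum[OF N])
    qed
    thus "c * f \<in> \<aa>" by (simp add: \<aa>_def)
  qed
  have pow: "?s {#e0#} 1 ^ k = ?s (replicate_mset k e0) 1" for k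
    by (induction k) (simp_all add: mult_single)
  have "\<forall>k. ?s {#e0#} 1 ^ k \<notin> \<aa>"
  proof (intro allI notI)
    fix k assume "?s {#e0#} 1 ^ k \<in> \<aa>"
    hence "\<Phi> k (?s 0 1 * ?s (replicate_mset k e0) 1) \<in> fibre_ideal E G k" unfolding pow \<aa>_def by blast
    moreover have "replicate_mset k e0 \<in> D k" using e0(1) by (auto simp: D_def)
    ultimately show False using e0(2) by (simp add: mult_single \<Phi>_single)
  qed
  note not_power = this
  have \<iota>: "comm_ring_hom (?s 0)"
    by unfold_locales (simp_all add: single_add mult_single)
  obtain \<psi> :: "_ \<Rightarrow> complex" where \<psi>: "\<forall>f g. \<psi> (f + g) = \<psi> f + \<psi> g" "\<forall>f g. \<psi> (f * g) = \<psi> f * \<psi> g"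
    "\<forall>c. \<psi> (?s 0 c) = c" "\<forall>f\<in>\<aa>. \<psi> f = 0" "\<psi> (?s {#e0#} 1) \<noteq> 0"
    by (rule character_exists[OF \<iota> poly_mapping_countable_span \<open>ideal.subspace \<aa>\<close> not_power])
  define c where "c e = \<psi> (?s {#e#} 1)" for e
  have \<psi>_1: "\<psi> (?s A 1) = prod_mset (image_mset c A)" for A
  proof (induction A)
    case empty
    show ?case using spec[OF \<psi>(3), of 1] by simp
  next
    case (add x A)
    have "?s (add_mset x A) 1 = ?s {#x#} 1 * ?s A 1" by (simp add: mult_single)
    thus ?case using add \<psi>(2) by (simp add: c_def)
  qed
  have \<psi>_single: "\<psi> (?s A \<gamma>) = \<gamma> * prod_mset (image_mset c A)" for A \<gamma>
  proof -
    have "?s A \<gamma> = ?s 0 \<gamma> * ?s A 1" by (simp add: mult_single)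
    thus ?thesis using \<psi>(2,3) \<psi>_1 by simp
  qed
  show ?thesis
  proof (rule that[of c]; (intro allI impI ballI)?)
    show "c e0 \<noteq> 0" using \<psi>(5) by (simp add: c_def)
  next
    fix A B :: "(nat^'n) multiset"
    assume AB: "set_mset A \<subseteq> E" "set_mset B \<subseteq> E" "size A = size B" "sum_mset A = sum_mset B"
    have "\<Phi> d (?s b \<gamma> * (?s A 1 + ?s B (-1))) = 0" for b \<gamma> d
    proof -
      have "b + A \<in> D d \<longleftrightarrow> b + B \<in> D d" using AB by (auto simp: D_def)
      moreover have "germ_const \<gamma> + germ_const (- \<gamma>) = (0 :: 'n germ)" by (simp flip: germ_const_add)
      hence "germ_const \<gamma> * f + germ_const (- \<gamma>) * f = 0" for f :: "'n germ"
        by (metis distrib_right mult_zero_left)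
      ultimately show ?thesis
        using AB(4) by (simp add: distrib_left mult_single \<Phi>_add \<Phi>_single)
    qed
    hence "?s A 1 + ?s B (-1) \<in> \<aa>" using ideal.subspace_0[OF N] by (simp add: \<aa>_def)
    hence "\<psi> (?s A 1 + ?s B (-1)) = 0" using \<psi>(4) by blast
    thus "prod_mset (image_mset c A) = prod_mset (image_mset c B)" using \<psi>(1) by (simp add: \<psi>_single)
  next
    fix A B :: "(nat^'n) multiset" and l
    assume AB: "set_mset A \<subseteq> E" "set_mset B \<subseteq> E" "size A = size B" "sum_mset A = sum_mset B + l" "l \<noteq> 0"
    have "\<Phi> d (?s b \<gamma> * ?s A 1) \<in> fibre_ideal E G d" for b \<gamma> d
    proof (cases "b + A \<in> D d")
      case True
      hence "germ_monom (sum_mset (b + B) + l) \<in> fibre_ideal E G d"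
        using AB by (intro fibre_ideal_nonminimal) (auto simp: D_def)
      hence "germ_const \<gamma> * germ_monom (sum_mset (b + A)) \<in> fibre_ideal E G d"
        using AB(4) by (intro ideal.subspace_scale[OF N]) (simp add: add_ac)
      thus ?thesis using True by (simp add: mult_single \<Phi>_single)
    qed (simp add: mult_single \<Phi>_single ideal.subspace_0[OF N])
    hence "\<psi> (?s A 1) = 0" using \<psi>(4) by (simp add: \<aa>_def)
    thus "prod_mset (image_mset c A) = 0" by (simp add: \<psi>_1)
  next
    fix g assume g: "g \<in> G"
    define f where "f = (\<Sum>e\<in>E. ?s {#e#} (germ_coeff g e))"
    have "\<Phi> d (?s b \<gamma> * f) \<in> fibre_ideal E G d" for b \<gamma> d
    proof -
      have \<Phi>f: "\<Phi> d (?s b \<gamma> * f) = (\<Sum>e\<in>E. \<Phi> d (?s (add_mset e b) (\<gamma> * germ_coeff g e)))"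
        by (simp add: f_def sum_distrib_left \<Phi>_sum mult_single)
      show ?thesis
      proof (cases "set_mset b \<subseteq> E \<and> Suc (size b) = d")
        case True
        let ?i = "\<Sum>e\<in>E. germ_const (germ_coeff g e) * germ_monom e"
        have "\<Phi> d (?s b \<gamma> * f) = germ_const \<gamma> * (?i * germ_monom (sum_mset b))"
          unfolding \<Phi>f sum_distrib_left sum_distrib_right using True
          by (intro sum.cong refl) (simp add: \<Phi>_single D_def germ_const_mult germ_monom_add mult_ac)
        also have "?i * germ_monom (sum_mset b) =
            g * germ_monom (sum_mset b) - (g - ?i) * germ_monom (sum_mset b)"
          by (simp add: left_diff_distrib)
        also have "germ_const \<gamma> * \<dots> \<in> fibre_ideal E G d"
          using True g G
          by (intro ideal.subspace_scale[OF N ideal.subspace_diff[OF N fibre_ideal_generator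
              initial_form_congruence[OF E]]]) auto
        finally show ?thesis .
      next
        case False
        hence "\<Phi> d (?s (add_mset e b) \<gamma>') = 0" for e \<gamma>' by (auto simp: \<Phi>_single D_def)
        thus ?thesis unfolding \<Phi>f by (simp add: ideal.subspace_0[OF N])
      qed
    qed
    hence "\<psi> f = 0" using \<psi>(4) by (simp add: \<aa>_def)
    have \<psi>_sum: "\<psi> (sum F I) = (\<Sum>i\<in>I. \<psi> (F i))" if "finite I" for F and I :: "(nat^'n) set"
      using that by (induction I) (use \<psi>(1) \<psi>_single[of 0 0] in simp_all)
    show "(\<Sum>e\<in>E. germ_coeff g e * c e) = 0"
      using \<open>\<psi> f = 0\<close> unfolding f_def \<psi>_sum[OF E] by (simp add: \<psi>_single)
  qed
qed

section \<open>Characters of finitely generated groups of exponents\<close>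

text \<open>
  A function with \<open>multiplicative_on S c\<close> extends to a homomorphism from the group generated by \<open>S\<close>
  to the multiplicative group of the complex numbers. The latter is divisible, so that the group
  can be enlarged one generator at a time.
\<close>

definition multiplicative_on :: "'b::real_vector set \<Rightarrow> ('b \<Rightarrow> complex) \<Rightarrow> bool" where
  "multiplicative_on S c \<longleftrightarrow> (\<forall>s\<in>S. c s \<noteq> 0) \<and>
     (\<forall>p :: 'b \<Rightarrow> int. (\<Sum>s\<in>S. of_int (p s) *\<^sub>R s) = 0 \<longrightarrow> (\<Prod>s\<in>S. c s powi p s) = 1)"

lemma prod_powi: "(\<Prod>s\<in>S. f s) powi t = (\<Prod>s\<in>S. (f s :: 'a::field) powi t)"
  by (induction S rule: infinite_finite_induct) (simp_all add: power_int_mult_distrib)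

lemma multiplicative_on_insert:
  assumes S: "finite S" and c: "multiplicative_on S c" and v: "v \<notin> S"
  shows "\<exists>\<gamma>. multiplicative_on (insert v S) (c(v := \<gamma>))"
proof -
  have c0: "c s \<noteq> 0" if "s \<in> S" for s using c that by (simp add: multiplicative_on_def)
  have rel: "(\<Prod>s\<in>S. c s powi p s) = 1" if "(\<Sum>s\<in>S. of_int (p s) *\<^sub>R s) = 0" for p :: "'a \<Rightarrow> int"
    using c that by (simp add: multiplicative_on_def)
  \<comment> \<open>The multiples of v that already belong to the group generated by S; on them the
    value of the character is prescribed.\<close>
  define H where "H = {k :: int. \<exists>p :: 'a \<Rightarrow> int. of_int k *\<^sub>R v = (\<Sum>s\<in>S. of_int (p s) *\<^sub>R s)}"
  have reduce: "\<exists>\<gamma>. multiplicative_on (insert v S) (c(v := \<gamma>))"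
    if \<gamma>: "\<gamma> \<noteq> 0" "\<And>k p. of_int k *\<^sub>R v = (\<Sum>s\<in>S. of_int (p s :: int) *\<^sub>R s) \<Longrightarrow> \<gamma> powi k = (\<Prod>s\<in>S. c s powi p s)" for \<gamma>
  proof (rule exI[of _ \<gamma>], unfold multiplicative_on_def, intro conjI ballI allI impI)
    fix s assume "s \<in> insert v S"
    thus "(c(v := \<gamma>)) s \<noteq> 0" using \<gamma>(1) c0 by auto
  next
    fix p :: "'a \<Rightarrow> int" assume "(\<Sum>s\<in>insert v S. of_int (p s) *\<^sub>R s) = 0"
    hence "of_int (- p v) *\<^sub>R v = (\<Sum>s\<in>S. of_int (p s) *\<^sub>R s)"
      using S v by (simp add: add_eq_0_iff)
    from \<gamma>(2)[OF this] have "(\<Prod>s\<in>S. c s powi p s) = \<gamma> powi (- p v)" by simp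
    moreover have "(\<Prod>s\<in>S. (c(v := \<gamma>)) s powi p s) = (\<Prod>s\<in>S. c s powi p s)"
      by (rule prod.cong) (use v in auto)
    hence "(\<Prod>s\<in>insert v S. (c(v := \<gamma>)) s powi p s) = \<gamma> powi p v * (\<Prod>s\<in>S. c s powi p s)"
      using prod.insert[OF S v, of "\<lambda>s. (c(v := \<gamma>)) s powi p s"] by simp
    ultimately show "(\<Prod>s\<in>insert v S. (c(v := \<gamma>)) s powi p s) = 1"
      using \<gamma>(1) by (simp add: power_int_minus)
  qed
  show ?thesis
  proof (cases "\<exists>k>0. int k \<in> H")
    case False
    show ?thesis
    \<comment> \<open>No positive multiple of v lies in the group of S, so v may take any non-zero
      value.\<close>
    proof (rule reduce[of 1])
      fix k p assume kp: "of_int k *\<^sub>R v = (\<Sum>s\<in>S. of_int (p s :: int) *\<^sub>R s)"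
      have "k = 0"
      proof (rule ccontr)
        assume "k \<noteq> 0"
        hence "nat \<bar>k\<bar> > 0" by simp
        hence "int (nat \<bar>k\<bar>) \<notin> H" using False by blast
        hence "\<bar>k\<bar> \<notin> H" by simp
        moreover have "k \<in> H" unfolding H_def using kp by blast
        moreover have "of_int (- k) *\<^sub>R v = (\<Sum>s\<in>S. of_int (- p s) *\<^sub>R s)" using kp by (simp add: sum_negf)
        hence "- k \<in> H" unfolding H_def by (intro CollectI) (rule exI)
        ultimately show False by (auto simp: abs_if split: if_splits)
      qed
      moreover have "(\<Sum>s\<in>S. of_int (p s) *\<^sub>R s) = 0" using kp \<open>k = 0\<close> by (metis of_int_0 scaleR_zero_left)
      hence "(\<Prod>s\<in>S. c s powi p s) = 1" by (rule rel)
      ultimately show "1 powi k = (\<Prod>s\<in>S. c s powi p s)" by simp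
    qed simp
  next
    case True
    define k0 where "k0 = (LEAST k. k > 0 \<and> int k \<in> H)"
    have k0: "k0 > 0" "int k0 \<in> H" using LeastI_ex[OF True] by (auto simp: k0_def)
    have least: "\<not> (0 < k \<and> k < k0 \<and> int k \<in> H)" for k using not_less_Least[of k "\<lambda>k. k > 0 \<and> int k \<in> H"] by (auto simp: k0_def)
    obtain p0 where p0: "of_int (int k0) *\<^sub>R v = (\<Sum>s\<in>S. of_int (p0 s) *\<^sub>R s)" using k0(2) by (auto simp: H_def)
    define \<pi> where "\<pi> = (\<Prod>s\<in>S. c s powi p0 s)"
    have \<pi>: "\<pi> \<noteq> 0" using S c0 by (simp add: \<pi>_def)
    \<comment> \<open>A root of order \<open>k0\<close> of the value prescribed for
      \<open>k0\<close> times v. As \<open>k0\<close> is the least positive element of H, it divides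
      all others, and no further condition arises.\<close>
    define \<gamma> where "\<gamma> = exp (Ln \<pi> / of_nat k0)"
    have \<gamma>: "\<gamma> ^ k0 = \<pi>" unfolding \<gamma>_def using k0(1) \<pi> by (simp flip: exp_of_nat_mult)
    show ?thesis
    proof (rule reduce[of \<gamma>])
      show "\<gamma> \<noteq> 0" by (simp add: \<gamma>_def)
      fix k p assume kp: "of_int k *\<^sub>R v = (\<Sum>s\<in>S. of_int (p s :: int) *\<^sub>R s)"
      define t where "t = k div int k0"
      have diff: "of_int (k - t * int k0) *\<^sub>R v = (\<Sum>s\<in>S. of_int (p s - t * p0 s) *\<^sub>R s)"
      proof -
        have "of_int (k - t * int k0) *\<^sub>R v = of_int k *\<^sub>R v - of_int t *\<^sub>R (of_int (int k0) *\<^sub>R v)"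
          by (simp add: algebra_simps)
        thus ?thesis unfolding kp p0 by (simp add: scaleR_sum_right sum_subtractf algebra_simps)
      qed
      have r: "k - t * int k0 = k mod int k0" by (simp add: t_def minus_div_mult_eq_mod)
      have "k mod int k0 \<in> H" unfolding H_def by (rule CollectI, rule exI, rule diff[unfolded r])
      moreover have "0 \<le> k mod int k0" "k mod int k0 < int k0" using k0(1) by simp_all
      ultimately have "k mod int k0 = 0" using least[of "nat (k mod int k0)"] by auto
      hence k: "k = int k0 * t" using r by simp
      have "1 = (\<Prod>s\<in>S. c s powi (p s - t * p0 s))"
        by (rule rel[symmetric]) (use diff k in simp)
      also have "\<dots> = (\<Prod>s\<in>S. c s powi p s * (c s powi p0 s) powi (- t))"
      proof (intro prod.cong refl)
        fix s assume "s \<in> S"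
        have "p s - t * p0 s = p s + p0 s * (- t)" by simp
        moreover have "c s powi (p s + p0 s * (- t)) = c s powi p s * c s powi (p0 s * (- t))"
          by (rule power_int_add) (use c0[OF \<open>s \<in> S\<close>] in simp)
        ultimately show "c s powi (p s - t * p0 s) = c s powi p s * (c s powi p0 s) powi (- t)"
          by (simp only: power_int_mult)
      qed
      also have "\<dots> = (\<Prod>s\<in>S. c s powi p s) * \<pi> powi (- t)"
        by (simp only: prod.distrib \<pi>_def prod_powi)
      finally have "\<pi> powi t = (\<Prod>s\<in>S. c s powi p s)"
        using \<pi> by (simp add: power_int_minus field_simps)
      moreover have "\<gamma> powi k = \<pi> powi t" unfolding k \<gamma>[symmetric] by (simp add: power_int_mult)
      ultimately show "\<gamma> powi k = (\<Prod>s\<in>S. c s powi p s)" by simp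
    qed
  qed
qed

lemma multiplicative_on_extend:
  assumes S: "finite S" and c: "multiplicative_on S c" and "finite V"
  shows "\<exists>c'. (\<forall>s\<in>S. c' s = c s) \<and> multiplicative_on (S \<union> V) c'"
  using \<open>finite V\<close>
proof (induction V rule: finite_induct)
  case empty
  show ?case using c by auto
next
  case (insert v V)
  then obtain c' where c': "\<forall>s\<in>S. c' s = c s" "multiplicative_on (S \<union> V) c'" by blast
  show ?case
  proof (cases "v \<in> S \<union> V")
    case True
    hence "S \<union> insert v V = S \<union> V" by blast
    thus ?thesis using c' by auto
  next
    case False
    have "finite (S \<union> V)" using S insert.hyps(1) by simp
    from multiplicative_on_insert[OF this c'(2) False] obtain \<gamma>
      where "multiplicative_on (insert v (S \<union> V)) (c'(v := \<gamma>))" ..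
    hence "multiplicative_on (S \<union> insert v V) (c'(v := \<gamma>))" by (simp del: fun_upd_apply)
    moreover have "\<forall>s\<in>S. (c'(v := \<gamma>)) s = c s" using c'(1) False by auto
    ultimately show ?thesis by blast
  qed
qed

text \<open>The values c respect only relations between products of equal degree. The additional
  coordinate 1 turns these into ordinary additive relations; after extension to all unit vectors,
  the value at (0, 1) is the scalar \<gamma> and the other values are the coordinates of a.\<close>

lemma torus_point:
  fixes E :: "(nat^'n::finite) set"
  assumes E: "finite E" and c0: "\<forall>e\<in>E. c e \<noteq> 0"
    and rel: "\<And>m n. sum m E = sum n E \<Longrightarrow> \<forall>i. (\<Sum>e\<in>E. m e * e $h i) = (\<Sum>e\<in>E. n e * e $h i) \<Longrightarrow>
      (\<Prod>e\<in>E. c e ^ m e) = (\<Prod>e\<in>E. c e ^ n e)"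
  obtains \<gamma> and a :: "complex^'n" where "\<gamma> \<noteq> 0" "\<forall>i. a $h i \<noteq> 0" "\<forall>e\<in>E. c e = \<gamma> * monom_eval a e"
proof -
  define \<phi> where "\<phi> e = (real_exponent e, 1 :: real)" for e :: "nat^'n"
  have inj: "inj_on \<phi> E" using inj_real_exponent by (auto simp: \<phi>_def inj_on_def)
  define c1 where "c1 s = c (inv_into E \<phi> s)" for s
  have c1: "c1 (\<phi> e) = c e" if "e \<in> E" for e using that inj by (simp add: c1_def)
  have "multiplicative_on (\<phi> ` E) c1"
    unfolding multiplicative_on_def
  proof (intro conjI ballI allI impI)
    fix s assume "s \<in> \<phi> ` E"
    thus "c1 s \<noteq> 0" using c1 c0 by auto
  next
    fix p :: "(real^'n) \<times> real \<Rightarrow> int" assume "(\<Sum>s\<in>\<phi> ` E. of_int (p s) *\<^sub>R s) = 0"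
    hence sum0: "(\<Sum>e\<in>E. of_int (p (\<phi> e)) *\<^sub>R \<phi> e) = 0" by (simp add: sum.reindex[OF inj])
    define m where "m e = nat (p (\<phi> e))" for e
    define n where "n e = nat (- p (\<phi> e))" for e
    have mn: "p (\<phi> e) = int (m e) - int (n e)" for e by (simp add: m_def n_def)
    have "snd (\<Sum>e\<in>E. of_int (p (\<phi> e)) *\<^sub>R \<phi> e) = 0" using sum0 by simp
    hence "(\<Sum>e\<in>E. real (m e)) = (\<Sum>e\<in>E. real (n e))"
      by (simp add: snd_sum \<phi>_def mn[unfolded \<phi>_def] sum_subtractf)
    hence "sum m E = sum n E" by (simp flip: of_nat_sum)
    moreover have "(\<Sum>e\<in>E. m e * e $h i) = (\<Sum>e\<in>E. n e * e $h i)" for i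
    proof -
      have "fst (\<Sum>e\<in>E. of_int (p (\<phi> e)) *\<^sub>R \<phi> e) $h i = 0" using sum0 by simp
      hence "(\<Sum>e\<in>E. real (m e) * real (e $h i)) = (\<Sum>e\<in>E. real (n e) * real (e $h i))"
        by (simp add: fst_sum \<phi>_def mn[unfolded \<phi>_def] sum_subtractf left_diff_distrib)
      thus ?thesis by (simp flip: of_nat_sum of_nat_mult)
    qed
    ultimately have eq: "(\<Prod>e\<in>E. c e ^ m e) = (\<Prod>e\<in>E. c e ^ n e)" by (intro rel) auto
    have "(\<Prod>s\<in>\<phi> ` E. c1 s powi p s) = (\<Prod>e\<in>E. c e ^ m e / c e ^ n e)"
      unfolding prod.reindex[OF inj] by (intro prod.cong refl) (use c0 in \<open>simp add: c1 mn power_int_diff\<close>)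
    also have "\<dots> = 1" using eq c0 E by (simp add: prod_dividef)
    finally show "(\<Prod>s\<in>\<phi> ` E. c1 s powi p s) = 1" .
  qed
  define ax where "ax i = (axis i (1 :: real) :: real^'n, 0 :: real)" for i
  let ?o = "(0, 1) :: (real^'n) \<times> real"
  have inj_ax: "inj ax" by (auto simp: inj_def ax_def axis_eq_axis)
  obtain c' where c': "\<forall>s\<in>\<phi> ` E. c' s = c1 s" "multiplicative_on (\<phi> ` E \<union> insert ?o (range ax)) c'"
    using multiplicative_on_extend[OF finite_imageI[OF E] \<open>multiplicative_on (\<phi> ` E) c1\<close>, of "insert ?o (range ax)"] by auto
  define a :: "complex^'n" where "a = (\<chi> i. c' (ax i))"
  have nz: "c' ?o \<noteq> 0" "c' (ax i) \<noteq> 0" for i using c'(2) by (auto simp: multiplicative_on_def)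
  show ?thesis
  proof (rule that[of "c' ?o" a])
    show "c' ?o \<noteq> 0" by (rule nz)
    show "\<forall>i. a $h i \<noteq> 0" using nz by (simp add: a_def)
    show "\<forall>e\<in>E. c e = c' ?o * monom_eval a e"
    proof
      fix e assume e: "e \<in> E"
      have ce: "c e = c' (\<phi> e)" using c'(1) c1[OF e] e by simp
      show "c e = c' ?o * monom_eval a e"
      proof (cases "e = 0")
        case True
        thus ?thesis using ce by (simp add: \<phi>_def)
      next
        case False
        hence ne: "\<phi> e \<noteq> ?o" using injD[OF inj_real_exponent, of e 0] by (auto simp: \<phi>_def)
        have ne': "\<phi> e \<notin> range ax" "?o \<notin> range ax" by (auto simp: \<phi>_def ax_def)
        \<comment> \<open>The integral relation that decomposes \<open>\<phi> e\<close> into (0, 1)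
          and multiples of the unit vectors. It presupposes that \<open>\<phi> e\<close> differs
          from (0, 1), hence the separate case e = 0.\<close>
        define p where "p s = (if s = \<phi> e then 1 else if s = ?o then -1
          else if s \<in> range ax then - int (e $h (inv_into UNIV ax s)) else 0)" for s
        have p_ax: "p (ax i) = - int (e $h i)" for i
        proof -
          have "ax i \<noteq> \<phi> e" "ax i \<noteq> ?o" using ne' rangeI[of ax i] by metis+
          thus ?thesis by (simp add: p_def inv_into_f_f[OF inj_ax UNIV_I])
        qed
        have p: "p (\<phi> e) = 1" "p ?o = -1" using ne by (simp_all add: p_def)
        let ?S = "\<phi> ` E \<union> insert ?o (range ax)" and ?T = "insert (\<phi> e) (insert ?o (range ax))"
        have T: "?T \<subseteq> ?S" "\<And>s. s \<in> ?S - ?T \<Longrightarrow> p s = 0" "finite ?S" using e E by (auto simp: p_def)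
        have "(\<Sum>s\<in>?S. of_int (p s) *\<^sub>R s) = (\<Sum>s\<in>?T. of_int (p s) *\<^sub>R s)"
          by (rule sum.mono_neutral_right[OF T(3,1)]) (use T(2) in auto)
        also have "\<dots> = \<phi> e - ?o + (\<Sum>i\<in>UNIV. of_int (p (ax i)) *\<^sub>R ax i)"
          using ne ne' p by (simp add: sum.reindex[OF inj_ax])
        also have "(\<Sum>i\<in>UNIV. of_int (p (ax i)) *\<^sub>R ax i) = (- real_exponent e, 0)"
        proof (rule prod_eqI)
          have "(\<Sum>i\<in>UNIV. - (real (e $h i) *\<^sub>R (axis i 1 :: real^'n))) $h j = - real (e $h j)" for j
          proof -
            have "(\<Sum>i\<in>UNIV. - (real (e $h i) *\<^sub>R (axis i 1 :: real^'n))) $h j =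
                (\<Sum>i\<in>UNIV. if i = j then - real (e $h j) else 0)"
              unfolding sum_component by (intro sum.cong refl) (auto simp: axis_def)
            thus ?thesis by simp
          qed
          thus "fst (\<Sum>i\<in>UNIV. of_int (p (ax i)) *\<^sub>R ax i) = fst (- real_exponent e, 0 :: real)"
            unfolding fst_sum p_ax unfolding ax_def by (simp add: Finite_Cartesian_Product.vec_eq_iff)
        qed (simp add: snd_sum ax_def)
        also have "\<phi> e - ?o + (- real_exponent e, 0) = 0" by (simp add: \<phi>_def zero_prod_def)
        finally have "(\<Prod>s\<in>?S. c' s powi p s) = 1" using c'(2) by (simp add: multiplicative_on_def)
        also have "(\<Prod>s\<in>?S. c' s powi p s) = (\<Prod>s\<in>?T. c' s powi p s)"
        proof (rule prod.mono_neutral_right[OF T(3,1)], rule ballI)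
          fix s assume "s \<in> ?S - ?T"
          hence "p s = 0" by (rule T(2))
          thus "c' s powi p s = 1" by simp
        qed
        also have "\<dots> = c' (\<phi> e) * (inverse (c' ?o) * (\<Prod>i\<in>UNIV. c' (ax i) powi p (ax i)))"
          using ne ne' p by (simp add: prod.reindex[OF inj_ax] power_int_minus)
        also have "(\<Prod>i\<in>UNIV. c' (ax i) powi p (ax i)) = inverse (monom_eval a e)"
          by (simp add: p_ax monom_eval_def a_def power_int_minus prod_inversef[unfolded o_def, symmetric])
        finally have "c' (\<phi> e) * (inverse (c' ?o) * inverse (monom_eval a e)) = 1" .
        moreover have "monom_eval a e \<noteq> 0" using nz by (simp add: monom_eval_def a_def)
        ultimately show ?thesis using nz(1) by (simp add: ce field_simps)
      qed
    qed
  qed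
qed

section \<open>The face of a character\<close>

lemma multiset_with_multiplicities:
  fixes E :: "(nat^'n::finite) set" and c :: "nat^'n \<Rightarrow> 'a::comm_monoid_mult"
  assumes "finite E"
  shows "\<exists>A. set_mset A \<subseteq> E \<and> size A = sum n E \<and> (\<forall>i. sum_mset A $h i = (\<Sum>e\<in>E. n e * e $h i)) \<and>
    prod_mset (image_mset c A) = (\<Prod>e\<in>E. c e ^ n e)"
  using assms
proof (induction E rule: finite_induct)
  case empty
  show ?case by (rule exI[of _ "{#}"]) simp
next
  case (insert e E)
  then obtain A where A: "set_mset A \<subseteq> E" "size A = sum n E" "\<forall>i. sum_mset A $h i = (\<Sum>e\<in>E. n e * e $h i)"
    "prod_mset (image_mset c A) = (\<Prod>e\<in>E. c e ^ n e)" by blast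
  have "sum_mset (replicate_mset k e) $h i = k * e $h i" for k i by (induction k) auto
  thus ?case using insert.hyps A by (intro exI[of _ "replicate_mset (n e) e + A"]) auto
qed

lemma convex_hull_real_exponent:
  assumes F: "finite F"
  shows "x \<in> convex hull (real_exponent ` F) \<longleftrightarrow>
    (\<exists>u. (\<forall>e\<in>F. 0 \<le> u e) \<and> sum u F = 1 \<and> (\<Sum>e\<in>F. u e *\<^sub>R real_exponent e) = x)"
proof -
  have inj: "inj_on real_exponent F" using inj_real_exponent by (rule inj_on_subset) simp
  show ?thesis
    unfolding convex_hull_finite[OF finite_imageI[OF F]] mem_Collect_eq sum.reindex[OF inj] o_def
  proof (intro iffI; elim exE conjE)
    fix u assume u: "\<forall>x\<in>real_exponent ` F. 0 \<le> u x" "(\<Sum>e\<in>F. u (real_exponent e)) = 1"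
      "(\<Sum>e\<in>F. u (real_exponent e) *\<^sub>R real_exponent e) = x"
    show "\<exists>u. (\<forall>e\<in>F. 0 \<le> u e) \<and> sum u F = 1 \<and> (\<Sum>e\<in>F. u e *\<^sub>R real_exponent e) = x"
      by (rule exI[of _ "\<lambda>e. u (real_exponent e)"]) (use u in simp)
  next
    fix u assume u: "\<forall>e\<in>F. 0 \<le> u e" "sum u F = 1" "(\<Sum>e\<in>F. u e *\<^sub>R real_exponent e) = x"
    show "\<exists>u. (\<forall>x\<in>real_exponent ` F. 0 \<le> u x) \<and> (\<Sum>e\<in>F. u (real_exponent e)) = 1 \<and>
        (\<Sum>e\<in>F. u (real_exponent e) *\<^sub>R real_exponent e) = x"
      by (rule exI[of _ "u \<circ> inv_into UNIV real_exponent"]) (use u in \<open>simp add: inv_into_f_f[OF inj_real_exponent UNIV_I]\<close>)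
  qed
qed

context
  fixes E :: "(nat^'n::finite) set" and c :: "nat^'n \<Rightarrow> complex"
  assumes E: "finite E"
    and eq: "\<And>A B. set_mset A \<subseteq> E \<Longrightarrow> set_mset B \<subseteq> E \<Longrightarrow> size A = size B \<Longrightarrow> sum_mset A = sum_mset B \<Longrightarrow>
       prod_mset (image_mset c A) = prod_mset (image_mset c B)"
    and zero: "\<And>A B l. set_mset A \<subseteq> E \<Longrightarrow> set_mset B \<subseteq> E \<Longrightarrow> size A = size B \<Longrightarrow> sum_mset A = sum_mset B + l \<Longrightarrow> l \<noteq> 0 \<Longrightarrow>
       prod_mset (image_mset c A) = 0"
begin

text \<open>A product with non-zero value cannot be a proper multiple of another product of the same
  degree, because c vanishes on non-minimal products. A componentwise inequality between the
  exponents is therefore an equality.\<close>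

lemma character_relation:
  assumes "sum m E = sum n E" "\<forall>i. (\<Sum>e\<in>E. m e * e $h i) \<le> (\<Sum>e\<in>E. n e * e $h i)" "(\<Prod>e\<in>E. c e ^ n e) \<noteq> 0"
  shows "\<forall>i. (\<Sum>e\<in>E. m e * e $h i) = (\<Sum>e\<in>E. n e * e $h i)" "(\<Prod>e\<in>E. c e ^ m e) = (\<Prod>e\<in>E. c e ^ n e)"
proof -
  obtain A where A: "set_mset A \<subseteq> E" "size A = sum n E" "\<forall>i. sum_mset A $h i = (\<Sum>e\<in>E. n e * e $h i)"
    "prod_mset (image_mset c A) = (\<Prod>e\<in>E. c e ^ n e)" using multiset_with_multiplicities[OF E] by blast
  obtain B where B: "set_mset B \<subseteq> E" "size B = sum m E" "\<forall>i. sum_mset B $h i = (\<Sum>e\<in>E. m e * e $h i)"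
    "prod_mset (image_mset c B) = (\<Prod>e\<in>E. c e ^ m e)" using multiset_with_multiplicities[OF E] by blast
  have size: "size A = size B" using A B assms(1) by simp
  have le: "sum_mset B $h i \<le> sum_mset A $h i" for i using assms(2) A(3) B(3) by simp
  hence sum: "sum_mset A = sum_mset B + (sum_mset A - sum_mset B)"
    by (simp add: Finite_Cartesian_Product.vec_eq_iff)
  have "sum_mset A - sum_mset B = 0"
    using zero[OF A(1) B(1) size sum] A(4) assms(3) by argo
  hence AB: "sum_mset A = sum_mset B" using sum by simp
  thus "\<forall>i. (\<Sum>e\<in>E. m e * e $h i) = (\<Sum>e\<in>E. n e * e $h i)" using A(3) B(3) by simp
  show "(\<Prod>e\<in>E. c e ^ m e) = (\<Prod>e\<in>E. c e ^ n e)" using eq[OF A(1) B(1) size AB] A(4) B(4) by simp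
qed

text \<open>The real version of \<open>character_relation\<close>, obtained through
  \<open>integral_relation\<close>: if a convex combination of surviving generators dominates
  another combination of generators, both are the same point and the latter involves only surviving
  generators.\<close>

lemma character_weights:
  assumes u: "\<And>e. e \<in> E \<Longrightarrow> 0 \<le> u e" "sum u E = 1"
    and w: "\<And>e. e \<in> E \<Longrightarrow> 0 \<le> w e" "sum w E = 1" "\<And>e. e \<in> E \<Longrightarrow> w e > 0 \<Longrightarrow> c e \<noteq> 0"
    and le: "\<And>i. (\<Sum>e\<in>E. u e * real (e $h i)) \<le> (\<Sum>e\<in>E. w e * real (e $h i))"
  shows "\<forall>e\<in>E. 0 < u e \<longrightarrow> c e \<noteq> 0" "\<forall>i. (\<Sum>e\<in>E. u e * real (e $h i)) = (\<Sum>e\<in>E. w e * real (e $h i))"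
proof -
  obtain q :: nat and m n where mn: "q > 0" "sum m E = q" "sum n E = q"
    "\<forall>e\<in>E. m e > 0 \<longleftrightarrow> u e > 0" "\<forall>e\<in>E. n e > 0 \<longleftrightarrow> w e > 0"
    "\<forall>i. (\<Sum>e\<in>E. m e * e $h i) \<le> (\<Sum>e\<in>E. n e * e $h i)"
    "\<forall>i. (\<Sum>e\<in>E. u e * real (e $h i)) < (\<Sum>e\<in>E. w e * real (e $h i)) \<longrightarrow>
       (\<Sum>e\<in>E. m e * e $h i) < (\<Sum>e\<in>E. n e * e $h i)"
    by (rule integral_relation[OF E u w(1,2) le])
  have nz: "(\<Prod>e\<in>E. c e ^ n e) \<noteq> 0" using E mn(5) w(3) by auto
  have "sum m E = sum n E" using mn by simp
  note rel = character_relation[OF this mn(6) nz]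
  show "\<forall>i. (\<Sum>e\<in>E. u e * real (e $h i)) = (\<Sum>e\<in>E. w e * real (e $h i))"
  proof
    fix i
    have "\<not> (\<Sum>e\<in>E. u e * real (e $h i)) < (\<Sum>e\<in>E. w e * real (e $h i))" using mn(7) rel(1) by (metis nat_less_le)
    thus "(\<Sum>e\<in>E. u e * real (e $h i)) = (\<Sum>e\<in>E. w e * real (e $h i))" using le[of i] by linarith
  qed
  have "(\<Prod>e\<in>E. c e ^ m e) \<noteq> 0" using rel(2) nz by simp
  thus "\<forall>e\<in>E. 0 < u e \<longrightarrow> c e \<noteq> 0" using E mn(4) by auto
qed

text \<open>Applied to a point of an open segment, \<open>character_weights\<close> shows that both
  ends lie in the hull of the surviving generators. Applied to a point mass, it shows that a lattice
  point of the face lying above a generator is itself a surviving generator, so the face picks no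
  further terms from the minors.\<close>

lemma character_face:
  defines "F \<equiv> {e\<in>E. c e \<noteq> 0}"
  shows "convex hull (real_exponent ` F) face_of upper_hull (real_exponent ` E)" (is "?\<Delta> face_of ?\<Gamma>")
    and "e \<in> E \<Longrightarrow> (\<forall>i. e $h i \<le> k $h i) \<Longrightarrow> real_exponent k \<in> convex hull (real_exponent ` F) \<Longrightarrow> k \<in> F"
proof -
  have F: "finite F" "F \<subseteq> E" using E by (auto simp: F_def)
  have hull: "\<exists>w. (\<forall>e\<in>E. 0 \<le> w e) \<and> sum w E = 1 \<and> (\<forall>e\<in>E. 0 < w e \<longrightarrow> c e \<noteq> 0) \<and>
      (\<forall>i. (\<Sum>e\<in>E. w e * real (e $h i)) = x $h i)" if x: "x \<in> ?\<Delta>" for x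
  proof -
    from x[unfolded convex_hull_real_exponent[OF F(1)]] obtain u
      where u: "\<forall>e\<in>F. 0 \<le> u e" "sum u F = 1" "(\<Sum>e\<in>F. u e *\<^sub>R real_exponent e) = x" by blast
    define w where "w e = (if e \<in> F then u e else 0)" for e
    have "sum w E = sum u F" unfolding w_def using F E by (simp add: sum.inter_restrict[symmetric] Int_absorb1)
    moreover have "(\<Sum>e\<in>E. w e * real (e $h i)) = x $h i" for i
    proof -
      have "(\<Sum>e\<in>E. w e * real (e $h i)) = (\<Sum>e\<in>F. u e * real (e $h i))"
        by (rule sum.mono_neutral_cong_right[OF E F(2)]) (auto simp: w_def)
      thus ?thesis by (simp flip: u(3))
    qed
    ultimately show ?thesis using u by (intro exI[of _ w]) (auto simp: w_def F_def)
  qed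
  have in_hull: "(\<Sum>e\<in>E. u e *\<^sub>R real_exponent e) \<in> ?\<Delta>"
    if "\<forall>e\<in>E. 0 \<le> u e" "sum u E = 1" "\<forall>e\<in>E. 0 < u e \<longrightarrow> c e \<noteq> 0" for u
  proof -
    have u0: "u e = 0" if "e \<in> E - F" for e
    proof -
      have "e \<in> E" "c e = 0" using that by (auto simp: F_def)
      hence "0 \<le> u e" "\<not> 0 < u e" using \<open>\<forall>e\<in>E. 0 \<le> u e\<close> \<open>\<forall>e\<in>E. 0 < u e \<longrightarrow> c e \<noteq> 0\<close> by auto
      thus ?thesis by simp
    qed
    have "(\<Sum>e\<in>E. u e *\<^sub>R real_exponent e) = (\<Sum>e\<in>F. u e *\<^sub>R real_exponent e)"
      by (rule sum.mono_neutral_right[OF E F(2)]) (simp add: u0)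
    moreover have "sum u E = sum u F" by (rule sum.mono_neutral_right[OF E F(2)]) (simp add: u0)
    ultimately show ?thesis
      unfolding convex_hull_real_exponent[OF F(1)] using that F(2) by (intro exI[of _ u]) auto
  qed
  have main: "a \<in> ?\<Delta> \<and> b \<in> ?\<Delta>"
    if a: "a \<in> ?\<Gamma>" and b: "b \<in> ?\<Gamma>" and x: "x \<in> ?\<Delta>" "x \<in> open_segment a b" for a b x
  proof -
    obtain t where t: "0 < t" "t < 1" "x = (1 - t) *\<^sub>R a + t *\<^sub>R b" using x(2) by (auto simp: in_segment)
    obtain ya va where a': "a = ya + va" "ya \<in> convex hull (real_exponent ` E)" "va \<in> orthant" using upper_hullE[OF a] .
    obtain yb vb where b': "b = yb + vb" "yb \<in> convex hull (real_exponent ` E)" "vb \<in> orthant" using upper_hullE[OF b] .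
    obtain ua where ua: "\<forall>e\<in>E. 0 \<le> ua e" "sum ua E = 1" "(\<Sum>e\<in>E. ua e *\<^sub>R real_exponent e) = ya"
      using a'(2)[unfolded convex_hull_real_exponent[OF E]] by blast
    obtain ub where ub: "\<forall>e\<in>E. 0 \<le> ub e" "sum ub E = 1" "(\<Sum>e\<in>E. ub e *\<^sub>R real_exponent e) = yb"
      using b'(2)[unfolded convex_hull_real_exponent[OF E]] by blast
    obtain w where w: "\<forall>e\<in>E. 0 \<le> w e" "sum w E = 1" "\<forall>e\<in>E. 0 < w e \<longrightarrow> c e \<noteq> 0"
      "\<forall>i. (\<Sum>e\<in>E. w e * real (e $h i)) = x $h i" using hull[OF x(1)] by blast
    \<comment> \<open>The coefficients of the point of the segment without its contributions from
      the orthant; they give a point componentwise below x.\<close>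
    define u where "u e = (1 - t) * ua e + t * ub e" for e
    have u: "0 \<le> u e" if "e \<in> E" for e using ua(1) ub(1) t that by (simp add: u_def)
    have "sum u E = 1" by (simp add: u_def sum.distrib ua(2) ub(2) flip: sum_distrib_left)
    have u_sum: "(\<Sum>e\<in>E. u e * real (e $h i)) = x $h i - ((1 - t) * va $h i + t * vb $h i)" for i
    proof -
      have "(\<Sum>e\<in>E. u e * real (e $h i)) = (1 - t) * ya $h i + t * yb $h i"
        by (simp add: u_def distrib_right sum.distrib sum_distrib_left mult.assoc flip: ua(3) ub(3))
      thus ?thesis unfolding t(3) a'(1) b'(1) by (simp add: algebra_simps)
    qed
    have v: "0 \<le> va $h i" "0 \<le> vb $h i" for i using a'(3) b'(3) by (auto simp: orthant_def)
    have nonneg: "0 \<le> (1 - t) * va $h i" "0 \<le> t * vb $h i" for i using v[of i] t by simp_all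
    have le: "(\<Sum>e\<in>E. u e * real (e $h i)) \<le> (\<Sum>e\<in>E. w e * real (e $h i))" for i
      using u_sum[of i] spec[OF w(4), of i] nonneg[of i] by linarith
    have supp: "\<forall>e\<in>E. 0 < u e \<longrightarrow> c e \<noteq> 0"
      and same: "\<forall>i. (\<Sum>e\<in>E. u e * real (e $h i)) = (\<Sum>e\<in>E. w e * real (e $h i))"
      using character_weights[of u w] u \<open>sum u E = 1\<close> w le by blast+
    have "(1 - t) * va $h i = 0" "t * vb $h i = 0" for i
      using spec[OF same, of i] u_sum[of i] spec[OF w(4), of i] nonneg[of i] by linarith+
    hence "va = 0" "vb = 0" using t by (simp_all add: Finite_Cartesian_Product.vec_eq_iff)
    moreover have "0 < u e" if "e \<in> E" "0 < ua e \<or> 0 < ub e" for e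
      using that ua(1) ub(1) t unfolding u_def
      by (metis add_nonneg_pos add_pos_nonneg diff_gt_0_iff_gt less_eq_real_def mult_nonneg_nonneg mult_pos_pos)
    hence "\<forall>e\<in>E. 0 < ua e \<longrightarrow> c e \<noteq> 0" "\<forall>e\<in>E. 0 < ub e \<longrightarrow> c e \<noteq> 0" using supp by blast+
    hence "ya \<in> ?\<Delta>" "yb \<in> ?\<Delta>" using in_hull[OF ua(1,2)] in_hull[OF ub(1,2)] ua(3) ub(3) by simp_all
    ultimately show ?thesis using a'(1) b'(1) by simp
  qed
  show "?\<Delta> face_of ?\<Gamma>"
    unfolding face_of_def
  proof (intro conjI ballI impI convex_convex_hull)
    have "?\<Delta> \<subseteq> convex hull (real_exponent ` E)" by (rule hull_mono) (use F(2) in blast)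
    thus "?\<Delta> \<subseteq> ?\<Gamma>" using convex_hull_subset_upper_hull by (rule subset_trans)
  qed (use main in blast)+
  show "k \<in> F" if e: "e \<in> E" and ek: "\<forall>i. e $h i \<le> k $h i" and k: "real_exponent k \<in> ?\<Delta>"
  proof -
    obtain w where w: "\<forall>e\<in>E. 0 \<le> w e" "sum w E = 1" "\<forall>e\<in>E. 0 < w e \<longrightarrow> c e \<noteq> 0"
      "\<forall>i. (\<Sum>e\<in>E. w e * real (e $h i)) = real_exponent k $h i" using hull[OF k] by blast
    define u where "u e' = (if e' = e then 1 else 0 :: real)" for e'
    have sum_u: "(\<Sum>e'\<in>E. u e' * f e') = f e" for f :: "nat^'n \<Rightarrow> real"
      using e E by (simp add: u_def if_distrib[of "\<lambda>x. x * _"] cong: if_cong)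
    have "sum u E = 1" using sum_u[of "\<lambda>_. 1"] by simp
    moreover have "0 \<le> u e'" for e' by (simp add: u_def)
    moreover have "(\<Sum>e\<in>E. u e * real (e $h i)) \<le> (\<Sum>e\<in>E. w e * real (e $h i))" for i
      unfolding sum_u using w(4) ek by simp
    ultimately have supp: "\<forall>e\<in>E. 0 < u e \<longrightarrow> c e \<noteq> 0"
      and same: "\<forall>i. (\<Sum>e\<in>E. u e * real (e $h i)) = (\<Sum>e\<in>E. w e * real (e $h i))"
      using character_weights[of u w] w by blast+
    have "e = k" using same w(4) unfolding sum_u by (simp add: Finite_Cartesian_Product.vec_eq_iff)
    moreover have "c e \<noteq> 0" using supp e by (simp add: u_def)
    ultimately show ?thesis using e by (simp add: F_def)
  qed
qed

end

lemma generator_power_in_fibre_ideal: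
  fixes E :: "(nat^'n::finite) set"
  assumes E: "finite E" and G: "\<forall>g\<in>G. \<forall>k\<in>supp g. \<exists>e\<in>E. \<forall>i. e $h i \<le> k $h i"
    and nondeg: "\<And>\<Delta> a. \<Delta> \<in> compact_faces (upper_hull (real_exponent ` E)) \<Longrightarrow> \<forall>i. a $h i \<noteq> 0 \<Longrightarrow>
      \<exists>g\<in>G. eval_face g \<Delta> a \<noteq> 0"
    and e0: "e0 \<in> E"
  shows "\<exists>N. germ_monom (sum_mset (replicate_mset N e0)) \<in> fibre_ideal E G N"
proof (rule ccontr)
  assume "\<not> ?thesis"
  hence "\<forall>N. germ_monom (sum_mset (replicate_mset N e0)) \<notin> fibre_ideal E G N" by blast
  from fibre_cone_character[OF E G e0 this] obtain c where c: "c e0 \<noteq> 0"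
    and eq: "\<forall>A B. set_mset A \<subseteq> E \<longrightarrow> set_mset B \<subseteq> E \<longrightarrow> size A = size B \<longrightarrow> sum_mset A = sum_mset B \<longrightarrow>
       prod_mset (image_mset c A) = prod_mset (image_mset c B)"
    and zero: "\<forall>A B l. set_mset A \<subseteq> E \<longrightarrow> set_mset B \<subseteq> E \<longrightarrow> size A = size B \<longrightarrow> sum_mset A = sum_mset B + l \<longrightarrow> l \<noteq> 0 \<longrightarrow>
       prod_mset (image_mset c A) = 0"
    and cG: "\<forall>g\<in>G. (\<Sum>e\<in>E. germ_coeff g e * c e) = 0" .
  define F where "F = {e\<in>E. c e \<noteq> 0}"
  define \<Delta> where "\<Delta> = convex hull (real_exponent ` F)"
  have F: "finite F" "F \<subseteq> E" "e0 \<in> F" using E e0 c by (auto simp: F_def)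
  have face: "\<Delta> face_of upper_hull (real_exponent ` E)"
    unfolding \<Delta>_def F_def by (rule character_face(1)[OF E]) (use eq zero in blast)+
  have lattice: "k \<in> F" if "e \<in> E" "\<forall>i. e $h i \<le> k $h i" "real_exponent k \<in> \<Delta>" for e k
    using that(3) unfolding \<Delta>_def F_def by (intro character_face(2)[OF E _ _ that(1,2)]) (use eq zero in blast)+
  have compact: "compact \<Delta>" unfolding \<Delta>_def using F(1) by (intro finite_imp_compact_convex_hull) simp
  have F\<Delta>: "real_exponent e \<in> \<Delta>" if "e \<in> F" for e unfolding \<Delta>_def using that by (intro hull_inc) simp
  have faceE: "\<Delta> \<in> compact_faces (upper_hull (real_exponent ` E))"
    using face compact F\<Delta>[OF F(3)] by (auto simp: compact_faces_def)
  have rel: "(\<Prod>e\<in>F. c e ^ m e) = (\<Prod>e\<in>F. c e ^ n e)"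
    if "sum m F = sum n F" "\<forall>i. (\<Sum>e\<in>F. m e * e $h i) = (\<Sum>e\<in>F. n e * e $h i)" for m n
  proof -
    obtain A where A: "set_mset A \<subseteq> F" "size A = sum n F" "\<forall>i. sum_mset A $h i = (\<Sum>e\<in>F. n e * e $h i)"
      "prod_mset (image_mset c A) = (\<Prod>e\<in>F. c e ^ n e)" using multiset_with_multiplicities[OF F(1)] by blast
    obtain B where B: "set_mset B \<subseteq> F" "size B = sum m F" "\<forall>i. sum_mset B $h i = (\<Sum>e\<in>F. m e * e $h i)"
      "prod_mset (image_mset c B) = (\<Prod>e\<in>F. c e ^ m e)" using multiset_with_multiplicities[OF F(1)] by blast
    have "sum_mset B = sum_mset A" using A(3) B(3) that(2) by (simp add: Finite_Cartesian_Product.vec_eq_iff)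
    moreover have "size B = size A" using A(2) B(2) that(1) by simp
    moreover have "set_mset A \<subseteq> E" "set_mset B \<subseteq> E" using A(1) B(1) F(2) by auto
    ultimately have "prod_mset (image_mset c B) = prod_mset (image_mset c A)" using eq by blast
    thus ?thesis using A(4) B(4) by simp
  qed
  have "\<forall>e\<in>F. c e \<noteq> 0" by (simp add: F_def)
  from torus_point[OF F(1) this rel] obtain \<gamma> and a :: "complex^'n" where
    a: "\<gamma> \<noteq> 0" "\<forall>i. a $h i \<noteq> 0" "\<forall>e\<in>F. c e = \<gamma> * monom_eval a e" .
  obtain g where g: "g \<in> G" "eval_face g \<Delta> a \<noteq> 0" using nondeg[OF faceE a(2)] by blast
  have "eval_face g \<Delta> a = (\<Sum>e\<in>F. germ_coeff g e * monom_eval a e)"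
    unfolding eval_face_eq
  proof (rule sum.mono_neutral_right[OF finite_exponents_bounded[OF compact_imp_bounded[OF compact]]])
    show "F \<subseteq> {k. real_exponent k \<in> \<Delta>}" using F\<Delta> by blast
    \<comment> \<open>An exponent of g lies above some element of E; if it also lies on \<Delta>, it
      is a surviving generator. Thus the face polynomial of g involves only exponents in F, where c
      is known.\<close>
    show "\<forall>k\<in>{k. real_exponent k \<in> \<Delta>} - F. germ_coeff g k * monom_eval a k = 0"
    proof
      fix k assume k: "k \<in> {k. real_exponent k \<in> \<Delta>} - F"
      have "k \<notin> supp g"
      proof
        assume "k \<in> supp g"
        then obtain e where "e \<in> E" "\<forall>i. e $h i \<le> k $h i" using G g(1) by blast
        thus False using lattice[of e k] k by blast
      qed
      thus "germ_coeff g k * monom_eval a k = 0" by (simp add: supp_def)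
    qed
  qed
  hence "\<gamma> * eval_face g \<Delta> a = (\<Sum>e\<in>F. germ_coeff g e * c e)"
    using a(3) by (simp add: sum_distrib_left mult_ac)
  also have "\<dots> = (\<Sum>e\<in>E. germ_coeff g e * c e)"
    by (rule sum.mono_neutral_left[OF E F(2)]) (auto simp: F_def)
  also have "\<dots> = 0" using cG g(1) by blast
  finally show False using a(1) g(2) by simp
qed

text \<open>Nakayama's lemma by elimination: the coefficient \<open>1 - m0 t0\<close> is a unit
  because the ring of germs is local, so \<open>b t0\<close> can be solved for and inserted into the
  remaining equations, whose coefficients still have no constant term.\<close>

lemma germ_nakayama:
  fixes b :: "'t \<Rightarrow> 'n::finite germ"
  assumes "finite T" and Q: "ideal.subspace Q"
  shows "(\<forall>t\<in>T. \<exists>q\<in>Q. \<exists>m. (\<forall>s\<in>T. germ_coeff (m s) 0 = 0) \<and> b t = q + (\<Sum>s\<in>T. m s * b s)) \<Longrightarrow> \<forall>t\<in>T. b t \<in> Q"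
  using assms(1)
proof (induction T rule: finite_induct)
  case (insert t0 T)
  obtain q0 m0 where q0: "q0 \<in> Q" "\<forall>s\<in>insert t0 T. germ_coeff (m0 s) 0 = 0" "b t0 = q0 + (\<Sum>s\<in>insert t0 T. m0 s * b s)"
    using insert.prems by blast
  have "germ_coeff (1 - m0 t0) 0 \<noteq> 0" using q0(2) by (simp add: germ_coeff_one)
  then obtain v where v: "(1 - m0 t0) * v = 1" by (rule germ_unit)
  have "b t0 = b t0 * ((1 - m0 t0) * v)" by (simp add: v)
  also have "\<dots> = v * (b t0 - m0 t0 * b t0)" by (simp add: algebra_simps)
  also have "b t0 - m0 t0 * b t0 = q0 + (\<Sum>s\<in>T. m0 s * b s)"
    using arg_cong[OF q0(3), of "\<lambda>x. x - m0 t0 * b t0"] insert.hyps by simp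
  finally have b0: "b t0 = v * q0 + (\<Sum>s\<in>T. v * m0 s * b s)" by (simp add: distrib_left sum_distrib_left mult.assoc)
  have vq: "v * q0 \<in> Q" by (rule ideal.subspace_scale[OF Q q0(1)])
  have bT: "\<forall>t\<in>T. b t \<in> Q"
  proof (rule insert.IH, rule ballI)
    fix t assume t: "t \<in> T"
    then obtain q m where q: "q \<in> Q" "\<forall>s\<in>insert t0 T. germ_coeff (m s) 0 = 0" "b t = q + (\<Sum>s\<in>insert t0 T. m s * b s)"
      using insert.prems by blast
    have "b t = q + (m t0 * (v * q0 + (\<Sum>s\<in>T. v * m0 s * b s)) + (\<Sum>s\<in>T. m s * b s))"
      using q(3) insert.hyps b0 by simp
    also have "\<dots> = (q + m t0 * (v * q0)) + (\<Sum>s\<in>T. (m t0 * v * m0 s + m s) * b s)"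
      by (simp add: distrib_left distrib_right sum.distrib sum_distrib_left mult.assoc)
    finally have "b t = (q + m t0 * (v * q0)) + (\<Sum>s\<in>T. (m t0 * v * m0 s + m s) * b s)" .
    moreover have "q + m t0 * (v * q0) \<in> Q" by (rule ideal.subspace_add[OF Q q(1) ideal.subspace_scale[OF Q vq]])
    moreover have "\<forall>s\<in>T. germ_coeff (m t0 * v * m0 s + m s) 0 = 0"
      using q0(2) q(2) by (simp add: germ_coeff_times_0)
    ultimately show "\<exists>q\<in>Q. \<exists>m. (\<forall>s\<in>T. germ_coeff (m s) 0 = 0) \<and> b t = q + (\<Sum>s\<in>T. m s * b s)"
      by (intro bexI[of _ "q + m t0 * (v * q0)"] exI[of _ "\<lambda>s. m t0 * v * m0 s + m s"] conjI)
  qed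
  have "b t0 \<in> Q"
    unfolding b0 by (rule ideal.subspace_add[OF Q vq ideal.subspace_sum[OF Q ideal.subspace_scale[OF Q]]]) (use bT in blast)
  thus ?case using bT by blast
qed simp

lemma power_reduction:
  fixes E :: "(nat^'n::finite) set"
  assumes E: "finite E"
    and gen: "\<And>e. e \<in> E \<Longrightarrow> \<exists>N. germ_monom (sum_mset (replicate_mset N e)) \<in> fibre_ideal E G N"
  shows "\<exists>d. \<forall>A. set_mset A \<subseteq> E \<longrightarrow> size A = Suc d \<longrightarrow>
    germ_monom (sum_mset A) \<in> ideal.span {g * germ_monom (sum_mset B) | g B. g \<in> G \<and> set_mset B \<subseteq> E \<and> size B = d}"
proof -
  have "\<forall>e\<in>E. \<exists>N. germ_monom (sum_mset (replicate_mset N e)) \<in> fibre_ideal E G N" using gen by blast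
  from bchoice[OF this] obtain N where N: "\<forall>e\<in>E. germ_monom (sum_mset (replicate_mset (N e) e)) \<in> fibre_ideal E G (N e)" ..
  \<comment> \<open>A product of d + 1 generators contains some e at least \<open>N e\<close> times,
    by the pigeonhole principle, and therefore lies in the fibre ideal.\<close>
  define d where "d = sum N E"
  define T where "T = {A :: (nat^'n) multiset. set_mset A \<subseteq> E \<and> size A = Suc d}"
  define Q where "Q = ideal.span {g * germ_monom (sum_mset B) | g B. g \<in> G \<and> set_mset B \<subseteq> E \<and> size B = d}"
  have finT: "finite T" unfolding T_def by (rule finite_multisets[OF E])
  have Q: "ideal.subspace Q" unfolding Q_def by (rule ideal.subspace_span)
  have in_fibre: "germ_monom (sum_mset A) \<in> fibre_ideal E G (Suc d)" if A: "A \<in> T" for A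
  proof -
    have "\<exists>e\<in>E. N e \<le> count A e"
    proof (rule ccontr)
      assume "\<not> ?thesis"
      hence "(\<Sum>e\<in>E. count A e) \<le> d" unfolding d_def by (intro sum_mono) (auto simp: not_le less_imp_le)
      moreover have "size A = (\<Sum>e\<in>E. count A e)"
        unfolding size_multiset_overloaded_eq using A E
        by (intro sum.mono_neutral_left) (auto simp: T_def not_in_iff)
      ultimately show False using A by (simp add: T_def)
    qed
    then obtain e where e: "e \<in> E" "N e \<le> count A e" by blast
    define B where "B = A - replicate_mset (N e) e"
    have AB: "A = replicate_mset (N e) e + B" unfolding B_def using e(2) by (simp add: count_le_replicate_mset_subset_eq)
    have "set_mset B \<subseteq> E" using A AB by (auto simp: T_def)
    from fibre_ideal_mult[OF bspec[OF N e(1)] this]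
    have "germ_monom (sum_mset A) \<in> fibre_ideal E G (N e + size B)" by (subst AB) (simp add: germ_monom_add)
    also have "N e + size B = Suc d" using A AB by (auto simp: T_def dest: arg_cong[of _ _ size])
    finally show ?thesis .
  qed
  \<comment> \<open>The sum of Q and the product of \<open>J^(d+1)\<close> with the maximal ideal,
    in the form that \<open>germ_nakayama\<close> expects.\<close>
  define W where "W = {y. \<exists>q\<in>Q. \<exists>m. (\<forall>s\<in>T. germ_coeff (m s) 0 = 0) \<and> y = q + (\<Sum>s\<in>T. m s * germ_monom (sum_mset s))}"
  have WI: "q + (\<Sum>s\<in>T. m s * germ_monom (sum_mset s)) \<in> W" if "q \<in> Q" "\<forall>s\<in>T. germ_coeff (m s) 0 = 0" for q m
    unfolding W_def using that by blast
  have W: "ideal.subspace W"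
  proof (rule ideal.subspaceI)
    show "0 \<in> W" using WI[OF ideal.subspace_0[OF Q], of "\<lambda>_. 0"] by simp
    fix x y assume "x \<in> W" "y \<in> W"
    then obtain q m q' m' where "q \<in> Q" "\<forall>s\<in>T. germ_coeff (m s) 0 = 0" "x = q + (\<Sum>s\<in>T. m s * germ_monom (sum_mset s))"
      "q' \<in> Q" "\<forall>s\<in>T. germ_coeff (m' s) 0 = 0" "y = q' + (\<Sum>s\<in>T. m' s * germ_monom (sum_mset s))"
      unfolding W_def by blast
    thus "x + y \<in> W" using WI[of "q + q'" "\<lambda>s. m s + m' s"] ideal.subspace_add[OF Q]
      by (simp add: distrib_right sum.distrib add_ac)
  next
    fix c x assume "x \<in> W"
    then obtain q m where "q \<in> Q" "\<forall>s\<in>T. germ_coeff (m s) 0 = 0" "x = q + (\<Sum>s\<in>T. m s * germ_monom (sum_mset s))"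
      unfolding W_def by blast
    thus "c * x \<in> W" using WI[of "c * q" "\<lambda>s. c * m s"] ideal.subspace_scale[OF Q]
      by (simp add: distrib_left sum_distrib_left mult.assoc germ_coeff_times_0)
  qed
  have "fibre_ideal E G (Suc d) \<subseteq> W"
    unfolding fibre_ideal_def
  proof (rule ideal.span_minimal[OF _ W], rule subsetI, elim UnE CollectE exE conjE)
    fix x g A assume x: "x = g * germ_monom (sum_mset A)" "g \<in> G" "set_mset A \<subseteq> E" "Suc (size A) = Suc d"
    hence "x \<in> Q" unfolding Q_def by (intro ideal.span_base) blast
    thus "x \<in> W" using WI[of x "\<lambda>_. 0"] by simp
  next
    fix x A and l :: "nat^'n" assume x: "x = germ_monom (sum_mset A + l)" "l \<noteq> 0" "set_mset A \<subseteq> E" "size A = Suc d"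
    define m where "m s = (if s = A then germ_monom l else 0 :: 'n germ)" for s
    have "(\<Sum>s\<in>T. m s * germ_monom (sum_mset s)) = (\<Sum>s\<in>T. if s = A then x else 0)"
      by (intro sum.cong refl) (simp add: m_def x(1) germ_monom_add mult.commute)
    also have "\<dots> = x" using finT x by (simp add: T_def)
    finally have "(\<Sum>s\<in>T. m s * germ_monom (sum_mset s)) = x" .
    moreover have "\<forall>s\<in>T. germ_coeff (m s) 0 = 0" using x(2) by (simp add: m_def germ_coeff_monom)
    ultimately show "x \<in> W" using WI[OF ideal.subspace_0[OF Q]] by force
  qed
  hence "\<forall>t\<in>T. \<exists>q\<in>Q. \<exists>m. (\<forall>s\<in>T. germ_coeff (m s) 0 = 0) \<and> germ_monom (sum_mset t) = q + (\<Sum>s\<in>T. m s * germ_monom (sum_mset s))"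
    using in_fibre unfolding W_def by blast
  from germ_nakayama[OF finT Q this] have "\<forall>t\<in>T. germ_monom (sum_mset t) \<in> Q" .
  thus ?thesis unfolding T_def Q_def by (intro exI[of _ d]) simp
qed

text \<open>The support condition puts y into J, so y takes \<open>J^d\<close> into
  \<open>J^(d+1)\<close>, which is contained in \<open>I J^d\<close>. The determinant trick applies
  to the monomial generators of \<open>J^d\<close>.\<close>

lemma integral_over_nondegenerate:
  fixes E :: "(nat^'n::finite) set"
  assumes E: "finite E" "E \<noteq> {}" and I: "ideal.subspace I" "G \<subseteq> I"
    and G: "\<forall>g\<in>G. \<forall>k\<in>supp g. \<exists>e\<in>E. \<forall>i. e $h i \<le> k $h i"
    and nondeg: "\<And>\<Delta> a. \<Delta> \<in> compact_faces (upper_hull (real_exponent ` E)) \<Longrightarrow> \<forall>i. a $h i \<noteq> 0 \<Longrightarrow>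
      \<exists>g\<in>G. eval_face g \<Delta> a \<noteq> 0"
    and y: "\<forall>k\<in>supp y. \<exists>e\<in>E. \<forall>i. e $h i \<le> k $h i"
  shows "y \<in> ideal_closure I"
proof -
  obtain d where d: "\<forall>A. set_mset A \<subseteq> E \<longrightarrow> size A = Suc d \<longrightarrow>
    germ_monom (sum_mset A) \<in> ideal.span {g * germ_monom (sum_mset B) | g B. g \<in> G \<and> set_mset B \<subseteq> E \<and> size B = d}"
    using power_reduction[OF E(1) generator_power_in_fibre_ideal[OF E(1) G nondeg]] by blast
  define T where "T = {A :: (nat^'n) multiset. set_mset A \<subseteq> E \<and> size A = d}"
  have finT: "finite T" unfolding T_def by (rule finite_multisets[OF E(1)])
  define W where "W = {y. \<exists>c. (\<forall>s\<in>T. c s \<in> I) \<and> y = (\<Sum>s\<in>T. c s * germ_monom (sum_mset s))}"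
  have W: "ideal.subspace W"
  proof (rule ideal.subspaceI)
    show "0 \<in> W" unfolding W_def using ideal.subspace_0[OF I(1)] by (intro CollectI exI[of _ "\<lambda>_. 0"]) simp
    fix x y assume "x \<in> W" "y \<in> W"
    then obtain c c' where "\<forall>s\<in>T. c s \<in> I" "x = (\<Sum>s\<in>T. c s * germ_monom (sum_mset s))"
      "\<forall>s\<in>T. c' s \<in> I" "y = (\<Sum>s\<in>T. c' s * germ_monom (sum_mset s))" unfolding W_def by blast
    thus "x + y \<in> W" unfolding W_def using ideal.subspace_add[OF I(1)]
      by (intro CollectI exI[of _ "\<lambda>s. c s + c' s"]) (simp add: distrib_right sum.distrib)
  next
    fix a x assume "x \<in> W"
    then obtain c where "\<forall>s\<in>T. c s \<in> I" "x = (\<Sum>s\<in>T. c s * germ_monom (sum_mset s))" unfolding W_def by blast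
    thus "a * x \<in> W" unfolding W_def using ideal.subspace_scale[OF I(1)]
      by (intro CollectI exI[of _ "\<lambda>s. a * c s"]) (simp add: sum_distrib_left mult.assoc)
  qed
  have spanW: "ideal.span {g * germ_monom (sum_mset B) | g B. g \<in> G \<and> set_mset B \<subseteq> E \<and> size B = d} \<subseteq> W"
  proof (rule ideal.span_minimal[OF _ W], rule subsetI, elim CollectE exE conjE)
    fix x g B assume x: "x = g * germ_monom (sum_mset B)" "g \<in> G" "set_mset B \<subseteq> E" "size B = d"
    have "(\<Sum>s\<in>T. (if s = B then g else 0) * germ_monom (sum_mset s)) = (\<Sum>s\<in>T. if s = B then x else 0)"
      by (intro sum.cong refl) (simp add: x(1))
    also have "\<dots> = x" using finT x by (simp add: T_def)
    finally show "x \<in> W"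
      unfolding W_def using x(2) I ideal.subspace_0[OF I(1)]
      by (intro CollectI exI[of _ "\<lambda>s. if s = B then g else 0"]) auto
  qed
  obtain q where q: "y = (\<Sum>e\<in>E. q e * germ_monom e)" using germ_division[OF E(1) y] by metis
  have stable: "y * germ_monom (sum_mset A) \<in> W" if A: "A \<in> T" for A
  proof -
    have "y * germ_monom (sum_mset A) = (\<Sum>e\<in>E. q e * germ_monom (sum_mset (add_mset e A)))"
      by (simp add: q sum_distrib_right germ_monom_add mult.assoc)
    also have "\<dots> \<in> W"
    proof (rule ideal.subspace_sum[OF W ideal.subspace_scale[OF W subsetD[OF spanW]]])
      fix e assume "e \<in> E"
      hence "set_mset (add_mset e A) \<subseteq> E" "size (add_mset e A) = Suc d" using A by (auto simp: T_def)
      thus "germ_monom (sum_mset (add_mset e A)) \<in>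
          ideal.span {g * germ_monom (sum_mset B) | g B. g \<in> G \<and> set_mset B \<subseteq> E \<and> size B = d}"
        using d by blast
    qed
    finally show ?thesis .
  qed
  obtain e where "e \<in> E" using E(2) by blast
  hence "replicate_mset d e \<in> T" by (auto simp: T_def)
  show ?thesis
  proof (rule ideal_closureI_module[OF I(1) finT, of "\<lambda>A. germ_monom (sum_mset A)"])
    show "\<exists>t\<in>T. germ_monom (sum_mset t) \<noteq> (0 :: 'n germ)" using \<open>replicate_mset d e \<in> T\<close> by auto
    fix A assume "A \<in> T"
    from stable[OF this] show "\<exists>c. (\<forall>s\<in>T. c s \<in> I) \<and> y * germ_monom (sum_mset A) = (\<Sum>s\<in>T. c s * germ_monom (sum_mset s))"
      unfolding W_def by blast
  qed
qed

section \<open>Minors of non-degenerate modules\<close>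

lemma fps_prod_nth_initial:
  fixes f :: "'i \<Rightarrow> 'a::comm_ring_1 fps"
  assumes "finite I" "\<And>i d. i \<in> I \<Longrightarrow> d < n i \<Longrightarrow> fps_nth (f i) d = 0"
  shows "fps_nth (\<Prod>i\<in>I. f i) (\<Sum>i\<in>I. n i) = (\<Prod>i\<in>I. fps_nth (f i) (n i)) \<and>
    (\<forall>d<(\<Sum>i\<in>I. n i). fps_nth (\<Prod>i\<in>I. f i) d = 0)"
  using assms
proof (induction I rule: finite_induct)
  case (insert j I)
  hence IH: "fps_nth (\<Prod>i\<in>I. f i) (\<Sum>i\<in>I. n i) = (\<Prod>i\<in>I. fps_nth (f i) (n i))"
    "\<And>d. d < (\<Sum>i\<in>I. n i) \<Longrightarrow> fps_nth (\<Prod>i\<in>I. f i) d = 0" by auto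
  have j: "\<And>d. d < n j \<Longrightarrow> fps_nth (f j) d = 0" using insert.prems by simp
  show ?case
    using fps_mult_nth_initial[of "n j" "f j" "\<Sum>i\<in>I. n i" "\<Prod>i\<in>I. f i", OF j IH(2)] IH(1) insert.hyps by simp
qed simp

lemma exponents_span:
  assumes "f \<in> ideal.span X" "e \<in> supp f"
  shows "\<exists>x\<in>X. \<exists>k\<in>supp x. \<forall>i. k $h i \<le> e $h i"
proof -
  have "\<forall>e\<in>supp f. \<exists>x\<in>X. \<exists>k\<in>supp x. \<forall>i. k $h i \<le> e $h i"
    using assms(1)
  proof (induction rule: ideal.span_induct_alt)
    case (step c x y)
    show ?case
    proof
      fix e assume "e \<in> supp (c * x + y)"
      hence "e \<in> supp (c * x) \<or> e \<in> supp y" using supp_add by blast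
      thus "\<exists>x\<in>X. \<exists>k\<in>supp x. \<forall>i. k $h i \<le> e $h i"
      proof
        assume "e \<in> supp (c * x)"
        then obtain i j where "j \<in> supp x" "e = i + j" by (rule supp_times)
        thus ?thesis using step(1) by (intro bexI[of _ x] bexI[of _ j]) simp_all
      qed (use step in blast)
    qed
  qed simp
  thus ?thesis using assms(2) by blast
qed

section \<open>From projections of the module to minors of its matrix\<close>

lemma pick_lessThan: "i < p \<Longrightarrow> pick {..<p} i = i"
  using pick_reduce_set[of i p UNIV] by (simp add: pick_UNIV lessThan_def)

text \<open>Gives the cases r = p and r < p a common form: the non-degenerate matrix R has the rows
  of A in L, all rows when r = p.\<close>

lemma nondegenerate_projection:
  fixes A :: "'n::finite germ mat"
  assumes A: "A \<in> carrier_mat p m" and r: "r = module_rank p (column_module A)"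
    and nd: "newton_nondegenerate p (column_module A) A" and L: "L \<in> nonzero_minor_rows r A"
  obtains N R where "newton_nondegenerate_full r N R" "R \<in> carrier_mat r m"
    "\<forall>i<r. component_ideal N i = component_ideal (column_module A) (pick L i)"
    "\<forall>i<r. \<forall>j<m. R $$ (i,j) = A $$ (pick L i, j)"
proof (cases "r = p")
  case True
  note L' = nonzero_minor_rowsD[OF A L]
  have "L = {..<p}" by (rule card_subset_eq[OF finite_lessThan L'(1)]) (simp add: L'(2) True)
  thus ?thesis using that[of "column_module A" A] nd A True r
    by (simp add: newton_nondegenerate_def pick_lessThan)
next
  case False
  note L' = nonzero_minor_rowsD[OF A L]
  have "{i. i < p \<and> i \<in> L} = L" using L'(1) by blast
  hence dim: "card {i. i < dim_row A \<and> i \<in> L} = r" "card {j. j < dim_col A \<and> j \<in> UNIV} = m" using A L'(2) by simp_all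
  show ?thesis
  proof (rule that[of "proj_module L (column_module A)" "submatrix A L UNIV"])
    show "newton_nondegenerate_full r (proj_module L (column_module A)) (submatrix A L UNIV)"
      using nd False r L by (simp add: newton_nondegenerate_def Let_def)
    show "submatrix A L UNIV \<in> carrier_mat r m" using dim by (intro carrier_matI) (simp_all only: dim_submatrix)
    show "\<forall>i<r. component_ideal (proj_module L (column_module A)) i = component_ideal (column_module A) (pick L i)"
      by (simp add: component_ideal_def proj_module_def image_image L'(2))
    show "\<forall>i<r. \<forall>j<m. submatrix A L UNIV $$ (i,j) = A $$ (pick L i, j)"
      using dim by (simp add: submatrix_index pick_UNIV)
  qed
qed

text \<open>Only the generators of the Minkowski sum have to be tested; they are lattice points, for
  which the criterion by weights is available.\<close>

lemma sum_polyhedra_subset: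
  fixes M :: "'n::finite germ Matrix.vec set"
  assumes L: "L \<in> \<Lambda>" "finite L" "card L = r"
    and P: "\<And>i. i < r \<Longrightarrow> P i = newton_polyhedron (component_ideal M (pick L i))"
  shows "(\<Sum>i<r. P i) \<subseteq> newton_polyhedron (J_ideal \<Lambda> M)"
proof -
  have lattice: "real_exponent (\<Sum>i<r. l i) \<in> newton_polyhedron (J_ideal \<Lambda> M)"
    if "\<And>i. i < r \<Longrightarrow> real_exponent (l i) \<in> newton_polyhedron (component_ideal M (pick L i))" for l
    by (rule newton_polyhedronI_weight) (rule weight_le_J_ideal[OF L that])
  show ?thesis
  proof (cases "r = 0")
    case True
    thus ?thesis using lattice[of "\<lambda>_. 0"] by (auto simp: set_zero)
  next
    case False
    let ?E = "\<lambda>i. real_exponent ` exponents (component_ideal M (pick L i))"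
    have "(\<Sum>i<r. P i) = (\<Sum>i<r. upper_hull (?E i))" by (intro sum.cong refl) (simp add: P newton_polyhedron_eq)
    also have "\<dots> = upper_hull (\<Sum>i<r. ?E i)" by (rule sum_upper_hull) (use False in auto)
    also have "\<dots> \<subseteq> newton_polyhedron (J_ideal \<Lambda> M)"
      unfolding newton_polyhedron_eq[of "J_ideal \<Lambda> M"]
    proof (rule upper_hull_subsetI, rule subsetI)
      fix x assume "x \<in> (\<Sum>i<r. ?E i)"
      then obtain y where y: "x = sum y {..<r}" "\<forall>i\<in>{..<r}. y i \<in> ?E i" unfolding mem_set_sum_iff[OF finite_lessThan] by blast
      from y(2) have "\<forall>i\<in>{..<r}. \<exists>l. l \<in> exponents (component_ideal M (pick L i)) \<and> y i = real_exponent l" by blast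
      from bchoice[OF this] obtain l where
        l: "\<forall>i\<in>{..<r}. l i \<in> exponents (component_ideal M (pick L i)) \<and> y i = real_exponent (l i)" ..
      have "x = real_exponent (\<Sum>i<r. l i)" unfolding y(1) real_exponent_sum using l by (intro sum.cong) auto
      moreover have "real_exponent (\<Sum>i<r. l i) \<in> newton_polyhedron (J_ideal \<Lambda> M)"
        by (rule lattice) (use l in \<open>auto simp: newton_polyhedron_eq intro!: upper_hull_inc\<close>)
      ultimately show "x \<in> upper_hull (real_exponent ` exponents (J_ideal \<Lambda> M))" by (simp add: newton_polyhedron_eq)
    qed
    finally show ?thesis .
  qed
qed

text \<open>The face \<Delta> meets the Minkowski sum belonging to some L in a compact face of that
  sum. Non-degeneracy for L yields a non-zero minor of the face polynomials, and this is the value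
  at a of the initial form along \<Delta> of the corresponding minor of A.\<close>

lemma nonvanishing_minor:
  fixes A :: "'n::finite germ mat"
  assumes A: "A \<in> carrier_mat p m" and r: "r = module_rank p (column_module A)"
    and nd: "newton_nondegenerate p (column_module A) A"
    and \<Delta>: "\<Delta> \<in> compact_faces (newton_polyhedron (J_ideal (nonzero_minor_rows r A) (column_module A)))"
    and a: "\<forall>i. a $h i \<noteq> 0"
  shows "\<exists>g\<in>minors r A. eval_face g \<Delta> a \<noteq> 0"
proof -
  let ?M = "column_module A" and ?\<Lambda> = "nonzero_minor_rows r A"
  let ?J = "J_ideal ?\<Lambda> ?M"
  obtain E where E: "finite E" "E \<subseteq> exponents ?J" "\<forall>k\<in>exponents ?J. \<exists>e\<in>E. \<forall>i. e $h i \<le> k $h i"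
    "newton_polyhedron ?J = upper_hull (real_exponent ` E)" using newton_polyhedron_finite[of ?J] .
  have face: "\<Delta> face_of upper_hull (real_exponent ` E)" and compact: "compact \<Delta>" and ne: "\<Delta> \<noteq> {}"
    using \<Delta> E(4) by (simp_all add: compact_faces_def)
  note bd = compact_imp_bounded[OF compact]
  obtain w c where w: "\<forall>i. 0 < w i"
    and wc: "\<forall>x\<in>upper_hull (real_exponent ` E). real c \<le> (\<chi> i. real (w i)) \<bullet> x"
      "\<forall>x\<in>upper_hull (real_exponent ` E). (\<chi> i. real (w i)) \<bullet> x = real c \<longleftrightarrow> x \<in> \<Delta>"
    using exposing_weight[OF E(1) face bd ne] .
  have "finite (real_exponent ` E)" using E(1) by simp
  from face_generator[OF this face bd ne] obtain e where e: "e \<in> E" "real_exponent e \<in> \<Delta>" by blast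
  then obtain f where f: "f \<in> ?J" "e \<in> supp f" using E(2) by (auto simp: exponents_def)
  from exponents_span[OF f(1)[unfolded J_ideal_eq] f(2)] obtain L F k where L: "L \<in> ?\<Lambda>"
    and F: "\<forall>i\<in>L. F i \<in> component_ideal ?M i" and k: "k \<in> supp (\<Prod>i\<in>L. F i)" "\<forall>i. k $h i \<le> e $h i" by blast
  note L' = nonzero_minor_rowsD[OF A L]
  from supp_prod[OF k(1) L'(3)] obtain l where l: "k = sum l L" "\<forall>i\<in>L. l i \<in> supp (F i)" by blast
  obtain N R where N: "newton_nondegenerate_full r N R" "R \<in> carrier_mat r m"
    "\<forall>i<r. component_ideal N i = component_ideal ?M (pick L i)"
    "\<forall>i<r. \<forall>j<m. R $$ (i,j) = A $$ (pick L i, j)"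
    by (rule nondegenerate_projection[OF A r nd L])
  define P where "P i = newton_polyhedron (component_ideal N i)" for i
  have PL: "P i = newton_polyhedron (component_ideal ?M (pick L i))" if "i < r" for i using N(3) that by (simp add: P_def)
  have sub: "(\<Sum>i<r. P i) \<subseteq> upper_hull (real_exponent ` E)"
    using sum_polyhedra_subset[OF L L'(3,2) PL] unfolding E(4) .
  have in_P: "real_exponent k \<in> P i" if "i < r" "k \<in> supp h" "h \<in> component_ideal ?M (pick L i)" for k h i
    unfolding PL[OF that(1)] newton_polyhedron_eq using that(2,3) by (intro upper_hull_inc imageI) (auto simp: exponents_def)
  define \<kappa> where "\<kappa> i = l (pick L i)" for i
  have bij: "bij_betw (pick L) {..<r} L" using bij_betw_pick[OF L'(3)] L'(2) by simp
  have k_sum: "k = (\<Sum>i<r. \<kappa> i)" unfolding l(1) \<kappa>_def by (rule sum.reindex_bij_betw[OF bij, symmetric])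
  have \<kappa>P: "real_exponent (\<kappa> i) \<in> P i" if "i < r" for i
  proof -
    have "pick L i \<in> L" using bij that by (auto simp: bij_betw_def)
    thus ?thesis unfolding \<kappa>_def using l(2) F that by (intro in_P) auto
  qed
  have kP: "real_exponent k \<in> (\<Sum>i<r. P i)"
    unfolding k_sum real_exponent_sum mem_set_sum_iff[OF finite_lessThan]
    using \<kappa>P by (intro exI[of _ "\<lambda>i. real_exponent (\<kappa> i)"]) simp
  \<comment> \<open>The exponent k comes from a product over L and lies below e componentwise. As e
    is on the bounded face \<Delta> and k in the polyhedron, they coincide.\<close>
  have "real_exponent e - real_exponent k = 0"
    by (rule face_add_orthant_zero[OF face bd upper_hull_add_orthant subsetD[OF sub kP]])
      (use k(2) e(2) in \<open>auto simp: orthant_def\<close>)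
  hence k\<Delta>: "real_exponent k \<in> \<Delta>" using e(2) by simp
  \<comment> \<open>The polyhedron of \<open>J_ideal\<close> collects the Minkowski sums of all L.
    The slice by one of them is a face of that sum, non-empty since it contains k.\<close>
  define \<Delta>' where "\<Delta>' = \<Delta> \<inter> (\<Sum>i<r. P i)"
  have conv: "convex (P i)" and closed: "closed (P i)" for i
    by (simp_all add: P_def newton_polyhedron_eq convex_upper_hull closed_newton_polyhedron[unfolded newton_polyhedron_eq])
  have face': "\<Delta>' face_of (\<Sum>i<r. P i)"
  proof -
    have "convex (\<Sum>i<r. P i)" using conv by (rule convex_set_sum)
    hence "\<Delta> \<inter> (\<Sum>i<r. P i) face_of upper_hull (real_exponent ` E) \<inter> (\<Sum>i<r. P i)" by (rule face_of_slice[OF face])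
    thus ?thesis using sub by (simp add: \<Delta>'_def Int_absorb1)
  qed
  have ne': "\<Delta>' \<noteq> {}" using k\<Delta> kP by (auto simp: \<Delta>'_def)
  have bd': "bounded \<Delta>'" unfolding \<Delta>'_def by (rule bounded_subset[OF bd]) simp
  define \<Delta>s where "\<Delta>s = face_part \<Delta>' P {..<r}"
  have \<Delta>s: "\<Delta>s i face_of P i" "compact (\<Delta>s i)" "\<Delta>s i \<noteq> {}" if "i < r" for i
    unfolding \<Delta>s_def
    using face_part_face_of[OF finite_lessThan face' _ conv] compact_face_part[OF finite_lessThan face' ne' bd' _ conv closed] that
    by simp_all
  have \<Delta>'_sum: "\<Delta>' = (\<Sum>i<r. \<Delta>s i)" unfolding \<Delta>s_def by (rule sum_face_part[OF finite_lessThan face' ne'])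
  have "compact \<Delta>'"
  proof (cases "r = 0")
    case True
    thus ?thesis unfolding \<Delta>'_sum by (simp add: set_zero)
  next
    case False
    then obtain E' where E': "finite E'" "(\<Sum>i<r. P i) = upper_hull (real_exponent ` E')"
      using module_polyhedron_finite[of r N] unfolding module_polyhedron_def P_def by blast
    have "closed (\<Sum>i<r. P i)" unfolding E'(2) using E'(1) by (intro closed_upper_hull) simp
    thus ?thesis unfolding \<Delta>'_def by (rule compact_Int_closed[OF compact])
  qed
  hence "\<Delta>' \<in> compact_faces (module_polyhedron r N)"
    using face' ne' by (simp add: compact_faces_def module_polyhedron_def P_def)
  define B where "B = Matrix.mat r (dim_col R) (\<lambda>(i,j). eval_face (R $$ (i,j)) (\<Delta>s i) a)"
  have B: "B \<in> carrier_mat r m" using N(2) by (simp add: B_def)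
  have "\<not> vec_space.rank r B < r"
  proof
    assume "vec_space.rank r B < r"
    moreover have "(\<forall>i<r. \<Delta>s i \<in> compact_faces (newton_polyhedron (component_ideal N i))) \<and> \<Delta>' = (\<Sum>i<r. \<Delta>s i)"
      using \<Delta>s \<Delta>'_sum by (simp add: compact_faces_def P_def)
    ultimately have "(\<Prod>i\<in>UNIV. a $h i) = 0"
      using N(1) \<open>\<Delta>' \<in> compact_faces (module_polyhedron r N)\<close> unfolding newton_nondegenerate_full_def B_def by blast
    thus False using a by simp
  qed
  then obtain C where C: "C \<subseteq> {..<m}" "card C = r" "det (submatrix B {..<r} C) \<noteq> 0"
    using full_rank_minor[OF B] by blast
  let ?S = "submatrix A L C" and ?B = "submatrix B {..<r} C"
  have S: "?S \<in> carrier_mat r r" using submatrix_carrier[OF A L'(1) C(1)] L'(2) C(2) by simp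
  have B': "?B \<in> carrier_mat r r" using submatrix_carrier[OF B subset_refl C(1)] C(2) by simp
  have pickC: "pick C j < m" if "j < r" for j using pick_mem[of C j] C finite_subset[OF C(1)] that by auto
  have S_comp: "?S $$ (i,j) \<in> component_ideal ?M (pick L i)" if "i < r" "j < r" for i j
    using submatrix_nth[OF A L'(1) C(1)] component_ideal_entry[OF A L'(4) pickC] L'(2) C(2) that by simp
  have B_nth: "?B $$ (i,j) = eval_face (?S $$ (i,j)) (\<Delta>s i) a" if "i < r" "j < r" for i j
  proof -
    have "?B $$ (i,j) = B $$ (i, pick C j)"
      using submatrix_nth[OF B subset_refl C(1)] C(2) that by (simp add: pick_lessThan)
    also have "\<dots> = eval_face (A $$ (pick L i, pick C j)) (\<Delta>s i) a"
      using N(2,4) that pickC[OF that(2)] by (simp add: B_def)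
    finally show ?thesis using submatrix_nth[OF A L'(1) C(1)] L'(2) C(2) that by simp
  qed
  have det_minor: "det ?S \<in> minors r A"
    unfolding minors_def using A L'(1,2) C(1,2) by blast
  have \<kappa>s: "\<forall>j\<in>{..<r}. real_exponent (\<kappa> j) \<in> face_part \<Delta>' P {..<r} j"
  proof -
    have "(\<Sum>i<r. real_exponent (\<kappa> i)) \<in> \<Delta>'" using k\<Delta> kP by (simp add: \<Delta>'_def k_sum real_exponent_sum)
    thus ?thesis using face_part_iff[OF finite_lessThan face' ne', of "\<lambda>i. real_exponent (\<kappa> i)"] \<kappa>P by simp
  qed
  have wc': "\<forall>x\<in>(\<Sum>i<r. P i). real c \<le> (\<chi> i. real (w i)) \<bullet> x"
    "\<forall>x\<in>(\<Sum>i<r. P i). (\<chi> i. real (w i)) \<bullet> x = real c \<longleftrightarrow> x \<in> \<Delta>'"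
    using wc sub unfolding \<Delta>'_def by blast+
  have comp: "weight w (\<kappa> i) \<le> weight w y" "weight w y = weight w (\<kappa> i) \<longleftrightarrow> real_exponent y \<in> \<Delta>s i"
    if "i < r" "real_exponent y \<in> P i" for i y
  proof -
    have i: "i \<in> {..<r}" using that(1) by simp
    note fw = face_part_weight[OF finite_lessThan face' ne' wc' \<kappa>s i that(2)]
    have "real (weight w (\<kappa> i)) \<le> real (weight w y)" unfolding real_weight by (rule fw(1))
    thus "weight w (\<kappa> i) \<le> weight w y" by simp
    have "real (weight w y) = real (weight w (\<kappa> i)) \<longleftrightarrow> real_exponent y \<in> \<Delta>s i"
      unfolding real_weight \<Delta>s_def by (rule fw(2))
    thus "weight w y = weight w (\<kappa> i) \<longleftrightarrow> real_exponent y \<in> \<Delta>s i" by simp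
  qed
  have c: "(\<Sum>i<r. weight w (\<kappa> i)) = c"
  proof -
    have "real (weight w k) = real c" unfolding real_weight using wc'(2) kP k\<Delta> unfolding \<Delta>'_def by blast
    hence "weight w k = c" by simp
    thus ?thesis by (simp add: k_sum weight_sum)
  qed
  let ?\<phi> = "torus_subst w a"
  have entry: "fps_nth (?\<phi> (?S $$ (i,j))) (weight w (\<kappa> i)) = germ_const (?B $$ (i,j))"
    and entry_low: "\<And>d. d < weight w (\<kappa> i) \<Longrightarrow> fps_nth (?\<phi> (?S $$ (i,j))) d = 0" if "i < r" "j < r" for i j
  proof -
    note inP = in_P[OF that(1) _ S_comp[OF that]]
    show "fps_nth (?\<phi> (?S $$ (i,j))) (weight w (\<kappa> i)) = germ_const (?B $$ (i,j))"
      unfolding B_nth[OF that]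
      by (rule torus_subst_face[OF w compact_imp_bounded[OF \<Delta>s(2)[OF that(1)]]])
        (use comp[OF that(1) inP] in blast)+
    show "fps_nth (?\<phi> (?S $$ (i,j))) d = 0" if "d < weight w (\<kappa> i)" for d
      by (rule torus_subst_low[OF w]) (use comp(1)[OF \<open>i < r\<close> inP] that in force)
  qed
  have \<phi>_prod: "?\<phi> (\<Prod>i\<in>I. h i) = (\<Prod>i\<in>I. ?\<phi> (h i))" if "finite I" "I \<noteq> {}" for h and I :: "nat set"
    using that by (induction I rule: finite_ne_induct) (simp_all add: torus_subst_mult[OF w])
  have prod: "fps_nth (?\<phi> (\<Prod>i<r. ?S $$ (i, \<sigma> i))) c = germ_const (\<Prod>i<r. ?B $$ (i, \<sigma> i))" if \<sigma>: "\<sigma> permutes {..<r}" for \<sigma>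
  \<comment> \<open>For the empty product the germ 1 is evaluated directly on the face {0}.\<close>
  proof (cases "r = 0")
    case True
    have "c = 0" using c True by simp
    have "fps_nth (?\<phi> 1) 0 = germ_const (eval_face 1 {0} a)"
      by (rule torus_subst_face[OF w]) (auto simp: supp_def germ_coeff_one split: if_splits)
    moreover have "{k. real_exponent k = 0} = {0 :: nat^'n}" using injD[OF inj_real_exponent, of _ 0] by auto
    ultimately show ?thesis using True \<open>c = 0\<close> by (simp add: eval_face_eq germ_coeff_one)
  next
    case False
    have \<sigma>r: "\<sigma> i < r" if "i < r" for i using permutes_in_image[OF \<sigma>, of i] that by simp
    have "fps_nth (\<Prod>i<r. ?\<phi> (?S $$ (i, \<sigma> i))) (\<Sum>i<r. weight w (\<kappa> i)) =
        (\<Prod>i<r. fps_nth (?\<phi> (?S $$ (i, \<sigma> i))) (weight w (\<kappa> i)))"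
      by (rule conjunct1[OF fps_prod_nth_initial]) (use entry_low \<sigma>r in auto)
    also have "\<dots> = (\<Prod>i<r. germ_const (?B $$ (i, \<sigma> i)))" using entry \<sigma>r by (intro prod.cong) auto
    finally have "fps_nth (\<Prod>i<r. ?\<phi> (?S $$ (i, \<sigma> i))) c = (\<Prod>i<r. germ_const (?B $$ (i, \<sigma> i)))" unfolding c .
    moreover have "?\<phi> (\<Prod>i<r. ?S $$ (i, \<sigma> i)) = (\<Prod>i<r. ?\<phi> (?S $$ (i, \<sigma> i)))"
      by (rule \<phi>_prod) (use False in auto)
    ultimately show ?thesis unfolding germ_const_prod by simp
  qed
  have sign: "(signof \<sigma> :: 'n germ) = germ_const (signof \<sigma>)" for \<sigma> :: "nat \<Rightarrow> nat"
  proof -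
    have neg: "(of_int (- 1) :: 'n germ) = germ_const (of_int (- 1))"
      by (rule germ_eqI) (simp add: germ_coeff_const germ_coeff_one)
    have pos: "(of_int 1 :: 'n germ) = germ_const (of_int 1)" by simp
    have "sign \<sigma> = (1 :: int) \<or> sign \<sigma> = - 1" by (simp add: sign_def)
    thus ?thesis
    proof
      assume "sign \<sigma> = (1 :: int)"
      thus ?thesis by (simp only: pos)
    next
      assume "sign \<sigma> = (- 1 :: int)"
      thus ?thesis by (simp only: neg)
    qed
  qed
  have "fps_nth (?\<phi> (det ?S)) c = germ_const (det ?B)"
    unfolding det_def'[OF S] det_def'[OF B'] torus_subst_sum[OF w] fps_sum_nth germ_const_sum
  proof (intro sum.cong refl)
    fix \<sigma> assume "\<sigma> \<in> {\<sigma>. \<sigma> permutes {0..<r}}"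
    hence perm: "\<sigma> permutes {..<r}" by (simp add: atLeast0LessThan)
    show "fps_nth (?\<phi> (signof \<sigma> * (\<Prod>i = 0..<r. ?S $$ (i, \<sigma> i)))) c =
        germ_const (signof \<sigma> * (\<Prod>i = 0..<r. ?B $$ (i, \<sigma> i)))"
      by (subst sign) (simp only: torus_subst_const_times_nth[OF w] prod[OF perm] atLeast0LessThan germ_const_mult)
  qed
  \<comment> \<open>The same coefficient, read off from the support of the determinant instead of
    its Leibniz expansion. The comparison remains valid if terms of the expansion cancel.\<close>
  moreover have "fps_nth (?\<phi> (det ?S)) c = germ_const (eval_face (det ?S) \<Delta> a)"
  proof (rule torus_subst_face[OF w bd])
    fix y assume "y \<in> supp (det ?S)"
    moreover have "det ?S \<in> newton_ideal ?J"
      by (rule subsetD[OF minors_subset_newton_ideal[OF A] det_minor])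
    ultimately have y: "real_exponent y \<in> upper_hull (real_exponent ` E)"
      unfolding E(4)[symmetric] mem_newton_ideal by blast
    have "real c \<le> real (weight w y)" unfolding real_weight using wc(1) y by blast
    thus "c \<le> weight w y" by simp
    have "real (weight w y) = real c \<longleftrightarrow> real_exponent y \<in> \<Delta>" unfolding real_weight using wc(2) y by blast
    thus "weight w y = c \<longleftrightarrow> real_exponent y \<in> \<Delta>" by simp
  qed
  ultimately have "germ_const (eval_face (det ?S) \<Delta> a) = (germ_const (det ?B) :: 'n germ)" by simp
  hence "eval_face (det ?S) \<Delta> a \<noteq> 0" using C(3) by (metis germ_const_eq_0_iff)
  thus ?thesis using det_minor by blast
qed

lemma newton_ideal_subset_closure:
  fixes A :: "'n::finite germ mat"
  assumes A: "A \<in> carrier_mat p m" and r: "r = module_rank p (column_module A)"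
    and nd: "newton_nondegenerate p (column_module A) A"
  shows "newton_ideal (J_ideal (nonzero_minor_rows r A) (column_module A)) \<subseteq> ideal_closure (minor_ideal r A)"
proof
  let ?J = "J_ideal (nonzero_minor_rows r A) (column_module A)"
  \<comment> \<open>All lattice points of the polyhedron, not just exponents of
    \<open>J_ideal\<close>: the Newton ideal is generated by all of them. The polyhedron they span
    is the same.\<close>
  define S where "S = {k :: nat^'n. real_exponent k \<in> newton_polyhedron ?J}"
  obtain E where E: "finite E" "E \<subseteq> S" "\<forall>k\<in>S. \<exists>e\<in>E. \<forall>i. e $h i \<le> k $h i" by (rule dickson[of S])
  have hull: "upper_hull (real_exponent ` E) = newton_polyhedron ?J"
  proof -
    have "upper_hull (real_exponent ` S) = newton_polyhedron ?J"
    proof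
      show "upper_hull (real_exponent ` S) \<subseteq> newton_polyhedron ?J"
        unfolding newton_polyhedron_eq by (rule upper_hull_subsetI) (auto simp: S_def newton_polyhedron_eq)
      have "exponents ?J \<subseteq> S"
        unfolding S_def newton_polyhedron_eq by (intro subsetI CollectI upper_hull_inc imageI)
      thus "newton_polyhedron ?J \<subseteq> upper_hull (real_exponent ` S)"
        unfolding newton_polyhedron_eq by (intro upper_hull_subsetI subsetI upper_hull_inc) blast
    qed
    thus ?thesis by (rule trans[OF upper_hull_dickson[OF E(2,3), symmetric]])
  qed
  have gen: "\<forall>k\<in>supp f. \<exists>e\<in>E. \<forall>i. e $h i \<le> k $h i" if "f \<in> newton_ideal ?J" for f
  proof
    fix k assume "k \<in> supp f"
    hence "k \<in> S" using that unfolding mem_newton_ideal S_def by blast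
    thus "\<exists>e\<in>E. \<forall>i. e $h i \<le> k $h i" by (rule bspec[OF E(3)])
  qed
  fix y assume y: "y \<in> newton_ideal ?J"
  obtain I C where IC: "I \<subseteq> {..<p}" "C \<subseteq> {..<m}" "card I = r" "card C = r" "det (submatrix A I C) \<noteq> 0"
    by (rule nonzero_minor_exists[OF A, folded r])
  hence "det (submatrix A I C) \<in> minors r A" unfolding minors_def using A by blast
  hence "det (submatrix A I C) \<in> newton_ideal ?J" by (rule subsetD[OF minors_subset_newton_ideal[OF A]])
  note gen_minor = gen[OF this]
  have "supp (det (submatrix A I C)) \<noteq> {}" using IC(5) by (simp add: supp_eq_empty)
  then obtain k where "k \<in> supp (det (submatrix A I C))" unfolding ex_in_conv[symmetric] ..
  from bspec[OF gen_minor this] have "E \<noteq> {}" by (elim bexE) (rule notI, simp)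
  show "y \<in> ideal_closure (minor_ideal r A)"
  proof (rule integral_over_nondegenerate[OF E(1) \<open>E \<noteq> {}\<close>])
    show "ideal.subspace (minor_ideal r A)" "minors r A \<subseteq> minor_ideal r A"
      unfolding minor_ideal_eq by (simp_all add: ideal.subspace_span ideal.span_superset)
    show "\<forall>g\<in>minors r A. \<forall>k\<in>supp g. \<exists>e\<in>E. \<forall>i. e $h i \<le> k $h i"
      by (intro ballI[of "minors r A"] gen subsetD[OF minors_subset_newton_ideal[OF A]])
    show "\<forall>k\<in>supp y. \<exists>e\<in>E. \<forall>i. e $h i \<le> k $h i" by (rule gen[OF y])
    show "\<exists>g\<in>minors r A. eval_face g \<Delta> a \<noteq> 0"
      if "\<Delta> \<in> compact_faces (upper_hull (real_exponent ` E))" "\<forall>i. a $h i \<noteq> 0" for \<Delta> a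
      by (rule nonvanishing_minor[OF A r nd that(1)[unfolded hull] that(2)])
  qed
qed

theorem corollary4p21:
  fixes M :: "'n::finite germ Matrix.vec set" and A :: "'n germ mat" and p m r :: nat
  assumes "LinearCombinations.submodule class_ring M (module_vec TYPE('n germ) p)"
    and "M \<noteq> {0\<^sub>v p}"
    and "A \<in> carrier_mat p m" and "p \<le> m" and "M = column_module A"
    and "r = module_rank p M"
  shows "let cond1 = newton_nondegenerate p M A;
             cond2 = (ideal_closure (minor_ideal r A) =
                      newton_ideal (J_ideal (nonzero_minor_rows r A) M));
             cond3 = (module_closure p M = C0_module p M)
         in (cond1 \<longrightarrow> cond2) \<and> (cond2 \<longrightarrow> cond3) \<and>
            (r = p \<longrightarrow> (cond1 \<longleftrightarrow> cond2) \<and> (cond2 \<longleftrightarrow> cond3))"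
proof -
  note A = \<open>A \<in> carrier_mat p m\<close> and M = \<open>M = column_module A\<close>
  have r: "r = module_rank p (column_module A)" using assms(5,6) by simp
  let ?c1 = "newton_nondegenerate p M A"
  let ?c2 = "ideal_closure (minor_ideal r A) = newton_ideal (J_ideal (nonzero_minor_rows r A) M)"
  let ?c3 = "module_closure p M = C0_module p M"
  have 12: "?c1 \<Longrightarrow> ?c2"
    unfolding M by (rule subset_antisym[OF closure_minor_ideal_subset[OF A r] newton_ideal_subset_closure[OF A r]])
  have 23: "?c2 \<Longrightarrow> ?c3"
    unfolding M by (rule subset_antisym[OF module_closure_subset_C0[OF A] C0_subset_module_closure[OF A r]])
  have 31: "?c1" if "r = p" ?c3
    using nondegenerate_of_C0_subset[OF A] that r unfolding M newton_nondegenerate_def by simp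
  show ?thesis unfolding Let_def using 12 23 31 by blast
qed

end
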